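(* Let $S=\{\beta_1,\beta_2,\beta_3\}$ be the set of Brun substitutions over the three letters $\mathcal{A}=\{1,2,3\}$, where $\beta_1:1\mapsto1,\,2\mapsto23,\,3\mapsto3$; $\beta_2:1\mapsto1,\,2\mapsto3,\,3\mapsto23$; $\beta_3:1\mapsto3,\,2\mapsto1,\,3\mapsto23$. Consider the shift $(S^{\mathbb{N}},\Sigma,\nu)$ for some shift invariant ergodic probability measure $\nu$ that assigns positive measure to each cylinder. Then $(S^{\mathbb{N}},\Sigma,\nu)$ satisfies the Pisot condition. Moreover, for $\nu$-almost all sequences $\boldsymbol{\sigma}\in S^{\mathbb{N}}$ the collection $\mathcal{C}_{\mathbf{1}}$ forms a tiling of $\mathbf{1}^\bot$, the $S$-adic shift $(X_{\boldsymbol{\sigma}},\Sigma)$ is measurably conjugate to a translation on the torus $\mathbb{T}^2$, and the words in $X_{\boldsymbol{\sigma}}$ form natural codings of this translation.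
   Context: $\mathbb{N}=\{0,1,2,\ldots\}$, $d=3$. The incidence matrix of a substitution $\sigma$ is $M_\sigma=(|\sigma(j)|_i)_{i,j\in\mathcal{A}}$, where $|w|_i$ counts occurrences of $i$ in $w$; $\mathbf{l}(w)={}^t(|w|_1,|w|_2,|w|_3)$. For $\boldsymbol{\sigma}=(\sigma_n)_{n\in\mathbb{N}}\in S^{\mathbb{N}}$ put $M_n=M_{\sigma_n}$, $\sigma_{[k,\ell)}=\sigma_k\cdots\sigma_{\ell-1}$, $M_{[k,\ell)}=M_k\cdots M_{\ell-1}$. Pisot condition: with the cocycle $A(\boldsymbol{\sigma})={}^tM_0$, the Lyapunov exponents $\theta_1,\theta_2,\theta_3$ of $(S^{\mathbb{N}},\Sigma,\nu)$ are defined recursively by $\theta_1+\cdots+\theta_k=\lim_{n\to\infty}\frac1n\int_{S^{\mathbb{N}}}\log\|\wedge^k(A(\Sigma^{n-1}(x))\cdots A(\Sigma(x))A(x))\|\,d\nu(x)$ ($\wedge^k$ the $k$-fold wedge product), and the Pisot condition is $\theta_1>0>\theta_2\ge\theta_3$. $X_{\boldsymbol{\sigma}}$ is the set of infinite words in $\mathcal{A}^{\mathbb{N}}$ each of whose factors is a factor of $\sigma_{[0,n)}(i)$ for some $i\in\mathcal{A}$, $n\in\mathbb{N}$; $\Sigma$ also denotes the shift on $X_{\boldsymbol{\sigma}}$, which is (for $\nu$-almost all $\boldsymbol{\sigma}$) uniquely ergodic and is equipped with its unique shift invariant probability measure. A limit word of $\boldsymbol{\sigma}$ is an infinite word $\omega=\omega^{(0)}$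 for which there are infinite words $\omega^{(n)}$ with $\omega^{(n)}=\sigma_n(\omega^{(n+1)})$ for all $n$. $\mathbf{u}$ is a positive vector with $\bigcap_nM_{[0,n)}\mathbb{R}_+^3=\mathbb{R}_+\mathbf{u}$ (it exists for $\nu$-almost all $\boldsymbol{\sigma}$). $\mathbf{1}={}^t(1,1,1)$, $\mathbf{1}^\bot$ is the plane orthogonal to $\mathbf{1}$, and $\pi_{\mathbf{u},\mathbf{1}}$ is the projection along $\mathbf{u}$ onto $\mathbf{1}^\bot$. $\mathcal{R}(i)$ is the closure of $\{\pi_{\mathbf{u},\mathbf{1}}\mathbf{l}(p):p\in\mathcal{A}^*,\ p\,i\text{ is a prefix of a limit word of }\boldsymbol{\sigma}\}$, and $\mathcal{C}_{\mathbf{1}}=\{\mathbf{x}+\mathcal{R}(i):\mathbf{x}\in\mathbb{Z}^3\cap\mathbf{1}^\bot,\ i\in\mathcal{A}\}$. A collection of compact sets is a tiling of $\mathbf{1}^\bot$ if each set is the closure of its interior and almost every point of $\mathbf{1}^\bot$ lies in exactly one of the sets. Natural coding: for a full-rank lattice $\Lambda$ in a Euclidean space, a translation $T_{\mathbf{t}}$ on the quotient torus, a fundamental domain $R$ of $\Lambda$ with induced map $\tilde T_{\mathbf{t}}:R\to R$, and a partition (up to measure zero) $R=R_1\cup\cdots\cup R_k$ such that each restriction $\tilde T_{\mathbf{t}}|_{R_i}$ is a translation $\mathbf{x}\mapsto\mathbf{x}+\mathbf{t}_i$, a coding of (the orbit of) a point of $R$ with respect to this partition is called a natural coding of $T_{\mathbf{t}}$;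 here one fixed partition serves for all words of $X_{\boldsymbol{\sigma}}$. *)

theory Defs
  imports "HOL-Probability.Probability" "HOL-Library.Sublist"
begin

section \<open>Substitutions and directive sequences\<close>

text \<open>
  Letters are the elements 1, 2, 3 of the numeral type 3 (so 3 = 0 there), infinite words are
  streams, and \<^term>\<open>stl\<close> is the shift, on infinite words and on directive sequences alike.
  A substitution is given by its values on letters.
\<close>

type_synonym 'a substitution = "'a \<Rightarrow> 'a list"

definition subst_word :: "'a substitution \<Rightarrow> 'a list \<Rightarrow> 'a list" where
  "subst_word s w = concat (map s w)"

text \<open>Meaningful for non-erasing substitutions only, as \<^term>\<open>flat\<close> assumes non-empty lists.\<close>
definition subst_stream :: "'a substitution \<Rightarrow> 'a stream \<Rightarrow> 'a stream" where
  "subst_stream s \<omega> = flat (smap s \<omega>)"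

text \<open>\<open>subst_upto \<sigma> n = \<sigma>\<^sub>0 \<circ> \<dots> \<circ> \<sigma>\<^sub>n\<^sub>-\<^sub>1\<close>, acting on words.\<close>
primrec subst_upto :: "'a substitution stream \<Rightarrow> nat \<Rightarrow> 'a list \<Rightarrow> 'a list" where
  "subst_upto \<sigma> 0 w = w"
| "subst_upto \<sigma> (Suc n) w = subst_upto \<sigma> n (subst_word (\<sigma> !! n) w)"

definition abelianization :: "'a list \<Rightarrow> real^'a::finite" where
  "abelianization w = (\<chi> i. real (count_list w i))"

definition incidence_matrix :: "'a substitution \<Rightarrow> real^'a^'a::finite" where
  "incidence_matrix s = (\<chi> i j. real (count_list (s j) i))"

primrec incidence_upto :: "'a substitution stream \<Rightarrow> nat \<Rightarrow> real^'a^'a::finite" where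
  "incidence_upto \<sigma> 0 = mat 1"
| "incidence_upto \<sigma> (Suc n) = incidence_upto \<sigma> n ** incidence_matrix (\<sigma> !! n)"

definition brun1 :: "3 substitution" where
  "brun1 i = (if i = 1 then [1] else if i = 2 then [2, 3] else [3])"

definition brun2 :: "3 substitution" where
  "brun2 i = (if i = 1 then [1] else if i = 2 then [3] else [2, 3])"

definition brun3 :: "3 substitution" where
  "brun3 i = (if i = 1 then [3] else if i = 2 then [1] else [2, 3])"

definition brun_substitutions :: "3 substitution set" where
  "brun_substitutions = {brun1, brun2, brun3}"

section \<open>Measure-preserving systems\<close>

definition invariant_prob :: "'a measure \<Rightarrow> ('a \<Rightarrow> 'a) \<Rightarrow> bool" where
  "invariant_prob M T \<longleftrightarrow> prob_space M \<and> T \<in> measurable M M \<and> distr M M T = M"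

definition ergodic :: "'a measure \<Rightarrow> ('a \<Rightarrow> 'a) \<Rightarrow> bool" where
  "ergodic M T \<longleftrightarrow>
     (\<forall>A\<in>sets M. T -` A \<inter> space M = A \<longrightarrow> measure M A = 0 \<or> measure M A = 1)"

text \<open>Isomorphism modulo null sets.\<close>
definition measurably_conjugate ::
    "'a measure \<Rightarrow> ('a \<Rightarrow> 'a) \<Rightarrow> 'b measure \<Rightarrow> ('b \<Rightarrow> 'b) \<Rightarrow> bool" where
  "measurably_conjugate M S N T \<longleftrightarrow>
     (\<exists>A\<in>sets M. \<exists>B\<in>sets N. \<exists>\<phi>.
        emeasure M (space M - A) = 0 \<and> emeasure N (space N - B) = 0 \<and>
        S ` A \<subseteq> A \<and> T ` B \<subseteq> B \<and>
        bij_betw \<phi> A B \<and>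
        \<phi> \<in> measurable (restrict_space M A) (restrict_space N B) \<and>
        the_inv_into A \<phi> \<in> measurable (restrict_space N B) (restrict_space M A) \<and>
        (\<forall>C\<in>sets N. C \<subseteq> B \<longrightarrow> emeasure M (\<phi> -` C \<inter> A) = emeasure N C) \<and>
        (\<forall>x\<in>A. \<phi> (S x) = T (\<phi> x)))"

section \<open>Lyapunov exponents and the Pisot condition\<close>

text \<open>
  The coordinate of \<open>x\<^sub>1 \<and> \<dots> \<and> x\<^sub>k\<close> with respect to \<open>e\<^sub>i\<^sub>1 \<and> \<dots> \<and> e\<^sub>i\<^sub>k\<close>: the determinant of the
  \<open>k \<times> k\<close> matrix of the coordinates of the \<open>x\<^sub>r\<close> at \<open>i\<^sub>1, \<dots>, i\<^sub>k\<close> (Leibniz formula).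
\<close>
definition wedge_coord :: "(real^'n) list \<Rightarrow> 'n list \<Rightarrow> real" where
  "wedge_coord xs I = (\<Sum>p | p permutes {..<length xs}.
      of_int (sign p) * (\<Prod>r<length xs. (xs ! r) $ (I ! p r)))"

text \<open>Indices of the standard basis of the \<open>k\<close>-th exterior power.\<close>
definition wedge_basis :: "nat \<Rightarrow> 'n::{finite,linorder} list set" where
  "wedge_basis k = {I. length I = k \<and> sorted_wrt (<) I}"

text \<open>
  Entry \<open>(I, J)\<close> of the matrix of the \<open>k\<close>-fold wedge product of \<open>A\<close> in the standard basis,
  from \<open>(\<and>\<^sup>k A) (e\<^sub>j\<^sub>1 \<and> \<dots> \<and> e\<^sub>j\<^sub>k) = A e\<^sub>j\<^sub>1 \<and> \<dots> \<and> A e\<^sub>j\<^sub>k\<close>.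
\<close>
definition wedge_power :: "real^'n^'n \<Rightarrow> 'n::finite list \<Rightarrow> 'n list \<Rightarrow> real" where
  "wedge_power A I J = wedge_coord (map (\<lambda>j. A *v axis j 1) J) I"

text \<open>
  The Euclidean (Frobenius) norm of the wedge product, in accordance with \<^term>\<open>norm\<close> on
  matrices; exponents do not depend on the norm.
\<close>
definition wedge_norm ::
    "nat \<Rightarrow> real^'n::{finite,linorder}^'n::{finite,linorder} \<Rightarrow> real" where
  "wedge_norm k A = sqrt (\<Sum>I\<in>wedge_basis k. \<Sum>J\<in>wedge_basis k.
      (wedge_power A I J)\<^sup>2)"

text \<open>\<open>cocycle n x = A(\<Sigma>\<^sup>n\<^sup>-\<^sup>1 x) \<dots> A(\<Sigma> x) A(x)\<close> with \<open>A(x) = \<^sup>tM\<^sub>0\<close>.\<close>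
primrec cocycle :: "nat \<Rightarrow> 'a substitution stream \<Rightarrow> real^'a^'a::finite" where
  "cocycle 0 x = mat 1"
| "cocycle (Suc n) x = transpose (incidence_matrix (shd ((stl ^^ n) x))) ** cocycle n x"

definition lyapunov_exponents :: "3 substitution stream measure \<Rightarrow> (nat \<Rightarrow> real) \<Rightarrow> bool" where
  "lyapunov_exponents \<nu> \<theta> \<longleftrightarrow>
     (\<forall>k\<in>{1..3}.
        (\<forall>n. integrable \<nu> (\<lambda>x. ln (wedge_norm k (cocycle n x)))) \<and>
        (\<lambda>n. (1 / real n) * (LINT x|\<nu>. ln (wedge_norm k (cocycle n x))))
          \<longlonglongrightarrow> (\<Sum>j=1..k. \<theta> j))"

definition pisot_condition :: "3 substitution stream measure \<Rightarrow> bool" where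
  "pisot_condition \<nu> \<longleftrightarrow>
     (\<exists>\<theta>. lyapunov_exponents \<nu> \<theta> \<and> \<theta> 1 > 0 \<and> 0 > \<theta> 2 \<and> \<theta> 2 \<ge> \<theta> 3)"

section \<open>S-adic shifts\<close>

definition sadic_shift :: "'a substitution stream \<Rightarrow> 'a stream set" where
  "sadic_shift \<sigma> =
     {\<omega>. \<forall>k m. \<exists>n i. sublist (stake m (sdrop k \<omega>)) (subst_upto \<sigma> n [i])}"

definition limit_word :: "'a substitution stream \<Rightarrow> 'a stream \<Rightarrow> bool" where
  "limit_word \<sigma> \<omega> \<longleftrightarrow>
     (\<exists>w. w 0 = \<omega> \<and> (\<forall>n. w n = subst_stream (\<sigma> !! n) (w (Suc n))))"

definition invariant_prob_on :: "'a stream set \<Rightarrow> 'a stream measure \<Rightarrow> bool" where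
  "invariant_prob_on X \<mu> \<longleftrightarrow>
     sets \<mu> = sets (restrict_space (stream_space (count_space UNIV)) X) \<and> invariant_prob \<mu> stl"

section \<open>Rauzy fractals and tilings\<close>

definition int_lattice :: "(real^'n) set" where
  "int_lattice = {x. \<forall>i. x $ i \<in> \<int>}"

text \<open>Positivity and the generalized right eigenvector condition, with \<open>\<real>\<^sub>+ = [0, \<infinity>)\<close>.\<close>
definition right_eigenvector :: "'a substitution stream \<Rightarrow> real^'a::finite \<Rightarrow> bool" where
  "right_eigenvector \<sigma> u \<longleftrightarrow>
     (\<forall>i. u $ i > 0) \<and>
     (\<Inter>n. (\<lambda>x. incidence_upto \<sigma> n *v x) ` {x. \<forall>i. 0 \<le> x $ i}) = {c *\<^sub>R u | c. 0 \<le> c}"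

definition perp :: "real^'n \<Rightarrow> (real^'n::finite) set" where
  "perp w = {x. x \<bullet> w = 0}"

text \<open>The projection along \<open>u\<close> onto \<^term>\<open>perp w\<close>, provided that \<open>u \<bullet> w \<noteq> 0\<close>.\<close>
definition proj_along :: "real^'n \<Rightarrow> real^'n \<Rightarrow> real^'n \<Rightarrow> real^'n::finite" where
  "proj_along u w x = x - ((x \<bullet> w) / (u \<bullet> w)) *\<^sub>R u"

definition rauzy_subtile ::
    "'a substitution stream \<Rightarrow> real^'a \<Rightarrow> 'a::finite \<Rightarrow> (real^'a) set" where
  "rauzy_subtile \<sigma> u i = closure {proj_along u (vec 1) (abelianization p) | p.
     \<exists>\<omega>. limit_word \<sigma> \<omega> \<and> stake (length (p @ [i])) \<omega> = p @ [i]}"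

definition rauzy_collection ::
    "'a substitution stream \<Rightarrow> real^'a::finite \<Rightarrow> (real^'a) set set" where
  "rauzy_collection \<sigma> u =
     {(+) x ` rauzy_subtile \<sigma> u i | x i. x \<in> int_lattice \<inter> perp (vec 1)}"

text \<open>
  Lebesgue measure on the hyperplane \<^term>\<open>perp w\<close>: the image under orthogonal projection of
  Lebesgue measure on a slab of thickness 1 parallel to it.
\<close>
definition perp_lborel :: "real^'n \<Rightarrow> (real^'n::finite) measure" where
  "perp_lborel w =
     distr (restrict_space lborel {x. 0 \<le> x \<bullet> w \<and> x \<bullet> w \<le> norm w})
       (restrict_space borel (perp w)) (proj_along w w)"

text \<open>Interior and closure are taken in \<^term>\<open>perp w\<close>.\<close>
definition tiling_of_perp :: "real^'n \<Rightarrow> (real^'n::finite) set set \<Rightarrow> bool" where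
  "tiling_of_perp w \<C> \<longleftrightarrow>
     (\<forall>K\<in>\<C>. compact K \<and> K \<subseteq> perp w \<and>
        (top_of_set (perp w)) closure_of ((top_of_set (perp w)) interior_of K) = K) \<and>
     (AE x in perp_lborel w. \<exists>!K. K \<in> \<C> \<and> x \<in> K)"

section \<open>Toral translations and natural codings\<close>

definition torus_class :: "real^'n \<Rightarrow> (real^'n) set" where
  "torus_class x = (+) x ` int_lattice"

text \<open>
  The torus \<open>\<real>\<^sup>n / \<int>\<^sup>n\<close> (points are cosets), with the quotient Borel sigma-algebra and Haar
  measure, the image of Lebesgue measure on the unit cube.
\<close>
definition torus :: "(real^'n::finite) set measure" where
  "torus = distr (restrict_space lborel {x. \<forall>i. 0 \<le> x $ i \<and> x $ i < 1})
     (sigma (range torus_class) {B. B \<subseteq> range torus_class \<and> torus_class -` B \<in> sets borel})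
     torus_class"

definition torus_translation :: "real^'n \<Rightarrow> (real^'n) set \<Rightarrow> (real^'n) set" where
  "torus_translation t C = (+) t ` C"

definition full_rank_lattice :: "'e::euclidean_space set \<Rightarrow> bool" where
  "full_rank_lattice \<Lambda> \<longleftrightarrow>
     (\<exists>B. independent B \<and> span B = UNIV \<and> \<Lambda> = {(\<Sum>b\<in>B. of_int (c b) *\<^sub>R b) | c. True})"

definition fundamental_domain :: "'e::euclidean_space set \<Rightarrow> 'e set \<Rightarrow> bool" where
  "fundamental_domain \<Lambda> R \<longleftrightarrow>
     R \<in> sets lebesgue \<and> (AE x in lborel. \<exists>!l. l \<in> \<Lambda> \<and> x + l \<in> R)"

text \<open>
  The map \<open>R \<rightarrow> R\<close> induced by the translation by \<open>t\<close> modulo \<open>\<Lambda>\<close>; well defined almost everywhere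
  if \<open>R\<close> is a fundamental domain.
\<close>
definition induced_map :: "'e::euclidean_space set \<Rightarrow> 'e \<Rightarrow> 'e set \<Rightarrow> 'e \<Rightarrow> 'e" where
  "induced_map \<Lambda> t R x = (THE y. y \<in> R \<and> y - (x + t) \<in> \<Lambda>)"

text \<open>
  Partitions are up to measure zero. The pieces are compact and the closures of their interiors:
  if they could be changed on arbitrary null sets, then countably many additional points would
  turn every word into a coding of a point.
\<close>
definition natural_partition ::
    "'e::euclidean_space set \<Rightarrow> 'e \<Rightarrow> ('a \<Rightarrow> 'e set) \<Rightarrow> ('a \<Rightarrow> 'e) \<Rightarrow> bool" where
  "natural_partition \<Lambda> t R \<tau> \<longleftrightarrow>
     full_rank_lattice \<Lambda> \<and>
     fundamental_domain \<Lambda> (\<Union>i. R i) \<and>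
     (\<forall>i. compact (R i) \<and> closure (interior (R i)) = R i) \<and>
     (\<forall>i j. i \<noteq> j \<longrightarrow> negligible (R i \<inter> R j)) \<and>
     (\<forall>i. AE x in lborel. x \<in> R i \<longrightarrow> induced_map \<Lambda> t (\<Union>i. R i) x = x + \<tau> i)"

text \<open>
  The induced map acts on the piece \<open>R i\<close> as the translation by \<open>\<tau> i\<close>, so the \<open>n\<close>-th point of the
  orbit of \<open>x\<close> is \<open>x + \<tau> \<omega>\<^sub>0 + \<dots> + \<tau> \<omega>\<^sub>n\<^sub>-\<^sub>1\<close>. A point whose orbit meets common boundaries
  of pieces can have several codings.
\<close>
definition codes_point ::
    "('a \<Rightarrow> 'e::euclidean_space set) \<Rightarrow> ('a \<Rightarrow> 'e) \<Rightarrow> 'a stream \<Rightarrow> 'e \<Rightarrow> bool" where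
  "codes_point R \<tau> \<omega> x \<longleftrightarrow> (\<forall>n. x + (\<Sum>k<n. \<tau> (\<omega> !! k)) \<in> R (\<omega> !! n))"

text \<open>One partition serves for all words.\<close>
definition natural_codings ::
    "'e::euclidean_space set \<Rightarrow> 'e \<Rightarrow> 'a stream set \<Rightarrow> bool" where
  "natural_codings \<Lambda> t X \<longleftrightarrow>
     (\<exists>R \<tau>. natural_partition \<Lambda> t R \<tau> \<and> (\<forall>\<omega>\<in>X. \<exists>x. codes_point R \<tau> \<omega> x))"

end

theory Submission
  imports Defs "HOL-Analysis.Kronecker_Approximation_Theorem"
begin

text \<open>
  The transposed Brun matrices do not increase the sup norm of a row vector \<open>x\<close> as long as \<open>x\<close>
  remains orthogonal to a vector with increasing coordinates, and five consecutive \<open>\<beta>\<^sub>3\<close> contract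
  it by \<open>3/4\<close>. Since this block has positive measure, it recurs with positive frequency, and the
  contraction rates are summable, with bounds that recur at infinitely many levels. This gives the
  gap between the first two exponents (the third is controlled by the determinant), the eigenvector
  \<open>u\<close>, and compact Rauzy pieces.

  For the tiling, let the dual substitutions act on the faces of discrete planes. The descendants of
  one face at level \<open>n\<close> have a boundary whose size is governed by matrices on pairs of letters that
  are dominated by the Brun products with the same contraction rate; so the boundary is negligible
  against the number of faces. Two pieces can only overlap near it, hence they overlap in a null set.
  The same argument shows that each piece is the closure of its interior.

  Finally, adding a letter to a prefix translates the pieces by a fixed vector modulo the lattice.
  This rotation is minimal because \<open>u\<close> satisfies no integer relation, so a word determines the point
  it codes, and unique ergodicity of the rotation transfers to the words.
\<close>

section \<open>Brun matrices\<close>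

text \<open>The obstacle is that the contraction is not uniform: between two blocks of five
  \<open>brun3\<close> there may be arbitrarily long stretches without gain, so the pieces of level
  \<open>n\<close> have no size bound uniform in \<open>n\<close>. All geometric estimates therefore
  use only levels where a block begins and the sum of later rates is at most a fixed
  \<open>C\<close>. There the block makes the eigenvector balanced, the sum bounds the pieces, and
  tiles that overlap have base points at bounded distance. Such levels recur with positive
  probability without any large deviation estimate, by stationarity and a sum read backwards from a
  common last level. Faces are handled through words: a face is dual to the lattice edge where a
  path crosses height 0, and a boundary square is a swap of two adjacent letters of a path. Two
  faces of different colours lie on rearrangements of one path, so sorting by adjacent swaps finds a
  boundary square near them. The value 3/4 serves both row vectors and pair weights, so one
  \<open>contraction_rate\<close> governs the exponents, the diameters and the boundaries.\<close>

lemma letter_neq [simp]: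
  "(1::3) \<noteq> 2" "(2::3) \<noteq> 1" "(3::3) \<noteq> 1" "(3::3) \<noteq> 2" "(1::3) \<noteq> 3" "(2::3) \<noteq> 3"
  by simp_all

lemma incidence_mult:
  "incidence_matrix brun1 *v y = vector [y$1, y$2, y$2 + y$3]"
  "incidence_matrix brun2 *v y = vector [y$1, y$3, y$2 + y$3]"
  "incidence_matrix brun3 *v y = vector [y$2, y$3, y$1 + y$3]"
  by (simp_all add: vec_eq_iff forall_3 matrix_vector_mult_def sum_3 incidence_matrix_def
      brun1_def brun2_def brun3_def)

lemma vector_incidence_mult:
  "y v* incidence_matrix brun1 = vector [y$1, y$2 + y$3, y$3]"
  "y v* incidence_matrix brun2 = vector [y$1, y$3, y$2 + y$3]"
  "y v* incidence_matrix brun3 = vector [y$3, y$1, y$2 + y$3]"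
  by (simp_all add: vec_eq_iff forall_3 vector_matrix_mult_def sum_3 incidence_matrix_def
      brun1_def brun2_def brun3_def)

section \<open>The cone of ordered vectors and the contraction of row vectors orthogonal to
  it\<close>

definition sorted_vec :: "real^3 \<Rightarrow> bool" where
  "sorted_vec u \<longleftrightarrow> 0 \<le> u$1 \<and> u$1 \<le> u$2 \<and> u$2 \<le> u$3 \<and> 0 < u$3"

lemma brun_cases:
  assumes "s \<in> brun_substitutions"
  obtains "s = brun1" | "s = brun2" | "s = brun3"
  using assms by (auto simp: brun_substitutions_def)

lemma sorted_vec_incidence:
  "s \<in> brun_substitutions \<Longrightarrow> sorted_vec u \<Longrightarrow> sorted_vec (incidence_matrix s *v u)"
  by (erule brun_cases) (auto simp: sorted_vec_def incidence_mult)

lemma inner_3: "(x::real^3) \<bullet> y = x$1 * y$1 + x$2 * y$2 + x$3 * y$3"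
  by (simp add: inner_vec_def sum_3)

text \<open>Summation by parts writes the inner product as a combination of the tail sums of
  \<open>x\<close> with the nonnegative weights \<open>u$1\<close>, \<open>u$2 - u$1\<close>,
  \<open>u$3 - u$2\<close>, not all zero. Hence the tails cannot share one strict sign. This
  obstruction is the source of the contraction of row vectors.\<close>

lemma mixed_tails:
  fixes x u :: "real^3"
  assumes "sorted_vec u" "x \<bullet> u = 0"
  shows "\<not> (x$3 > 0 \<and> x$2 + x$3 > 0 \<and> x$1 + x$2 + x$3 > 0)"
    and "\<not> (x$3 < 0 \<and> x$2 + x$3 < 0 \<and> x$1 + x$2 + x$3 < 0)"
proof -
  have eq: "(x$1 + x$2 + x$3) * u$1 + (x$2 + x$3) * (u$2 - u$1) + x$3 * (u$3 - u$2) = 0"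
    using assms(2) by (simp add: inner_3 algebra_simps)
  have nn: "u$1 \<ge> 0" "u$2 - u$1 \<ge> 0" "u$3 - u$2 \<ge> 0" "u$1 > 0 \<or> u$2 - u$1 > 0 \<or> u$3 - u$2 > 0"
    using assms(1) by (auto simp: sorted_vec_def)
  show "\<not> (x$3 > 0 \<and> x$2 + x$3 > 0 \<and> x$1 + x$2 + x$3 > 0)"
  proof
    assume a: "x$3 > 0 \<and> x$2 + x$3 > 0 \<and> x$1 + x$2 + x$3 > 0"
    then have "(x$1 + x$2 + x$3) * u$1 \<ge> 0" "(x$2 + x$3) * (u$2 - u$1) \<ge> 0" "x$3 * (u$3 - u$2) \<ge> 0"
      using nn by auto
    moreover have "(x$1 + x$2 + x$3) * u$1 > 0 \<or> (x$2 + x$3) * (u$2 - u$1) > 0 \<or> x$3 * (u$3 - u$2) > 0"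
      using nn(4) a by (metis mult_pos_pos)
    ultimately show False using eq by linarith
  qed
  show "\<not> (x$3 < 0 \<and> x$2 + x$3 < 0 \<and> x$1 + x$2 + x$3 < 0)"
  proof
    assume a: "x$3 < 0 \<and> x$2 + x$3 < 0 \<and> x$1 + x$2 + x$3 < 0"
    then have "(x$1 + x$2 + x$3) * u$1 \<le> 0" "(x$2 + x$3) * (u$2 - u$1) \<le> 0" "x$3 * (u$3 - u$2) \<le> 0"
      using nn by (auto intro!: mult_nonpos_nonneg)
    moreover have "(x$1 + x$2 + x$3) * u$1 < 0 \<or> (x$2 + x$3) * (u$2 - u$1) < 0 \<or> x$3 * (u$3 - u$2) < 0"
      using nn(4) a by (metis mult_neg_pos)
    ultimately show False using eq by linarith
  qed
qed

definition bounded_by :: "real \<Rightarrow> real^3 \<Rightarrow> bool" where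
  "bounded_by r x \<longleftrightarrow> (\<forall>i. \<bar>x$i\<bar> \<le> r)"

text \<open>Only the entry \<open>x$2 + x$3\<close> is new, the others are copied. If it exceeded
  \<open>r\<close>, then \<open>x$3\<close> and \<open>x$1 + x$2 + x$3\<close> would be positive,
  and with them every tail of the image, against \<open>mixed_tails\<close>; likewise below
  \<open>- r\<close>. It is the image, not \<open>x\<close>, that must be orthogonal to the sorted
  vector.\<close>

lemma bounded_by_vector_incidence:
  assumes "s \<in> brun_substitutions" "sorted_vec u" "bounded_by r x"
    "(x v* incidence_matrix s) \<bullet> u = 0"
  shows "bounded_by r (x v* incidence_matrix s)"
proof -
  note t = mixed_tails[OF assms(2,4)]
  show ?thesis
    using assms(1)
  proof (cases rule: brun_cases)
    case 1
    show ?thesis using t assms(3) unfolding 1 bounded_by_def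
      by (simp add: vector_incidence_mult forall_3) (smt (verit))
  next
    case 2
    show ?thesis using t assms(3) unfolding 2 bounded_by_def
      by (simp add: vector_incidence_mult forall_3) (smt (verit))
  next
    case 3
    show ?thesis using t assms(3) unfolding 3 bounded_by_def
      by (simp add: vector_incidence_mult forall_3) (smt (verit))
  qed
qed

text \<open>Each tail of the image is a positive multiple of a chosen entry plus a small remainder.
  For the entry e = x1 + x2 + 2 x3 the tails are 2 e + x2, 3 e + x2 and 4 e + 2 x2 + x3, all
  positive as soon as e > 3/4 r. The last of them is where 3/4 enters.\<close>

lemma brun3_contraction:
  assumes "sorted_vec u" "bounded_by r x"
    "(((\<lambda>x. x v* incidence_matrix brun3) ^^ 5) x) \<bullet> u = 0"
  shows "bounded_by (3/4 * r) (((\<lambda>x. x v* incidence_matrix brun3) ^^ 5) x)"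
proof -
  have eq: "((\<lambda>x. x v* incidence_matrix brun3) ^^ 5) x =
      vector [x$1 + 2*x$2 + 3*x$3, x$1 + x$2 + 2*x$3, 2*x$1 + 3*x$2 + 4*x$3]"
    by (simp add: eval_nat_numeral vector_incidence_mult vec_eq_iff forall_3)
  show ?thesis
    using mixed_tails[OF assms(1,3)] assms(2) unfolding eq bounded_by_def
    by (simp add: forall_3) (smt (verit))
qed

lemma brun3_power5:
  "((*v) (incidence_matrix brun3) ^^ 5) u =
     vector [u$1 + u$2 + 2*u$3, 2*u$1 + u$2 + 3*u$3, 3*u$1 + 2*u$2 + 4*u$3]"
  by (simp add: eval_nat_numeral incidence_mult vec_eq_iff forall_3)

text \<open>
  Weights of unordered pairs of letters, indexed by the letter missing from the pair. Boundary
  squares of type \<open>{i, j}\<close> at level \<open>n + 1\<close> produce boundary squares at level \<open>n\<close> according to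
  the transpose of these maps.
\<close>
definition pair_step :: "3 substitution \<Rightarrow> real^3 \<Rightarrow> real^3" where
  "pair_step s p =
     (if s = brun1 then vector [p$1, p$2 + p$3, p$3]
      else if s = brun2 then vector [p$1, p$2 + p$3, p$2]
      else vector [p$2, p$1 + p$3, p$1])"

text \<open>The coordinate bounds alone are not inductive, because \<open>pair_step\<close> adds
  coordinates: under \<open>brun3\<close> the sum \<open>p$1 + p$3\<close> becomes a coordinate. The
  two bounds on sums close the family under all three maps. Together with the bound on
  \<open>p$2\<close> they also compare the totals of \<open>p\<close> and \<open>u\<close>.\<close>

definition dominated :: "real \<Rightarrow> real^3 \<Rightarrow> real^3 \<Rightarrow> bool" where
  "dominated k u p \<longleftrightarrow> p$1 \<le> k * u$2 \<and> p$3 \<le> k * u$2 \<and> p$2 \<le> k * u$3 \<and>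
     p$1 + p$3 \<le> k * (u$1 + u$2) \<and> p$1 + p$2 \<le> k * (u$1 + u$3)"

lemma brun_distinct: "brun1 \<noteq> brun2" "brun1 \<noteq> brun3" "brun2 \<noteq> brun3"
  by (auto simp: fun_eq_iff brun1_def brun2_def brun3_def)

lemma pair_step_simps:
  "pair_step brun1 p = vector [p$1, p$2 + p$3, p$3]"
  "pair_step brun2 p = vector [p$1, p$2 + p$3, p$2]"
  "pair_step brun3 p = vector [p$2, p$1 + p$3, p$1]"
  using brun_distinct by (auto simp: pair_step_def)

lemma dominated_step:
  assumes "s \<in> brun_substitutions" "sorted_vec u" "k \<ge> 0" "dominated k u p"
  shows "dominated k (incidence_matrix s *v u) (pair_step s p)"
proof -
  have "k * u$1 \<le> k * u$2" "k * u$2 \<le> k * u$3" "0 \<le> k * u$1"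
    using assms(2,3) by (auto simp: sorted_vec_def intro: mult_left_mono)
  then show ?thesis
    using assms(1,4) unfolding dominated_def
    by (elim brun_cases) (auto simp: incidence_mult pair_step_simps distrib_left)
qed

text \<open>The new coordinates are regrouped into the sums that \<open>dominated\<close> controls.
  The first one, for instance, is (p1 + p2) + (p1 + p3), at most k (2 u1 + u2 + u3), while 3/4 of
  the new second coordinate of \<open>u\<close> is (6 u1 + 3 u2 + 9 u3)/4; sortedness of
  \<open>u\<close> closes the gap.\<close>

lemma dominated_brun3:
  assumes "sorted_vec u" "k \<ge> 0" "dominated k u p"
  shows "dominated (3/4 * k) (((*v) (incidence_matrix brun3) ^^ 5) u) ((pair_step brun3 ^^ 5) p)"
proof -
  have p: "(pair_step brun3 ^^ 5) p = vector
     [2*p$1 + p$2 + p$3, 2*p$1 + 2*p$2 + p$3, p$1 + p$2 + p$3]"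
    by (simp add: eval_nat_numeral pair_step_simps vec_eq_iff forall_3)
  have "k * u$1 \<le> k * u$2" "k * u$2 \<le> k * u$3" "0 \<le> k * u$1"
    using assms(1,2) by (auto simp: sorted_vec_def intro: mult_left_mono)
  then show ?thesis
    using assms(3) unfolding dominated_def p brun3_power5
    by (simp add: algebra_simps)
qed

section \<open>Products along a directive sequence\<close>

lemma incidence_upto_Suc_left:
  "incidence_upto \<sigma> (Suc n) = incidence_matrix (shd \<sigma>) ** incidence_upto (stl \<sigma>) n"
proof (induction n)
  case 0
  then show ?case by simp
next
  case (Suc n)
  have "incidence_upto \<sigma> (Suc (Suc n)) = incidence_upto \<sigma> (Suc n) ** incidence_matrix (stl \<sigma> !! n)"
    by simp
  also have "\<dots> = incidence_matrix (shd \<sigma>) ** incidence_upto (stl \<sigma>) (Suc n)"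
    unfolding Suc.IH by (simp add: matrix_mul_assoc)
  finally show ?case .
qed

lemma incidence_upto_add:
  "incidence_upto \<sigma> (m + n) = incidence_upto \<sigma> m ** incidence_upto (sdrop m \<sigma>) n"
proof (induction n)
  case (Suc n)
  then show ?case
    by (simp add: matrix_mul_assoc sdrop_snth)
qed simp

section \<open>Counting contracting blocks\<close>

definition contraction_rate :: real where
  "contraction_rate = root 5 (3/4)"

lemma contraction_rate_bounds: "0 < contraction_rate" "contraction_rate < 1"
  by (auto simp: contraction_rate_def)

lemma contraction_rate_power5: "contraction_rate ^ 5 = 3/4"
  by (simp add: contraction_rate_def)

definition occurs :: "3 substitution stream \<Rightarrow> nat \<Rightarrow> bool" where
  "occurs \<sigma> m \<longleftrightarrow> (\<forall>j<5. \<sigma> !! (m + j) = brun3)"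

text \<open>Overlapping blocks are all counted. This keeps the expectation linear in the number of
  levels; the price is a fifth root in \<open>contraction_rate\<close>.\<close>

definition visits :: "3 substitution stream \<Rightarrow> nat \<Rightarrow> nat \<Rightarrow> nat" where
  "visits \<sigma> m k = card {l. m \<le> l \<and> l + 5 \<le> m + k \<and> occurs \<sigma> l}"

lemma visits_0 [simp]: "visits \<sigma> m 0 = 0"
proof -
  have "{l. m \<le> l \<and> l + 5 \<le> m + 0 \<and> occurs \<sigma> l} = {}" by auto
  then show ?thesis unfolding visits_def by (simp only: card.empty)
qed

lemma finite_visits [simp]: "finite {l. m \<le> l \<and> l + 5 \<le> m + k \<and> occurs \<sigma> l}"
  by (rule finite_subset[of _ "{..m+k}"]) auto

lemma visits_Suc_le:
  "visits \<sigma> m (Suc k) \<le> (if occurs \<sigma> m then 1 else 0) + visits \<sigma> (Suc m) k"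
proof -
  have "{l. m \<le> l \<and> l + 5 \<le> m + Suc k \<and> occurs \<sigma> l} \<subseteq>
      (if occurs \<sigma> m then {m} else {}) \<union> {l. Suc m \<le> l \<and> l + 5 \<le> Suc m + k \<and> occurs \<sigma> l}"
    by (auto simp: le_eq_less_or_eq)
  then have "visits \<sigma> m (Suc k) \<le> card ((if occurs \<sigma> m then {m} else {}) \<union>
       {l. Suc m \<le> l \<and> l + 5 \<le> Suc m + k \<and> occurs \<sigma> l})"
    unfolding visits_def
    by (intro card_mono) (auto intro: finite_subset[of _ "{..m+k}"])
  also have "\<dots> \<le> card (if occurs \<sigma> m then {m} else {}) + visits \<sigma> (Suc m) k"
    unfolding visits_def by (rule card_Un_le)
  finally show ?thesis by (auto split: if_splits)
qed

lemma visits_add_le: "visits \<sigma> m (k + j) \<le> j + visits \<sigma> (m + j) k"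
proof (induction j arbitrary: m)
  case (Suc j)
  have "visits \<sigma> m (Suc (k + j)) \<le> 1 + visits \<sigma> (Suc m) (k + j)"
    using visits_Suc_le[of \<sigma> m "k + j"] by (auto split: if_splits)
  also have "\<dots> \<le> 1 + (j + visits \<sigma> (Suc m + j) k)"
    using Suc.IH[of "Suc m"] by simp
  finally show ?case by simp
qed simp

lemma visits_sdrop: "visits (sdrop n \<sigma>) m k = visits \<sigma> (n + m) k"
proof -
  have "{l. n + m \<le> l \<and> l + 5 \<le> n + m + k \<and> occurs \<sigma> l} =
      (+) n ` {l. m \<le> l \<and> l + 5 \<le> m + k \<and> occurs (sdrop n \<sigma>) l}"
  proof (intro set_eqI iffI)
    fix l assume l: "l \<in> {l. n + m \<le> l \<and> l + 5 \<le> n + m + k \<and> occurs \<sigma> l}"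
    then have "l = n + (l - n)" by simp
    with l show "l \<in> (+) n ` {l. m \<le> l \<and> l + 5 \<le> m + k \<and> occurs (sdrop n \<sigma>) l}"
      by (intro image_eqI[of _ _ "l - n"]) (auto simp: occurs_def sdrop_snth add.assoc)
  qed (auto simp: occurs_def sdrop_snth add.assoc)
  then show ?thesis
    by (simp add: visits_def card_image)
qed

text \<open>Disjoint blocks are selected greedily. A selected block gains the factor 3/4 and skips
  five levels, which costs at most five counted visits, so each visit is worth the fifth root of
  3/4. The predicate \<open>Q\<close> is abstract because the same bookkeeping serves row vectors
  and pair weights.\<close>

lemma visits_rule:
  fixes Q :: "nat \<Rightarrow> nat \<Rightarrow> real \<Rightarrow> bool"
  assumes base: "\<And>m. Q m 0 1"
    and step: "\<And>m k r. 0 \<le> r \<Longrightarrow> Q (Suc m) k r \<Longrightarrow> Q m (Suc k) r"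
    and occ: "\<And>m k r. 0 \<le> r \<Longrightarrow> occurs \<sigma> m \<Longrightarrow> Q (m + 5) k r \<Longrightarrow> Q m (k + 5) (3/4 * r)"
    and mono: "\<And>m k r s. r \<le> s \<Longrightarrow> Q m k r \<Longrightarrow> Q m k s"
  shows "Q m k (contraction_rate ^ visits \<sigma> m k)"
proof -
  have "\<exists>r\<ge>0. Q m k r \<and> r ^ 5 \<le> (3/4) ^ visits \<sigma> m k"
  proof (induction k arbitrary: m rule: less_induct)
    case (less k)
    show ?case
    proof (cases "occurs \<sigma> m \<and> k \<ge> 5")
      case True
      define j where "j = k - 5"
      have k: "k = j + 5" "j < k" using True by (auto simp: j_def)
      obtain r where r: "r \<ge> 0" "Q (m + 5) j r" "r ^ 5 \<le> (3/4) ^ visits \<sigma> (m + 5) j"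
        using less[OF k(2)] by blast
      have "(3/4 * r) ^ 5 \<le> (3/4) ^ 5 * (3/4) ^ visits \<sigma> (m + 5) j"
        unfolding power_mult_distrib using r by (intro mult_left_mono) auto
      also have "\<dots> = (3/4) ^ (5 + visits \<sigma> (m + 5) j)"
        by (simp add: power_add)
      also have "\<dots> \<le> (3/4) ^ visits \<sigma> m k"
        unfolding k by (intro power_decreasing visits_add_le) auto
      finally show ?thesis
        using r True occ[of r m j] k by (intro exI[of _ "3/4 * r"]) auto
    next
      case False
      show ?thesis
      proof (cases k)
        case 0
        then show ?thesis using base by (intro exI[of _ 1]) auto
      next
        case (Suc j)
        obtain r where r: "r \<ge> 0" "Q (Suc m) j r" "r ^ 5 \<le> (3/4) ^ visits \<sigma> (Suc m) j"
          using less[of j] Suc by blast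
        \<comment> \<open>Either no block begins at \<open>m\<close>, or fewer than five levels
          remain and there is nothing to count: moving on by one level loses no visit.\<close>
        have "visits \<sigma> m k \<le> visits \<sigma> (Suc m) j"
        proof (cases "occurs \<sigma> m")
          case True
          then have "k < 5" using False by auto
          then have "visits \<sigma> m k = 0" by (auto simp: visits_def)
          then show ?thesis by simp
        next
          case False
          then show ?thesis using visits_Suc_le[of \<sigma> m j] Suc by simp
        qed
        then have "(3/4::real) ^ visits \<sigma> (Suc m) j \<le> (3/4) ^ visits \<sigma> m k"
          by (intro power_decreasing) auto
        then show ?thesis
          using r step[OF r(1,2)] Suc order_trans[OF r(3)] by (intro exI[of _ r]) auto
      qed
    qed
  qed
  then obtain r where r: "r \<ge> 0" "Q m k r" "r ^ 5 \<le> (3/4) ^ visits \<sigma> m k"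
    by blast
  have "(contraction_rate ^ visits \<sigma> m k) ^ 5 = (3/4) ^ visits \<sigma> m k"
    by (simp add: contraction_rate_power5[symmetric] flip: power_mult, simp add: mult.commute)
  then have "r \<le> contraction_rate ^ visits \<sigma> m k"
    using r by (intro power_le_imp_le_base[of r 4]) (auto simp: contraction_rate_bounds less_imp_le)
  then show ?thesis using mono r by blast
qed

section \<open>Products of matrices and pair weights along one directive sequence\<close>

locale brun_sequence =
  fixes \<sigma> :: "3 substitution stream"
  assumes brun: "\<And>n. \<sigma> !! n \<in> brun_substitutions"
begin

definition prod_mat :: "nat \<Rightarrow> nat \<Rightarrow> real^3^3" where
  "prod_mat m k = incidence_upto (sdrop m \<sigma>) k"

lemma prod_mat_0 [simp]: "prod_mat m 0 = mat 1"
  by (simp add: prod_mat_def)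

lemma prod_mat_Suc: "prod_mat m (Suc k) = prod_mat m k ** incidence_matrix (\<sigma> !! (m + k))"
  by (simp add: prod_mat_def sdrop_snth)

lemma prod_mat_Suc_left:
  "prod_mat m (Suc k) = incidence_matrix (\<sigma> !! m) ** prod_mat (Suc m) k"
  unfolding prod_mat_def incidence_upto_Suc_left by (simp only: sdrop_simps)

lemma prod_mat_add: "prod_mat m (k + l) = prod_mat m k ** prod_mat (m + k) l"
  by (simp add: prod_mat_def incidence_upto_add sdrop_add)

lemma prod_mat_occurs:
  assumes "occurs \<sigma> m"
  shows "prod_mat m 5 *v u = ((*v) (incidence_matrix brun3) ^^ 5) u"
    and "x v* prod_mat m 5 = ((\<lambda>x. x v* incidence_matrix brun3) ^^ 5) x"
proof -
  have e: "\<sigma> !! m = brun3" "\<sigma> !! Suc m = brun3" "\<sigma> !! Suc (Suc m) = brun3"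
    "\<sigma> !! Suc (Suc (Suc m)) = brun3" "\<sigma> !! Suc (Suc (Suc (Suc m))) = brun3"
    using assms[unfolded occurs_def, rule_format, of 0]
      assms[unfolded occurs_def, rule_format, of 1] assms[unfolded occurs_def, rule_format, of 2]
      assms[unfolded occurs_def, rule_format, of 3] assms[unfolded occurs_def, rule_format, of 4]
    by (simp_all add: eval_nat_numeral)
  have *: "prod_mat m 5 = incidence_matrix brun3 ** (incidence_matrix brun3 **
     (incidence_matrix brun3 ** (incidence_matrix brun3 ** incidence_matrix brun3)))"
    by (simp add: eval_nat_numeral prod_mat_Suc_left e[simplified])
  show "prod_mat m 5 *v u = ((*v) (incidence_matrix brun3) ^^ 5) u"
    unfolding * by (simp add: eval_nat_numeral matrix_vector_mul_assoc[symmetric])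
  show "x v* prod_mat m 5 = ((\<lambda>x. x v* incidence_matrix brun3) ^^ 5) x"
    unfolding * by (simp add: eval_nat_numeral vector_matrix_mul_assoc[symmetric])
qed

lemma sorted_vec_prod_mat: "sorted_vec u \<Longrightarrow> sorted_vec (prod_mat m k *v u)"
proof (induction k arbitrary: m)
  case (Suc k)
  then show ?case
    by (simp add: prod_mat_Suc_left matrix_vector_mul_assoc[symmetric] sorted_vec_incidence brun)
qed simp

lemma prod_mat_contraction:
  assumes "sorted_vec u" "bounded_by r x" "x \<bullet> (prod_mat m k *v u) = 0"
  shows "bounded_by (contraction_rate ^ visits \<sigma> m k * r) (x v* prod_mat m k)"
proof -
  \<comment> \<open>Matrices are peeled off on the left, which changes \<open>x\<close>, so
    \<open>x\<close> is quantified. The sorted vector required by the one-step bound is the image of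
    \<open>u\<close> under the remaining product.\<close>
  define Q where "Q = (\<lambda>m k c. \<forall>x u r. sorted_vec u \<longrightarrow> bounded_by r x \<longrightarrow>
     x \<bullet> (prod_mat m k *v u) = 0 \<longrightarrow> bounded_by (c * r) (x v* prod_mat m k))"
  have "Q m k (contraction_rate ^ visits \<sigma> m k)"
  proof (rule visits_rule)
    fix m show "Q m 0 1" by (simp add: Q_def)
  next
    fix m k and c :: real assume Q: "Q (Suc m) k c" "0 \<le> c"
    show "Q m (Suc k) c"
      unfolding Q_def
    proof (intro allI impI)
      fix x u r assume a: "sorted_vec u" "bounded_by r x" "x \<bullet> (prod_mat m (Suc k) *v u) = 0"
      have b: "bounded_by r (x v* incidence_matrix (\<sigma> !! m))"
        using a by (intro bounded_by_vector_incidence[OF brun sorted_vec_prod_mat[of u "Suc m" k]])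
          (simp_all add: dot_lmul_matrix prod_mat_Suc_left matrix_vector_mul_assoc)
      have "(x v* incidence_matrix (\<sigma> !! m)) \<bullet> (prod_mat (Suc m) k *v u) = 0"
        using a(3) by (simp add: dot_lmul_matrix prod_mat_Suc_left matrix_vector_mul_assoc)
      from Q(1)[unfolded Q_def, rule_format, OF a(1) b this]
      have "bounded_by (c * r) (x v* incidence_matrix (\<sigma> !! m) v* prod_mat (Suc m) k)" .
      then show "bounded_by (c * r) (x v* prod_mat m (Suc k))"
        by (simp add: prod_mat_Suc_left vector_matrix_mul_assoc)
    qed
  next
    fix m k and c :: real assume Q: "Q (m + 5) k c" "0 \<le> c" and o: "occurs \<sigma> m"
    show "Q m (k + 5) (3/4 * c)"
      unfolding Q_def
    proof (intro allI impI)
      fix x u r assume a: "sorted_vec u" "bounded_by r x" "x \<bullet> (prod_mat m (k + 5) *v u) = 0"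
      have e: "prod_mat m (k + 5) = prod_mat m 5 ** prod_mat (m + 5) k"
        using prod_mat_add[of m 5 k] by (simp add: add.commute)
      have b: "bounded_by (3/4 * r) (x v* prod_mat m 5)"
        unfolding prod_mat_occurs(2)[OF o]
        using a by (intro brun3_contraction[OF sorted_vec_prod_mat[of u "m+5" k]])
         (simp_all add: prod_mat_occurs(2)[OF o, symmetric] dot_lmul_matrix e matrix_vector_mul_assoc)
      have "(x v* prod_mat m 5) \<bullet> (prod_mat (m + 5) k *v u) = 0"
        using a(3) by (simp add: dot_lmul_matrix e matrix_vector_mul_assoc)
      from Q(1)[unfolded Q_def, rule_format, OF a(1) b this]
      have "bounded_by (c * (3/4 * r)) (x v* prod_mat m 5 v* prod_mat (m + 5) k)" .
      then show "bounded_by (3/4 * c * r) (x v* prod_mat m (k + 5))"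
        by (simp add: e vector_matrix_mul_assoc mult_ac)
    qed
  next
    fix m k and c d :: real assume cd: "c \<le> d" and Q: "Q m k c"
    show "Q m k d"
      unfolding Q_def
    proof (intro allI impI)
      fix x u r assume a: "sorted_vec u" "bounded_by r x" "x \<bullet> (prod_mat m k *v u) = 0"
      have "0 \<le> r" using a(2) unfolding bounded_by_def by (meson abs_ge_zero order_trans)
      then have "c * r \<le> d * r" using cd by (rule mult_right_mono[rotated])
      then show "bounded_by (d * r) (x v* prod_mat m k)"
        using Q a unfolding Q_def bounded_by_def by (meson order_trans)
    qed
  qed
  then show ?thesis using assms by (simp add: Q_def)
qed

primrec pair_weight :: "nat \<Rightarrow> nat \<Rightarrow> real^3 \<Rightarrow> real^3" where
  "pair_weight m 0 p = p"
| "pair_weight m (Suc k) p = pair_step (\<sigma> !! m) (pair_weight (Suc m) k p)"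

lemma pair_weight_add: "pair_weight m (k + l) p = pair_weight m k (pair_weight (m + k) l p)"
  by (induction k arbitrary: m) auto

lemma pair_weight_occurs:
  assumes "occurs \<sigma> m"
  shows "pair_weight m 5 p = (pair_step brun3 ^^ 5) p"
proof -
  have e: "\<sigma> !! m = brun3" "\<sigma> !! Suc m = brun3" "\<sigma> !! Suc (Suc m) = brun3"
    "\<sigma> !! Suc (Suc (Suc m)) = brun3" "\<sigma> !! Suc (Suc (Suc (Suc m))) = brun3"
    using assms[unfolded occurs_def, rule_format, of 0]
      assms[unfolded occurs_def, rule_format, of 1] assms[unfolded occurs_def, rule_format, of 2]
      assms[unfolded occurs_def, rule_format, of 3] assms[unfolded occurs_def, rule_format, of 4]
    by (simp_all add: eval_nat_numeral)
  show ?thesis by (simp add: eval_nat_numeral e[simplified])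
qed

text \<open>The boundary grows more slowly than the entries of the product, by the very factor that
  contracts row vectors. This is what makes boundaries negligible.\<close>

lemma dominated_pair_weight:
  "dominated (contraction_rate ^ visits \<sigma> m k) (prod_mat m k *v vec 1) (pair_weight m k (vec 1))"
proof -
  define Q where "Q = (\<lambda>m k c. dominated c (prod_mat m k *v vec 1) (pair_weight m k (vec 1)))"
  have s: "sorted_vec (prod_mat m k *v vec 1)" for m k
    by (rule sorted_vec_prod_mat) (simp add: sorted_vec_def)
  have "Q m k (contraction_rate ^ visits \<sigma> m k)"
  proof (rule visits_rule)
    fix m show "Q m 0 1" by (simp add: Q_def dominated_def)
  next
    fix m k and c :: real assume Q: "Q (Suc m) k c" "0 \<le> c"
    show "Q m (Suc k) c"
      using dominated_step[OF brun s Q(2) Q(1)[unfolded Q_def], of m]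
      by (simp add: Q_def prod_mat_Suc_left matrix_vector_mul_assoc)
  next
    fix m k and c :: real assume Q: "Q (m + 5) k c" "0 \<le> c" and o: "occurs \<sigma> m"
    show "Q m (k + 5) (3/4 * c)"
      using dominated_brun3[OF s Q(2) Q(1)[unfolded Q_def]]
        prod_mat_add[of m 5 k] pair_weight_add[of m 5 k]
      by (simp add: Q_def pair_weight_occurs[OF o, symmetric] prod_mat_occurs[OF o, symmetric]
          add.commute matrix_vector_mul_assoc)
  next
    fix m k and c d :: real assume cd: "c \<le> d" and Q: "Q m k c"
    have "0 \<le> (prod_mat m k *v vec 1) $ 1" "0 \<le> (prod_mat m k *v vec 1) $ 2"
      "0 \<le> (prod_mat m k *v vec 1) $ 3"
      using s[of m k] unfolding sorted_vec_def by linarith+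
    then have "c * (prod_mat m k *v vec 1) $ 1 \<le> d * (prod_mat m k *v vec 1) $ 1"
      "c * (prod_mat m k *v vec 1) $ 2 \<le> d * (prod_mat m k *v vec 1) $ 2"
      "c * (prod_mat m k *v vec 1) $ 3 \<le> d * (prod_mat m k *v vec 1) $ 3"
      using cd by (auto intro: mult_right_mono)
    with Q show "Q m k d"
      unfolding Q_def dominated_def by (simp add: distrib_left) 
  qed
  then show ?thesis by (simp add: Q_def)
qed

lemma incidence_inj: "inj ((*v) (incidence_matrix (\<sigma> !! m)))"
  using brun[of m] by (elim brun_cases) (auto intro!: injI simp: incidence_mult vec_eq_iff forall_3)

lemma prod_mat_inj: "inj ((*v) (prod_mat m k))"
proof (induction k arbitrary: m)
  case 0
  show ?case by (simp add: inj_def)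
next
  case (Suc k)
  have "(*v) (prod_mat m (Suc k)) = (*v) (incidence_matrix (\<sigma> !! m)) \<circ> (*v) (prod_mat (Suc m) k)"
    by (auto simp: prod_mat_Suc_left matrix_vector_mul_assoc)
  then show ?case by (simp only: inj_compose[OF incidence_inj[of m] Suc.IH[of "Suc m"]])
qed

end

section \<open>The generalized eigenvector\<close>

definition total :: "real^3 \<Rightarrow> real" where
  "total x = x$1 + x$2 + x$3"

lemma total_add: "total (x + y) = total x + total y"
  and total_diff: "total (x - y) = total x - total y"
  and total_scaleR: "total (c *\<^sub>R x) = c * total x"
  by (simp_all add: total_def algebra_simps)

lemma total_eq_inner: "total x = x \<bullet> vec 1"
  by (simp add: total_def inner_3)

lemma sorted_vec_total: "sorted_vec u \<Longrightarrow> 0 < total u"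
  by (auto simp: sorted_vec_def total_def)

lemma int_lattice_iff_3: "x \<in> int_lattice \<longleftrightarrow> x$1 \<in> \<int> \<and> x$2 \<in> \<int> \<and> x$(3::3) \<in> \<int>"
  by (auto simp: int_lattice_def forall_3)

lemma incidence_int_lattice_iff:
  assumes "s \<in> brun_substitutions"
  shows "incidence_matrix s *v x \<in> int_lattice \<longleftrightarrow> x \<in> int_lattice"
proof -
  have "b \<in> \<int> \<Longrightarrow> a + b \<in> \<int> \<longleftrightarrow> a \<in> \<int>" "b \<in> \<int> \<Longrightarrow> b + a \<in> \<int> \<longleftrightarrow> a \<in> \<int>" for a b :: real
    by (metis Ints_add Ints_diff add_diff_cancel add.commute)+
  then show ?thesis
    using assms by (elim brun_cases) (auto simp: incidence_mult int_lattice_iff_3)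
qed

lemma incidence_surj:
  assumes "s \<in> brun_substitutions"
  shows "\<exists>y. incidence_matrix s *v y = x"
  using assms
proof (cases rule: brun_cases)
  case 1
  show ?thesis unfolding 1
    by (rule exI[of _ "vector [x$1, x$2, x$3 - x$2]"]) (simp add: incidence_mult vec_eq_iff forall_3)
next
  case 2
  show ?thesis unfolding 2
    by (rule exI[of _ "vector [x$1, x$3 - x$2, x$2]"]) (simp add: incidence_mult vec_eq_iff forall_3)
next
  case 3
  show ?thesis unfolding 3
    by (rule exI[of _ "vector [x$3 - x$2, x$1, x$2]"]) (simp add: incidence_mult vec_eq_iff forall_3)
qed

lemma int_lattice_vector_incidence:
  assumes "s \<in> brun_substitutions" "x \<in> int_lattice"
  shows "x v* incidence_matrix s \<in> int_lattice"
  using assms by (elim brun_cases) (auto simp: vector_incidence_mult int_lattice_iff_3)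

lemma vector_incidence_inj:
  assumes "s \<in> brun_substitutions" "x v* incidence_matrix s = 0"
  shows "x = 0"
  using assms by (elim brun_cases) (auto simp: vector_incidence_mult vec_eq_iff forall_3)

context brun_sequence
begin

lemma prod_mat_nonneg:
  assumes "\<And>i. 0 \<le> y$i"
  shows "0 \<le> (prod_mat m k *v y) $ i" "total y \<le> total (prod_mat m k *v y)"
proof -
  have "(\<forall>i. 0 \<le> (prod_mat m k *v y) $ i) \<and> total y \<le> total (prod_mat m k *v y)"
  proof (induction k arbitrary: m)
    case 0
    show ?case using assms by simp
  next
    case (Suc k)
    have *: "(\<forall>i. 0 \<le> x $ i) \<Longrightarrow> (\<forall>i. 0 \<le> (incidence_matrix (\<sigma> !! m) *v x) $ i) \<and>
       total x \<le> total (incidence_matrix (\<sigma> !! m) *v x)" for x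
      using brun[of m] by (elim brun_cases) (auto simp: incidence_mult total_def forall_3)
    show ?case
      using Suc.IH[of "Suc m"] *[of "prod_mat (Suc m) k *v y"]
      by (auto simp: prod_mat_Suc_left matrix_vector_mul_assoc)
  qed
  then show "0 \<le> (prod_mat m k *v y) $ i" "total y \<le> total (prod_mat m k *v y)" by auto
qed

text \<open>The images of the ordered cone, cut at total 1, are nested compact sets. A common point
  has preimages at all levels, and injectivity of the products makes them compatible, including
  their scaling. No contraction is involved, so this works for every sequence; uniqueness of the
  direction follows only from \<open>right_eigenvector_eig\<close>.\<close>

lemma eigenvectors_exist:
  "\<exists>U. \<forall>n. sorted_vec (U n) \<and> U n = incidence_matrix (\<sigma> !! n) *v U (Suc n)"
proof -
  define S where "S = {y :: real^3. 0 \<le> y$1 \<and> y$1 \<le> y$2 \<and> y$2 \<le> y$3}"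
  define K where "K = (\<lambda>n. (*v) (prod_mat 0 n) ` S \<inter> {x. total x = 1})"
  have clS: "closed S"
    unfolding S_def by (intro closed_Collect_conj closed_Collect_le continuous_intros)
  have SM: "incidence_matrix (\<sigma> !! n) *v y \<in> S" if "y \<in> S" for n y
    using that brun[of n] by (elim brun_cases) (auto simp: S_def incidence_mult)
  have SP: "prod_mat m n *v y \<in> S" if "y \<in> S" for m n y
  proof (induction n arbitrary: m)
    case 0
    show ?case using that by simp
  next
    case (Suc n)
    show ?case
      using SM[OF Suc.IH[of "Suc m"], of m] by (simp add: prod_mat_Suc_left matrix_vector_mul_assoc)
  qed
  have "\<Inter>(range K) \<noteq> {}"
  proof (rule compact_nest)
    fix n
    have "closed ((*v) (prod_mat 0 n) ` S)"
      by (intro closed_injective_linear_image clS prod_mat_inj matrix_vector_mul_linear)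
    moreover have "closed {x. total x = 1}"
      unfolding total_def by (intro closed_Collect_eq continuous_intros)
    ultimately have "closed (K n)" unfolding K_def by blast
    moreover have "K n \<subseteq> cbox 0 (vec 1)"
    proof
      fix x assume "x \<in> K n"
      then have "x \<in> S" "total x = 1" using SP by (auto simp: K_def)
      then show "x \<in> cbox 0 (vec 1)"
        by (auto simp: mem_box_cart forall_3 S_def total_def)
    qed
    ultimately show "compact (K n)"
      by (meson bounded_cbox bounded_subset compact_eq_bounded_closed)
    define s where "s = total (prod_mat 0 n *v vec 1)"
    have "sorted_vec (prod_mat 0 n *v vec 1)" 
      by (rule sorted_vec_prod_mat) (simp add: sorted_vec_def)
    then have s: "s > 0" by (simp add: s_def sorted_vec_total)
    have "(1/s) *\<^sub>R vec 1 \<in> S" using s by (simp add: S_def)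
    moreover have "total (prod_mat 0 n *v ((1/s) *\<^sub>R vec 1)) = 1"
      using s unfolding matrix_vector_mult_scaleR total_scaleR s_def[symmetric] by simp
    ultimately show "K n \<noteq> {}" by (auto simp: K_def)
  next
    fix m n :: nat assume "m \<le> n"
    then obtain k where n: "n = m + k" using le_Suc_ex by blast
    show "K n \<subseteq> K m"
    proof
      fix x assume "x \<in> K n"
      then obtain y where y: "y \<in> S" "x = prod_mat 0 n *v y" "total x = 1" by (auto simp: K_def)
      then have "x = prod_mat 0 m *v (prod_mat m k *v y)"
        by (simp add: n prod_mat_add matrix_vector_mul_assoc)
      with SP[OF y(1)] y(3) show "x \<in> K m" by (auto simp: K_def)
    qed
  qed
  then obtain u where u: "u \<in> K n" for n by blast
  define U where "U = (\<lambda>n. SOME y. y \<in> S \<and> u = prod_mat 0 n *v y)"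
  have U: "U n \<in> S" "u = prod_mat 0 n *v U n" for n
  proof -
    have "\<exists>y. y \<in> S \<and> u = prod_mat 0 n *v y" using u[of n] by (auto simp: K_def)
    from someI_ex[OF this] show "U n \<in> S" "u = prod_mat 0 n *v U n" by (auto simp: U_def)
  qed
  have "U n = incidence_matrix (\<sigma> !! n) *v U (Suc n)" for n
  proof -
    have "prod_mat 0 n *v U n = prod_mat 0 n *v (incidence_matrix (\<sigma> !! n) *v U (Suc n))"
      using U(2)[of n] U(2)[of "Suc n"] by (simp add: prod_mat_Suc matrix_vector_mul_assoc)
    then show ?thesis using prod_mat_inj[of 0 n] by (simp add: inj_eq)
  qed
  moreover have "sorted_vec (U n)" for n
  proof -
    \<comment> \<open>The cone \<open>S\<close> contains 0, which makes it closed; total 1 of the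
      common point excludes the zero vector again.\<close>
    have "U n $ 3 \<noteq> 0"
    proof
      assume "U n $ 3 = 0"
      then have "U n = 0" using U(1)[of n] by (auto simp: S_def vec_eq_iff forall_3)
      then have "u = 0" using U(2)[of n] by simp
      then show False using u[of 0] by (auto simp: K_def total_def)
    qed
    then show ?thesis using U(1)[of n] by (auto simp: S_def sorted_vec_def)
  qed
  ultimately show ?thesis by blast
qed

definition eig :: "nat \<Rightarrow> real^3" where
  "eig = (SOME U. \<forall>n. sorted_vec (U n) \<and> U n = incidence_matrix (\<sigma> !! n) *v U (Suc n))"

lemma sorted_eig: "sorted_vec (eig n)"
  and eig_Suc: "eig n = incidence_matrix (\<sigma> !! n) *v eig (Suc n)"
proof -
  have "\<forall>n. sorted_vec (eig n) \<and> eig n = incidence_matrix (\<sigma> !! n) *v eig (Suc n)"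
    unfolding eig_def by (rule someI_ex[OF eigenvectors_exist])
  then show "sorted_vec (eig n)" "eig n = incidence_matrix (\<sigma> !! n) *v eig (Suc n)"
    by blast+
qed

lemma eig_prod: "eig m = prod_mat m k *v eig (m + k)"
proof (induction k arbitrary: m)
  case (Suc k)
  have "eig m = incidence_matrix (\<sigma> !! m) *v (prod_mat (Suc m) k *v eig (Suc m + k))"
    using eig_Suc[of m] Suc.IH[of "Suc m"] by simp
  then show ?case by (simp add: prod_mat_Suc_left matrix_vector_mul_assoc)
qed simp

lemma total_eig_pos: "0 < total (eig n)"
  by (simp add: sorted_eig sorted_vec_total)

text \<open>After a block applied to a sorted v the total is 6 v1 + 4 v2 + 9 v3 and the smallest
  coordinate is v1 + v2 + 2 v3, whence the factor 6. Levels with a block are thus the balanced ones,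
  and this 6 reappears in the overlap and boundary bounds.\<close>

lemma eig_occurs:
  assumes "occurs \<sigma> n"
  shows "total (eig n) \<le> 6 * eig n $ i"
proof -
  have "eig n = vector [eig (n+5)$1 + eig (n+5)$2 + 2*eig (n+5)$3,
      2*eig (n+5)$1 + eig (n+5)$2 + 3*eig (n+5)$3, 3*eig (n+5)$1 + 2*eig (n+5)$2 + 4*eig (n+5)$3]"
    using eig_prod[of n 5] by (simp add: prod_mat_occurs[OF assms] brun3_power5)
  then have e: "eig n $ 1 = eig (n+5)$1 + eig (n+5)$2 + 2*eig (n+5)$3"
    "eig n $ 2 = 2*eig (n+5)$1 + eig (n+5)$2 + 3*eig (n+5)$3"
    "eig n $ 3 = 3*eig (n+5)$1 + 2*eig (n+5)$2 + 4*eig (n+5)$3"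
    by (simp_all add: vec_eq_iff forall_3)
  have "\<forall>i. total (eig n) \<le> 6 * eig n $ i"
    using sorted_eig[of "n+5"] unfolding forall_3 total_def e sorted_vec_def by auto
  then show ?thesis by blast
qed

end

text \<open>Both assumptions hold for almost every directive sequence.\<close>
locale brun_generic = brun_sequence +
  assumes summable_visits_0: "summable (\<lambda>k. contraction_rate ^ visits \<sigma> 0 k)"
    and recurrent: "\<exists>C. \<forall>N. \<exists>n\<ge>N. occurs \<sigma> n \<and> (\<Sum>k. contraction_rate ^ visits \<sigma> n k) \<le> C"
begin

abbreviation rate :: "nat \<Rightarrow> nat \<Rightarrow> real" where
  "rate m k \<equiv> contraction_rate ^ visits \<sigma> m k"

lemma rate_nonneg [simp]: "0 \<le> rate m k"
  by (simp add: contraction_rate_bounds less_imp_le)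

text \<open>The first \<open>m\<close> levels hide at most \<open>m\<close> visits, so passing to
  level \<open>m\<close> costs the factor \<open>contraction_rate ^ m\<close>. Summability survives
  this, a uniform bound on the sums does not; hence the separate recurrence assumption of the
  locale.\<close>

lemma summable_rate: "summable (rate m)"
proof -
  have "summable (\<lambda>k. (1 / contraction_rate ^ m) * rate 0 (k + m))"
    by (intro summable_mult summable_ignore_initial_segment summable_visits_0)
  moreover have "norm (rate m k) \<le> (1 / contraction_rate ^ m) * rate 0 (k + m)" for k
  proof -
    have "contraction_rate ^ (m + visits \<sigma> m k) \<le> rate 0 (k + m)"
      using visits_add_le[of \<sigma> 0 k m] contraction_rate_bounds
      by (intro power_decreasing) (auto simp: less_imp_le)
    then show ?thesis
      using contraction_rate_bounds by (simp add: power_add field_simps)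
  qed
  ultimately show ?thesis by (rule summable_comparison_test'[where N=0])
qed

lemma rate_tendsto_0: "rate m \<longlonglongrightarrow> 0"
  by (rule summable_LIMSEQ_zero[OF summable_rate])

lemma infinitely_occurs: "\<exists>n\<ge>N. occurs \<sigma> n"
  using recurrent by blast

lemma eig_pos: "0 < eig n $ i"
proof -
  obtain m where m: "m \<ge> n" "occurs \<sigma> m" using infinitely_occurs by blast
  have "\<forall>i. 0 < eig m $ i"
    using eig_occurs[OF m(2)] total_eig_pos[of m] by (smt (verit))
  with m(1) have "\<forall>i. 0 < eig n $ i"
  proof (induction n rule: inc_induct)
    case (step n)
    then show ?case
      using brun[of n] eig_Suc[of n] by (elim brun_cases) (auto simp: incidence_mult forall_3 add_pos_pos)
  qed
  then show ?thesis by blast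
qed

text \<open>Total irrationality of the eigenvector. The images of an integer row vector orthogonal
  to it stay integral while their sup norm falls below 1, so one of them is 0, and the matrices are
  injective.\<close>

lemma eig_orthogonal_int:
  assumes "x \<in> int_lattice" "x \<bullet> eig n = 0"
  shows "x = 0"
proof -
  define r where "r = \<bar>x$1\<bar> + \<bar>x$2\<bar> + \<bar>x$3\<bar>"
  have r: "bounded_by r x" "0 \<le> r" by (auto simp: bounded_by_def r_def forall_3)
  have "(\<lambda>k. rate n k * r) \<longlonglongrightarrow> 0"
    using tendsto_mult_right[OF rate_tendsto_0, of n r] by simp
  then have "eventually (\<lambda>k. rate n k * r < 1) sequentially"
    by (rule order_tendstoD) simp
  then obtain k where k: "rate n k * r < 1"
    by (auto simp: eventually_sequentially)
  have "bounded_by (rate n k * r) (x v* prod_mat n k)"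
    by (rule prod_mat_contraction[OF sorted_eig[of "n + k"] r(1)])
       (simp add: eig_prod[symmetric] assms)
  moreover have "x v* prod_mat n k \<in> int_lattice"
    using assms(1)
  proof (induction k arbitrary: n x)
    case (Suc k)
    then show ?case
      by (simp add: prod_mat_Suc_left vector_matrix_mul_assoc[symmetric] int_lattice_vector_incidence brun)
  qed simp
  ultimately have "x v* prod_mat n k = 0"
    using k unfolding bounded_by_def int_lattice_def vec_eq_iff
    by (auto intro: Ints_nonzero_abs_less1 dest: order_le_less_trans)
  then show "x = 0"
  proof (induction k arbitrary: n x)
    case (Suc k)
    have "x v* incidence_matrix (\<sigma> !! n) = 0"
      by (rule Suc.IH[of _ "Suc n"]) (use Suc.prems in \<open>simp add: prod_mat_Suc_left vector_matrix_mul_assoc\<close>)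
    then show ?case by (rule vector_incidence_inj[OF brun])
  qed simp
qed

text \<open>The functional \<open>x \<mapsto> x\<^sub>i - total x * u\<^sub>i / total u\<close> vanishes at \<open>u\<close>, so it is contracted.\<close>
lemma prod_mat_deviation:
  "\<bar>(prod_mat m k *v y) $ i - total (prod_mat m k *v y) * eig m $ i / total (eig m)\<bar>
     \<le> rate m k * (\<bar>y$1\<bar> + \<bar>y$2\<bar> + \<bar>y$3\<bar>)"
proof -
  define f where "f = axis i 1 - (eig m $ i / total (eig m)) *\<^sub>R (vec 1 :: real^3)"
  have f: "f \<bullet> z = z $ i - total z * eig m $ i / total (eig m)" for z
  proof -
    have "vec 1 \<bullet> z = total z" by (simp add: inner_3 total_def)
    then show ?thesis by (simp add: f_def inner_diff_left inner_axis')
  qed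
  have pos: "0 < eig m $ j" for j by (rule eig_pos)
  have le: "eig m $ j \<le> total (eig m)" for j
    using pos[of 1] pos[of 2] pos[of 3] exhaust_3[of j] by (auto simp: total_def)
  have "bounded_by 1 f"
    using pos[of i] le[of i] total_eig_pos[of m]
    by (auto simp: bounded_by_def f_def axis_def abs_if divide_simps)
  then have b: "bounded_by (rate m k * 1) (f v* prod_mat m k)"
    using total_eig_pos[of m]
    by (intro prod_mat_contraction[OF sorted_eig[of "m + k"]])
       (simp_all add: eig_prod[symmetric] f)
  have "\<bar>f \<bullet> (prod_mat m k *v y)\<bar> = \<bar>(f v* prod_mat m k) \<bullet> y\<bar>"
    by (simp only: dot_lmul_matrix)
  also have "\<dots> \<le> \<bar>(f v* prod_mat m k)$1 * y$1\<bar> + \<bar>(f v* prod_mat m k)$2 * y$2\<bar> +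
      \<bar>(f v* prod_mat m k)$3 * y$3\<bar>"
    unfolding inner_3 by linarith
  also have "\<dots> \<le> rate m k * \<bar>y$1\<bar> + rate m k * \<bar>y$2\<bar> + rate m k * \<bar>y$3\<bar>"
    using b unfolding bounded_by_def abs_mult by (intro add_mono mult_right_mono) auto
  finally show ?thesis by (simp add: f algebra_simps)
qed

text \<open>A vector z in all the cones has at every level a nonnegative preimage of total at most
  \<open>total z\<close>. The deviation bound is then a fixed number times a rate that tends to 0,
  so z is a multiple of \<open>eig 0\<close>.\<close>

lemma right_eigenvector_eig: "right_eigenvector \<sigma> (eig 0)"
proof -
  have P: "incidence_upto \<sigma> n = prod_mat 0 n" for n by (simp add: prod_mat_def)
  have "z = (total z / total (eig 0)) *\<^sub>R eig 0 \<and> 0 \<le> total z"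
    if z: "\<And>n. z \<in> (\<lambda>x. prod_mat 0 n *v x) ` {x. \<forall>i. 0 \<le> x $ i}" for z
  proof -
    have nn: "0 \<le> total z" using z[of 0] by (auto simp: total_def)
    have "z $ i - total z * eig 0 $ i / total (eig 0) = 0" for i
    proof -
      have "\<bar>z $ i - total z * eig 0 $ i / total (eig 0)\<bar> \<le> rate 0 n * total z" for n
      proof -
        obtain y where y: "z = prod_mat 0 n *v y" "\<And>i. 0 \<le> y $ i" using z[of n] by auto
        have "\<bar>z $ i - total z * eig 0 $ i / total (eig 0)\<bar> \<le> rate 0 n * total y"
          using prod_mat_deviation[of 0 n y i] y by (simp add: total_def)
        also have "\<dots> \<le> rate 0 n * total z"
          using prod_mat_nonneg(2)[OF y(2), of 0 n] y(1) by (intro mult_left_mono) auto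
        finally show ?thesis .
      qed
      moreover have "(\<lambda>n. rate 0 n * total z) \<longlonglongrightarrow> 0"
        using tendsto_mult_right[OF rate_tendsto_0, of 0 "total z"] by simp
      ultimately have "\<bar>z $ i - total z * eig 0 $ i / total (eig 0)\<bar> \<le> 0"
        by (intro LIMSEQ_le_const) auto
      then show ?thesis by simp
    qed
    then show ?thesis using nn by (simp add: vec_eq_iff)
  qed
  then have "(\<Inter>n. (\<lambda>x. prod_mat 0 n *v x) ` {x. \<forall>i. 0 \<le> x $ i}) \<subseteq> {c *\<^sub>R eig 0 | c. 0 \<le> c}"
    using total_eig_pos[of 0] by (fastforce intro: divide_nonneg_pos)
  moreover have "c *\<^sub>R eig 0 \<in> (\<lambda>x. prod_mat 0 n *v x) ` {x. \<forall>i. 0 \<le> x $ i}" if "0 \<le> c" for c n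
  proof (rule image_eqI)
    show "c *\<^sub>R eig 0 = prod_mat 0 n *v (c *\<^sub>R eig n)"
      using eig_prod[of 0 n] by (simp add: matrix_vector_mult_scaleR)
    show "c *\<^sub>R eig n \<in> {x. \<forall>i. 0 \<le> x $ i}"
      using that eig_pos[of n] by (simp add: less_imp_le)
  qed
  ultimately have "(\<Inter>n. (\<lambda>x. prod_mat 0 n *v x) ` {x. \<forall>i. 0 \<le> x $ i}) = {c *\<^sub>R eig 0 | c. 0 \<le> c}"
    by auto
  then show ?thesis
    unfolding right_eigenvector_def P using eig_pos by blast
qed

end

section \<open>Stepped surfaces\<close>

lemma abelianization_append [simp]: "abelianization (p @ q) = abelianization p + abelianization q"
  by (simp add: abelianization_def vec_eq_iff)

lemma abelianization_Nil [simp]: "abelianization [] = 0"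
  by (simp add: abelianization_def vec_eq_iff)

lemma abelianization_Cons: "abelianization (i # w) = axis i 1 + abelianization w"
  by (simp add: abelianization_def vec_eq_iff axis_def)

lemma abelianization_nth_nonneg [simp]: "0 \<le> abelianization w $ i"
  by (simp add: abelianization_def)

lemma abelianization_int_lattice [simp]: "abelianization w \<in> int_lattice"
  by (simp add: abelianization_def int_lattice_def)

lemma int_lattice_diff: "x \<in> int_lattice \<Longrightarrow> y \<in> int_lattice \<Longrightarrow> x - y \<in> int_lattice"
  and int_lattice_add: "x \<in> int_lattice \<Longrightarrow> y \<in> int_lattice \<Longrightarrow> x + y \<in> int_lattice"
  by (auto simp: int_lattice_def)

lemma axis_int_lattice [simp]: "axis i 1 \<in> int_lattice"
  by (simp add: int_lattice_def axis_def)

lemma abelianization_subst_word: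
  "abelianization (subst_word s w) = incidence_matrix s *v abelianization w"
proof (induction w)
  case (Cons i w)
  have "incidence_matrix s *v axis i 1 = abelianization (s i)"
    by (simp add: matrix_vector_mul_component vec_eq_iff incidence_matrix_def abelianization_def
        matrix_vector_mult_def axis_def if_distrib cong: if_cong)
  with Cons show ?case
    by (simp add: subst_word_def abelianization_Cons matrix_vector_right_distrib)
qed (simp add: subst_word_def)

lemma subst_word_append [simp]: "subst_word s (p @ q) = subst_word s p @ subst_word s q"
  and subst_word_Nil [simp]: "subst_word s [] = []"
  and subst_word_Cons: "subst_word s (i # q) = s i @ subst_word s q"
  by (simp_all add: subst_word_def)

text \<open>
  The pair \<open>(y, i)\<close> stands for the edge from \<open>-y\<close> to \<open>-y + e\<^sub>i\<close>, which crosses height 0. Every path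
  from \<open>-z\<close> that crosses height 0, given by its word of steps, contains exactly one of them.
\<close>
definition surface :: "real^3 \<Rightarrow> ((real^3) \<times> 3) set" where
  "surface v = {(y, i). y \<in> int_lattice \<and> 0 \<le> y \<bullet> v \<and> y \<bullet> v < v $ i}"

text \<open>The value at the empty word is a placeholder for paths that end before crossing. It
  depends only on the endpoint, so rearranged paths that do not cross get equal values and produce
  no spurious boundary.\<close>

primrec crossing :: "real^3 \<Rightarrow> real^3 \<Rightarrow> 3 list \<Rightarrow> (real^3) \<times> 3" where
  "crossing v z [] = (z, 1)"
| "crossing v z (i # w) = (if z \<bullet> v < v $ i then (z, i) else crossing v (z - axis i 1) w)"

lemma inner_axis_1: "axis i 1 \<bullet> (v::real^3) = v $ i"
  by (simp add: inner_axis')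

lemma abelianization_inner_nonneg:
  "(\<And>i. 0 < v $ i) \<Longrightarrow> 0 \<le> abelianization w \<bullet> (v :: real^3)"
  by (simp add: inner_3 less_imp_le)

lemma crossing_append_less:
  assumes "0 \<le> z \<bullet> v" "z \<bullet> v < abelianization w \<bullet> v"
  shows "crossing v z (w @ w') = crossing v z w"
  using assms
  by (induction w arbitrary: z)
     (auto simp: abelianization_Cons inner_add_left inner_diff_left inner_axis_1)

lemma crossing_append_ge:
  assumes "\<And>i. 0 < v $ i" "abelianization w \<bullet> v \<le> z \<bullet> v"
  shows "crossing v z (w @ w') = crossing v (z - abelianization w) w'"
  using assms(2)
proof (induction w arbitrary: z)
  case (Cons i w)
  then have "v $ i \<le> z \<bullet> v" "abelianization w \<bullet> v \<le> (z - axis i 1) \<bullet> v"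
    using abelianization_inner_nonneg[of v w] assms(1)
    by (auto simp: abelianization_Cons inner_add_left inner_diff_left inner_axis_1)
  then show ?case using Cons.IH by (simp add: abelianization_Cons diff_diff_eq)
qed simp

lemma crossing_eqI:
  assumes "\<And>i. 0 < v $ i" "0 \<le> (z - abelianization p) \<bullet> v" "(z - abelianization p) \<bullet> v < v $ i"
  shows "crossing v z (p @ i # s) = (z - abelianization p, i)"
  using assms by (subst crossing_append_ge) (auto simp: inner_diff_left)

lemma crossing_cases:
  assumes "\<And>i. 0 < v $ i" "0 \<le> z \<bullet> v" "z \<bullet> v < abelianization w \<bullet> v"
  obtains p i s where "w = p @ i # s" "0 \<le> (z - abelianization p) \<bullet> v"
    "(z - abelianization p) \<bullet> v < v $ i" "crossing v z w = (z - abelianization p, i)"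
proof -
  have "\<exists>p i s. w = p @ i # s \<and> 0 \<le> (z - abelianization p) \<bullet> v \<and> (z - abelianization p) \<bullet> v < v $ i"
    using assms(2,3)
  proof (induction w arbitrary: z)
    case (Cons i w)
    show ?case
    proof (cases "z \<bullet> v < v $ i")
      case True
      then show ?thesis using Cons.prems by (intro exI[of _ "[]"] exI[of _ i] exI[of _ w]) auto
    next
      case False
      then have "0 \<le> (z - axis i 1) \<bullet> v" "(z - axis i 1) \<bullet> v < abelianization w \<bullet> v"
        using Cons.prems by (auto simp: abelianization_Cons inner_add_left inner_diff_left inner_axis_1)
      from Cons.IH[OF this] obtain p j s where *: "w = p @ j # s"
        "0 \<le> (z - axis i 1 - abelianization p) \<bullet> v" "(z - axis i 1 - abelianization p) \<bullet> v < v $ j"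
        by blast
      then show ?thesis
        by (intro exI[of _ "i # p"] exI[of _ j] exI[of _ s]) (simp add: abelianization_Cons diff_diff_eq)
    qed
  qed simp
  then obtain p i s where *: "w = p @ i # s" "0 \<le> (z - abelianization p) \<bullet> v"
    "(z - abelianization p) \<bullet> v < v $ i" by blast
  moreover have "crossing v z w = (z - abelianization p, i)"
    unfolding *(1) by (rule crossing_eqI) (use assms(1) * in auto)
  ultimately show thesis using that by blast
qed

lemma crossing_in_surface:
  assumes "\<And>i. 0 < v $ i" "z \<in> int_lattice" "0 \<le> z \<bullet> v" "z \<bullet> v < abelianization w \<bullet> v"
  shows "crossing v z w \<in> surface v"
proof -
  from assms(1,3,4) obtain p i s where "0 \<le> (z - abelianization p) \<bullet> v"
    "(z - abelianization p) \<bullet> v < v $ i" "crossing v z w = (z - abelianization p, i)"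
    by (rule crossing_cases)
  then show ?thesis using assms(2) by (auto simp: surface_def int_lattice_diff)
qed

text \<open>The corner \<open>z\<close> stands for the lattice square from \<open>-z\<close> to
  \<open>-z\<close> plus the unit vectors \<open>i\<close> and \<open>j\<close>. Its two edge paths
  cross height 0 in two edges, dual to two adjacent faces, and the square is dual to their common
  side.\<close>

definition boundary :: "real^3 \<Rightarrow> ((real^3) \<times> 3 \<Rightarrow> 'c) \<Rightarrow> 3 \<Rightarrow> 3 \<Rightarrow> (real^3) set" where
  "boundary v c i j = {z \<in> int_lattice. 0 \<le> z \<bullet> v \<and> c (crossing v z [i, j]) \<noteq> c (crossing v z [j, i])}"

lemma boundary_commute: "boundary v c i j = boundary v c j i"
  unfolding boundary_def by metis

text \<open>If the path crosses inside \<open>a\<close>, the two words pick the same edge; if it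
  crosses after the swapped letters, both have reached the same point. Only the square at the end of
  \<open>a\<close> can separate them.\<close>

lemma boundary_swap:
  assumes "\<And>i. 0 < v $ i" "z \<in> int_lattice" "0 \<le> z \<bullet> v"
    "c (crossing v z (a @ i # j # w)) \<noteq> c (crossing v z (a @ j # i # w))"
  shows "z - abelianization a \<in> boundary v c i j"
proof -
  have "\<not> z \<bullet> v < abelianization a \<bullet> v"
  proof
    assume "z \<bullet> v < abelianization a \<bullet> v"
    then show False using assms(3,4) by (simp add: crossing_append_less)
  qed
  then have ge: "abelianization a \<bullet> v \<le> z \<bullet> v" by simp
  define y where "y = z - abelianization a"
  have ne: "c (crossing v y (i # j # w)) \<noteq> c (crossing v y (j # i # w))"
    using assms(4) crossing_append_ge[OF assms(1) ge] by (simp add: y_def)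
  have "y \<bullet> v < v $ i + v $ j"
  proof (rule ccontr)
    assume "\<not> y \<bullet> v < v $ i + v $ j"
    then have "crossing v y ([i, j] @ w) = crossing v (y - abelianization [i, j]) w"
      "crossing v y ([j, i] @ w) = crossing v (y - abelianization [j, i]) w"
      using assms(1)
      by (intro crossing_append_ge; simp add: abelianization_Cons inner_add_left inner_axis_1)+
    then show False using ne by (simp add: abelianization_Cons add.commute)
  qed
  moreover have y0: "0 \<le> y \<bullet> v" using ge by (simp add: y_def inner_diff_left)
  ultimately have "crossing v y ([i, j] @ w) = crossing v y [i, j]" "crossing v y ([j, i] @ w) = crossing v y [j, i]"
    by (intro crossing_append_less; simp add: abelianization_Cons inner_add_left inner_axis_1)+
  with ne have "c (crossing v y [i, j]) \<noteq> c (crossing v y [j, i])" by simp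
  then show ?thesis
    using assms(2) y0 by (auto simp: boundary_def y_def[symmetric]) (simp add: y_def int_lattice_diff)
qed

text \<open>Insertion by adjacent swaps: the colour has to change at one of them.\<close>

lemma boundary_move:
  assumes v: "\<And>i. 0 < v $ i" and "z \<in> int_lattice" "0 \<le> z \<bullet> v"
    "c (crossing v z (b @ x # d)) \<noteq> c (crossing v z (x # b @ d))"
  shows "\<exists>a i j. i \<noteq> j \<and> z - abelianization a \<in> boundary v c i j \<and> mset a \<subseteq># mset (b @ x # d)"
  using assms(2-)
proof (induction b arbitrary: z)
  case (Cons y b)
  show ?case
  proof (cases "c (crossing v z (y # b @ x # d)) = c (crossing v z (y # x # b @ d))")
    case True
    then have ne: "c (crossing v z (y # x # b @ d)) \<noteq> c (crossing v z (x # y # b @ d))"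
      using Cons.prems by simp
    then have "z - abelianization [] \<in> boundary v c y x"
      using Cons.prems by (intro boundary_swap[OF v, where w = "b @ d"]) auto
    moreover have "x \<noteq> y" using ne by auto
    ultimately show ?thesis by (intro exI[of _ "[]"] exI[of _ y] exI[of _ x]) auto
  next
    case False
    then have *: "\<not> z \<bullet> v < v $ y"
      "c (crossing v (z - axis y 1) (b @ x # d)) \<noteq> c (crossing v (z - axis y 1) (x # b @ d))"
      by (auto split: if_splits)
    then obtain a i j where "i \<noteq> j" "z - axis y 1 - abelianization a \<in> boundary v c i j"
      "mset a \<subseteq># mset (b @ x # d)"
      using Cons.IH[of "z - axis y 1"] Cons.prems
      by (auto simp: int_lattice_diff inner_diff_left inner_axis_1)
    then show ?thesis
      by (intro exI[of _ "y # a"] exI[of _ i] exI[of _ j]) (auto simp: abelianization_Cons diff_diff_eq)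
  qed
qed simp

text \<open>Insertion sort from one word to the other. The path \<open>a\<close> to the separating
  square uses only letters of the word, which keeps the square close to the starting point.\<close>

lemma boundary_between:
  assumes v: "\<And>i. 0 < v $ i" and "z \<in> int_lattice" "0 \<le> z \<bullet> v" "mset w1 = mset w2"
    "c (crossing v z w1) \<noteq> c (crossing v z w2)"
  shows "\<exists>a i j. i \<noteq> j \<and> z - abelianization a \<in> boundary v c i j \<and> mset a \<subseteq># mset w1"
  using assms(2-)
proof (induction w1 arbitrary: z w2)
  case (Cons x w)
  from Cons.prems(3) have "x \<in> set w2" by (metis list.set_intros(1) mset_eq_setD)
  then obtain b d where w2: "w2 = b @ x # d" by (meson split_list)
  have m: "mset w = mset (b @ d)" using Cons.prems(3) w2 by simp
  show ?case
  proof (cases "c (crossing v z (b @ x # d)) = c (crossing v z (x # b @ d))")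
    case False
    from boundary_move[OF v Cons.prems(1,2) False] Cons.prems(3) w2 show ?thesis by metis
  next
    case True
    then have "c (crossing v z (x # w)) \<noteq> c (crossing v z (x # b @ d))"
      using Cons.prems w2 by metis
    then have *: "\<not> z \<bullet> v < v $ x"
      "c (crossing v (z - axis x 1) w) \<noteq> c (crossing v (z - axis x 1) (b @ d))"
      by (auto split: if_splits)
    then obtain a i j where "i \<noteq> j" "z - axis x 1 - abelianization a \<in> boundary v c i j"
      "mset a \<subseteq># mset w"
      using Cons.IH[of "z - axis x 1" "b @ d"] Cons.prems m
      by (auto simp: int_lattice_diff inner_diff_left inner_axis_1)
    then show ?thesis
      by (intro exI[of _ "x # a"] exI[of _ i] exI[of _ j]) (auto simp: abelianization_Cons diff_diff_eq)
  qed
qed simp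

lemma word_of_int_lattice:
  assumes "d \<in> int_lattice" "\<And>i. 0 \<le> d $ i"
  obtains p where "abelianization p = (d :: real^3)"
proof -
  have "\<exists>n. d $ i = real n" for i
  proof -
    obtain k where k: "d $ i = of_int k" using assms(1) by (auto simp: int_lattice_def elim: Ints_cases)
    then have "d $ i = real (nat k)" using assms(2)[of i] by simp
    then show ?thesis by blast
  qed
  then obtain n where n: "\<And>i. d $ i = real (n i)" by metis
  have "count_list (replicate k x) y = (if x = y then k else 0)" for k and x y :: 3
    by (induction k) auto
  then have "abelianization (replicate (n 1) 1 @ replicate (n 2) 2 @ replicate (n 3) (3::3)) = d"
    by (simp add: abelianization_def vec_eq_iff forall_3 n)
  then show thesis using that by blast
qed

text \<open>The coordinatewise maximum of \<open>y\<close> and \<open>y'\<close> gives a common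
  starting point for paths to both edges. Visiting one edge first and the other afterwards gives two
  rearrangements of the same word that cross in the two given edges. The final 2 allows for the
  letters \<open>j\<close> and \<open>j'\<close>, which may coincide.\<close>

lemma boundary_near:
  assumes v: "\<And>i. 0 < v $ i" and q: "(y, j) \<in> surface v" "(y', j') \<in> surface v"
    and c: "c (y, j) \<noteq> c (y', j')" and r: "\<And>i. \<bar>y $ i - y' $ i\<bar> \<le> r"
  obtains z i k where "i \<noteq> k" "z \<in> boundary v c i k" "\<And>l. \<bar>z $ l - y $ l\<bar> \<le> r + 2"
proof -
  define z where "z = (\<chi> i. max (y $ i) (y' $ i))"
  have y: "y \<in> int_lattice" "y' \<in> int_lattice" using q by (auto simp: surface_def)
  then have z: "z \<in> int_lattice" by (auto simp: z_def int_lattice_def max_def)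
  obtain p where p: "abelianization p = z - y"
    using word_of_int_lattice[OF int_lattice_diff[OF z y(1)]] by (auto simp: z_def)
  obtain p' where p': "abelianization p' = z - y'"
    using word_of_int_lattice[OF int_lattice_diff[OF z y(2)]] by (auto simp: z_def)
  define w where "w = p @ j # p' @ [j']"
  define w' where "w' = p' @ j' # p @ [j]"
  have "crossing v z w = (y, j)"
    unfolding w_def using crossing_eqI[OF v, of z p j] q(1) by (simp add: p surface_def)
  moreover have "crossing v z w' = (y', j')"
    unfolding w'_def using crossing_eqI[OF v, of z p' j'] q(2) by (simp add: p' surface_def)
  moreover have "mset w = mset w'" by (simp add: w_def w'_def)
  moreover have "0 \<le> z \<bullet> v"
  proof -
    have "y \<bullet> v \<le> z \<bullet> v"
      unfolding inner_3 using v by (intro add_mono mult_right_mono) (auto simp: z_def less_imp_le)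
    then show ?thesis using q(1) by (simp add: surface_def)
  qed
  ultimately obtain a i k where a: "i \<noteq> k" "z - abelianization a \<in> boundary v c i k" "mset a \<subseteq># mset w"
    using boundary_between[OF v z, of w w' c] c by auto
  have "\<bar>(z - abelianization a) $ l - y $ l\<bar> \<le> r + 2" for l
  proof -
    have "count_list a l \<le> count_list w l"
      using mset_subset_eq_count[OF a(3), of l] by (simp add: count_mset)
    then have "abelianization a $ l \<le> abelianization w $ l" by (simp add: abelianization_def)
    also have "\<dots> \<le> (z $ l - y $ l) + (z $ l - y' $ l) + 2"
      by (simp add: w_def abelianization_Cons p p' axis_def)
    finally show ?thesis
      using r[of l] abelianization_nth_nonneg[of a l]
      by (auto simp: z_def max_def abs_le_iff simp del: abelianization_nth_nonneg split: if_splits)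
  qed
  then show thesis using that a by blast
qed

text \<open>The geometric dual of the substitution, read backwards: the faces with parent
  \<open>p\<close> form the image of \<open>p\<close> on the refined surface. As a function it makes
  the images disjoint by construction.\<close>

definition parent :: "3 substitution \<Rightarrow> real^3 \<Rightarrow> (real^3) \<times> 3 \<Rightarrow> (real^3) \<times> 3" where
  "parent s v q = crossing v (incidence_matrix s *v fst q) (s (snd q))"

text \<open>The height of \<open>z\<close> for the row vector \<open>v v* incidence_matrix s\<close>
  is the height of its image for \<open>v\<close>. Hence the substituted path crosses inside the
  image of the letter that crossed before.\<close>

lemma parent_crossing:
  assumes "\<And>i. 0 < v $ i" "\<And>i. 0 < (v v* incidence_matrix s) $ i"
    "0 \<le> z \<bullet> (v v* incidence_matrix s)"
    "z \<bullet> (v v* incidence_matrix s) < abelianization w \<bullet> (v v* incidence_matrix s)"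
  shows "parent s v (crossing (v v* incidence_matrix s) z w) =
     crossing v (incidence_matrix s *v z) (subst_word s w)"
proof -
  have in_eq: "x \<bullet> (v v* incidence_matrix s) = (incidence_matrix s *v x) \<bullet> v" for x
    by (metis dot_lmul_matrix inner_commute)
  obtain p i t where *: "w = p @ i # t" "0 \<le> (z - abelianization p) \<bullet> (v v* incidence_matrix s)"
    "(z - abelianization p) \<bullet> (v v* incidence_matrix s) < (v v* incidence_matrix s) $ i"
    "crossing (v v* incidence_matrix s) z w = (z - abelianization p, i)"
    using crossing_cases[OF assms(2-)] by blast
  have si: "abelianization (s i) \<bullet> v = (v v* incidence_matrix s) $ i"
    using abelianization_subst_word[of s "[i]"] in_eq[of "axis i 1"]
    by (simp add: subst_word_Cons abelianization_Cons inner_axis_1)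
  have "crossing v (incidence_matrix s *v z) (subst_word s p @ (s i @ subst_word s t)) =
      crossing v (incidence_matrix s *v z - abelianization (subst_word s p)) (s i @ subst_word s t)"
    using *(2) by (intro crossing_append_ge assms(1))
      (simp add: abelianization_subst_word in_eq matrix_vector_mult_diff_distrib inner_diff_left)
  also have "\<dots> = crossing v (incidence_matrix s *v z - abelianization (subst_word s p)) (s i)"
    using *(2,3) by (intro crossing_append_less;
      simp add: abelianization_subst_word in_eq matrix_vector_mult_diff_distrib inner_diff_left si)
  also have "\<dots> = parent s v (z - abelianization p, i)"
    by (simp add: parent_def abelianization_subst_word matrix_vector_mult_diff_distrib)
  finally show ?thesis using * by (simp add: subst_word_Cons)
qed

lemma parent_in_surface:
  assumes v: "\<And>i. 0 < v $ i" and "\<And>i. s i \<noteq> []" and q: "q \<in> surface (v v* incidence_matrix s)"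
    and s: "s \<in> brun_substitutions"
  shows "parent s v q \<in> surface v"
proof -
  obtain y i where q': "q = (y, i)" by (cases q)
  have in_eq: "x \<bullet> (v v* incidence_matrix s) = (incidence_matrix s *v x) \<bullet> v" for x
    by (metis dot_lmul_matrix inner_commute)
  have si: "abelianization (s i) \<bullet> v = (v v* incidence_matrix s) $ i"
    using abelianization_subst_word[of s "[i]"] in_eq[of "axis i 1"]
    by (simp add: subst_word_Cons abelianization_Cons inner_axis_1)
  show ?thesis
    unfolding parent_def q' fst_conv snd_conv
    using q by (intro crossing_in_surface v)
      (auto simp: q' surface_def in_eq si incidence_int_lattice_iff[OF s])
qed

section \<open>Growth of boundaries under the dual substitutions\<close>

definition boundary_count :: "real^3 \<Rightarrow> ((real^3) \<times> 3 \<Rightarrow> 'c) \<Rightarrow> real^3" where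
  "boundary_count v c =
     vector [real (card (boundary v c 2 3)), real (card (boundary v c 1 3)), real (card (boundary v c 1 2))]"

definition finite_boundary :: "real^3 \<Rightarrow> ((real^3) \<times> 3 \<Rightarrow> 'c) \<Rightarrow> bool" where
  "finite_boundary v c \<longleftrightarrow> finite (boundary v c 2 3) \<and> finite (boundary v c 1 3) \<and> finite (boundary v c 1 2)"

lemma vector_incidence_pos:
  assumes "s \<in> brun_substitutions" "\<And>i. 0 < v $ i"
  shows "0 < (v v* incidence_matrix s) $ i"
proof -
  have "\<forall>i. 0 < (v v* incidence_matrix s) $ i"
    using assms by (elim brun_cases) (auto simp: vector_incidence_mult forall_3 add_pos_pos)
  then show ?thesis by blast
qed

text \<open>
  Passing from \<open>v\<close> to its image refines the surface. A boundary square of type \<open>{i, j}\<close> of the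
  refined colouring separates the paths \<open>s i @ s j\<close> and \<open>s j @ s i\<close>, which differ by one or two
  transpositions of neighbouring letters, so one of the corresponding squares is a boundary square.
\<close>
lemma boundary_parent:
  assumes s: "s \<in> brun_substitutions" and v: "\<And>i. 0 < v $ i"
    and z: "z \<in> boundary (v v* incidence_matrix s) (\<lambda>q. c (parent s v q)) i j"
  shows "c (crossing v (incidence_matrix s *v z) (s i @ s j)) \<noteq>
         c (crossing v (incidence_matrix s *v z) (s j @ s i))"
    and "incidence_matrix s *v z \<in> int_lattice" "0 \<le> (incidence_matrix s *v z) \<bullet> v"
proof -
  define v' where "v' = v v* incidence_matrix s"
  have v': "0 < v' $ i" for i unfolding v'_def by (rule vector_incidence_pos[OF s v])
  have in_eq: "x \<bullet> v' = (incidence_matrix s *v x) \<bullet> v" for x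
    unfolding v'_def by (metis dot_lmul_matrix inner_commute)
  have z0: "z \<in> int_lattice" "0 \<le> z \<bullet> v'"
    "c (parent s v (crossing v' z [i, j])) \<noteq> c (parent s v (crossing v' z [j, i]))"
    using z by (auto simp: boundary_def v'_def)
  show "incidence_matrix s *v z \<in> int_lattice" "0 \<le> (incidence_matrix s *v z) \<bullet> v"
    using z0 by (simp_all add: incidence_int_lattice_iff[OF s] in_eq)
  have lt: "z \<bullet> v' < v' $ i + v' $ j"
  proof (rule ccontr)
    assume "\<not> z \<bullet> v' < v' $ i + v' $ j"
    then have "crossing v' z [i, j] = crossing v' z [j, i]"
      using v'[of i] v'[of j] by (simp add: inner_diff_left inner_axis_1 diff_diff_eq add.commute)
    then show False using z0(3) by simp
  qed
  have "parent s v (crossing v' z [i, j]) = crossing v (incidence_matrix s *v z) (s i @ s j)"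
    "parent s v (crossing v' z [j, i]) = crossing v (incidence_matrix s *v z) (s j @ s i)"
    using parent_crossing[OF v vector_incidence_pos[OF s v], of z "[i, j]"]
      parent_crossing[OF v vector_incidence_pos[OF s v], of z "[j, i]"] z0(2) lt
    by (simp_all add: v'_def[symmetric] subst_word_Cons abelianization_Cons inner_add_left inner_axis_1)
  then show "c (crossing v (incidence_matrix s *v z) (s i @ s j)) \<noteq>
         c (crossing v (incidence_matrix s *v z) (s j @ s i))"
    using z0(3) by simp
qed

text \<open>The incidence matrix carries corners injectively to corners, and a single swap
  identifies the square that is hit.\<close>

lemma boundary_parent_simple:
  assumes s: "s \<in> brun_substitutions" and v: "\<And>i. 0 < v $ i"
    and w: "s i @ s j = k # l # w" "s j @ s i = l # k # w" and fin: "finite (boundary v c k l)"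
  shows "finite (boundary (v v* incidence_matrix s) (\<lambda>q. c (parent s v q)) i j)"
    "card (boundary (v v* incidence_matrix s) (\<lambda>q. c (parent s v q)) i j) \<le> card (boundary v c k l)"
proof -
  let ?B = "boundary (v v* incidence_matrix s) (\<lambda>q. c (parent s v q)) i j"
  have inj: "inj_on ((*v) (incidence_matrix s)) ?B"
    using s by (elim brun_cases) (auto intro!: inj_onI simp: incidence_mult vec_eq_iff forall_3)
  have sub: "(*v) (incidence_matrix s) ` ?B \<subseteq> boundary v c k l"
  proof safe
    fix z assume z: "z \<in> ?B"
    show "incidence_matrix s *v z \<in> boundary v c k l"
      using boundary_parent[OF s v z] boundary_swap[OF v, of "incidence_matrix s *v z" c "[]" k l w]
      by (simp add: w)
  qed
  show "finite ?B" using inj sub fin by (meson finite_imageD finite_subset)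
  show "card ?B \<le> card (boundary v c k l)"
    using card_mono[OF fin sub] card_image[OF inj] by simp
qed

text \<open>The letter \<open>k\<close> moves past \<open>l\<close> and then past \<open>m\<close>.
  The second swap takes place after the step \<open>l\<close>, hence the translate by
  \<open>axis l 1\<close> in \<open>?C\<close>.\<close>

lemma boundary_parent_double:
  assumes s: "s \<in> brun_substitutions" and v: "\<And>i. 0 < v $ i"
    and w: "s i @ s j = [k, l, m]" "s j @ s i = [l, m, k]"
    and fin: "finite (boundary v c k l)" "finite (boundary v c k m)"
  shows "finite (boundary (v v* incidence_matrix s) (\<lambda>q. c (parent s v q)) i j)"
    "card (boundary (v v* incidence_matrix s) (\<lambda>q. c (parent s v q)) i j)
       \<le> card (boundary v c k l) + card (boundary v c k m)"
proof -
  let ?B = "boundary (v v* incidence_matrix s) (\<lambda>q. c (parent s v q)) i j"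
  have inj: "inj_on ((*v) (incidence_matrix s)) ?B"
    using s by (elim brun_cases) (auto intro!: inj_onI simp: incidence_mult vec_eq_iff forall_3)
  let ?C = "boundary v c k l \<union> (+) (axis l 1) ` boundary v c k m"
  have sub: "(*v) (incidence_matrix s) ` ?B \<subseteq> ?C"
  proof safe
    fix z assume z: "z \<in> ?B" and no: "incidence_matrix s *v z \<notin> (+) (axis l 1) ` boundary v c k m"
    define y where "y = incidence_matrix s *v z"
    have y: "c (crossing v y [k, l, m]) \<noteq> c (crossing v y [l, m, k])" "y \<in> int_lattice" "0 \<le> y \<bullet> v"
      using boundary_parent[OF s v z] by (simp_all add: w y_def)
    have "c (crossing v y [l, k, m]) = c (crossing v y [l, m, k])"
    proof (rule ccontr)
      assume "c (crossing v y [l, k, m]) \<noteq> c (crossing v y [l, m, k])"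
      then have "y - axis l 1 \<in> boundary v c k m"
        using boundary_swap[OF v y(2,3), of c "[l]" k m "[]"] by (simp add: abelianization_Cons)
      then show False using no by (auto simp: y_def intro: image_eqI[of _ _ "y - axis l 1"])
    qed
    then show "incidence_matrix s *v z \<in> boundary v c k l"
      using y boundary_swap[OF v y(2,3), of c "[]" k l "[m]"] by (simp add: y_def)
  qed
  have finC: "finite ?C" using fin by simp
  show "finite ?B" using inj sub finC by (meson finite_imageD finite_subset)
  have "card ?B \<le> card ?C"
    using card_mono[OF finC sub] card_image[OF inj] by simp
  also have "\<dots> \<le> card (boundary v c k l) + card (boundary v c k m)"
    using card_Un_le[of "boundary v c k l" "(+) (axis l 1) ` boundary v c k m"]
      card_image_le[OF fin(2), of "(+) (axis l 1)"] by linarith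
  finally show "card ?B \<le> card (boundary v c k l) + card (boundary v c k m)" .
qed

text \<open>Pairing the counts with nonnegative weights moves the recursion from the counts to the
  weights. Iterated, this leaves \<open>pair_weight\<close> applied to the weights and the initial
  boundary untouched.\<close>

lemma boundary_count_step:
  assumes s: "s \<in> brun_substitutions" and v: "\<And>i. 0 < v $ i" and fin: "finite_boundary v c"
    and p: "\<And>i. 0 \<le> p $ i"
  shows "finite_boundary (v v* incidence_matrix s) (\<lambda>q. c (parent s v q))"
    "boundary_count (v v* incidence_matrix s) (\<lambda>q. c (parent s v q)) \<bullet> p \<le>
       boundary_count v c \<bullet> pair_step s p"
proof -
  let ?v = "v v* incidence_matrix s" and ?c = "\<lambda>q. c (parent s v q)"
  note f = fin[unfolded finite_boundary_def]
  have mono: "a \<le> b \<Longrightarrow> real a * p $ i \<le> real b * p $ i" for a b i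
    using p by (intro mult_right_mono) auto
  have "finite_boundary ?v ?c \<and> boundary_count ?v ?c \<bullet> p \<le> boundary_count v c \<bullet> pair_step s p"
    using s
  proof (cases rule: brun_cases)
    case 1
    note a = boundary_parent_simple[OF s v, of 2 3 2 3 "[3]" c]
      boundary_parent_simple[OF s v, of 1 3 1 3 "[]" c]
      boundary_parent_double[OF s v, of 1 2 1 2 3 c]
    then show ?thesis
      using f mono[of "card (boundary ?v ?c 2 3)" "card (boundary v c 2 3)" 1]
        mono[of "card (boundary ?v ?c 1 3)" "card (boundary v c 1 3)" 2]
        mono[of "card (boundary ?v ?c 1 2)" "card (boundary v c 1 2) + card (boundary v c 1 3)" 3]
      by (auto simp: 1 brun1_def finite_boundary_def boundary_count_def inner_3
          pair_step_simps algebra_simps)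
  next
    case 2
    note a = boundary_parent_simple[OF s v, of 3 2 2 3 "[3]" c]
      boundary_parent_double[OF s v, of 1 3 1 2 3 c]
      boundary_parent_simple[OF s v, of 1 2 1 3 "[]" c]
    then show ?thesis
      using f mono[of "card (boundary ?v ?c 2 3)" "card (boundary v c 2 3)" 1]
        mono[of "card (boundary ?v ?c 1 3)" "card (boundary v c 1 2) + card (boundary v c 1 3)" 2]
        mono[of "card (boundary ?v ?c 1 2)" "card (boundary v c 1 3)" 3]
        boundary_commute[of ?v ?c 2 3]
      by (auto simp: 2 brun2_def finite_boundary_def boundary_count_def inner_3
          pair_step_simps algebra_simps)
  next
    case 3
    note a = boundary_parent_double[OF s v, of 2 3 1 2 3 c]
      boundary_parent_simple[OF s v, of 3 1 2 3 "[3]" c]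
      boundary_parent_simple[OF s v, of 2 1 1 3 "[]" c]
    then show ?thesis
      using f mono[of "card (boundary ?v ?c 2 3)" "card (boundary v c 1 2) + card (boundary v c 1 3)" 1]
        mono[of "card (boundary ?v ?c 1 3)" "card (boundary v c 2 3)" 2]
        mono[of "card (boundary ?v ?c 1 2)" "card (boundary v c 1 3)" 3]
        boundary_commute[of ?v ?c 1 3] boundary_commute[of ?v ?c 1 2]
      by (auto simp: 3 brun3_def finite_boundary_def boundary_count_def inner_3
          pair_step_simps algebra_simps)
  qed
  then show "finite_boundary ?v ?c" "boundary_count ?v ?c \<bullet> p \<le> boundary_count v c \<bullet> pair_step s p"
    by auto
qed

text \<open>A square sees a single edge (y, k) only as a first step, with corner y, or as a second
  step, with corner y plus a unit vector. This leaves four corners, and the bound 4 enters the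
  constants below.\<close>

lemma boundary_singleton:
  fixes p :: "(real^3) \<times> 3"
  assumes v: "\<And>i. 0 < v $ i"
  shows "finite_boundary v (\<lambda>q. q = p)" "boundary_count v (\<lambda>q. q = p) $ i \<le> 4"
proof -
  define F where "F = {fst p, fst p + axis 1 1, fst p + axis 2 1, fst p + axis 3 1}"
  have sub: "boundary v (\<lambda>q. q = p) i j \<subseteq> F" for i j
  proof
    fix z assume "z \<in> boundary v (\<lambda>q. q = p) i j"
    then have z: "crossing v z [i, j] \<noteq> crossing v z [j, i]"
      "crossing v z [i, j] = p \<or> crossing v z [j, i] = p"
      by (auto simp: boundary_def simp del: crossing.simps)
    have "z \<bullet> v < v $ i + v $ j"
    proof (rule ccontr)
      assume "\<not> z \<bullet> v < v $ i + v $ j"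
      then have "crossing v z ([i, j] @ []) = crossing v (z - abelianization [i, j]) []"
        "crossing v z ([j, i] @ []) = crossing v (z - abelianization [j, i]) []"
        by (intro crossing_append_ge v; simp add: abelianization_Cons inner_add_left inner_axis_1)+
      then show False using z(1) by (simp add: abelianization_Cons add.commute)
    qed
    with z(2) have "z = fst p \<or> (\<exists>k. z = fst p + axis k 1)"
      by (cases "z \<bullet> v < v $ i"; cases "z \<bullet> v < v $ j")
        (auto simp: inner_diff_left inner_axis_1 intro: exI[of _ i] exI[of _ j])
    then show "z \<in> F" using exhaust_3 by (auto simp: F_def) (metis exhaust_3)
  qed
  have F: "finite F" "card F \<le> 4" by (auto simp: F_def card_insert_if)
  show "finite_boundary v (\<lambda>q. q = p)"
    using finite_subset[OF sub F(1)] by (auto simp: finite_boundary_def)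
  have "card (boundary v (\<lambda>q. q = p) i j) \<le> 4" for i j
    using card_mono[OF F(1) sub] F(2) by (meson order_trans)
  then show "boundary_count v (\<lambda>q. q = p) $ i \<le> 4"
    using exhaust_3[of i] by (auto simp: boundary_count_def)
qed

section \<open>Limit words\<close>

lemma brun_nonempty: "s \<in> brun_substitutions \<Longrightarrow> s i \<noteq> []"
  by (auto simp: brun_substitutions_def brun1_def brun2_def brun3_def split: if_splits)

lemma brun_first_letter:
  assumes "s \<in> brun_substitutions"
  shows "\<exists>j w. s j = i # w"
proof -
  have "(\<exists>j w. s j = 1 # w) \<and> (\<exists>j w. s j = 2 # w) \<and> (\<exists>j w. s j = 3 # w)"
    using assms
  proof (cases rule: brun_cases)
    case 1
    have "brun1 1 = 1 # []" "brun1 2 = 2 # [3]" "brun1 3 = 3 # []" by (simp_all add: brun1_def)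
    then show ?thesis unfolding 1 by blast
  next
    case 2
    have "brun2 1 = 1 # []" "brun2 3 = 2 # [3]" "brun2 2 = 3 # []" by (simp_all add: brun2_def)
    then show ?thesis unfolding 2 by blast
  next
    case 3
    have "brun3 2 = 1 # []" "brun3 3 = 2 # [3]" "brun3 1 = 3 # []" by (simp_all add: brun3_def)
    then show ?thesis unfolding 3 by blast
  qed
  then show ?thesis using exhaust_3[of i] by auto
qed

text \<open>The only image of length two is 23. So the digits in the expansion of a prefix are empty
  or the single letter 2, which later bounds each digit by 1.\<close>

lemma brun_proper_prefix:
  assumes "s \<in> brun_substitutions" "s j = q @ i # t"
  shows "q = [] \<or> q = [2]"
  using assms by (elim brun_cases)
    (auto simp: brun1_def brun2_def brun3_def Cons_eq_append_conv split: if_splits)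

lemma subst_stream_SCons:
  assumes "\<And>i. s i \<noteq> []"
  shows "subst_stream s (j ## \<omega>) = s j @- subst_stream s \<omega>"
  using assms by (simp add: subst_stream_def)

definition stream_prefix :: "'a list \<Rightarrow> 'a stream \<Rightarrow> bool" where
  "stream_prefix p \<omega> \<longleftrightarrow> stake (length p) \<omega> = p"

lemma stream_prefix_iff: "stream_prefix p \<omega> \<longleftrightarrow> (\<exists>\<omega>'. \<omega> = p @- \<omega>')"
  by (metis stream_prefix_def stake_sdrop stake_shift append_Nil2 diff_self_eq_0 stake.simps(1) take_all order_refl)

lemma stream_prefix_snth: "stream_prefix p \<omega> \<longleftrightarrow> (\<forall>k<length p. \<omega> !! k = p ! k)"
  by (auto simp: stream_prefix_def list_eq_iff_nth_eq)

lemma subst_stream_shift: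
  assumes "\<And>i. s i \<noteq> []"
  shows "subst_stream s (p @- \<omega>) = subst_word s p @- subst_stream s \<omega>"
  by (induction p) (simp_all add: subst_word_Cons subst_stream_SCons[OF assms])

lemma stream_prefix_subst:
  assumes "\<And>i. s i \<noteq> []" "stream_prefix p \<omega>"
  shows "stream_prefix (subst_word s p) (subst_stream s \<omega>)"
proof -
  obtain \<omega>' where "\<omega> = p @- \<omega>'" using assms(2) by (auto simp: stream_prefix_iff)
  then show ?thesis by (auto simp: stream_prefix_iff subst_stream_shift[OF assms(1)])
qed

text \<open>Dumont-Thomas desubstitution of a prefix: a complete image followed by a proper prefix
  of the image of the next letter.\<close>

lemma stream_prefix_subst_cases:
  assumes s: "\<And>i. s i \<noteq> []" and "stream_prefix (p @ [i]) (subst_stream s \<omega>)"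
  shows "\<exists>p' j q t. stream_prefix (p' @ [j]) \<omega> \<and> s j = q @ i # t \<and> p = subst_word s p' @ q"
  using assms(2)
proof (induction "length p" arbitrary: p \<omega> rule: less_induct)
  case less
  obtain j \<omega>' where \<omega>: "\<omega> = j ## \<omega>'" by (cases \<omega>)
  have eq: "subst_stream s \<omega> = s j @- subst_stream s \<omega>'" by (simp add: \<omega> subst_stream_SCons[OF s])
  obtain \<tau> where \<tau>: "s j @- subst_stream s \<omega>' = (p @ [i]) @- \<tau>"
    using less.prems by (auto simp: stream_prefix_iff eq)
  show ?case
  proof (cases "length p < length (s j)")
    case True
    have "take (Suc (length p)) (s j) = stake (Suc (length p)) (s j @- subst_stream s \<omega>')"
      using True by (simp add: stake_shift del: stake.simps)
    also have "\<dots> = p @ [i]" unfolding \<tau> by (simp add: stake_shift)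
    finally obtain t where "s j = p @ i # t"
      by (metis append_take_drop_id append.assoc append_Cons append_Nil)
    moreover have "stream_prefix ([] @ [j]) \<omega>" by (simp add: \<omega> stream_prefix_def)
    moreover have "p = subst_word s [] @ p" by simp
    ultimately show ?thesis by blast
  next
    case False
    define p2 where "p2 = drop (length (s j)) p"
    have "take (length (s j)) p = stake (length (s j)) ((p @ [i]) @- \<tau>)"
      using False by (simp add: stake_shift del: stake.simps shift_append)
    also have "\<dots> = s j" unfolding \<tau>[symmetric] by (simp add: stake_shift)
    finally have p: "p = s j @ p2" by (metis p2_def append_take_drop_id)
    have "subst_stream s \<omega>' = (p2 @ [i]) @- \<tau>" using \<tau> unfolding p by simp
    then have "stream_prefix (p2 @ [i]) (subst_stream s \<omega>')" by (auto simp: stream_prefix_iff)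
    moreover have "length p2 < length p" using s[of j] by (simp add: p)
    ultimately obtain p' k q t where "stream_prefix (p' @ [k]) \<omega>'" "s k = q @ i # t"
      "p2 = subst_word s p' @ q" using less.hyps by blast
    then show ?thesis
      by (intro exI[of _ "j # p'"] exI[of _ k] exI[of _ q] exI[of _ t])
         (auto simp: \<omega> p subst_word_Cons stream_prefix_iff)
  qed
qed

lemma stream_eqI_prefixes:
  assumes "\<And>n. \<exists>p. length p \<ge> n \<and> stream_prefix p \<omega> \<and> stream_prefix p \<omega>'"
  shows "\<omega> = \<omega>'"
proof -
  have "\<omega> !! n = \<omega>' !! n" for n
    using assms[of "Suc n"] by (auto simp: stream_prefix_snth)
  then show ?thesis using smap_alt[of "\<lambda>x. x" \<omega> \<omega>'] by (simp add: stream.map_ident)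
qed

lemma subst_upto_append [simp]: "subst_upto \<sigma> n (p @ q) = subst_upto \<sigma> n p @ subst_upto \<sigma> n q"
  by (induction n arbitrary: p q) auto

lemma subst_upto_Suc_left:
  "subst_upto \<sigma> (Suc n) w = subst_word (shd \<sigma>) (subst_upto (stl \<sigma>) n w)"
  by (induction n arbitrary: w) auto

lemma abelianization_subst_upto:
  "abelianization (subst_upto \<sigma> n w) = incidence_upto \<sigma> n *v abelianization w"
  by (induction n arbitrary: w) (auto simp: abelianization_subst_word matrix_vector_mul_assoc)

lemma length_eq_total: "real (length w) = total (abelianization (w :: 3 list))"
proof (induction w)
  case (Cons i w)
  then show ?case
    using exhaust_3[of i] by (auto simp: abelianization_Cons total_def axis_def)
qed (simp add: total_def)

lemma limit_word_step:
  "limit_word \<sigma> \<omega> \<longleftrightarrow> (\<exists>\<omega>'. limit_word (stl \<sigma>) \<omega>' \<and> \<omega> = subst_stream (shd \<sigma>) \<omega>')"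
proof
  assume "limit_word \<sigma> \<omega>"
  then obtain w where w: "w 0 = \<omega>" "\<And>n. w n = subst_stream (\<sigma> !! n) (w (Suc n))"
    unfolding limit_word_def by blast
  have *: "w (Suc m) = subst_stream (stl \<sigma> !! m) (w (Suc (Suc m)))" for m
    using w(2)[of "Suc m"] by simp
  have "limit_word (stl \<sigma>) (w (Suc 0))"
    unfolding limit_word_def by (rule exI[of _ "\<lambda>n. w (Suc n)"]) (use * in blast)
  then show "\<exists>\<omega>'. limit_word (stl \<sigma>) \<omega>' \<and> \<omega> = subst_stream (shd \<sigma>) \<omega>'"
    using w(1) w(2)[of 0] by auto
next
  assume "\<exists>\<omega>'. limit_word (stl \<sigma>) \<omega>' \<and> \<omega> = subst_stream (shd \<sigma>) \<omega>'"
  then obtain w where w: "\<omega> = subst_stream (shd \<sigma>) (w 0)"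
    "\<And>n. w n = subst_stream (stl \<sigma> !! n) (w (Suc n))"
    unfolding limit_word_def by blast
  have "(case n of 0 \<Rightarrow> \<omega> | Suc m \<Rightarrow> w m) = subst_stream (\<sigma> !! n) (w n)" for n
  proof (cases n)
    case 0
    then show ?thesis using w(1) by simp
  next
    case (Suc m)
    then show ?thesis using w(2)[of m] by simp
  qed
  then show "limit_word \<sigma> \<omega>"
    unfolding limit_word_def by (intro exI[of _ "\<lambda>n. case n of 0 \<Rightarrow> \<omega> | Suc m \<Rightarrow> w m"]) auto
qed

context brun_generic
begin

lemma nonempty [simp]: "(\<sigma> !! n) i \<noteq> []"
  by (rule brun_nonempty[OF brun])

lemma limit_word_Suc:
  "limit_word (sdrop n \<sigma>) \<omega> \<longleftrightarrow> (\<exists>\<omega>'. limit_word (sdrop (Suc n) \<sigma>) \<omega>' \<and> \<omega> = subst_stream (\<sigma> !! n) \<omega>')"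
  using limit_word_step[of "sdrop n \<sigma>" \<omega>] by (simp only: sdrop_simps)

lemma limit_word_add:
  assumes "limit_word (sdrop n \<sigma>) \<omega>"
  shows "\<exists>\<omega>'. limit_word (sdrop (n + k) \<sigma>) \<omega>' \<and>
    (\<forall>p. stream_prefix p \<omega>' \<longrightarrow> stream_prefix (subst_upto (sdrop n \<sigma>) k p) \<omega>)"
proof (induction k)
  case 0
  show ?case using assms by auto
next
  case (Suc k)
  then obtain \<omega>' where 1: "limit_word (sdrop (n + k) \<sigma>) \<omega>'"
    "\<And>p. stream_prefix p \<omega>' \<Longrightarrow> stream_prefix (subst_upto (sdrop n \<sigma>) k p) \<omega>" by blast
  then obtain \<omega>'' where 2: "limit_word (sdrop (n + Suc k) \<sigma>) \<omega>''"
    "\<omega>' = subst_stream (\<sigma> !! (n + k)) \<omega>''"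
    using limit_word_Suc[of "n + k"] by auto
  show ?case
    using 1 2 stream_prefix_subst[OF nonempty]
    by (intro exI[of _ \<omega>'']) (auto simp: sdrop_snth)
qed

text \<open>The fifth power of the matrix of \<open>brun3\<close> has column sums 6, 4 and 9, so
  each block multiplies totals by at least 4. The other factors do not decrease them, and disjoint
  blocks can be found again and again.\<close>

lemma total_prod_mat_grows:
  "\<exists>k0. \<forall>k\<ge>k0. \<forall>y. (\<forall>i. 0 \<le> y $ i) \<longrightarrow> 4 ^ N * total y \<le> total (prod_mat m k *v y)"
proof (induction N arbitrary: m)
  case 0
  show ?case using prod_mat_nonneg(2) by auto
next
  case (Suc N)
  obtain n where n: "n \<ge> m" "occurs \<sigma> n" using infinitely_occurs by blast
  obtain k0 where k0: "\<And>k y. k \<ge> k0 \<Longrightarrow> (\<And>i. 0 \<le> y $ i) \<Longrightarrow>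
      4 ^ N * total y \<le> total (prod_mat (n + 5) k *v y)" using Suc[of "n + 5"] by blast
  show ?case
  proof (intro exI[of _ "(n - m) + (5 + k0)"] allI impI)
    fix k and y :: "real^3" assume k: "(n - m) + (5 + k0) \<le> k" and y: "\<forall>i. 0 \<le> y $ i"
    define l where "l = k - ((n - m) + 5)"
    have kl: "k = (n - m) + (5 + l)" "l \<ge> k0" using k by (auto simp: l_def)
    define x where "x = prod_mat (n + 5) l *v y"
    have x: "0 \<le> x $ i" for i unfolding x_def by (rule prod_mat_nonneg) (use y in auto)
    have "4 ^ Suc N * total y \<le> 4 * total x"
      using k0[OF kl(2), of y] y by (simp add: x_def)
    also have "\<dots> \<le> total (prod_mat n 5 *v x)"
      using x[of 1] x[of 2] x[of 3] by (simp add: prod_mat_occurs[OF n(2)] brun3_power5 total_def)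
    also have "\<dots> \<le> total (prod_mat m (n - m) *v (prod_mat n 5 *v x))"
      by (intro prod_mat_nonneg x)
    also have "prod_mat m (n - m) *v (prod_mat n 5 *v x) = prod_mat m k *v y"
      using n(1) prod_mat_add[of m "n - m" "5 + l"] prod_mat_add[of n 5 l]
      by (simp add: x_def kl(1) matrix_vector_mul_assoc)
    finally show "4 ^ Suc N * total y \<le> total (prod_mat m k *v y)" .
  qed
qed

lemma abelianization_subst_sdrop:
  "abelianization (subst_upto (sdrop m \<sigma>) k w) = prod_mat m k *v abelianization w"
  by (simp add: abelianization_subst_upto prod_mat_def)

lemma length_subst_grows:
  "\<exists>k0. \<forall>k\<ge>k0. \<forall>i. N \<le> length (subst_upto (sdrop m \<sigma>) k [i])"
proof -
  obtain k0 where k0: "\<And>k y. k \<ge> k0 \<Longrightarrow> (\<And>i. 0 \<le> y $ i) \<Longrightarrow>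
      4 ^ N * total y \<le> total (prod_mat m k *v y)" using total_prod_mat_grows[of N m] by blast
  show ?thesis
  proof (intro exI[of _ k0] allI impI)
    fix k i assume "k0 \<le> k"
    then have "4 ^ N * total (abelianization [i]) \<le> total (prod_mat m k *v abelianization [i])"
      by (intro k0) auto
    then have "4 ^ N \<le> real (length (subst_upto (sdrop m \<sigma>) k [i]))"
      by (simp only: length_eq_total abelianization_subst_sdrop)
         (simp add: length_eq_total[symmetric])
    moreover have "real N \<le> 4 ^ N"
      using of_nat_less_two_power[of N, where ?'a = real] power_mono[of "2::real" 4 N] by linarith
    ultimately show "N \<le> length (subst_upto (sdrop m \<sigma>) k [i])" by linarith
  qed
qed

text \<open>The Brun substitutions permute the initial letters, hence every letter starts a limit word.\<close>
lemma limit_word_exists: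
  "\<exists>\<omega>. limit_word (sdrop n \<sigma>) \<omega> \<and> (\<forall>k. \<exists>j. stream_prefix (subst_upto (sdrop n \<sigma>) k [j]) \<omega>) \<and> shd \<omega> = i"
proof -
  define nxt where "nxt = (\<lambda>k j. SOME j'. \<exists>w. (\<sigma> !! k) j' = j # w)"
  have nxt: "\<exists>w. (\<sigma> !! k) (nxt k j) = j # w" for k j
    unfolding nxt_def using someI_ex[OF brun_first_letter[OF brun, of k j]] by blast
  define a where "a = rec_nat i (\<lambda>k j. nxt (n + k) j)"
  have a: "a 0 = i" "a (Suc k) = nxt (n + k) (a k)" for k by (simp_all add: a_def)
  define u where "u = (\<lambda>k l. subst_upto (sdrop (n + k) \<sigma>) l [a (k + l)])"
  have u_Suc: "\<exists>w. u k (Suc l) = u k l @ w" for k l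
  proof -
    obtain w where "(\<sigma> !! (n + (k + l))) (a (Suc (k + l))) = [a (k + l)] @ w"
      using nxt[of "n + (k + l)" "a (k + l)"] a(2) by auto
    then show ?thesis
      using subst_upto_append[of "sdrop (n + k) \<sigma>" l "[a (k + l)]" w]
      by (auto simp: u_def sdrop_snth subst_word_Cons add.assoc)
  qed
  have u_le: "l \<le> l' \<Longrightarrow> \<exists>w. u k l' = u k l @ w" for k l l'
  proof (induction l' rule: dec_induct)
    case (step m)
    then show ?case using u_Suc[of k m] by auto
  qed auto
  have u_nth: "u k l ! t = u k l' ! t" if "t < length (u k l)" "t < length (u k l')" for k l l' t
    using u_le[of l l' k] u_le[of l' l k] that by (cases "l \<le> l'") (auto simp: nth_append)
  have long: "\<exists>l. N \<le> length (u k l)" for k N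
    using length_subst_grows[of N "n + k"] by (auto simp: u_def)
  define w where "w = (\<lambda>k. to_stream (\<lambda>t. u k (SOME l. t < length (u k l)) ! t))"
  have pre: "stream_prefix (u k l) (w k)" for k l
    unfolding stream_prefix_snth
  proof (intro allI impI)
    fix t assume t: "t < length (u k l)"
    then have "t < length (u k (SOME l. t < length (u k l)))" by (rule someI)
    from u_nth[OF this t] show "w k !! t = u k l ! t" by (simp add: w_def to_stream_def)
  qed
  have "w k = subst_stream (sdrop n \<sigma> !! k) (w (Suc k))" for k
  proof (rule stream_eqI_prefixes)
    fix N
    obtain l where "Suc N \<le> length (u k l)" using long by blast
    then have l: "N \<le> length (u k (Suc l))" using u_Suc[of k l] by auto
    have "u k (Suc l) = subst_word (\<sigma> !! (n + k)) (u (Suc k) l)"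
      unfolding u_def subst_upto_Suc_left by (simp only: sdrop_simps) simp
    then have "stream_prefix (u k (Suc l)) (subst_stream (sdrop n \<sigma> !! k) (w (Suc k)))"
      using stream_prefix_subst[OF nonempty pre] by (simp add: sdrop_snth)
    then show "\<exists>p. N \<le> length p \<and> stream_prefix p (w k) \<and>
        stream_prefix p (subst_stream (sdrop n \<sigma> !! k) (w (Suc k)))"
      using pre[of k "Suc l"] l by blast
  qed
  then have "limit_word (sdrop n \<sigma>) (w 0)" unfolding limit_word_def by blast
  moreover have "shd (w 0) = i"
    using pre[of 0 0] by (simp add: u_def a stream_prefix_def)
  moreover have "\<exists>j. stream_prefix (subst_upto (sdrop n \<sigma>) k [j]) (w 0)" for k
    using pre[of 0 k] by (auto simp: u_def)
  ultimately show ?thesis by blast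
qed

lemma limit_word_starting:
  obtains \<omega> where "limit_word (sdrop n \<sigma>) \<omega>" "shd \<omega> = i"
  using limit_word_exists by blast

section \<open>Abelianized prefixes of limit words\<close>

definition prefix_points :: "nat \<Rightarrow> 3 \<Rightarrow> (real^3) set" where
  "prefix_points n i =
     {abelianization p | p. \<exists>\<omega>. limit_word (sdrop n \<sigma>) \<omega> \<and> stream_prefix (p @ [i]) \<omega>}"

lemma zero_prefix_points: "0 \<in> prefix_points n i"
proof -
  obtain \<omega> where "limit_word (sdrop n \<sigma>) \<omega>" "shd \<omega> = i" by (rule limit_word_starting)
  then show ?thesis
    unfolding prefix_points_def
    by (intro CollectI exI[of _ "[]"]) (auto simp: stream_prefix_def intro!: exI[of _ \<omega>])
qed

text \<open>Desubstitution in both directions: a prefix of a limit word splits, and conversely every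
  limit word of the next level is carried to a limit word. After projection and closure this becomes
  the set equation for the pieces.\<close>

lemma prefix_points_Suc:
  "x \<in> prefix_points n i \<longleftrightarrow> (\<exists>j q t y. (\<sigma> !! n) j = q @ i # t \<and> y \<in> prefix_points (Suc n) j \<and>
     x = abelianization q + incidence_matrix (\<sigma> !! n) *v y)"
proof
  assume "x \<in> prefix_points n i"
  then obtain p \<omega> where p: "x = abelianization p" "limit_word (sdrop n \<sigma>) \<omega>" "stream_prefix (p @ [i]) \<omega>"
    by (auto simp: prefix_points_def)
  then obtain \<omega>' where \<omega>': "limit_word (sdrop (Suc n) \<sigma>) \<omega>'" "\<omega> = subst_stream (\<sigma> !! n) \<omega>'"
    using limit_word_Suc by blast
  obtain p' j q t where q: "stream_prefix (p' @ [j]) \<omega>'" "(\<sigma> !! n) j = q @ i # t"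
    "p = subst_word (\<sigma> !! n) p' @ q"
    using stream_prefix_subst_cases[OF nonempty p(3)[unfolded \<omega>'(2)]] by blast
  show "\<exists>j q t y. (\<sigma> !! n) j = q @ i # t \<and> y \<in> prefix_points (Suc n) j \<and>
     x = abelianization q + incidence_matrix (\<sigma> !! n) *v y"
    using q \<omega>'(1) p(1)
    by (intro exI[of _ j] exI[of _ q] exI[of _ t] exI[of _ "abelianization p'"])
       (auto simp: prefix_points_def abelianization_subst_word add.commute)
next
  assume "\<exists>j q t y. (\<sigma> !! n) j = q @ i # t \<and> y \<in> prefix_points (Suc n) j \<and>
     x = abelianization q + incidence_matrix (\<sigma> !! n) *v y"
  then obtain j q t p' \<omega>' where *: "(\<sigma> !! n) j = q @ i # t" "limit_word (sdrop (Suc n) \<sigma>) \<omega>'"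
    "stream_prefix (p' @ [j]) \<omega>'" "x = abelianization q + incidence_matrix (\<sigma> !! n) *v abelianization p'"
    by (auto simp: prefix_points_def)
  have "stream_prefix (subst_word (\<sigma> !! n) (p' @ [j])) (subst_stream (\<sigma> !! n) \<omega>')"
    by (rule stream_prefix_subst[OF nonempty *(3)])
  then have "stream_prefix ((subst_word (\<sigma> !! n) p' @ q) @ [i]) (subst_stream (\<sigma> !! n) \<omega>')"
    using *(1) by (auto simp: stream_prefix_iff subst_word_Cons)
  moreover have "limit_word (sdrop n \<sigma>) (subst_stream (\<sigma> !! n) \<omega>')"
    using *(2) limit_word_Suc by blast
  ultimately show "x \<in> prefix_points n i"
    unfolding prefix_points_def
    by (intro CollectI exI[of _ "subst_word (\<sigma> !! n) p' @ q"])
       (auto simp: *(4) abelianization_subst_word add.commute)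
qed

lemma prefix_points_nonneg: "x \<in> prefix_points n i \<Longrightarrow> 0 \<le> x $ j"
  by (auto simp: prefix_points_def)

end

section \<open>Rauzy fractals in coordinates of the plane\<close>

text \<open>The first two coordinates identify the plane of total 0 with \<open>real^2\<close> and
  its integer points with \<open>int_lattice\<close>. Lebesgue measure and the standard torus of
  dimension 2 are then directly available.\<close>

definition lift :: "real^2 \<Rightarrow> real^3" where
  "lift \<xi> = vector [\<xi>$1, \<xi>$2, - \<xi>$1 - \<xi>$2]"

lemma lift_nth [simp]: "lift \<xi> $ 1 = \<xi>$1" "lift \<xi> $ 2 = \<xi>$2" "lift \<xi> $ 3 = - \<xi>$1 - \<xi>$2"
  by (simp_all add: lift_def)

lemma total_lift [simp]: "total (lift \<xi>) = 0"
  by (simp add: total_def)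

lemma linear_lift: "linear lift"
  by (rule linearI) (simp_all add: vec_eq_iff forall_3 algebra_simps)

lemma lift_int_lattice_iff: "lift \<xi> \<in> int_lattice \<longleftrightarrow> \<xi> \<in> int_lattice"
  by (auto simp: int_lattice_def forall_3 forall_2)

lemma closed_int_lattice: "closed (int_lattice :: (real^'n) set)"
proof -
  have "closed (\<Inter>i. (\<lambda>x::real^'n. x $ i) -` \<int>)"
    by (intro closed_INT ballI closed_vimage closed_Ints continuous_intros)
  also have "(\<Inter>i. (\<lambda>x::real^'n. x $ i) -` \<int>) = int_lattice" by (auto simp: int_lattice_def)
  finally show ?thesis .
qed

lemma norm_le_2: "norm (x :: real^2) \<le> \<bar>x$1\<bar> + \<bar>x$2\<bar>"
  using norm_le_l1_cart[of x] by (simp add: sum_2)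

lemma surface_vec_1: "(x, i) \<in> surface (vec 1) \<longleftrightarrow> x \<in> int_lattice \<and> total x = 0"
proof
  assume a: "(x, i) \<in> surface (vec 1)"
  then have "total x \<in> \<int>" "0 \<le> total x" "total x < 1"
    unfolding total_eq_inner
    by (auto simp: surface_def inner_3 int_lattice_iff_3)
  then have "total x = 0" by (metis Ints_nonzero_abs_less1 abs_of_nonneg)
  then show "x \<in> int_lattice \<and> total x = 0" using a by (simp add: surface_def)
qed (auto simp: surface_def total_eq_inner)

lemma closure_UN_finite: "finite I \<Longrightarrow> closure (\<Union>(f ` I)) = (\<Union>i\<in>I. closure (f i))"
  by (induction rule: finite_induct) auto

context brun_generic
begin

text \<open>The projection along \<open>eig n\<close> onto the plane of total 0, read in the first
  two coordinates (see \<open>lift_coord\<close>). Each level projects along its own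
  eigenvector.\<close>

definition coord :: "nat \<Rightarrow> real^3 \<Rightarrow> real^2" where
  "coord n x = vector [x$1 - total x * eig n $ 1 / total (eig n), x$2 - total x * eig n $ 2 / total (eig n)]"

lemma coord_nth [simp]:
  "coord n x $ 1 = x$1 - total x * eig n $ 1 / total (eig n)"
  "coord n x $ 2 = x$2 - total x * eig n $ 2 / total (eig n)"
  by (simp_all add: coord_def)

lemma linear_coord: "linear (coord n)"
  by (rule linearI)
     (simp_all add: vec_eq_iff forall_2 total_add total_scaleR add_divide_distrib algebra_simps)

lemmas coord_add = linear_add[OF linear_coord]
lemmas coord_diff = linear_diff[OF linear_coord]
lemmas coord_0 [simp] = linear_0[OF linear_coord]
lemmas coord_scaleR = linear_scale[OF linear_coord]

lemma coord_lift [simp]: "coord n (lift \<xi>) = \<xi>"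
  by (simp add: vec_eq_iff forall_2)

lemma coord_eig [simp]: "coord n (eig n) = 0"
  using total_eig_pos[of n] by (simp add: vec_eq_iff forall_2)

lemma lift_coord: "lift (coord n x) = x - (total x / total (eig n)) *\<^sub>R eig n"
proof -
  define c where "c = total x / total (eig n)"
  have "c * total (eig n) = total x" using total_eig_pos[of n] by (simp add: c_def)
  moreover have "coord n x = vector [x$1 - c * eig n $ 1, x$2 - c * eig n $ 2]"
    by (simp add: coord_def c_def)
  moreover have "c * total (eig n) = total x \<Longrightarrow>
      lift (vector [x$1 - c * eig n $ 1, x$2 - c * eig n $ 2]) = x - c *\<^sub>R eig n"
    by (simp add: vec_eq_iff forall_3 total_def algebra_simps)
  ultimately have "lift (coord n x) = x - c *\<^sub>R eig n" by simp
  then show ?thesis by (simp add: c_def)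
qed

lemma coord_total_0: "total x = 0 \<Longrightarrow> lift (coord n x) = x"
  by (simp add: lift_coord)

lemma coord_eq_0: "coord n x = 0 \<Longrightarrow> x = (total x / total (eig n)) *\<^sub>R eig n"
  using lift_coord[of n x] linear_0[OF linear_lift] by simp

lemma norm_coord_prod:
  "norm (coord m (prod_mat m k *v y)) \<le> 2 * rate m k * (\<bar>y$1\<bar> + \<bar>y$2\<bar> + \<bar>y$3\<bar>)"
  using norm_le_2[of "coord m (prod_mat m k *v y)"] prod_mat_deviation[of m k y 1]
    prod_mat_deviation[of m k y 2] by simp

text \<open>The product maps \<open>eig (m + k)\<close> to \<open>eig m\<close>, so it descends to
  the quotients by these directions. This is the induced map of the planes, as
  \<open>ren_coord\<close> shows.\<close>

definition ren :: "nat \<Rightarrow> nat \<Rightarrow> real^2 \<Rightarrow> real^2" where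
  "ren m k \<xi> = coord m (prod_mat m k *v lift \<xi>)"

lemma linear_ren: "linear (ren m k)"
proof -
  have "linear (coord m \<circ> ((*v) (prod_mat m k) \<circ> lift))"
    by (intro linear_compose linear_lift linear_coord matrix_vector_mul_linear)
  then show ?thesis by (simp add: ren_def[abs_def] o_def)
qed

lemmas ren_add = linear_add[OF linear_ren]
lemmas ren_diff = linear_diff[OF linear_ren]

lemma ren_coord: "ren m k (coord (m + k) x) = coord m (prod_mat m k *v x)"
proof -
  define c where "c = total x / total (eig (m + k))"
  have "prod_mat m k *v lift (coord (m + k) x) = prod_mat m k *v x - c *\<^sub>R eig m"
    by (simp add: lift_coord c_def matrix_vector_mult_diff_distrib matrix_vector_mult_scaleR
        eig_prod[symmetric])
  then show ?thesis by (simp add: ren_def coord_diff coord_scaleR)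
qed

lemma ren_0 [simp]: "ren m 0 \<xi> = \<xi>"
  by (simp add: ren_def)

lemma ren_add_level: "ren m k (ren (m + k) l \<xi>) = ren m (k + l) \<xi>"
  using ren_coord[of m k "prod_mat (m + k) l *v lift \<xi>"]
  by (simp add: ren_def prod_mat_add matrix_vector_mul_assoc)

lemma inj_ren: "inj (ren m k)"
  unfolding linear_injective_0[OF linear_ren]
proof (intro allI impI)
  fix \<xi> assume 0: "ren m k \<xi> = 0"
  define c where "c = total (prod_mat m k *v lift \<xi>) / total (eig m)"
  have "prod_mat m k *v lift \<xi> = c *\<^sub>R eig m"
    unfolding c_def using 0 by (intro coord_eq_0) (simp add: ren_def)
  also have "\<dots> = prod_mat m k *v (c *\<^sub>R eig (m + k))"
    by (simp add: matrix_vector_mult_scaleR eig_prod[symmetric])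
  finally have l: "lift \<xi> = c *\<^sub>R eig (m + k)" using prod_mat_inj[of m k] by (simp add: inj_eq)
  then have "total (lift \<xi>) = c * total (eig (m + k))" by (simp add: total_scaleR)
  then have "c = 0" using total_eig_pos[of "m + k"] by simp
  with l show "\<xi> = 0" by (simp add: vec_eq_iff forall_3 forall_2)
qed

section \<open>Size and subdivision of the pieces\<close>

definition piece :: "nat \<Rightarrow> 3 \<Rightarrow> (real^2) set" where
  "piece n i = closure (coord n ` prefix_points n i)"

text \<open>Dumont-Thomas expansion: a prefix point is a sum of digits of size at most 1, one for
  each level, carried down by the products and contracted by the rates. The factor 2 adds up the two
  coordinates.\<close>

lemma norm_coord_prefix_points:
  assumes "d \<in> prefix_points (m + k) i"
  shows "norm (coord m (prod_mat m k *v d)) \<le> 2 * (\<Sum>l. rate m (l + k))"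
proof -
  have bound: "norm (coord m (prod_mat m k *v d)) \<le> 2 * (\<Sum>l<K. rate m (l + k)) + 2 * rate m (K + k) * total d"
    for K
    using assms
  proof (induction K arbitrary: k d i)
    case 0
    then show ?case
      using norm_coord_prod[of m k d] prefix_points_nonneg[OF 0] by (simp add: total_def)
  next
    case (Suc K)
    from Suc.prems obtain j q t y where *: "(\<sigma> !! (m + k)) j = q @ i # t" "y \<in> prefix_points (m + Suc k) j"
      "d = abelianization q + incidence_matrix (\<sigma> !! (m + k)) *v y"
      using prefix_points_Suc[of d "m + k" i] by auto
    have "total y \<le> total (prod_mat (m + k) 1 *v y)"
      by (rule prod_mat_nonneg) (rule prefix_points_nonneg[OF *(2)])
    \<comment> \<open>The undigested rest keeps a total of at most \<open>total d\<close>. Its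
      contribution is a fixed number times a rate and vanishes in the limit.\<close>
    then have ty: "total y \<le> total d"
      using *(3) prod_mat_Suc[of "m + k" 0] length_eq_total[of q] by (simp add: total_add)
    have q: "\<bar>abelianization q$1\<bar> + \<bar>abelianization q$2\<bar> + \<bar>abelianization q$3\<bar> \<le> 1"
      using brun_proper_prefix[OF brun *(1)] by (auto simp: abelianization_def)
    have "coord m (prod_mat m k *v d) = coord m (prod_mat m k *v abelianization q) +
        coord m (prod_mat m (Suc k) *v y)"
      by (simp add: *(3) matrix_vector_right_distrib coord_add prod_mat_Suc matrix_vector_mul_assoc)
    also have "norm \<dots> \<le> 2 * rate m k * 1 + norm (coord m (prod_mat m (Suc k) *v y))"
      using norm_coord_prod[of m k "abelianization q"] mult_left_mono[OF q, of "2 * rate m k"]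
      by (intro norm_triangle_mono) auto
    also have "\<dots> \<le> 2 * rate m k + (2 * (\<Sum>l<K. rate m (l + Suc k)) + 2 * rate m (K + Suc k) * total y)"
      using Suc.IH[OF *(2)] by simp
    also have "\<dots> \<le> 2 * rate m k + (2 * (\<Sum>l<K. rate m (l + Suc k)) + 2 * rate m (K + Suc k) * total d)"
      using ty by (intro add_left_mono mult_left_mono) auto
    also have "\<dots> = 2 * (\<Sum>l<Suc K. rate m (l + k)) + 2 * rate m (Suc K + k) * total d"
      by (subst sum.lessThan_Suc_shift) simp
    finally show ?case .
  qed
  have s: "summable (\<lambda>l. rate m (l + k))" by (rule summable_ignore_initial_segment[OF summable_rate])
  have "(\<lambda>K. 2 * (\<Sum>l<K. rate m (l + k)) + 2 * rate m (K + k) * total d) \<longlonglongrightarrow>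
      2 * (\<Sum>l. rate m (l + k)) + 2 * 0 * total d"
    using summable_LIMSEQ[OF s] summable_LIMSEQ_zero[OF s] by (intro tendsto_intros)
  then show ?thesis using bound by (intro LIMSEQ_le_const) auto
qed

lemma norm_ren_piece:
  assumes "\<xi> \<in> piece (m + k) i"
  shows "norm (ren m k \<xi>) \<le> 2 * (\<Sum>l. rate m (l + k))"
proof -
  have "closed {\<xi>. norm (ren m k \<xi>) \<le> 2 * (\<Sum>l. rate m (l + k))}"
    by (intro closed_Collect_le continuous_intros linear_continuous_on linear_conv_bounded_linear[THEN iffD1] linear_ren)
  moreover have "coord (m + k) ` prefix_points (m + k) i \<subseteq> {\<xi>. norm (ren m k \<xi>) \<le> 2 * (\<Sum>l. rate m (l + k))}"
    using norm_coord_prefix_points by (auto simp: ren_coord)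
  ultimately show ?thesis using assms closure_minimal unfolding piece_def by blast
qed

lemma norm_piece: "\<xi> \<in> piece n i \<Longrightarrow> norm \<xi> \<le> 2 * (\<Sum>l. rate n l)"
  using norm_ren_piece[of \<xi> n 0 i] by simp

lemma compact_piece: "compact (piece n i)"
  unfolding compact_eq_bounded_closed
  using norm_piece by (auto simp: bounded_iff piece_def[of n i]) (auto simp: piece_def)

lemma zero_piece: "0 \<in> piece n i"
  unfolding piece_def
  by (rule subsetD[OF closure_subset]) (auto intro!: image_eqI[of _ _ 0] zero_prefix_points)

lemma prod_mat_1: "prod_mat n (Suc 0) = incidence_matrix (\<sigma> !! n)"
  by (simp add: prod_mat_Suc)

text \<open>The graph-directed set equation of the Rauzy fractals. The index set is finite because
  the digits \<open>q\<close> are, so closure commutes with the union.\<close>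

lemma piece_Suc:
  "piece n i = (\<Union>(j, q)\<in>{(j, q). \<exists>t. (\<sigma> !! n) j = q @ i # t}.
     (+) (coord n (abelianization q)) ` ren n (Suc 0) ` piece (Suc n) j)" (is "_ = (\<Union>(j, q)\<in>?I. ?F j q)")
proof -
  have fin: "finite ?I"
    by (rule finite_subset[of _ "UNIV \<times> {[], [2]}"]; (simp | force dest: brun_proper_prefix[OF brun]))
  have "coord n ` prefix_points n i = (\<Union>(j, q)\<in>?I.
      (+) (coord n (abelianization q)) ` ren n (Suc 0) ` coord (Suc n) ` prefix_points (Suc n) j)"
    (is "?L = ?R")
  proof (intro set_eqI iffI)
    fix \<xi> assume "\<xi> \<in> ?L"
    then obtain x where x: "x \<in> prefix_points n i" "\<xi> = coord n x" by blast
    then obtain j q t y where *: "(\<sigma> !! n) j = q @ i # t" "y \<in> prefix_points (Suc n) j"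
      "x = abelianization q + incidence_matrix (\<sigma> !! n) *v y"
      using prefix_points_Suc[of x n i] by auto
    have "\<xi> = coord n (abelianization q) + ren n (Suc 0) (coord (Suc n) y)"
      using ren_coord[of n "Suc 0" y] by (simp add: x * coord_add prod_mat_1)
    then show "\<xi> \<in> ?R" using *(1,2) by (intro UN_I[of "(j, q)"]) auto
  next
    fix \<xi> assume "\<xi> \<in> ?R"
    then obtain j q t y where *: "(\<sigma> !! n) j = q @ i # t" "y \<in> prefix_points (Suc n) j"
      "\<xi> = coord n (abelianization q) + ren n (Suc 0) (coord (Suc n) y)" by auto
    have "\<xi> = coord n (abelianization q + incidence_matrix (\<sigma> !! n) *v y)"
      using ren_coord[of n "Suc 0" y] by (simp add: * coord_add prod_mat_1)
    then show "\<xi> \<in> ?L" using *(1,2) prefix_points_Suc by blast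
  qed
  then have "piece n i = (\<Union>(j, q)\<in>?I.
      closure ((+) (coord n (abelianization q)) ` ren n (Suc 0) ` coord (Suc n) ` prefix_points (Suc n) j))"
    unfolding piece_def using closure_UN_finite[OF fin] by (simp add: case_prod_beta)
  also have "\<dots> = (\<Union>(j, q)\<in>?I. ?F j q)"
    by (simp add: closure_translation piece_def closure_injective_linear_image[OF linear_ren inj_ren])
  finally show ?thesis .
qed

section \<open>Discrete planes at all levels and their projected tiles\<close>

definition height :: "nat \<Rightarrow> real^3" where
  "height n = vec 1 v* prod_mat 0 n"

lemma height_0 [simp]: "height 0 = vec 1"
  by (simp add: height_def)

lemma height_Suc: "height (Suc n) = height n v* incidence_matrix (\<sigma> !! n)"
  by (simp add: height_def prod_mat_Suc vector_matrix_mul_assoc)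

lemma height_pos: "0 < height n $ i"
proof -
  have "\<forall>i. 0 < height n $ i"
    by (induction n) (auto simp: height_Suc intro: vector_incidence_pos[OF brun])
  then show ?thesis by blast
qed

lemma inner_height_Suc: "y \<bullet> height (Suc n) = (incidence_matrix (\<sigma> !! n) *v y) \<bullet> height n"
  by (metis height_Suc dot_lmul_matrix inner_commute)

text \<open>Entry \<open>i\<close> of \<open>height n\<close> is the length of
  \<open>subst_upto \<sigma> n [i]\<close>. The faces of the discrete plane with this normal vector
  carry the pieces of level \<open>n\<close>; the tiles are these, renormalized to level 0.\<close>

definition tile :: "nat \<Rightarrow> (real^3) \<times> 3 \<Rightarrow> (real^2) set" where
  "tile n q = (\<lambda>\<xi>. coord 0 (prod_mat 0 n *v fst q) + ren 0 n \<xi>) ` piece n (snd q)"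

abbreviation par :: "nat \<Rightarrow> (real^3) \<times> 3 \<Rightarrow> (real^3) \<times> 3" where
  "par n \<equiv> parent (\<sigma> !! n) (height n)"

lemma height_letter: "abelianization ((\<sigma> !! n) j) \<bullet> height n = height (Suc n) $ j"
  using inner_height_Suc[of "abelianization [j]" n] abelianization_subst_word[of "\<sigma> !! n" "[j]"]
  by (simp add: subst_word_Cons abelianization_Cons inner_axis_1)

lemma par_in_surface: "q \<in> surface (height (Suc n)) \<Longrightarrow> par n q \<in> surface (height n)"
  unfolding height_Suc by (intro parent_in_surface height_pos nonempty brun)

text \<open>Subdivision of pieces matches parents of faces. The part of piece \<open>i\<close> that
  comes from \<open>(\<sigma> !! n) j = p @ i # t\<close> belongs to the face \<open>(y', j)\<close>
  whose corner is mapped to \<open>y + abelianization p\<close>; it is integral because the matrix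
  is unimodular. The height of the image then lies just where the path of \<open>j\<close> crosses
  at its letter \<open>i\<close> after \<open>p\<close>.\<close>

lemma tile_Suc:
  assumes "q \<in> surface (height n)"
  shows "tile n q = \<Union>(tile (Suc n) ` {q' \<in> surface (height (Suc n)). par n q' = q})"
proof -
  obtain y i where q: "q = (y, i)" by (cases q)
  have tile_eq: "coord 0 (prod_mat 0 n *v y) + ren 0 n (coord n (abelianization p) + ren n (Suc 0) \<eta>) =
      coord 0 (prod_mat 0 (Suc n) *v y') + ren 0 (Suc n) \<eta>"
    if "incidence_matrix (\<sigma> !! n) *v y' = y + abelianization p" for y' p \<eta>
  proof -
    have "prod_mat 0 (Suc n) *v y' = prod_mat 0 n *v (y + abelianization p)"
      using that by (simp add: prod_mat_Suc matrix_vector_mul_assoc[symmetric])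
    then show ?thesis
      using ren_coord[of 0 n "abelianization p"] ren_add_level[of 0 n "Suc 0" \<eta>]
      by (simp add: ren_add matrix_vector_right_distrib coord_add)
  qed
  show ?thesis
  proof (intro set_eqI iffI)
    fix \<zeta> assume "\<zeta> \<in> tile n q"
    then obtain \<xi> where \<xi>: "\<xi> \<in> piece n i" "\<zeta> = coord 0 (prod_mat 0 n *v y) + ren 0 n \<xi>"
      by (auto simp: tile_def q)
    obtain j p t \<eta> where *: "(\<sigma> !! n) j = p @ i # t" "\<eta> \<in> piece (Suc n) j"
      "\<xi> = coord n (abelianization p) + ren n (Suc 0) \<eta>"
      using \<xi>(1) piece_Suc[of n i] by auto
    obtain y' where y': "incidence_matrix (\<sigma> !! n) *v y' = y + abelianization p"
      using incidence_surj[OF brun] by blast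
    have ys: "y \<in> int_lattice" "0 \<le> y \<bullet> height n" "y \<bullet> height n < height n $ i"
      using assms by (auto simp: q surface_def)
    have "y' \<in> int_lattice"
      using incidence_int_lattice_iff[OF brun, of n y'] ys by (simp add: y' int_lattice_add)
    moreover have "0 \<le> y' \<bullet> height (Suc n)"
      using ys abelianization_inner_nonneg[of "height n" p] height_pos
      by (simp add: inner_height_Suc y' inner_add_left)
    moreover have "y' \<bullet> height (Suc n) < height (Suc n) $ j"
      using ys abelianization_inner_nonneg[of "height n" t] height_pos
      unfolding inner_height_Suc y' height_letter[symmetric] *(1)
      by (simp add: inner_add_left abelianization_Cons inner_axis_1)
    moreover have "par n (y', j) = (y, i)"
      using crossing_eqI[of "height n" "y + abelianization p" p i t] height_pos ys
      by (simp add: parent_def y' *(1))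
    moreover have "\<zeta> \<in> tile (Suc n) (y', j)"
      using *(2) tile_eq[OF y'] \<xi>(2) *(3) by (auto simp: tile_def)
    ultimately show "\<zeta> \<in> \<Union>(tile (Suc n) ` {q' \<in> surface (height (Suc n)). par n q' = q})"
      by (auto simp: q surface_def)
  next
    fix \<zeta> assume "\<zeta> \<in> \<Union>(tile (Suc n) ` {q' \<in> surface (height (Suc n)). par n q' = q})"
    then obtain y' j where q': "(y', j) \<in> surface (height (Suc n))" "par n (y', j) = q"
      "\<zeta> \<in> tile (Suc n) (y', j)" by auto
    have h: "0 \<le> (incidence_matrix (\<sigma> !! n) *v y') \<bullet> height n"
      "(incidence_matrix (\<sigma> !! n) *v y') \<bullet> height n < abelianization ((\<sigma> !! n) j) \<bullet> height n"
      using q'(1) by (auto simp: surface_def height_letter inner_height_Suc)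
    obtain p k t where *: "(\<sigma> !! n) j = p @ k # t"
      "crossing (height n) (incidence_matrix (\<sigma> !! n) *v y') ((\<sigma> !! n) j) =
        (incidence_matrix (\<sigma> !! n) *v y' - abelianization p, k)"
      by (rule crossing_cases[OF height_pos h]) blast
    then have y: "incidence_matrix (\<sigma> !! n) *v y' = y + abelianization p" "k = i"
      using q'(2) by (auto simp: parent_def q)
    from q'(3) obtain \<eta> where \<eta>: "\<eta> \<in> piece (Suc n) j"
      "\<zeta> = coord 0 (prod_mat 0 (Suc n) *v y') + ren 0 (Suc n) \<eta>"
      by (auto simp: tile_def)
    have "coord n (abelianization p) + ren n (Suc 0) \<eta> \<in> piece n i"
      using * y(2) \<eta>(1) piece_Suc[of n i] by auto
    then show "\<zeta> \<in> tile n q"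
      unfolding tile_def q fst_conv snd_conv
      by (rule image_eqI[rotated]) (simp add: tile_eq[OF y(1)] \<eta>(2))
  qed
qed

primrec ancestor :: "nat \<Rightarrow> (real^3) \<times> 3 \<Rightarrow> (real^3) \<times> 3" where
  "ancestor 0 q = q"
| "ancestor (Suc n) q = ancestor n (par n q)"

lemma tile_ancestor:
  assumes "p \<in> surface (height 0)"
  shows "tile 0 p = \<Union>(tile n ` {q \<in> surface (height n). ancestor n q = p})"
proof (induction n)
  case 0
  have "{q \<in> surface (height 0). ancestor 0 q = p} = {p}" using assms by auto
  then show ?case by simp
next
  case (Suc n)
  have "tile 0 p = (\<Union>q\<in>{q \<in> surface (height n). ancestor n q = p}.
      \<Union>(tile (Suc n) ` {q' \<in> surface (height (Suc n)). par n q' = q}))"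
    unfolding Suc using tile_Suc by auto
  also have "\<dots> = \<Union>(tile (Suc n) ` {q \<in> surface (height (Suc n)). ancestor (Suc n) q = p})"
    using par_in_surface by auto
  finally show ?case .
qed

section \<open>The limiting rotation and the covering of the plane\<close>

definition rotation :: "real^2" where
  "rotation = vector [- eig 0 $ 1 / total (eig 0), - eig 0 $ 2 / total (eig 0)]"

lemma rotation_nth:
  "rotation $ 1 = - eig 0 $ 1 / total (eig 0)" "rotation $ 2 = - eig 0 $ 2 / total (eig 0)"
  by (simp_all add: rotation_def)

text \<open>All unit vectors project to \<open>rotation\<close> modulo integers. A prefix of length
  \<open>m\<close> therefore projects to \<open>m\<close> times the rotation, whatever its letters
  are.\<close>

lemma coord_rotation: 
  assumes "x \<in> int_lattice"
  shows "coord 0 x - total x *\<^sub>R rotation \<in> int_lattice"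
  using assms by (simp add: int_lattice_def forall_2 forall_3 rotation_nth)

text \<open>A relation turns into the integer vector (c - a, c - b, c) orthogonal to
  \<open>eig 0\<close>.\<close>

lemma rotation_independent:
  assumes "real_of_int a * rotation $ 1 + real_of_int b * rotation $ 2 + real_of_int c = 0"
  shows "a = 0" "b = 0" "c = 0"
proof -
  define x :: "real^3" where "x = vector [real_of_int (c - a), real_of_int (c - b), real_of_int c]"
  have "x \<in> int_lattice" by (simp add: x_def int_lattice_iff_3)
  moreover have "x \<bullet> eig 0 = 0"
  proof -
    have "x \<bullet> eig 0 = total (eig 0) * (real_of_int a * rotation $ 1 + real_of_int b * rotation $ 2 + real_of_int c)"
      using total_eig_pos[of 0] by (simp add: x_def inner_3 rotation_nth field_simps) (simp add: total_def algebra_simps)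
    then show ?thesis using assms by simp
  qed
  ultimately have "x = 0" by (rule eig_orthogonal_int)
  then have "x $ 1 = 0" "x $ 2 = 0" "x $ 3 = 0" by simp_all
  then show "a = 0" "b = 0" "c = 0" by (simp_all add: x_def)
qed

text \<open>Kronecker's theorem yields some integer multiple of the rotation. A nonnegative one is
  required here, since prefixes of a word realize only forward multiples.\<close>

lemma rotation_dense:
  assumes "0 < e"
  obtains m l where "l \<in> int_lattice" "norm (\<xi> - l - real m *\<^sub>R rotation) < e"
proof -
  define \<theta> where "\<theta> = (\<lambda>i::nat. if i = 0 then rotation $ 1 else if i = 1 then rotation $ 2 else 1)"
  have S: "\<theta> ` {..2} = {rotation $ 1, rotation $ 2, 1}"
    by (auto simp: \<theta>_def image_iff intro: bexI[of _ 0] bexI[of _ 1] bexI[of _ 2])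
  have ne: "rotation $ 1 \<noteq> rotation $ 2" "rotation $ 1 \<noteq> 1" "rotation $ 2 \<noteq> 1"
    using rotation_independent[of 1 "-1" 0] rotation_independent[of 1 0 "-1"]
      rotation_independent[of 0 1 "-1"] by auto
  interpret m: Modules.module "\<lambda>r x. real_of_int r * x"
    by standard (auto simp: algebra_simps)
  have ind: "m.independent (\<theta> ` {..2})"
  proof
    assume "m.dependent (\<theta> ` {..2})"
    then obtain u where u: "\<exists>v\<in>{rotation $ 1, rotation $ 2, 1}. u v \<noteq> 0"
      "(\<Sum>v\<in>{rotation $ 1, rotation $ 2, 1}. real_of_int (u v) * v) = 0"
      using m.dependent_finite[of "{rotation $ 1, rotation $ 2, 1}"] unfolding S by blast
    then show False
      using ne rotation_independent[of "u (rotation $ 1)" "u (rotation $ 2)" "u 1"] by auto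
  qed
  have inj: "inj_on \<theta> {..2}"
  proof (rule eq_card_imp_inj_on)
    show "card (\<theta> ` {..2}) = card {..2::nat}" unfolding S using ne by simp
  qed simp
  define \<alpha> where "\<alpha> = (\<lambda>i::nat. if i = 0 then \<xi> $ 1 else \<xi> $ 2)"
  obtain k h where kh: "\<And>i. i < 2 \<Longrightarrow> \<bar>of_int k * \<theta> i - of_int (h i) - \<alpha> i\<bar> < e / 4"
  proof (rule Kronecker_thm_2[of \<theta> 2 "e / 4" \<alpha>])
    show "\<theta> 2 = 1" by (simp add: \<theta>_def)
  qed (use ind inj assms in auto)
  text \<open>A Dirichlet approximation makes the possibly negative \<open>k\<close> positive.\<close>
  obtain N :: nat where N: "real (nat \<bar>k\<bar> + 1) * 4 / e < real N" using reals_Archimedean2 by blast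
  have Npos: "0 < N" using N assms by (smt (verit) divide_nonneg_pos of_nat_0 of_nat_0_le_iff gr0I mult_nonneg_nonneg)
  obtain q p where q: "0 < q" "\<And>i. i < 2 \<Longrightarrow> \<bar>of_int q * \<theta> i - of_int (p i)\<bar> < 1 / N"
    by (rule Dirichlet_approx_simult[OF Npos, of 2 \<theta>]) blast
  define M where "M = k + int (nat \<bar>k\<bar> + 1) * q"
  have "\<bar>k\<bar> \<le> int (nat \<bar>k\<bar> + 1) * q" using q(1) by (smt (verit) int_nat_eq mult_le_cancel_left1 of_nat_1 of_nat_add)
  then have M: "0 \<le> M" by (simp add: M_def)
  define l :: "real^2" where
    "l = vector [- of_int (h 0 + int (nat \<bar>k\<bar> + 1) * p 0), - of_int (h 1 + int (nat \<bar>k\<bar> + 1) * p 1)]"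
  have close: "\<bar>of_int M * \<theta> i - of_int (h i + int (nat \<bar>k\<bar> + 1) * p i) - \<alpha> i\<bar> < e / 2" if "i < 2" for i
  proof -
    have "real (nat \<bar>k\<bar> + 1) * \<bar>of_int q * \<theta> i - of_int (p i)\<bar> \<le> real (nat \<bar>k\<bar> + 1) * (1 / N)"
      using q(2)[OF that] by (intro mult_left_mono) auto
    also have "\<dots> < e / 4" using N Npos assms by (simp add: field_simps)
    finally have *: "\<bar>real (nat \<bar>k\<bar> + 1) * (of_int q * \<theta> i - of_int (p i))\<bar> < e / 4"
      by (simp add: abs_mult)
    have "of_int M * \<theta> i - of_int (h i + int (nat \<bar>k\<bar> + 1) * p i) - \<alpha> i =
        (of_int k * \<theta> i - of_int (h i) - \<alpha> i) + real (nat \<bar>k\<bar> + 1) * (of_int q * \<theta> i - of_int (p i))"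
      by (simp add: M_def algebra_simps)
    then show ?thesis using * kh[OF that] by linarith
  qed
  show thesis
  proof (rule that)
    show "l \<in> int_lattice" by (simp add: l_def int_lattice_def forall_2)
    have "norm (\<xi> - l - real (nat M) *\<^sub>R rotation) \<le> \<bar>(\<xi> - l - real (nat M) *\<^sub>R rotation) $ 1\<bar> +
        \<bar>(\<xi> - l - real (nat M) *\<^sub>R rotation) $ 2\<bar>"
      by (rule norm_le_2)
    also have "(\<xi> - l - real (nat M) *\<^sub>R rotation) $ 1 =
        - (of_int M * \<theta> 0 - of_int (h 0 + int (nat \<bar>k\<bar> + 1) * p 0) - \<alpha> 0)"
      using M by (simp add: l_def \<theta>_def \<alpha>_def)
    also have "(\<xi> - l - real (nat M) *\<^sub>R rotation) $ 2 =
        - (of_int M * \<theta> 1 - of_int (h 1 + int (nat \<bar>k\<bar> + 1) * p 1) - \<alpha> 1)"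
      using M by (simp add: l_def \<theta>_def \<alpha>_def)
    also have "\<bar>- (of_int M * \<theta> 0 - of_int (h 0 + int (nat \<bar>k\<bar> + 1) * p 0) - \<alpha> 0)\<bar> +
        \<bar>- (of_int M * \<theta> 1 - of_int (h 1 + int (nat \<bar>k\<bar> + 1) * p 1) - \<alpha> 1)\<bar> < e"
      using close[of 0] close[of 1] unfolding abs_minus_cancel by linarith
    finally show "norm (\<xi> - l - real (nat M) *\<^sub>R rotation) < e" .
  qed
qed

text \<open>The prefixes of one limit word project into the pieces and, modulo integers, run through
  the dense forward orbit of 0. The sum of a closed lattice and a compact set is closed.\<close>

lemma pieces_cover: "\<exists>l i. l \<in> int_lattice \<and> \<xi> - l \<in> piece 0 i"
proof -
  obtain \<omega> where \<omega>: "limit_word \<sigma> \<omega>" using limit_word_starting[of 0] by auto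
  have pt: "coord 0 (abelianization (stake m \<omega>)) \<in> piece 0 (\<omega> !! m)" for m
  proof -
    have "stream_prefix (stake m \<omega> @ [\<omega> !! m]) \<omega>"
      by (simp add: stream_prefix_def stake_Suc[symmetric] del: stake.simps)
    then show ?thesis
      unfolding piece_def using \<omega>
      by (intro subsetD[OF closure_subset] imageI) (auto simp: prefix_points_def)
  qed
  define K where "K = (\<Union>i. piece 0 i)"
  have "compact K" unfolding K_def by (intro compact_UN compact_piece) auto
  then have cl: "closed (\<Union>x\<in>int_lattice. \<Union>y\<in>K. {x + y})"
    by (intro closed_compact_sums closed_int_lattice)
  have "\<xi> \<in> closure (\<Union>x\<in>int_lattice. \<Union>y\<in>K. {x + y})"
    unfolding closure_approachable
  proof (intro allI impI)
    fix e :: real assume "0 < e"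
    then obtain m l where ml: "l \<in> int_lattice" "norm (\<xi> - l - real m *\<^sub>R rotation) < e"
      by (rule rotation_dense)
    define x where "x = abelianization (stake m \<omega>)"
    have tot: "total x = real m" unfolding x_def length_eq_total[symmetric] by simp
    define l' where "l' = l - (coord 0 x - total x *\<^sub>R rotation)"
    have "l' \<in> int_lattice"
      unfolding l'_def by (intro int_lattice_diff ml coord_rotation) (simp add: x_def)
    moreover have "coord 0 x \<in> K" using pt[of m] by (auto simp: x_def K_def)
    moreover have "dist (l' + coord 0 x) \<xi> < e"
      using ml(2) by (simp add: l'_def tot dist_norm norm_minus_commute algebra_simps)
    ultimately show "\<exists>y\<in>(\<Union>x\<in>int_lattice. \<Union>y\<in>K. {x + y}). dist y \<xi> < e" by blast
  qed
  then have "\<xi> \<in> (\<Union>x\<in>int_lattice. \<Union>y\<in>K. {x + y})" using cl by simp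
  then obtain l y i where "l \<in> int_lattice" "y \<in> piece 0 i" "\<xi> = l + y" by (auto simp: K_def)
  then show ?thesis by (intro exI[of _ l] exI[of _ i]) auto
qed

lemma tile_0: "tile 0 (x, i) = (+) (coord 0 x) ` piece 0 i"
  by (simp add: tile_def)

lemma tiles_cover: "\<exists>q\<in>surface (height n). \<xi> \<in> tile n q"
proof -
  obtain l i where l: "l \<in> int_lattice" "\<xi> - l \<in> piece 0 i" using pieces_cover by blast
  have s: "(lift l, i) \<in> surface (height 0)"
    using l(1) unfolding height_0 surface_vec_1 by (simp add: lift_int_lattice_iff)
  have "\<xi> \<in> tile 0 (lift l, i)"
    unfolding tile_0 using l(2) by (auto intro: image_eqI[of _ _ "\<xi> - l"])
  then show ?thesis unfolding tile_ancestor[OF s, of n] by auto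
qed

end

section \<open>Tiles overlap in null sets only\<close>

lemma finite_int_lattice_box:
  "finite {x \<in> int_lattice :: (real^3) set. \<forall>i. \<bar>x $ i\<bar> \<le> r}" (is "finite ?S")
proof -
  define K where "K = \<lceil>r\<rceil>"
  define g where "g = (\<lambda>(a, b, c). vector [real_of_int a, real_of_int b, real_of_int c] :: real^3)"
  have "?S \<subseteq> g ` ({-K..K} \<times> {-K..K} \<times> {-K..K})"
  proof
    fix x :: "real^3" assume x: "x \<in> ?S"
    have "\<exists>n\<in>{-K..K}. x $ i = of_int n" for i
    proof -
      have "x $ i \<in> \<int>" using x by (simp add: int_lattice_def)
      then obtain n where n: "x $ i = of_int n" by (rule Ints_cases)
      have "\<bar>real_of_int n\<bar> \<le> r" using x n by (metis (mono_tags, lifting) mem_Collect_eq)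
      then have "n \<in> {-K..K}" unfolding K_def by (auto simp: abs_le_iff) linarith+
      with n show ?thesis by blast
    qed
    then obtain n where n: "\<And>i. n i \<in> {-K..K}" "\<And>i. x $ i = of_int (n i)" by metis
    have "x = g (n 1, n 2, n 3)" by (simp add: g_def vec_eq_iff forall_3 n)
    then show "x \<in> g ` ({-K..K} \<times> {-K..K} \<times> {-K..K})" using n(1) by blast
  qed
  then show ?thesis by (rule finite_subset) simp
qed

lemma countable_int_lattice: "countable (int_lattice :: (real^'n::finite) set)"
proof -
  define g where "g = (\<lambda>f :: 'n \<Rightarrow> int. (\<chi> i. real_of_int (f i)) :: real^'n)"
  have "int_lattice \<subseteq> range g"
  proof
    fix x :: "real^'n" assume "x \<in> int_lattice"
    then have "x = g (\<lambda>i. \<lfloor>x $ i\<rfloor>)"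
      by (auto simp: g_def int_lattice_def vec_eq_iff)
    then show "x \<in> range g" by blast
  qed
  moreover have "countable (UNIV :: ('n \<Rightarrow> int) set)" by simp
  ultimately show ?thesis by (meson countable_image countable_subset)
qed

lemma countable_surface: "countable (surface v)"
proof (rule countable_subset)
  show "surface v \<subseteq> int_lattice \<times> UNIV" by (auto simp: surface_def)
  show "countable (int_lattice \<times> (UNIV :: 3 set) :: ((real^3) \<times> 3) set)"
    by (intro countable_SIGMA countable_int_lattice countable_finite) auto
qed

lemma closed_subset_int_lattice:
  assumes "S \<subseteq> (int_lattice :: (real^'n) set)"
  shows "closed S"
proof (rule discrete_imp_closed[of 1])
  show "\<forall>x\<in>S. \<forall>y\<in>S. dist y x < 1 \<longrightarrow> y = x"
  proof (intro ballI impI)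
    fix x y assume xy: "x \<in> S" "y \<in> S" "dist y x < 1"
    have "y $ i - x $ i = 0" for i
    proof (rule Ints_nonzero_abs_less1)
      show "y $ i - x $ i \<in> \<int>" using xy assms by (auto simp: int_lattice_def subset_eq)
      show "\<bar>y $ i - x $ i\<bar> < 1"
        using component_le_norm_cart[of "y - x" i] xy(3) by (simp add: dist_norm)
    qed
    then show "y = x" by (simp add: vec_eq_iff)
  qed
qed simp

section \<open>Areas of tiles and distances between overlapping tiles\<close>

context brun_generic
begin

text \<open>The incidence matrix preserves volume and maps \<open>eig (Suc m)\<close> to
  \<open>eig m\<close>. Splitting space into the plane of total 0 and the eigenvector, volume is
  area times the multiple of the eigenvector times its total. The area factor is therefore the
  quotient of the totals.\<close>

lemma det_ren: "\<bar>det (matrix (ren m (Suc 0)))\<bar> = total (eig (Suc m)) / total (eig m)"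
proof -
  define u where "u = eig (Suc m)"
  define s where "s = total (eig m)"
  have s: "s > 0" unfolding s_def by (rule total_eig_pos)
  have T: "total u > 0" unfolding u_def by (rule total_eig_pos)
  have e: "eig m = incidence_matrix (\<sigma> !! m) *v u" unfolding u_def by (rule eig_Suc)
  have d: "det (matrix (ren m (Suc 0))) =
      ren m (Suc 0) (axis 1 1) $ 1 * ren m (Suc 0) (axis 2 1) $ 2 -
      ren m (Suc 0) (axis 2 1) $ 1 * ren m (Suc 0) (axis 1 1) $ 2"
    by (simp add: det_2 matrix_def)
  have r: "ren m (Suc 0) \<xi> $ i = (incidence_matrix (\<sigma> !! m) *v lift \<xi>) $ i'
      - total (incidence_matrix (\<sigma> !! m) *v lift \<xi>) * eig m $ i' / s"
    if "i = 1 \<and> i' = 1 \<or> i = 2 \<and> i' = 2" for \<xi> i i'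
    using that by (auto simp: ren_def prod_mat_1 s_def)
  have "\<bar>det (matrix (ren m (Suc 0)))\<bar> = total u / s"
    using brun[of m]
  proof (cases rule: brun_cases)
    case 1
    have "det (matrix (ren m (Suc 0))) = 1 - u$2 / s"
      unfolding d r[of 1 1, simplified] r[of 2 2, simplified] using e
      by (simp add: 1 incidence_mult total_def axis_def)
    moreover have "s = total u + u$2" using e by (simp add: 1 incidence_mult s_def total_def)
    ultimately have "det (matrix (ren m (Suc 0))) = total u / s" using s by (simp add: field_simps)
    then show ?thesis using s T by simp
  next
    case 2
    have "det (matrix (ren m (Suc 0))) = u$3 / s - 1"
      unfolding d r[of 1 1, simplified] r[of 2 2, simplified] using e s
      by (simp add: 2 incidence_mult total_def axis_def) (simp add: field_simps)
    moreover have "s = total u + u$3" using e by (simp add: 2 incidence_mult s_def total_def)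
    ultimately have "det (matrix (ren m (Suc 0))) = - (total u / s)" using s by (simp add: field_simps)
    then show ?thesis using s T by simp
  next
    case 3
    have "det (matrix (ren m (Suc 0))) = 1 - u$3 / s"
      unfolding d r[of 1 1, simplified] r[of 2 2, simplified] using e s
      by (simp add: 3 incidence_mult total_def axis_def) (simp add: field_simps)
    moreover have "s = total u + u$3" using e by (simp add: 3 incidence_mult s_def total_def)
    ultimately have "det (matrix (ren m (Suc 0))) = total u / s" using s by (simp add: field_simps)
    then show ?thesis using s T by simp
  qed
  then show ?thesis by (simp add: u_def s_def)
qed

lemma measure_ren:
  assumes "S \<in> lmeasurable"
  shows "ren m k ` S \<in> lmeasurable"
    "measure lebesgue (ren m k ` S) = total (eig (m + k)) / total (eig m) * measure lebesgue S"
proof -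
  show "ren m k ` S \<in> lmeasurable" by (intro measurable_linear_image linear_ren assms)
  show "measure lebesgue (ren m k ` S) = total (eig (m + k)) / total (eig m) * measure lebesgue S"
    using assms
  proof (induction k arbitrary: S)
    case 0
    then show ?case using total_eig_pos[of m] by (simp add: image_def)
  next
    case (Suc k)
    have eq: "ren m (Suc k) ` S = ren m k ` ren (m + k) (Suc 0) ` S"
      using ren_add_level[of m k "Suc 0"] by (simp add: image_image)
    have "ren (m + k) (Suc 0) ` S \<in> lmeasurable" by (intro measurable_linear_image linear_ren Suc)
    from Suc.IH[OF this] show ?case
      using total_eig_pos[of "m + k"]
      by (simp add: eq measure_linear_image[OF linear_ren Suc.prems] det_ren)
  qed
qed

lemma tile_eq_translate:
  "tile n q = (+) (coord 0 (prod_mat 0 n *v fst q)) ` ren 0 n ` piece n (snd q)"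
  by (auto simp: tile_def)

lemma lmeasurable_piece [simp]: "piece n i \<in> lmeasurable"
  by (intro lmeasurable_compact compact_piece)

lemma lmeasurable_tile [simp]: "tile n q \<in> lmeasurable"
  unfolding tile_eq_translate by (intro measurable_translation measure_ren) simp

lemma compact_tile: "compact (tile n q)"
  unfolding tile_eq_translate
  by (intro compact_translation compact_continuous_image compact_piece linear_continuous_on
      linear_conv_bounded_linear[THEN iffD1] linear_ren)

lemma measure_tile:
  "measure lebesgue (tile n q) = total (eig n) / total (eig 0) * measure lebesgue (piece n (snd q))"
  unfolding tile_eq_translate measure_translation using measure_ren(2)[of "piece n (snd q)" 0 n] by simp

lemma measure_piece_le:
  assumes "(\<Sum>l. rate n l) \<le> C"
  shows "measure lebesgue (piece n i) \<le> (4 * C)\<^sup>2"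
proof -
  have C: "0 \<le> C" using suminf_nonneg[OF summable_rate[of n]] assms by simp
  have "piece n i \<subseteq> cbox (- vec (2 * C)) (vec (2 * C))"
  proof
    fix \<xi> assume "\<xi> \<in> piece n i"
    then have "norm \<xi> \<le> 2 * C" using norm_piece[of \<xi> n i] assms by linarith
    then have "\<bar>\<xi> $ j\<bar> \<le> 2 * C" for j using component_le_norm_cart[of \<xi> j] by linarith
    then show "\<xi> \<in> cbox (- vec (2 * C)) (vec (2 * C))"
      by (auto simp: mem_box_cart abs_le_iff) (smt (verit))
  qed
  then have "measure lebesgue (piece n i) \<le> measure lebesgue (cbox (- vec (2 * C)) (vec (2 * C) :: real^2))"
    by (intro measure_mono_fmeasurable) (auto simp: fmeasurableD)
  also have "\<dots> = measure lborel (cbox (- vec (2 * C)) (vec (2 * C) :: real^2))"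
    by (simp add: measure_completion)
  also have "\<dots> = (4 * C)\<^sup>2"
  proof -
    have "cbox (- vec (2 * C)) (vec (2 * C) :: real^2) \<noteq> {}"
      using C by (auto simp: interval_ne_empty_cart)
    then show ?thesis by (simp add: content_cbox_cart UNIV_2 power2_eq_square)
  qed
  finally show ?thesis .
qed

text \<open>The difference of the base points is split along the plane and \<open>eig n\<close>.
  Overlap bounds the projected part by 4 C, twice the radius of the pieces, hence the coordinates of
  its lift by 8 C. Both faces have heights between 0 and H, which bounds the part along
  \<open>eig n\<close>; balance at a block costs the factor 6 and gives 6 + 48 C.\<close>

lemma overlap_bounded:
  assumes q: "(y, j) \<in> surface (height n)" "(y', j') \<in> surface (height n)"
    and ne: "tile n (y, j) \<inter> tile n (y', j') \<noteq> {}"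
    and occ: "occurs \<sigma> n" and C: "(\<Sum>l. rate n l) \<le> C"
  shows "\<bar>y $ i - y' $ i\<bar> \<le> 6 + 56 * C"
proof -
  define d where "d = y - y'"
  obtain \<xi> \<xi>' where \<xi>: "\<xi> \<in> piece n j" "\<xi>' \<in> piece n j'"
    "coord 0 (prod_mat 0 n *v y) + ren 0 n \<xi> = coord 0 (prod_mat 0 n *v y') + ren 0 n \<xi>'"
    using ne by (auto simp: tile_def)
  have "ren 0 n (coord n d + \<xi> - \<xi>') =
      (coord 0 (prod_mat 0 n *v y) + ren 0 n \<xi>) - (coord 0 (prod_mat 0 n *v y') + ren 0 n \<xi>')"
    using ren_coord[of 0 n y] ren_coord[of 0 n y']
    by (simp add: ren_add ren_diff d_def coord_diff)
  then have "ren 0 n (coord n d + \<xi> - \<xi>') = 0" using \<xi>(3) by simp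
  then have "coord n d + \<xi> - \<xi>' = 0"
    using inj_ren[of 0 n] linear_injective_0[OF linear_ren] by blast
  moreover have "coord n d = (coord n d + \<xi> - \<xi>') + (\<xi>' - \<xi>)" by simp
  ultimately have "coord n d = \<xi>' - \<xi>" by (metis add_0)
  then have "norm (coord n d) \<le> norm \<xi>' + norm \<xi>" by (simp add: norm_triangle_ineq4)
  also have "\<dots> \<le> 4 * C" using norm_piece[OF \<xi>(1)] norm_piece[OF \<xi>(2)] C by linarith
  finally have c: "norm (coord n d) \<le> 4 * C" .
  define H where "H = total (height n)"
  have hp: "0 < height n $ i" for i by (rule height_pos)
  have hH: "height n $ i \<le> H" for i
    using exhaust_3[of i] hp[of 1] hp[of 2] hp[of 3] by (auto simp: H_def total_def)
  have H: "H > 0" using hp[of 1] hp[of 2] hp[of 3] by (simp add: H_def total_def)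
  have dh: "\<bar>d \<bullet> height n\<bar> \<le> H"
    using q hH[of j] hH[of j'] by (auto simp: surface_def d_def inner_diff_left)
  define a where "a = total d / total (eig n)"
  have T: "0 < total (eig n)" by (rule total_eig_pos)
  have d: "d = lift (coord n d) + a *\<^sub>R eig n" by (simp add: lift_coord a_def)
  have l: "\<bar>lift (coord n d) $ i\<bar> \<le> 8 * C" for i
    using exhaust_3[of i] component_le_norm_cart[of "coord n d" 1] component_le_norm_cart[of "coord n d" 2] c
    by (auto simp del: coord_nth)
  have lh: "\<bar>lift (coord n d) \<bullet> height n\<bar> \<le> 8 * C * H"
  proof -
    have "\<bar>lift (coord n d) \<bullet> height n\<bar> \<le> \<bar>lift (coord n d) $ 1 * height n $ 1\<bar> +
       \<bar>lift (coord n d) $ 2 * height n $ 2\<bar> + \<bar>lift (coord n d) $ 3 * height n $ 3\<bar>"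
      unfolding inner_3 by linarith
    also have "\<dots> \<le> 8 * C * height n $ 1 + 8 * C * height n $ 2 + 8 * C * height n $ 3"
    proof -
      have "\<bar>lift (coord n d) $ i * height n $ i\<bar> \<le> 8 * C * height n $ i" for i
        unfolding abs_mult abs_of_pos[OF hp[of i]]
        by (intro mult_right_mono l) (simp add: hp less_imp_le)
      from add_mono[OF add_mono[OF this[of 1] this[of 2]] this[of 3]] show ?thesis .
    qed
    finally show ?thesis by (simp add: H_def total_def algebra_simps)
  qed
  have "d \<bullet> height n = lift (coord n d) \<bullet> height n + a * (eig n \<bullet> height n)"
    by (subst d) (simp add: inner_add_left)
  then have "\<bar>a * (eig n \<bullet> height n)\<bar> \<le> H + 8 * C * H" using dh lh by linarith
  moreover have Q: "total (eig n) / 6 * H \<le> eig n \<bullet> height n"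
  proof -
    have "total (eig n) / 6 * height n $ i \<le> eig n $ i * height n $ i" for i
      using eig_occurs[OF occ, of i] hp[of i] by (intro mult_right_mono) auto
    from add_mono[OF add_mono[OF this[of 1] this[of 2]] this[of 3]]
    show ?thesis unfolding inner_3 H_def total_def[of "height n"] distrib_left .
  qed
  moreover have "0 < eig n \<bullet> height n" using Q T H by (meson divide_pos_pos less_le_trans mult_pos_pos zero_less_numeral)
  moreover have "\<bar>a\<bar> * (total (eig n) / 6 * H) \<le> \<bar>a\<bar> * (eig n \<bullet> height n)"
    by (rule mult_left_mono[OF Q]) simp
  ultimately have "\<bar>a\<bar> * (total (eig n) / 6 * H) \<le> H + 8 * C * H"
    by (simp add: abs_mult)
  then have "(\<bar>a\<bar> * total (eig n)) * H \<le> (6 + 48 * C) * H" by (simp add: algebra_simps)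
  then have a: "\<bar>a\<bar> * total (eig n) \<le> 6 + 48 * C" using H by simp
  have "eig n $ i \<le> total (eig n)"
    using exhaust_3[of i] eig_pos[of n 1] eig_pos[of n 2] eig_pos[of n 3] by (auto simp: total_def)
  then have "\<bar>a * eig n $ i\<bar> \<le> \<bar>a\<bar> * total (eig n)"
    unfolding abs_mult using eig_pos[of n i] by (intro mult_left_mono) auto
  moreover have "d $ i = lift (coord n d) $ i + a * eig n $ i" by (subst d) simp
  ultimately have "\<bar>d $ i\<bar> \<le> 8 * C + (6 + 48 * C)" using a l[of i] by linarith
  then show ?thesis by (simp add: d_def)
qed

text \<open>The colouring of level \<open>Suc n\<close> by ancestors is that of level
  \<open>n\<close> composed with \<open>par n\<close>. Each level thus moves one
  \<open>pair_step\<close> to the weights, which is why the weight is arbitrary in the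
  induction.\<close>

lemma boundary_count_ancestor:
  assumes "\<And>i. 0 \<le> w $ i"
  shows "finite_boundary (height n) (\<lambda>q. ancestor n q = p) \<and>
    boundary_count (height n) (\<lambda>q. ancestor n q = p) \<bullet> w \<le>
      boundary_count (height 0) (\<lambda>q. q = p) \<bullet> pair_weight 0 n w"
  using assms
proof (induction n arbitrary: w)
  case 0
  have "finite_boundary (height 0) (\<lambda>q. q = p)"
    by (rule boundary_singleton) (simp add: height_pos)
  then show ?case by simp
next
  case (Suc n)
  have "\<forall>i. 0 \<le> pair_step (\<sigma> !! n) w $ i"
    using brun[of n] Suc.prems by (elim brun_cases) (auto simp: pair_step_simps forall_3)
  then have IH: "finite_boundary (height n) (\<lambda>q. ancestor n q = p)"
    "boundary_count (height n) (\<lambda>q. ancestor n q = p) \<bullet> pair_step (\<sigma> !! n) w \<le>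
      boundary_count (height 0) (\<lambda>q. q = p) \<bullet> pair_weight 0 n (pair_step (\<sigma> !! n) w)"
    using Suc.IH[of "pair_step (\<sigma> !! n) w"] Suc.IH[of 0] by auto
  have "pair_weight 0 (Suc n) w = pair_weight 0 n (pair_step (\<sigma> !! n) w)"
    using pair_weight_add[of 0 n "Suc 0" w] by simp
  then show ?case
    using boundary_count_step[OF brun[of n] height_pos IH(1) Suc.prems] IH(2)
    by (auto simp: height_Suc[symmetric] simp del: pair_weight.simps)
qed

text \<open>The constant is 4 times 6: four squares of each type around a single face, and at a
  balanced level \<open>vec 1\<close> is at most 6 / \<open>total (eig n)\<close> times
  \<open>eig n\<close>, which the product takes to \<open>eig 0\<close>. The factor
  \<open>total (eig n)\<close> on the left is the area scale of a tile of level
  \<open>n\<close>.\<close>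

lemma boundary_total:
  fixes p
  defines "B \<equiv> \<lambda>n i j. boundary (height n) (\<lambda>q. ancestor n q = p) i j"
  assumes "occurs \<sigma> n"
  shows "finite (B n 2 3 \<union> B n 1 3 \<union> B n 1 2)"
    "real (card (B n 2 3 \<union> B n 1 3 \<union> B n 1 2)) * total (eig n) \<le> 24 * rate 0 n * total (eig 0)"
proof -
  have f: "finite_boundary (height n) (\<lambda>q. ancestor n q = p)"
    and le: "boundary_count (height n) (\<lambda>q. ancestor n q = p) \<bullet> vec 1 \<le>
      boundary_count (height 0) (\<lambda>q. q = p) \<bullet> pair_weight 0 n (vec 1)"
    using boundary_count_ancestor[of "vec 1" n p] by auto
  show "finite (B n 2 3 \<union> B n 1 3 \<union> B n 1 2)" using f by (simp add: finite_boundary_def B_def)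
  have wpos: "\<forall>i. 0 \<le> pair_weight m k (vec 1) $ i" for m k
  proof (induction k arbitrary: m)
    case (Suc k)
    then show ?case
      using brun[of m] by (elim brun_cases) (auto simp: pair_step_simps forall_3)
  qed simp
  have "real (card (B n 2 3 \<union> B n 1 3 \<union> B n 1 2)) \<le>
      real (card (B n 2 3) + card (B n 1 3) + card (B n 1 2))"
    unfolding of_nat_le_iff
    using card_Un_le[of "B n 2 3 \<union> B n 1 3" "B n 1 2"] card_Un_le[of "B n 2 3" "B n 1 3"] by linarith
  also have "\<dots> = boundary_count (height n) (\<lambda>q. ancestor n q = p) \<bullet> vec 1"
    by (simp add: boundary_count_def inner_3 B_def)
  also have "\<dots> \<le> 4 * total (pair_weight 0 n (vec 1))"
  proof -
    have b: "boundary_count (height 0) (\<lambda>q. q = p) $ i \<le> 4" for i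
      by (rule boundary_singleton) (rule height_pos)
    have "boundary_count (height 0) (\<lambda>q. q = p) \<bullet> pair_weight 0 n (vec 1) \<le> 4 * total (pair_weight 0 n (vec 1))"
      unfolding inner_3 total_def distrib_left using b wpos by (intro add_mono mult_right_mono) auto
    then show ?thesis using le by linarith
  qed
  also have "total (pair_weight 0 n (vec 1)) \<le> rate 0 n * total (prod_mat 0 n *v vec 1)"
    using dominated_pair_weight[of 0 n] by (simp add: dominated_def total_def distrib_left)
  finally have 1: "real (card (B n 2 3 \<union> B n 1 3 \<union> B n 1 2)) \<le> 4 * (rate 0 n * total (prod_mat 0 n *v vec 1))"
    by simp
  define c where "c = total (eig n) / 6"
  have "0 \<le> total (prod_mat 0 n *v (eig n - c *\<^sub>R vec 1))"
  proof -
    have "0 \<le> (eig n - c *\<^sub>R vec 1) $ i" for i using eig_occurs[OF assms(2), of i] by (simp add: c_def)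
    from prod_mat_nonneg(1)[OF this, of 0 n] show ?thesis by (simp add: total_def)
  qed
  then have "c * total (prod_mat 0 n *v vec 1) \<le> total (eig 0)"
    using eig_prod[of 0 n]
    by (simp only: matrix_vector_mult_diff_distrib matrix_vector_mult_scaleR total_diff total_scaleR) simp
  then have 2: "total (prod_mat 0 n *v vec 1) * total (eig n) \<le> 6 * total (eig 0)"
    by (simp add: c_def mult.commute)
  have "real (card (B n 2 3 \<union> B n 1 3 \<union> B n 1 2)) * total (eig n) \<le>
      4 * (rate 0 n * total (prod_mat 0 n *v vec 1)) * total (eig n)"
    using 1 total_eig_pos[of n] by (intro mult_right_mono) auto
  also have "\<dots> = 4 * rate 0 n * (total (prod_mat 0 n *v vec 1) * total (eig n))" by simp
  also have "\<dots> \<le> 4 * rate 0 n * (6 * total (eig 0))" using 2 by (intro mult_left_mono) auto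
  finally show "real (card (B n 2 3 \<union> B n 1 3 \<union> B n 1 2)) * total (eig n) \<le> 24 * rate 0 n * total (eig 0)"
    by simp
qed

section \<open>Faces whose tiles meet foreign tiles\<close>

definition impure :: "nat \<Rightarrow> (real^3) \<times> 3 \<Rightarrow> ((real^3) \<times> 3) set" where
  "impure n p = {q \<in> surface (height n). ancestor n q = p \<and>
     (\<exists>q'\<in>surface (height n). ancestor n q' \<noteq> p \<and> tile n q \<inter> tile n q' \<noteq> {})}"

text \<open>An impure face and the foreign face that it meets have different colours and bounded
  distance, so a boundary square lies within (6 + 56 C) + 2. The face is determined by this square,
  the displacement and its own type, one of three.\<close>

lemma card_impure:
  fixes p
  defines "B \<equiv> \<lambda>n i j. boundary (height n) (\<lambda>q. ancestor n q = p) i j"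
  assumes occ: "occurs \<sigma> n" and C: "(\<Sum>l. rate n l) \<le> C"
  shows "finite (impure n p)"
    "card (impure n p) \<le> card (B n 2 3 \<union> B n 1 3 \<union> B n 1 2) *
       (3 * card {x \<in> int_lattice :: (real^3) set. \<forall>i. \<bar>x $ i\<bar> \<le> 8 + 56 * C})"
proof -
  define D where "D = {x \<in> int_lattice :: (real^3) set. \<forall>i. \<bar>x $ i\<bar> \<le> 8 + 56 * C}"
  define BB where "BB = B n 2 3 \<union> B n 1 3 \<union> B n 1 2"
  have fin: "finite BB" unfolding BB_def B_def by (rule boundary_total(1)[OF occ])
  have finD: "finite D" unfolding D_def by (rule finite_int_lattice_box)
  have sub: "impure n p \<subseteq> (\<lambda>(z, d, j). (z + d, j)) ` (BB \<times> D \<times> UNIV)"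
  proof
    fix q assume "q \<in> impure n p"
    then obtain y j y' j' where q: "q = (y, j)" "(y, j) \<in> surface (height n)" "ancestor n (y, j) = p"
      "(y', j') \<in> surface (height n)" "ancestor n (y', j') \<noteq> p" "tile n (y, j) \<inter> tile n (y', j') \<noteq> {}"
      by (cases q) (auto simp: impure_def)
    have ne: "(ancestor n (y, j) = p) \<noteq> (ancestor n (y', j') = p)" using q by simp
    obtain z i k where z: "i \<noteq> k" "z \<in> boundary (height n) (\<lambda>q. ancestor n q = p) i k"
      "\<And>l. \<bar>z $ l - y $ l\<bar> \<le> (6 + 56 * C) + 2"
      by (rule boundary_near[OF height_pos q(2,4), of "\<lambda>q. ancestor n q = p", OF ne
           overlap_bounded[OF q(2,4,6) occ C]]) blast
    have "z \<in> BB"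
      using z(1,2) exhaust_3[of i] exhaust_3[of k] boundary_commute[of "height n" "\<lambda>q. ancestor n q = p"]
      by (auto simp: BB_def B_def)
    moreover have "y - z \<in> D"
      using z(2,3) q(2) unfolding D_def
      by (auto simp: boundary_def surface_def int_lattice_diff abs_minus_commute)
    ultimately have "(z, y - z, j) \<in> BB \<times> D \<times> UNIV" by auto
    then show "q \<in> (\<lambda>(z, d, j). (z + d, j)) ` (BB \<times> D \<times> UNIV)"
      by (intro image_eqI[of _ _ "(z, y - z, j)"]) (auto simp: q(1))
  qed
  have finX: "finite (BB \<times> D \<times> (UNIV :: 3 set))" using fin finD by simp
  show "finite (impure n p)" using sub finX by (meson finite_imageI finite_subset)
  have "card (impure n p) \<le> card ((\<lambda>(z, d, j::3). (z + d, j)) ` (BB \<times> D \<times> UNIV))"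
    by (rule card_mono[OF finite_imageI[OF finX] sub])
  also have "\<dots> \<le> card (BB \<times> D \<times> (UNIV :: 3 set))" by (rule card_image_le[OF finX])
  also have "\<dots> = card BB * (3 * card D)" by (simp add: card_cartesian_product)
  finally show "card (impure n p) \<le> card (B n 2 3 \<union> B n 1 3 \<union> B n 1 2) *
       (3 * card {x \<in> int_lattice :: (real^3) set. \<forall>i. \<bar>x $ i\<bar> \<le> 8 + 56 * C})"
    unfolding BB_def D_def .
qed

text \<open>The number of impure faces times the area of a tile is at most the rate times a constant
  \<open>K\<close> that depends on \<open>C\<close> only. The recurrence assumption supplies
  arbitrarily late levels with this same \<open>C\<close>.\<close>

lemma impure_small:
  assumes "0 < e"
  obtains n where "finite (impure n p)" "\<Union>(tile n ` impure n p) \<in> lmeasurable"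
    "measure lebesgue (\<Union>(tile n ` impure n p)) < e"
proof -
  obtain C where C: "\<And>N. \<exists>n\<ge>N. occurs \<sigma> n \<and> (\<Sum>k. rate n k) \<le> C" using recurrent by blast
  define K where "K = real (3 * card {x \<in> int_lattice :: (real^3) set. \<forall>i. \<bar>x $ i\<bar> \<le> 8 + 56 * C}) * (24 * (4 * C)\<^sup>2)"
  have "(\<lambda>n. rate 0 n * K) \<longlonglongrightarrow> 0"
    using tendsto_mult_right[OF rate_tendsto_0, of 0 K] by simp
  then have "eventually (\<lambda>n. rate 0 n * K < e) sequentially"
    by (rule order_tendstoD) (rule assms)
  then obtain N where N: "\<And>n. n \<ge> N \<Longrightarrow> rate 0 n * K < e" by (auto simp: eventually_sequentially)
  obtain n where n: "n \<ge> N" "occurs \<sigma> n" "(\<Sum>k. rate n k) \<le> C" using C by blast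
  note fin = card_impure(1)[OF n(2,3), of p]
  define D where "D = card {x \<in> int_lattice :: (real^3) set. \<forall>i. \<bar>x $ i\<bar> \<le> 8 + 56 * C}"
  define b where "b = card (boundary (height n) (\<lambda>q. ancestor n q = p) 2 3 \<union>
      boundary (height n) (\<lambda>q. ancestor n q = p) 1 3 \<union> boundary (height n) (\<lambda>q. ancestor n q = p) 1 2)"
  have T: "0 < total (eig 0)" "0 < total (eig n)" by (rule total_eig_pos)+
  have "measure lebesgue (\<Union>(tile n ` impure n p)) \<le> (\<Sum>q\<in>impure n p. measure lebesgue (tile n q))"
    by (rule measure_UNION_le[OF fin]) (simp add: fmeasurableD)
  also have "\<dots> \<le> (\<Sum>q\<in>impure n p. total (eig n) / total (eig 0) * (4 * C)\<^sup>2)"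
    unfolding measure_tile using T by (intro sum_mono mult_left_mono measure_piece_le n(3)) auto
  also have "\<dots> = real (card (impure n p)) * (total (eig n) / total (eig 0) * (4 * C)\<^sup>2)" by simp
  also have "\<dots> \<le> real (b * (3 * D)) * (total (eig n) / total (eig 0) * (4 * C)\<^sup>2)"
    using card_impure(2)[OF n(2,3), of p] T unfolding b_def D_def
    by (intro mult_right_mono) (auto simp del: of_nat_mult)
  also have "\<dots> = real (3 * D) * (4 * C)\<^sup>2 / total (eig 0) * (real b * total (eig n))" by simp
  also have "\<dots> \<le> real (3 * D) * (4 * C)\<^sup>2 / total (eig 0) * (24 * rate 0 n * total (eig 0))"
    using boundary_total(2)[OF n(2), of p] T unfolding b_def by (intro mult_left_mono) auto
  also have "\<dots> = rate 0 n * K" using T by (simp add: K_def D_def)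
  also have "\<dots> < e" by (rule N[OF n(1)])
  finally have "measure lebesgue (\<Union>(tile n ` impure n p)) < e" .
  moreover have "\<Union>(tile n ` impure n p) \<in> lmeasurable"
    using fin by (intro fmeasurable.finite_UN) auto
  ultimately show thesis using that fin by blast
qed

lemma tile_0_overlap_impure:
  assumes p: "p \<in> surface (height 0)" "p' \<in> surface (height 0)" "p \<noteq> p'"
    and "\<xi> \<in> tile 0 p" "\<xi> \<in> tile 0 p'"
  shows "\<xi> \<in> \<Union>(tile n ` impure n p)"
proof -
  obtain q where q: "q \<in> surface (height n)" "ancestor n q = p" "\<xi> \<in> tile n q"
    using assms(4) tile_ancestor[OF p(1), of n] by auto
  obtain q' where q': "q' \<in> surface (height n)" "ancestor n q' = p'" "\<xi> \<in> tile n q'"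
    using assms(5) tile_ancestor[OF p(2), of n] by auto
  have "q \<in> impure n p" using q q' p(3) by (auto simp: impure_def intro!: bexI[of _ q'])
  then show ?thesis using q(3) by blast
qed

lemma negligible_overlap:
  assumes p: "p \<in> surface (height 0)" "p' \<in> surface (height 0)" "p \<noteq> p'"
  shows "negligible (tile 0 p \<inter> tile 0 p')"
  unfolding negligible_outer_le
proof (intro allI impI)
  fix e :: real assume "e > 0"
  then obtain n where "\<Union>(tile n ` impure n p) \<in> lmeasurable"
    "measure lebesgue (\<Union>(tile n ` impure n p)) < e" by (rule impure_small)
  moreover have "tile 0 p \<inter> tile 0 p' \<subseteq> \<Union>(tile n ` impure n p)"
    using tile_0_overlap_impure[OF p] by blast
  ultimately show "\<exists>T. tile 0 p \<inter> tile 0 p' \<subseteq> T \<and> T \<in> lmeasurable \<and> measure lebesgue T \<le> e"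
    by (meson less_imp_le)
qed

text \<open>If one piece is null, so are the pieces of the next level for all letters whose image
  contains its letter. A block spreads this to every letter; then all tiles of one level are null,
  although countably many of them cover the plane.\<close>

lemma not_negligible_piece: "\<not> negligible (piece n i)"
proof
  assume neg: "negligible (piece n i)"
  define N where "N = (\<lambda>m. {i. negligible (piece m i)})"
  have next_level: "{j. i \<in> set ((\<sigma> !! m) j)} \<subseteq> N (Suc m)" if "i \<in> N m" for m i
  proof safe
    fix j assume "i \<in> set ((\<sigma> !! m) j)"
    then obtain q t where "(\<sigma> !! m) j = q @ i # t" by (meson split_list)
    then have "(+) (coord m (abelianization q)) ` ren m (Suc 0) ` piece (Suc m) j \<subseteq> piece m i"
      unfolding piece_Suc[of m i] by auto
    then have "negligible ((+) (coord m (abelianization q)) ` ren m (Suc 0) ` piece (Suc m) j)"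
      using that negligible_subset by (auto simp: N_def)
    then have "negligible (ren m (Suc 0) ` piece (Suc m) j)" by (rule negligible_translation_rev)
    then have "measure lebesgue (ren m (Suc 0) ` piece (Suc m) j) = 0" by (rule negligible_imp_measure0)
    then have "measure lebesgue (piece (Suc m) j) = 0"
      using measure_ren(2)[of "piece (Suc m) j" m "Suc 0"] total_eig_pos[of m] total_eig_pos[of "Suc m"] by simp
    then show "j \<in> N (Suc m)" by (simp add: N_def negligible_iff_measure)
  qed
  have ne: "N m \<noteq> {}" if "m \<ge> n" for m
    using that
  proof (induction m rule: dec_induct)
    case base
    show ?case using neg by (auto simp: N_def)
  next
    case (step m)
    then obtain i where i: "i \<in> N m" by blast
    obtain j w where "(\<sigma> !! m) j = i # w" using brun_first_letter[OF brun] by blast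
    then have "j \<in> N (Suc m)" using next_level[OF i] by auto
    then show ?case by blast
  qed
  obtain m where m: "m \<ge> n" "occurs \<sigma> m" using infinitely_occurs by blast
  \<comment> \<open>Under \<open>brun3\<close>, nullity passes from 1 to 2, from 2 to 3, and from 3
    to both 1 and 3. Five steps therefore reach all letters from any one.\<close>
  have b3: "1 \<in> N (m + k) \<Longrightarrow> 2 \<in> N (Suc (m + k))" "2 \<in> N (m + k) \<Longrightarrow> 3 \<in> N (Suc (m + k))"
    "3 \<in> N (m + k) \<Longrightarrow> 1 \<in> N (Suc (m + k)) \<and> 3 \<in> N (Suc (m + k))" if "k < 5" for k
  proof -
    have s: "\<sigma> !! (m + k) = brun3" using m(2) that unfolding occurs_def by blast
    have "1 \<in> set (brun3 2)" "2 \<in> set (brun3 3)" "3 \<in> set (brun3 1)" "3 \<in> set (brun3 3)"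
      by (simp_all add: brun3_def)
    then show "1 \<in> N (m + k) \<Longrightarrow> 2 \<in> N (Suc (m + k))" "2 \<in> N (m + k) \<Longrightarrow> 3 \<in> N (Suc (m + k))"
      "3 \<in> N (m + k) \<Longrightarrow> 1 \<in> N (Suc (m + k)) \<and> 3 \<in> N (Suc (m + k))"
      using next_level[of _ "m + k"] unfolding s by blast+
  qed
  have "1 \<in> N (m + 0) \<or> 2 \<in> N (m + 0) \<or> 3 \<in> N (m + 0)"
    using ne[OF m(1)] exhaust_3 by auto (metis exhaust_3)
  then have all: "1 \<in> N (m + 5) \<and> 2 \<in> N (m + 5) \<and> 3 \<in> N (m + 5)"
    using b3[of 0] b3[of 1] b3[of 2] b3[of 3] b3[of 4] by (auto simp: eval_nat_numeral)
  have "negligible (tile (m + 5) q)" for q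
  proof -
    have "snd q \<in> N (m + 5)" using all exhaust_3[of "snd q"] by auto
    then show ?thesis
      by (simp add: N_def negligible_iff_measure measure_tile)
  qed
  then have "negligible (\<Union>(tile (m + 5) ` surface (height (m + 5))))"
    by (intro negligible_countable_Union countable_image countable_surface) auto
  moreover have "\<Union>(tile (m + 5) ` surface (height (m + 5))) = UNIV"
    using tiles_cover[of "m + 5"] by blast
  ultimately show False by simp
qed

lemma dist_tile:
  assumes "\<xi> \<in> tile n q" "\<zeta> \<in> tile n q"
  shows "dist \<xi> \<zeta> \<le> 4 * (\<Sum>l. rate 0 (l + n))"
proof -
  obtain x y where "x \<in> piece n (snd q)" "y \<in> piece n (snd q)"
    "\<xi> = coord 0 (prod_mat 0 n *v fst q) + ren 0 n x" "\<zeta> = coord 0 (prod_mat 0 n *v fst q) + ren 0 n y"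
    using assms by (auto simp: tile_def)
  then show ?thesis
    using norm_ren_piece[of x 0 n "snd q"] norm_ren_piece[of y 0 n "snd q"]
      norm_triangle_ineq4[of "ren 0 n x" "ren 0 n y"] by (simp add: dist_norm)
qed

text \<open>For each of the three letters this is a set of integer points plus a compact
  set.\<close>

lemma closed_Union_tile_0:
  assumes "P \<subseteq> surface (height 0)"
  shows "closed (\<Union>(tile 0 ` P))"
proof -
  have eq: "\<Union>(tile 0 ` P) = (\<Union>j. \<Union>x\<in>{coord 0 x | x. (x, j) \<in> P}. \<Union>y\<in>piece 0 j. {x + y})"
    by (auto simp: tile_def) blast
  have "{coord 0 x | x. (x, j) \<in> P} \<subseteq> int_lattice" for j
  proof safe
    fix x assume "(x, j) \<in> P"
    then have "x \<in> int_lattice" "total x = 0"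
      using assms unfolding height_0 by (auto simp: surface_vec_1[simplified] subset_eq)
    then show "coord 0 x \<in> int_lattice" by (simp add: int_lattice_def forall_2)
  qed
  then have "closed (\<Union>x\<in>{coord 0 x | x. (x, j) \<in> P}. \<Union>y\<in>piece 0 j. {x + y})" for j
    by (intro closed_compact_sums closed_subset_int_lattice compact_piece)
  then show ?thesis unfolding eq by (intro closed_UN) auto
qed

text \<open>Near a given point there is a small subtile of positive measure, and at a late level the
  impure part is smaller still. So the subtile contains a point in no other tile of level 0. The
  union of these others is closed and its complement lies in the tile, hence the point is
  interior.\<close>

lemma tile_0_closure_interior:
  assumes p: "p \<in> surface (height 0)"
  shows "closure (interior (tile 0 p)) = tile 0 p"
proof
  show "closure (interior (tile 0 p)) \<subseteq> tile 0 p"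
    by (simp add: closure_minimal interior_subset compact_imp_closed compact_tile)
  show "tile 0 p \<subseteq> closure (interior (tile 0 p))"
  proof
    fix \<zeta> assume \<zeta>: "\<zeta> \<in> tile 0 p"
    show "\<zeta> \<in> closure (interior (tile 0 p))"
      unfolding closure_approachable
    proof (intro allI impI)
      fix e :: real assume e: "e > 0"
      have "(\<lambda>n. \<Sum>l. rate 0 (l + n)) \<longlonglongrightarrow> 0"
        by (rule suminf_exist_split2[OF summable_rate])
      then have "eventually (\<lambda>n. (\<Sum>l. rate 0 (l + n)) < e / 4) sequentially"
        by (rule order_tendstoD) (use e in simp)
      then obtain n where n: "(\<Sum>l. rate 0 (l + n)) < e / 4" by (auto simp: eventually_sequentially)
      obtain q where q: "q \<in> surface (height n)" "ancestor n q = p" "\<zeta> \<in> tile n q"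
        using \<zeta> tile_ancestor[OF p, of n] by auto
      have "0 < measure lebesgue (piece n (snd q))"
        using not_negligible_piece[of n "snd q"] by (simp add: negligible_iff_measure zero_less_measure_iff)
      then have "0 < measure lebesgue (tile n q)"
        unfolding measure_tile using total_eig_pos by simp
      then obtain N where N: "\<Union>(tile N ` impure N p) \<in> lmeasurable"
        "measure lebesgue (\<Union>(tile N ` impure N p)) < measure lebesgue (tile n q)" by (rule impure_small)
      have "\<not> tile n q \<subseteq> \<Union>(tile N ` impure N p)"
      proof
        assume "tile n q \<subseteq> \<Union>(tile N ` impure N p)"
        from measure_mono_fmeasurable[OF this fmeasurableD[OF lmeasurable_tile] N(1)] N(2)
        show False by simp
      qed
      then obtain \<eta> where \<eta>: "\<eta> \<in> tile n q" "\<eta> \<notin> \<Union>(tile N ` impure N p)" by blast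
      define F where "F = \<Union>(tile 0 ` (surface (height 0) - {p}))"
      have "closed F" unfolding F_def by (rule closed_Union_tile_0) auto
      have "\<eta> \<in> tile 0 p" using \<eta>(1) q unfolding tile_ancestor[OF p, of n] by blast
      then have "\<eta> \<notin> F"
        using \<eta>(2) tile_0_overlap_impure[OF p] unfolding F_def by blast
      moreover have "- F \<subseteq> tile 0 p" using tiles_cover[of 0] unfolding F_def by blast
      ultimately have "\<eta> \<in> interior (tile 0 p)"
        using \<open>closed F\<close> by (intro interiorI[of "- F"]) auto
      moreover have "dist \<eta> \<zeta> < e" using dist_tile[OF \<eta>(1) q(3)] n by linarith
      ultimately show "\<exists>y\<in>interior (tile 0 p). dist y \<zeta> < e" by blast
    qed
  qed
qed

end

section \<open>The tiling and the natural partition\<close>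

lemma inj_lift: "inj lift"
proof (rule injI)
  fix x y assume "lift x = lift y"
  from arg_cong[OF this, of "\<lambda>v. v $ 1"] arg_cong[OF this, of "\<lambda>v. v $ 2"]
  show "x = y" by (simp add: vec_eq_iff forall_2)
qed

lemma int_lattice_uminus [simp]: "- x \<in> int_lattice \<longleftrightarrow> x \<in> int_lattice"
  by (simp add: int_lattice_def)

lemma zero_int_lattice [simp]: "0 \<in> int_lattice"
  by (simp add: int_lattice_def)

lemma full_rank_int_lattice: "full_rank_lattice (int_lattice :: (real^2) set)"
proof -
  have B: "(Basis :: (real^2) set) = {axis 1 1, axis 2 1}"
    by (auto simp: Basis_vec_def UNIV_2)
  have ne: "(axis 1 1 :: real^2) \<noteq> axis 2 1" by (simp add: axis_eq_axis)
  have "(int_lattice :: (real^2) set) = {\<Sum>b\<in>Basis. of_int (c b) *\<^sub>R b | c. True}"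
  proof (intro set_eqI iffI)
    fix x :: "real^2" assume "x \<in> int_lattice"
    then have "x $ 1 \<in> \<int>" "x $ 2 \<in> \<int>" by (auto simp: int_lattice_def)
    then obtain a b where ab: "x $ 1 = of_int a" "x $ 2 = of_int b" by (auto elim!: Ints_cases)
    define c where "c = (\<lambda>v :: real^2. if v = axis 1 1 then a else b)"
    have "x = (\<Sum>b\<in>Basis. of_int (c b) *\<^sub>R b)"
      unfolding B using ne by (simp add: c_def vec_eq_iff forall_2 ab axis_def)
    then show "x \<in> {\<Sum>b\<in>Basis. of_int (c b) *\<^sub>R b | c. True}" by blast
  next
    fix x :: "real^2" assume "x \<in> {\<Sum>b\<in>Basis. of_int (c b) *\<^sub>R b | c. True}"
    then obtain c where "x = (\<Sum>b\<in>Basis. of_int (c b) *\<^sub>R b)" by blast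
    then show "x \<in> int_lattice"
      unfolding B using ne by (auto simp: int_lattice_def forall_2 axis_def)
  qed
  then show ?thesis
    unfolding full_rank_lattice_def
    by (intro exI[of _ "Basis :: (real^2) set"] conjI independent_Basis span_Basis)
qed

lemma perp_vec_1: "perp (vec 1) = {x :: real^3. total x = 0}" "perp 1 = {x :: real^3. total x = 0}"
  by (auto simp: perp_def total_eq_inner)

lemma lift_perp: "lift \<xi> \<in> perp (vec 1)" "lift \<xi> \<in> perp 1"
  by (simp_all add: perp_vec_1)

lemma AE_lborel_negligible:
  assumes "negligible N" "N \<in> sets borel" "\<And>x. x \<notin> N \<Longrightarrow> P x"
  shows "AE x in lborel. P x"
proof (rule AE_I'[of N])
  show "N \<in> null_sets lborel"
    using assms by (auto simp: negligible_iff_null_sets null_sets_completion_iff)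
qed (use assms(3) in auto)

lemma continuous_on_vector_2:
  fixes f g :: "'a::topological_space \<Rightarrow> real"
  assumes "continuous_on S f" "continuous_on S g"
  shows "continuous_on S (\<lambda>x. vector [f x, g x] :: real^2)"
proof -
  have "(vector [a, b] :: real^2) = (\<chi> i. if i = 1 then a else b)" for a b :: real
    by (simp add: vec_eq_iff forall_2)
  then show ?thesis
  proof (simp only:, intro continuous_on_vec_lambda)
    show "continuous_on S (\<lambda>x. if i = 1 then f x else g x)" for i :: 2
      using assms by (cases "i = 1") auto
  qed
qed

text \<open>In the slab, the points projecting to the lift of \<open>N\<close> lie in the linear
  image of \<open>N\<close> times the real line, which is null by Fubini. This transports statements
  from plane coordinates to \<open>perp_lborel\<close>.\<close>

lemma AE_perp_lborel:
  assumes N: "negligible N" "N \<in> sets borel" and P: "\<And>\<xi>. \<xi> \<notin> N \<Longrightarrow> P (lift \<xi>)"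
  shows "AE x in perp_lborel (vec 1 :: real^3). P x"
proof -
  let ?\<pi> = "proj_along (vec 1 :: real^3) (vec 1)"
  let ?S = "{x :: real^3. 0 \<le> x \<bullet> vec 1 \<and> x \<bullet> vec 1 \<le> norm (vec 1 :: real^3)}"
  define g where "g = (\<lambda>x :: real^3. vector [x$1 - total x / 3, x$2 - total x / 3] :: real^2)"
  have proj: "?\<pi> x = lift (g x)" for x
  proof -
    have "(vec 1 :: real^3) \<bullet> vec 1 = 3" by (simp add: inner_3)
    then have "?\<pi> x = x - (total x / 3) *\<^sub>R vec 1" by (simp add: proj_along_def total_eq_inner)
    then show ?thesis by (simp add: g_def vec_eq_iff forall_3) (simp add: total_def field_simps)
  qed
  have g: "continuous_on UNIV g"
    unfolding g_def total_def by (intro continuous_on_vector_2 continuous_intros) auto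
  define h where "h = (\<lambda>(\<xi>, s). lift \<xi> + s *\<^sub>R (vec 1 :: real^3))"
  have hlin: "linear h"
    by (rule linearI) (auto simp: h_def linear_add[OF linear_lift] linear_scale[OF linear_lift] algebra_simps)
  have "N \<in> null_sets lborel"
    using N by (auto simp: negligible_iff_null_sets null_sets_completion_iff)
  then have "N \<times> (UNIV :: real set) \<in> null_sets (lborel \<Otimes>\<^sub>M lborel)"
    by (intro lborel.times_in_null_sets1) auto
  then have "N \<times> (UNIV :: real set) \<in> null_sets lborel" by (simp only: lborel_prod)
  then have "negligible (N \<times> (UNIV :: real set))"
    by (simp add: negligible_iff_null_sets null_sets_completionI)
  then have "negligible (h ` (N \<times> UNIV))"
    by (rule negligible_differentiable_image_negligible[rotated])
       (use hlin in \<open>auto intro: linear_imp_differentiable_on\<close>)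
  moreover have "{x. g x \<in> N} \<subseteq> h ` (N \<times> UNIV)"
  proof safe
    fix x assume "g x \<in> N"
    moreover have "x = h (g x, total x / 3)"
      by (simp add: h_def g_def vec_eq_iff forall_3) (simp add: total_def field_simps)
    ultimately show "x \<in> h ` (N \<times> UNIV)" by blast
  qed
  ultimately have neg: "negligible {x. g x \<in> N}" by (rule negligible_subset)
  have gm: "g \<in> borel_measurable borel" by (rule borel_measurable_continuous_onI[OF g])
  have "g -` N \<inter> space borel \<in> sets borel" using gm N(2) by (rule measurable_sets)
  then have meas: "{x. g x \<in> N} \<in> sets borel" by (simp add: vimage_def)
  then have null: "{x. g x \<in> N} \<in> null_sets lborel"
    using neg by (auto simp: negligible_iff_null_sets null_sets_completion_iff)
  have S: "?S \<in> sets borel"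
    by (intro borel_closed closed_Collect_conj closed_Collect_le continuous_intros)
  have "continuous_on UNIV (\<lambda>x. lift (g x))"
    by (rule linear_continuous_on_compose[OF g linear_lift])
  then have "(\<lambda>x. lift (g x)) \<in> borel_measurable borel" by (rule borel_measurable_continuous_onI)
  then have \<pi>: "?\<pi> \<in> borel_measurable borel" unfolding proj[abs_def] .
  have \<pi>m: "?\<pi> \<in> measurable (restrict_space lborel ?S) (restrict_space borel (perp (vec 1)))"
    using \<pi> by (intro measurable_restrict_space2 measurable_restrict_space1) (auto simp: proj[simplified] lift_perp)
  define c where "c = (\<lambda>x :: real^3. vector [x$1, x$2] :: real^2)"
  have c: "c (lift \<xi>) = \<xi>" "x \<in> perp (vec 1) \<Longrightarrow> lift (c x) = x" for \<xi> x
    by (auto simp: c_def vec_eq_iff forall_3 forall_2 perp_vec_1 total_def)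
  define Z where "Z = perp (vec 1) \<inter> c -` N"
  have "c \<in> borel_measurable borel"
    unfolding c_def by (intro borel_measurable_continuous_onI continuous_on_vector_2 continuous_intros)
  then have "c -` N \<in> sets borel" using N(2) by (auto dest: measurable_sets)
  then have Z: "Z \<in> sets (restrict_space borel (perp (vec 1)))"
    unfolding Z_def sets_restrict_space by auto
  have "emeasure (perp_lborel (vec 1)) Z =
      emeasure (restrict_space lborel ?S) (?\<pi> -` Z \<inter> space (restrict_space lborel ?S))"
    unfolding perp_lborel_def by (rule emeasure_distr[OF \<pi>m Z])
  also have "\<dots> = emeasure lborel (?\<pi> -` Z \<inter> space (restrict_space lborel ?S))"
    using S by (intro emeasure_restrict_space) (auto simp: space_restrict_space)
  also have "\<dots> \<le> emeasure lborel {x. g x \<in> N}"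
    using meas by (intro emeasure_mono) (auto simp: Z_def proj[simplified] c)
  also have "\<dots> = 0" using null by auto
  finally have "Z \<in> null_sets (perp_lborel (vec 1))"
    using Z by (simp add: null_sets_def perp_lborel_def)
  then show ?thesis
  proof (rule AE_I', safe)
    fix x assume x: "x \<in> space (perp_lborel (vec 1))" "\<not> P x"
    then have "x \<in> perp (vec 1)" by (simp add: perp_lborel_def space_restrict_space)
    then show "x \<in> Z" using P[of "c x"] x(2) c(2)[of x] by (auto simp: Z_def)
  qed
qed

context brun_generic
begin

definition simple_point :: "real^2 \<Rightarrow> bool" where
  "simple_point \<xi> \<longleftrightarrow> (\<forall>l\<in>int_lattice. \<forall>l'\<in>int_lattice. \<forall>i i'.
     \<xi> - l \<in> piece 0 i \<longrightarrow> \<xi> - l' \<in> piece 0 i' \<longrightarrow> l = l' \<and> i = i')"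

lemma tile_0_lift: "\<xi> \<in> tile 0 (lift l, i) \<longleftrightarrow> \<xi> - l \<in> piece 0 i"
  unfolding tile_0 by (auto intro: image_eqI[of _ _ "\<xi> - l"])

lemma lift_in_surface: "(lift l, i) \<in> surface (height 0) \<longleftrightarrow> l \<in> int_lattice"
  unfolding height_0 surface_vec_1 by (simp add: lift_int_lattice_iff)

text \<open>The points that are not simple form the countable union of the overlaps of different
  tiles of level 0, whose faces correspond to pairs of a lattice point and a letter.\<close>

lemma negligible_not_simple: "negligible {\<xi>. \<not> simple_point \<xi>}"
  and borel_not_simple: "{\<xi>. \<not> simple_point \<xi>} \<in> sets borel"
proof -
  let ?I = "{(p, p'). p \<in> surface (height 0) \<and> p' \<in> surface (height 0) \<and> p \<noteq> p'}"
  have eq: "{\<xi>. \<not> simple_point \<xi>} = (\<Union>(p, p')\<in>?I. tile 0 p \<inter> tile 0 p')"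
  proof (intro set_eqI iffI)
    fix \<xi> assume "\<xi> \<in> {\<xi>. \<not> simple_point \<xi>}"
    then obtain l l' i i' where l: "l \<in> int_lattice" "l' \<in> int_lattice" "\<xi> - l \<in> piece 0 i"
      "\<xi> - l' \<in> piece 0 i'" "\<not> (l = l' \<and> i = i')" unfolding simple_point_def by blast
    have "(lift l, i) \<noteq> (lift l', i')" using l(5) inj_lift by (auto dest: injD)
    then have "((lift l, i), (lift l', i')) \<in> ?I" using l by (simp add: lift_in_surface del: height_0)
    moreover have "\<xi> \<in> tile 0 (lift l, i) \<inter> tile 0 (lift l', i')" using l by (simp add: tile_0_lift)
    ultimately show "\<xi> \<in> (\<Union>(p, p')\<in>?I. tile 0 p \<inter> tile 0 p')" by blast
  next
    fix \<xi> assume "\<xi> \<in> (\<Union>(p, p')\<in>?I. tile 0 p \<inter> tile 0 p')"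
    then obtain x i x' i' where *: "(x, i) \<in> surface (height 0)" "(x', i') \<in> surface (height 0)"
      "(x, i) \<noteq> (x', i')" "\<xi> \<in> tile 0 (x, i)" "\<xi> \<in> tile 0 (x', i')" by auto
    have x: "x = lift (coord 0 x)" "x' = lift (coord 0 x')"
      using *(1,2) unfolding height_0 surface_vec_1 by (simp_all add: coord_total_0)
    have l: "coord 0 x \<in> int_lattice" "coord 0 x' \<in> int_lattice"
      using *(1,2) x lift_in_surface by metis+
    have "\<xi> - coord 0 x \<in> piece 0 i" "\<xi> - coord 0 x' \<in> piece 0 i'"
      using *(4,5) x tile_0_lift by metis+
    moreover have "\<not> (coord 0 x = coord 0 x' \<and> i = i')" using *(3) x by metis
    ultimately show "\<xi> \<in> {\<xi>. \<not> simple_point \<xi>}" using l unfolding simple_point_def by blast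
  qed
  have cI: "countable ?I"
    by (rule countable_subset[of _ "surface (height 0) \<times> surface (height 0)"])
       (auto intro: countable_surface)
  show "negligible {\<xi>. \<not> simple_point \<xi>}"
    unfolding eq using cI by (intro negligible_countable_Union countable_image) (auto intro: negligible_overlap)
  have "closed (tile 0 p \<inter> tile 0 p')" for p p'
    by (intro closed_Int compact_imp_closed compact_tile)
  then show "{\<xi>. \<not> simple_point \<xi>} \<in> sets borel"
    unfolding eq using cI by (intro sets.countable_UN') (auto intro: borel_closed)
qed

lemma simple_point_translate:
  assumes "l \<in> int_lattice"
  shows "simple_point (\<xi> + l) \<longleftrightarrow> simple_point \<xi>"
proof -
  have "simple_point (\<xi> + l)" if "simple_point \<xi>" "l \<in> int_lattice" for \<xi> l
    unfolding simple_point_def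
  proof (intro ballI allI impI)
    fix l1 l2 i i' assume a: "l1 \<in> int_lattice" "l2 \<in> int_lattice" "\<xi> + l - l1 \<in> piece 0 i" "\<xi> + l - l2 \<in> piece 0 i'"
    have "l1 - l \<in> int_lattice" "l2 - l \<in> int_lattice"
      using int_lattice_diff[OF a(1) that(2)] int_lattice_diff[OF a(2) that(2)] by auto
    moreover have "\<xi> - (l1 - l) \<in> piece 0 i" "\<xi> - (l2 - l) \<in> piece 0 i'"
      using a(3,4) by (simp_all add: algebra_simps)
    ultimately have "l1 - l = l2 - l \<and> i = i'" using that(1) unfolding simple_point_def by blast
    then show "l1 = l2 \<and> i = i'" by simp
  qed
  from this[of \<xi> l] this[of "\<xi> + l" "- l"] show ?thesis using assms by auto
qed

lemma piece_closure_interior: "closure (interior (piece 0 i)) = piece 0 i"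
proof -
  have "tile 0 (0, i) = piece 0 i" by (simp add: tile_0)
  moreover have "(0, i) \<in> surface (height 0)" unfolding height_0 surface_vec_1 by (simp add: total_def)
  ultimately show ?thesis using tile_0_closure_interior by metis
qed

lemma rauzy_subtile_eq: "rauzy_subtile \<sigma> (eig 0) i = lift ` piece 0 i"
proof -
  have proj: "proj_along (eig 0) (vec 1) x = lift (coord 0 x)" for x
    by (simp only: proj_along_def lift_coord total_eq_inner)
  have "{proj_along (eig 0) (vec 1) (abelianization p) | p.
      \<exists>\<omega>. limit_word \<sigma> \<omega> \<and> stake (length (p @ [i])) \<omega> = p @ [i]} = lift ` coord 0 ` prefix_points 0 i"
    unfolding proj prefix_points_def stream_prefix_def by auto
  then show ?thesis
    unfolding rauzy_subtile_def piece_def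
    by (simp add: closure_injective_linear_image[OF linear_lift inj_lift])
qed

lemma rauzy_collection_eq:
  "rauzy_collection \<sigma> (eig 0) = {lift ` (+) l ` piece 0 i | l i. l \<in> int_lattice}"
proof -
  have eq: "(+) (lift l) ` lift ` S = lift ` (+) l ` S" for l S
    by (auto simp: image_image linear_add[OF linear_lift])
  show ?thesis
    unfolding rauzy_collection_def rauzy_subtile_eq
  proof (intro set_eqI iffI)
    fix K assume "K \<in> {(+) x ` lift ` piece 0 i | x i. x \<in> int_lattice \<inter> perp (vec 1)}"
    then obtain x i where x: "K = (+) x ` lift ` piece 0 i" "x \<in> int_lattice" "total x = 0"
      by (auto simp: perp_vec_1)
    then have "x = lift (coord 0 x)" by (simp add: coord_total_0)
    moreover from this x(2) have "coord 0 x \<in> int_lattice" by (metis lift_int_lattice_iff)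
    moreover have "K = lift ` (+) (coord 0 x) ` piece 0 i"
      unfolding eq[symmetric] using x(1) calculation(1) by metis
    ultimately show "K \<in> {lift ` (+) l ` piece 0 i | l i. l \<in> int_lattice}" by blast
  next
    fix K assume "K \<in> {lift ` (+) l ` piece 0 i | l i. l \<in> int_lattice}"
    then obtain l i where "K = (+) (lift l) ` lift ` piece 0 i" "l \<in> int_lattice" using eq by auto
    moreover from this have "lift l \<in> int_lattice \<inter> perp (vec 1)"
      using lift_perp(1)[of l] by (simp only: lift_int_lattice_iff Int_iff)
    ultimately show "K \<in> {(+) x ` lift ` piece 0 i | x i. x \<in> int_lattice \<inter> perp (vec 1)}" by blast
  qed
qed

lemma lift_closure_interior:
  assumes "compact K" "closure (interior K) = K"
  shows "compact (lift ` K)" "lift ` K \<subseteq> perp (vec 1)"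
    "(top_of_set (perp (vec 1))) closure_of ((top_of_set (perp (vec 1))) interior_of (lift ` K)) = lift ` K"
proof -
  let ?T = "top_of_set (perp (vec 1 :: real^3))"
  show c: "compact (lift ` K)"
    by (intro compact_continuous_image linear_continuous_on linear_conv_bounded_linear[THEN iffD1] linear_lift assms)
  show p: "lift ` K \<subseteq> perp (vec 1)" using lift_perp by blast
  define c where "c = (\<lambda>x :: real^3. vector [x$1, x$2] :: real^2)"
  have cl: "c (lift \<xi>) = \<xi>" "x \<in> perp (vec 1) \<Longrightarrow> lift (c x) = x" for \<xi> x
    by (auto simp: c_def vec_eq_iff forall_3 forall_2 perp_vec_1 total_def)
  have cont: "continuous_on UNIV c"
    unfolding c_def by (intro continuous_on_vector_2 continuous_intros)
  have "lift ` interior K = perp (vec 1) \<inter> c -` interior K"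
  proof (intro set_eqI iffI)
    fix x assume "x \<in> perp (vec 1) \<inter> c -` interior K"
    then show "x \<in> lift ` interior K" using cl(2)[of x] by (metis IntE image_eqI vimageE)
  qed (use cl lift_perp in auto)
  moreover have "open (c -` interior K)" using cont by (simp add: open_vimage)
  ultimately have "openin ?T (lift ` interior K)" by (auto simp: openin_open)
  then have int: "lift ` interior K \<subseteq> ?T interior_of (lift ` K)"
    by (intro interior_of_maximal image_mono interior_subset)
  have "?T closure_of (?T interior_of (lift ` K)) \<subseteq> lift ` K"
  proof (rule closure_of_minimal[OF interior_of_subset])
    show "closedin ?T (lift ` K)"
      using compact_imp_closed[OF c] p closed_subset by blast
  qed
  moreover have "lift ` K \<subseteq> ?T closure_of (?T interior_of (lift ` K))"
  proof -
    have "lift ` K = closure (lift ` interior K)"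
      using assms(2) closure_injective_linear_image[OF linear_lift inj_lift, of "interior K"] by simp
    also have "\<dots> \<subseteq> closure (?T interior_of (lift ` K))" by (rule closure_mono[OF int])
    finally have "lift ` K \<subseteq> closure (?T interior_of (lift ` K))" .
    moreover have "?T interior_of (lift ` K) \<subseteq> perp (vec 1)" by (rule subset_trans[OF interior_of_subset p])
    ultimately show ?thesis using p by (auto simp: closure_of_subtopology Int_absorb1)
  qed
  ultimately show "?T closure_of (?T interior_of (lift ` K)) = lift ` K" by blast
qed

theorem tiling: "tiling_of_perp (vec 1) (rauzy_collection \<sigma> (eig 0))"
  unfolding tiling_of_perp_def
proof (intro conjI ballI)
  fix K assume "K \<in> rauzy_collection \<sigma> (eig 0)"
  then obtain l i where K: "K = lift ` (+) l ` piece 0 i" by (auto simp: rauzy_collection_eq)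
  have "compact ((+) l ` piece 0 i)" "closure (interior ((+) l ` piece 0 i)) = (+) l ` piece 0 i"
    by (simp_all add: compact_translation compact_piece interior_translation closure_translation piece_closure_interior)
  then show "compact K" "K \<subseteq> perp (vec 1)"
    "(top_of_set (perp (vec 1))) closure_of ((top_of_set (perp (vec 1))) interior_of K) = K"
    unfolding K by (rule lift_closure_interior)+
next
  show "AE x in perp_lborel (vec 1). \<exists>!K. K \<in> rauzy_collection \<sigma> (eig 0) \<and> x \<in> K"
  proof (rule AE_perp_lborel[OF negligible_not_simple borel_not_simple])
    fix \<xi> assume "\<xi> \<notin> {\<xi>. \<not> simple_point \<xi>}"
    then have s: "simple_point \<xi>" by simp
    have mem: "lift \<xi> \<in> lift ` (+) l ` piece 0 i \<longleftrightarrow> \<xi> - l \<in> piece 0 i" for l i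
      by (auto simp: inj_image_mem_iff[OF inj_lift] intro: image_eqI[of _ _ "\<xi> - l"])
    obtain l i where l: "l \<in> int_lattice" "\<xi> - l \<in> piece 0 i" using pieces_cover by blast
    show "\<exists>!K. K \<in> rauzy_collection \<sigma> (eig 0) \<and> lift \<xi> \<in> K"
    proof (rule ex1I[of _ "lift ` (+) l ` piece 0 i"])
      show "lift ` (+) l ` piece 0 i \<in> rauzy_collection \<sigma> (eig 0) \<and> lift \<xi> \<in> lift ` (+) l ` piece 0 i"
        using l mem unfolding rauzy_collection_eq by blast
    next
      fix K assume K: "K \<in> rauzy_collection \<sigma> (eig 0) \<and> lift \<xi> \<in> K"
      then obtain l' i' where l': "K = lift ` (+) l' ` piece 0 i'" "l' \<in> int_lattice"
        by (auto simp: rauzy_collection_eq)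
      then have "\<xi> - l' \<in> piece 0 i'" using K mem by simp
      then have "l = l' \<and> i = i'" using s l l'(2) unfolding simple_point_def by blast
      then show "K = lift ` (+) l ` piece 0 i" using l'(1) by simp
    qed
  qed
qed

section \<open>The exchange of pieces\<close>

definition step :: "3 \<Rightarrow> real^2" where
  "step i = coord 0 (axis i 1)"

lemma step_rotation: "step i - rotation \<in> int_lattice"
proof -
  have "total (axis i 1 :: real^3) = 1" using exhaust_3[of i] by (auto simp: total_def axis_def)
  then show ?thesis using coord_rotation[of "axis i 1"] by (simp add: step_def)
qed

text \<open>A prefix \<open>p @ [i]\<close> of a limit word is followed by some letter
  \<open>j\<close>, so prefix points of \<open>i\<close> move by \<open>step i\<close> to prefix
  points of \<open>j\<close>. The inclusion passes to closures.\<close>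

lemma piece_exchange:
  assumes "\<xi> \<in> piece 0 i"
  shows "\<exists>j. \<xi> + step i \<in> piece 0 j"
proof -
  have "(\<lambda>\<xi>. \<xi> + step i) ` coord 0 ` prefix_points 0 i \<subseteq> (\<Union>j. piece 0 j)"
  proof safe
    fix x assume "x \<in> prefix_points 0 i"
    then obtain p \<omega> where p: "x = abelianization p" "limit_word \<sigma> \<omega>" "stream_prefix (p @ [i]) \<omega>"
      by (auto simp: prefix_points_def)
    define j where "j = \<omega> !! length (p @ [i])"
    have "stream_prefix ((p @ [i]) @ [j]) \<omega>"
      using p(3) unfolding stream_prefix_def j_def
      by (metis length_append_singleton stake_Suc)
    then have "\<exists>\<omega>. limit_word \<sigma> \<omega> \<and> stream_prefix ((p @ [i]) @ [j]) \<omega>" using p(2) by blast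
    then have "abelianization (p @ [i]) \<in> prefix_points 0 j"
      unfolding prefix_points_def
      by (intro CollectI exI[of _ "p @ [i]"]) (simp del: append_assoc abelianization_append)
    then have "coord 0 (abelianization (p @ [i])) \<in> piece 0 j"
      unfolding piece_def by (intro subsetD[OF closure_subset] imageI)
    then show "coord 0 x + step i \<in> (\<Union>j. piece 0 j)"
      by (auto simp: p(1) step_def coord_add abelianization_Cons)
  qed
  moreover have "closed (\<Union>j. piece 0 j)" by (auto intro!: closed_UN intro: compact_imp_closed compact_piece)
  moreover have "closed ((\<lambda>\<xi>. \<xi> + step i) -` (\<Union>j. piece 0 j))"
    using calculation(2) by (rule closed_vimage) (intro continuous_intros)
  ultimately have "closure (coord 0 ` prefix_points 0 i) \<subseteq> (\<lambda>\<xi>. \<xi> + step i) -` (\<Union>j. piece 0 j)"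
    by (intro closure_minimal) blast
  then show ?thesis using assms by (auto simp: piece_def)
qed

lemma AE_simple_point: "AE \<xi> in lborel. simple_point (\<xi> + a)"
proof (rule AE_lborel_negligible)
  have eq: "{\<xi>. \<not> simple_point (\<xi> + a)} = (+) (- a) ` {\<xi>. \<not> simple_point \<xi>}"
    by (auto intro!: image_eqI[of _ _ "_ + a"])
  show "negligible {\<xi>. \<not> simple_point (\<xi> + a)}"
    unfolding eq by (rule negligible_translation[OF negligible_not_simple])
  have "(\<lambda>\<xi>. \<xi> + a) -` {\<xi>. \<not> simple_point \<xi>} \<inter> space borel \<in> sets borel"
    by (intro measurable_sets[OF _ borel_not_simple]) auto
  then show "{\<xi>. \<not> simple_point (\<xi> + a)} \<in> sets borel" by (simp add: vimage_def)
qed simp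

text \<open>\<open>step i\<close> is congruent to the rotation and keeps the point in the union of
  the pieces. Where the translated point is simple, it is the only representative there, so the
  induced map is the translation by \<open>step i\<close>.\<close>

lemma natural_partition_pieces: "natural_partition int_lattice rotation (piece 0) step"
  unfolding natural_partition_def
proof (intro conjI allI impI)
  show "full_rank_lattice (int_lattice :: (real^2) set)" by (rule full_rank_int_lattice)
  show "fundamental_domain int_lattice (\<Union>i. piece 0 i)"
    unfolding fundamental_domain_def
  proof
    have "closed (\<Union>j. piece 0 j)" by (auto intro!: closed_UN intro: compact_imp_closed compact_piece)
    then show "(\<Union>i. piece 0 i) \<in> sets lebesgue" by (simp add: borel_closed)
    show "AE x in lborel. \<exists>!l. l \<in> int_lattice \<and> x + l \<in> (\<Union>i. piece 0 i)"
      using AE_simple_point[of 0]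
    proof eventually_elim
      case (elim \<xi>)
      obtain l i where l: "l \<in> int_lattice" "\<xi> - l \<in> piece 0 i" using pieces_cover by blast
      show ?case
      proof (rule ex1I[of _ "- l"])
        show "- l \<in> int_lattice \<and> \<xi> + - l \<in> (\<Union>i. piece 0 i)" using l by auto
      next
        fix k assume "k \<in> int_lattice \<and> \<xi> + k \<in> (\<Union>i. piece 0 i)"
        then obtain j where "- k \<in> int_lattice" "\<xi> - (- k) \<in> piece 0 j" by auto
        then have "l = - k" using elim l unfolding simple_point_def by auto
        then show "k = - l" by simp
      qed
    qed
  qed
  fix i
  show "compact (piece 0 i)" by (rule compact_piece)
  show "closure (interior (piece 0 i)) = piece 0 i" by (rule piece_closure_interior)
  show "negligible (piece 0 i \<inter> piece 0 j)" if "i \<noteq> j" for j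
  proof (rule negligible_subset[OF negligible_not_simple])
    show "piece 0 i \<inter> piece 0 j \<subseteq> {\<xi>. \<not> simple_point \<xi>}"
    proof
      fix \<xi> assume "\<xi> \<in> piece 0 i \<inter> piece 0 j"
      then have "\<xi> - 0 \<in> piece 0 i" "\<xi> - 0 \<in> piece 0 j" by simp_all
      then show "\<xi> \<in> {\<xi>. \<not> simple_point \<xi>}"
        using that zero_int_lattice unfolding simple_point_def by blast
    qed
  qed
  show "AE x in lborel. x \<in> piece 0 i \<longrightarrow> induced_map int_lattice rotation (\<Union>i. piece 0 i) x = x + step i"
    using AE_simple_point[of "step i"]
  proof eventually_elim
    case (elim \<xi>)
    show ?case
    proof
      assume "\<xi> \<in> piece 0 i"
      then obtain j where j: "\<xi> + step i \<in> piece 0 j" using piece_exchange by blast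
      show "induced_map int_lattice rotation (\<Union>i. piece 0 i) \<xi> = \<xi> + step i"
        unfolding induced_map_def
      proof (rule the_equality)
        show "\<xi> + step i \<in> (\<Union>i. piece 0 i) \<and> \<xi> + step i - (\<xi> + rotation) \<in> int_lattice"
          using j step_rotation[of i] by auto
      next
        fix y assume y: "y \<in> (\<Union>i. piece 0 i) \<and> y - (\<xi> + rotation) \<in> int_lattice"
        then obtain k where k: "y \<in> piece 0 k" by blast
        have "(\<xi> + step i) - y = (step i - rotation) - (y - (\<xi> + rotation))" by simp
        then have "(\<xi> + step i) - y \<in> int_lattice"
          using int_lattice_diff[OF step_rotation[of i] conjunct2[OF y]] by (simp only:)
        moreover have "(\<xi> + step i) - ((\<xi> + step i) - y) \<in> piece 0 k" using k by simp
        moreover have "(\<xi> + step i) - 0 \<in> piece 0 j" using j by simp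
        ultimately have "(\<xi> + step i) - y = 0"
          using elim zero_int_lattice unfolding simple_point_def by metis
        then show "y = \<xi> + step i" by simp
      qed
    qed
  qed
qed

end

section \<open>Translations of the torus\<close>

definition unit_cube :: "(real^'n::finite) set" where
  "unit_cube = {x. \<forall>i. 0 \<le> x $ i \<and> x $ i < 1}"

definition frac_vec :: "real^'n \<Rightarrow> real^'n::finite" where
  "frac_vec x = (\<chi> i. frac (x $ i))"

lemma frac_vec_unit_cube [simp]: "frac_vec x \<in> unit_cube"
  by (simp add: unit_cube_def frac_vec_def frac_lt_1)

lemma diff_frac_vec: "x - frac_vec x \<in> int_lattice"
  by (simp add: int_lattice_def frac_vec_def frac_def)

lemma frac_vec_add: "l \<in> int_lattice \<Longrightarrow> frac_vec (x + l) = frac_vec x"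
  by (simp add: int_lattice_def frac_vec_def vec_eq_iff frac_add_int_right)

lemma frac_vec_id: "x \<in> unit_cube \<Longrightarrow> frac_vec x = x"
  by (simp add: unit_cube_def frac_vec_def vec_eq_iff frac_eq)

lemma unit_cube_int_lattice:
  assumes "x \<in> unit_cube" "y \<in> unit_cube" "x - y \<in> int_lattice"
  shows "x = y"
  using frac_vec_add[OF assms(3), of y] frac_vec_id[OF assms(1)] frac_vec_id[OF assms(2)] by simp

lemma borel_unit_cube [measurable]: "unit_cube \<in> sets borel"
proof -
  have "unit_cube = (\<Inter>i. {x :: real^'a. 0 \<le> x $ i} \<inter> {x. x $ i < 1})"
    by (auto simp: unit_cube_def)
  also have "\<dots> \<in> sets borel"
    by (intro sets.finite_INT sets.Int borel_closed borel_open closed_Collect_le open_Collect_less continuous_intros) auto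
  finally show ?thesis .
qed

lemma emeasure_unit_cube: "emeasure lborel (unit_cube :: (real^'n::finite) set) = 1"
proof (rule antisym)
  have one: "\<And>b. b \<in> Basis \<Longrightarrow> (0 :: real^'n) \<bullet> b \<le> vec 1 \<bullet> b"
    by (auto simp: Basis_vec_def inner_axis)
  have p: "(\<Prod>b\<in>Basis. ((vec 1 :: real^'n) - 0) \<bullet> b) = 1"
    by (rule prod.neutral) (auto simp: Basis_vec_def inner_axis)
  have "unit_cube \<subseteq> (cbox 0 (vec 1) :: (real^'n) set)"
    by (auto simp: unit_cube_def mem_box_cart less_imp_le)
  then have "emeasure lborel (unit_cube :: (real^'n) set) \<le> emeasure lborel (cbox 0 (vec 1) :: (real^'n) set)"
    by (intro emeasure_mono) auto
  also have "\<dots> = 1" using emeasure_lborel_cbox[OF one] p by simp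
  finally show "emeasure lborel (unit_cube :: (real^'n) set) \<le> 1" .
  have "1 = emeasure lborel (box 0 (vec 1) :: (real^'n) set)"
    using emeasure_lborel_box[OF one] p by simp
  also have "\<dots> \<le> emeasure lborel (unit_cube :: (real^'n) set)"
    by (intro emeasure_mono) (auto simp: unit_cube_def mem_box_cart less_imp_le)
  finally show "1 \<le> emeasure lborel (unit_cube :: (real^'n) set)" .
qed

lemma torus_class_eq_iff: "torus_class x = torus_class y \<longleftrightarrow> x - y \<in> int_lattice"
proof
  assume "torus_class x = torus_class y"
  moreover have "x \<in> torus_class x"
    unfolding torus_class_def by (rule image_eqI[of _ _ 0]) auto
  ultimately show "x - y \<in> int_lattice" by (auto simp: torus_class_def)
next
  have "torus_class x \<subseteq> torus_class y" if "x - y \<in> int_lattice" for x y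
  proof
    fix z assume "z \<in> torus_class x"
    then obtain l where l: "l \<in> int_lattice" "z = x + l" by (auto simp: torus_class_def)
    then have "(x - y) + l \<in> int_lattice" "z = y + ((x - y) + l)" using that by (auto simp: int_lattice_add)
    then show "z \<in> torus_class y" unfolding torus_class_def by blast
  qed
  moreover assume "x - y \<in> int_lattice"
  moreover from this have "y - x \<in> int_lattice" using int_lattice_uminus[of "x - y"] by simp
  ultimately show "torus_class x = torus_class y" by blast
qed

lemma torus_class_frac_vec: "torus_class (frac_vec x) = torus_class x"
  using diff_frac_vec[of x] int_lattice_uminus[of "x - frac_vec x"] by (simp add: torus_class_eq_iff)

lemma torus_translation_class: "torus_translation t (torus_class x) = torus_class (x + t)"
  by (auto simp: torus_translation_def torus_class_def image_image add_ac)

lemma sets_torus: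
  "sets (torus :: (real^'a::finite) set measure) = {B. B \<subseteq> range torus_class \<and> torus_class -` B \<in> sets borel}"
proof -
  let ?S = "{B. B \<subseteq> range torus_class \<and> torus_class -` B \<in> sets (borel :: (real^'a) measure)}"
  have "sigma_algebra (range torus_class) ?S"
    unfolding sigma_algebra_iff2
  proof (intro conjI ballI allI impI)
    fix B assume "B \<in> ?S"
    then have "torus_class -` B \<in> sets (borel :: (real^'a) measure)" by simp
    moreover have "torus_class -` (range torus_class - B) = - (torus_class -` B)" by auto
    ultimately show "range torus_class - B \<in> ?S" by auto
  next
    fix A :: "nat \<Rightarrow> (real^'a) set set" assume "range A \<subseteq> ?S"
    then have "A i \<subseteq> range torus_class" "torus_class -` A i \<in> sets (borel :: (real^'a) measure)" for i by auto
    then show "(\<Union>i. A i) \<in> ?S" by (auto simp: vimage_UN)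
  qed auto
  from sigma_algebra.sets_measure_of_eq[OF this] show ?thesis by (simp add: torus_def)
qed

lemma space_torus [simp]: "space torus = range torus_class"
  by (simp add: torus_def space_measure_of_conv)

lemma measurable_torus_class [measurable]: "torus_class \<in> measurable borel torus"
  by (rule measurableI) (auto simp: sets_torus)

lemma measurable_torusI:
  fixes f :: "(real^'n::finite) set \<Rightarrow> 'b"
  assumes "(\<lambda>x. f (torus_class x)) \<in> measurable borel N"
  shows "f \<in> measurable torus N"
proof (rule measurableI)
  fix C :: "(real^'n) set" assume "C \<in> space torus"
  then show "f C \<in> space N" using measurable_space[OF assms] by auto
next
  fix B assume "B \<in> sets N"
  then have "(\<lambda>x. f (torus_class x)) -` B \<inter> space borel \<in> sets borel" by (rule measurable_sets[OF assms])
  moreover have "torus_class -` (f -` B \<inter> range torus_class) = (\<lambda>x. f (torus_class x)) -` B" by auto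
  ultimately show "f -` B \<inter> space torus \<in> sets torus" by (simp add: sets_torus)
qed

lemma emeasure_torus:
  assumes "B \<in> sets (torus :: (real^'a::finite) set measure)"
  shows "emeasure torus B = emeasure lborel (torus_class -` B \<inter> unit_cube)"
proof -
  have Q: "{x :: real^'a. \<forall>i. 0 \<le> x $ i \<and> x $ i < 1} = unit_cube" by (simp add: unit_cube_def)
  have eq: "measurable lborel (sigma (range torus_class)
      {B. B \<subseteq> range torus_class \<and> torus_class -` B \<in> sets (borel :: (real^'a) measure)}) = measurable borel torus"
    by (rule measurable_cong_sets) (simp_all add: torus_def)
  have m: "torus_class \<in> measurable (restrict_space lborel unit_cube)
      (sigma (range torus_class) {B. B \<subseteq> range torus_class \<and> torus_class -` B \<in> sets (borel :: (real^'a) measure)})"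
    by (rule measurable_restrict_space1) (unfold eq, rule measurable_torus_class)
  have "emeasure torus B = emeasure (restrict_space lborel unit_cube) (torus_class -` B \<inter> space (restrict_space lborel unit_cube))"
    unfolding torus_def Q using assms by (intro emeasure_distr m) (simp add: torus_def)
  also have "\<dots> = emeasure lborel (torus_class -` B \<inter> space (restrict_space lborel unit_cube))"
    by (intro emeasure_restrict_space) (auto simp: space_restrict_space)
  finally show ?thesis by (simp add: space_restrict_space)
qed

lemma prob_space_torus: "prob_space (torus :: (real^'a::finite) set measure)"
proof (rule prob_spaceI)
  have "(range torus_class :: (real^'a) set set) \<in> sets torus" using sets.top[of torus] by simp
  then show "emeasure torus (space (torus :: (real^'a) set measure)) = 1"
    using emeasure_torus[of "range torus_class :: (real^'a) set set"] emeasure_unit_cube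
    by (simp add: vimage_def)
qed

lemma emeasure_lborel_translate:
  fixes E :: "'a::euclidean_space set"
  assumes "E \<in> sets borel"
  shows "emeasure lborel ((\<lambda>x. x + a) -` E) = emeasure lborel E"
proof -
  have "emeasure lborel E = emeasure (distr lborel borel ((+) a)) E"
    using lborel_distr_plus[of a] by simp
  also have "\<dots> = emeasure lborel ((+) a -` E \<inter> space lborel)"
    using assms by (intro emeasure_distr) auto
  finally show ?thesis by (simp add: vimage_def add.commute)
qed

text \<open>Two translates of the unit cube are cut into pieces that agree up to lattice translations.\<close>
lemma emeasure_periodic_translate:
  fixes E :: "(real^'n::finite) set"
  assumes E: "E \<in> sets borel" "\<And>x l. l \<in> int_lattice \<Longrightarrow> x + l \<in> E \<longleftrightarrow> x \<in> E"
  shows "emeasure lborel ((\<lambda>x. x + t) -` E \<inter> unit_cube) = emeasure lborel (E \<inter> unit_cube)"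
proof -
  let ?Q = "\<lambda>a. (\<lambda>x. x + a) -` (unit_cube :: (real^'n) set)"
  have Qm [measurable]: "?Q a \<in> sets borel" for a
    using measurable_sets[of "\<lambda>x. x + a" borel borel unit_cube] by auto
  have part: "\<exists>l\<in>int_lattice. x \<in> ?Q (a + l)" for a x
    using diff_frac_vec[of "x + a"] frac_vec_unit_cube[of "x + a"]
      int_lattice_uminus[of "x + a - frac_vec (x + a)"]
    by (intro bexI[of _ "- (x + a - frac_vec (x + a))"]) (auto simp: algebra_simps)
  have disj: "disjoint_family_on (\<lambda>l. F \<inter> ?Q (a + l)) int_lattice" for F a
    unfolding disjoint_family_on_def
  proof (intro ballI impI)
    fix l k :: "real^'n" assume lk: "l \<in> int_lattice" "k \<in> int_lattice" "l \<noteq> k"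
    have False if "x + (a + l) \<in> unit_cube" "x + (a + k) \<in> unit_cube" for x
    proof -
      have "x + (a + l) - (x + (a + k)) \<in> int_lattice" using int_lattice_diff[OF lk(1,2)] by simp
      from unit_cube_int_lattice[OF that this] lk(3) show False by simp
    qed
    then show "F \<inter> ?Q (a + l) \<inter> (F \<inter> ?Q (a + k)) = {}" by blast
  qed
  have split: "emeasure lborel F = (\<integral>\<^sup>+l. emeasure lborel (F \<inter> ?Q (a + l)) \<partial>count_space int_lattice)"
    if "F \<in> sets borel" for F a
  proof -
    have "F = (\<Union>l\<in>int_lattice. F \<inter> ?Q (a + l))" using part by blast
    then have "emeasure lborel F = emeasure lborel (\<Union>l\<in>int_lattice. F \<inter> ?Q (a + l))" by simp
    also have "\<dots> = (\<integral>\<^sup>+l. emeasure lborel (F \<inter> ?Q (a + l)) \<partial>count_space int_lattice)"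
      using that by (intro emeasure_UN_countable countable_int_lattice disj) auto
    finally show ?thesis .
  qed
  have cube0: "?Q 0 = unit_cube" by auto
  have "emeasure lborel ((\<lambda>x. x + t) -` E \<inter> unit_cube) = emeasure lborel ((\<lambda>x. x + t) -` (E \<inter> ?Q (- t)))"
    by (rule arg_cong[where f = "emeasure lborel"]) auto
  also have "\<dots> = emeasure lborel (E \<inter> ?Q (- t))"
    using E(1) by (intro emeasure_lborel_translate) auto
  also have "\<dots> = (\<integral>\<^sup>+l. emeasure lborel (E \<inter> ?Q (- t) \<inter> ?Q (0 + l)) \<partial>count_space int_lattice)"
    using E(1) by (intro split) auto
  also have "\<dots> = (\<integral>\<^sup>+l. emeasure lborel (E \<inter> unit_cube \<inter> ?Q (- t + - l)) \<partial>count_space int_lattice)"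
  proof (rule nn_integral_cong)
    fix l :: "real^'n" assume "l \<in> space (count_space int_lattice)"
    then have l: "l \<in> int_lattice" by simp
    have "emeasure lborel (E \<inter> ?Q (- t) \<inter> ?Q (0 + l)) =
        emeasure lborel ((\<lambda>x. x + l) -` (E \<inter> unit_cube \<inter> ?Q (- t + - l)))"
      using E(2)[OF l] by (intro arg_cong[where f = "emeasure lborel"]) auto
    also have "\<dots> = emeasure lborel (E \<inter> unit_cube \<inter> ?Q (- t + - l))"
      using E(1) by (intro emeasure_lborel_translate) auto
    finally show "emeasure lborel (E \<inter> ?Q (- t) \<inter> ?Q (0 + l)) =
        emeasure lborel (E \<inter> unit_cube \<inter> ?Q (- t + - l))" .
  qed
  also have "\<dots> = (\<integral>\<^sup>+l. emeasure lborel (E \<inter> unit_cube \<inter> ?Q (- t + l)) \<partial>count_space int_lattice)"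
    by (rule nn_integral_bij_count_space[where g = uminus])
       (auto simp: bij_betw_def inj_on_def image_iff intro!: bexI[of _ "- _"])
  also have "\<dots> = emeasure lborel (E \<inter> unit_cube)"
    using E(1) by (intro split[symmetric]) auto
  finally show ?thesis .
qed

lemma measurable_torus_translation [measurable]: "torus_translation t \<in> measurable torus torus"
  by (rule measurable_torusI) (simp add: torus_translation_class)

lemma distr_torus_translation: "distr torus torus (torus_translation t) = torus"
proof (rule measure_eqI)
  fix B assume "B \<in> sets (distr torus torus (torus_translation t))"
  then have B: "B \<in> sets torus" by simp
  let ?E = "torus_class -` B"
  have per: "x + l \<in> ?E \<longleftrightarrow> x \<in> ?E" if "l \<in> int_lattice" for x l
    using that torus_class_eq_iff[of "x + l" x] by simp
  have "emeasure (distr torus torus (torus_translation t)) B =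
      emeasure torus (torus_translation t -` B \<inter> space torus)"
    using B by (intro emeasure_distr) auto
  also have "\<dots> = emeasure lborel (torus_class -` (torus_translation t -` B \<inter> space torus) \<inter> unit_cube)"
    using B by (intro emeasure_torus measurable_sets[OF measurable_torus_translation])
  also have "torus_class -` (torus_translation t -` B \<inter> space torus) = (\<lambda>x. x + t) -` ?E"
    unfolding vimage_def by (simp add: torus_translation_class)
  also have "emeasure lborel ((\<lambda>x. x + t) -` ?E \<inter> unit_cube) = emeasure lborel (?E \<inter> unit_cube)"
    using B per by (intro emeasure_periodic_translate) (auto simp: sets_torus)
  also have "\<dots> = emeasure torus B" by (simp add: emeasure_torus[OF B])
  finally show "emeasure (distr torus torus (torus_translation t)) B = emeasure torus B" .
qed simp

definition torus_rep :: "(real^'n) set \<Rightarrow> real^'n::finite" where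
  "torus_rep C = frac_vec (SOME x. C = torus_class x)"

lemma torus_rep_class [simp]: "torus_rep (torus_class x) = frac_vec x"
proof -
  have "torus_class x = torus_class (SOME y. torus_class x = torus_class y)" by (rule someI) simp
  then have "x - (SOME y. torus_class x = torus_class y) \<in> int_lattice" by (simp add: torus_class_eq_iff)
  from frac_vec_add[OF this, of "SOME y. torus_class x = torus_class y"]
  show ?thesis by (simp add: torus_rep_def)
qed

lemma measurable_frac_vec [measurable]: "frac_vec \<in> borel_measurable borel"
proof -
  have "(\<lambda>x :: real^'a. frac_vec x \<bullet> b) \<in> borel_measurable borel" if "b \<in> Basis" for b
  proof -
    obtain i where b: "b = axis i 1" using \<open>b \<in> Basis\<close> by (auto simp: Basis_vec_def)
    have "(\<lambda>x :: real^'a. frac (x $ i)) \<in> borel_measurable borel"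
      unfolding frac_def by measurable
    then show ?thesis by (simp add: b inner_axis frac_vec_def)
  qed
  then show ?thesis using borel_measurable_euclidean_space by blast
qed

lemma measurable_torus_rep [measurable]: "torus_rep \<in> borel_measurable torus"
  by (rule measurable_torusI) simp

lemma torus_rep_translation:
  "\<exists>l\<in>int_lattice. torus_rep (torus_translation t (torus_class x)) = torus_rep (torus_class x) + t + l"
proof -
  have "frac_vec (x + t) - (frac_vec x + t) = (x - frac_vec x) - (x + t - frac_vec (x + t))" by simp
  also have "\<dots> \<in> int_lattice" by (intro int_lattice_diff diff_frac_vec)
  finally show ?thesis
    unfolding torus_translation_class torus_rep_class
    by (intro bexI[of _ "frac_vec (x + t) - (frac_vec x + t)"]) auto
qed

lemma integral_invariant_translation:
  fixes f :: "real^'n::finite \<Rightarrow> real"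
  assumes \<mu>: "sets \<mu> = sets torus" "distr \<mu> torus (torus_translation t) = \<mu>"
    and f: "f \<in> borel_measurable borel" "\<And>x l. l \<in> int_lattice \<Longrightarrow> f (x + l) = f x"
  shows "(\<integral>C. f (torus_rep C + (v + t)) \<partial>\<mu>) = (\<integral>C. f (torus_rep C + v) \<partial>\<mu>)"
proof -
  have sp: "space \<mu> = range torus_class" using sets_eq_imp_space_eq[OF \<mu>(1)] by simp
  have m: "(\<lambda>C. f (torus_rep C + v)) \<in> borel_measurable torus" using f(1) by measurable
  have T: "torus_translation t \<in> measurable \<mu> torus"
    using measurable_torus_translation \<mu>(1) by (simp cong: measurable_cong_sets)
  have "(\<integral>C. f (torus_rep C + v) \<partial>\<mu>) = (\<integral>C. f (torus_rep C + v) \<partial>distr \<mu> torus (torus_translation t))"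
    by (simp add: \<mu>(2))
  also have "\<dots> = (\<integral>C. f (torus_rep (torus_translation t C) + v) \<partial>\<mu>)"
    by (rule integral_distr[OF T m])
  also have "\<dots> = (\<integral>C. f (torus_rep C + (v + t)) \<partial>\<mu>)"
  proof (rule Bochner_Integration.integral_cong[OF refl])
    fix C assume "C \<in> space \<mu>"
    then obtain x where C: "C = torus_class x" using sp by auto
    obtain l where l: "l \<in> int_lattice"
      "torus_rep (torus_translation t (torus_class x)) = torus_rep (torus_class x) + t + l"
      using torus_rep_translation[of t x] by blast
    have "torus_rep (torus_translation t C) + v = (torus_rep C + (v + t)) + l"
      unfolding C l(2) by simp
    then show "f (torus_rep (torus_translation t C) + v) = f (torus_rep C + (v + t))"
      using f(2)[OF l(1), of "torus_rep C + (v + t)"] by (simp only:)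
  qed
  finally show ?thesis by simp
qed

text \<open>
  The integral of a continuous periodic function is invariant under a dense set of translations,
  hence under all of them; averaging over all translations gives the Haar integral.
\<close>
lemma integral_unique_invariant:
  fixes f :: "real^'n::finite \<Rightarrow> real"
  assumes dense: "\<And>\<xi> e. 0 < e \<Longrightarrow> \<exists>m l. l \<in> int_lattice \<and> norm (\<xi> - l - real m *\<^sub>R t) < e"
    and \<mu>: "sets \<mu> = sets torus" "prob_space \<mu>" "distr \<mu> torus (torus_translation t) = \<mu>"
    and f: "continuous_on UNIV f" "\<And>x l. l \<in> int_lattice \<Longrightarrow> f (x + l) = f x" "\<And>x. \<bar>f x\<bar> \<le> 1"
  shows "(\<integral>C. f (torus_rep C) \<partial>\<mu>) = (\<integral>C. f (torus_rep C) \<partial>torus)"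
proof -
  interpret \<mu>: prob_space \<mu> by (rule \<mu>(2))
  interpret H: prob_space "torus :: (real^'n) set measure" by (rule prob_space_torus)
  have fm [measurable]: "f \<in> borel_measurable borel" by (rule borel_measurable_continuous_onI[OF f(1)])
  have rep [measurable]: "torus_rep \<in> borel_measurable \<mu>"
    using measurable_torus_rep \<mu>(1) by (simp cong: measurable_cong_sets)
  define F where "F = (\<lambda>v. \<integral>C. f (torus_rep C + v) \<partial>\<mu>)"
  have F_t: "F (v + t) = F v" for v
    unfolding F_def by (rule integral_invariant_translation[OF \<mu>(1,3) fm f(2)])
  have F_mt: "F (v + real m *\<^sub>R t) = F v" for v m
  proof (induction m)
    case (Suc m)
    have "v + real (Suc m) *\<^sub>R t = (v + real m *\<^sub>R t) + t" by (simp add: algebra_simps)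
    then show ?case using F_t Suc by metis
  qed simp
  have F_l: "F (v + l) = F v" if "l \<in> int_lattice" for v l
    using f(2)[OF that] by (simp add: F_def add.assoc[symmetric])
  have F0: "F v = F 0" for v
  proof -
    have "\<exists>m l. l \<in> int_lattice \<and> norm (v - l - real m *\<^sub>R t) < inverse (real (Suc k))" for k
      by (rule dense) simp
    then obtain m l where ml: "\<And>k. l k \<in> int_lattice" "\<And>k. norm (v - l k - real (m k) *\<^sub>R t) < inverse (real (Suc k))"
      by metis
    define w where "w = (\<lambda>k. l k + real (m k) *\<^sub>R t)"
    have "(\<lambda>k. w k - v) \<longlonglongrightarrow> 0"
    proof (rule tendsto_norm_zero_cancel, rule tendsto_sandwich[OF _ _ tendsto_const LIMSEQ_inverse_real_of_nat])
      show "\<forall>\<^sub>F k in sequentially. norm (w k - v) \<le> inverse (real (Suc k))"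
        using ml(2) by (intro always_eventually allI) (simp add: w_def norm_minus_commute algebra_simps less_imp_le)
    qed auto
    then have w: "w \<longlonglongrightarrow> v" by (simp add: LIM_zero_iff)
    have "(\<lambda>k. F (w k)) \<longlonglongrightarrow> F v"
      unfolding F_def
    proof (rule integral_dominated_convergence[where w = "\<lambda>_. 1"])
      show "AE C in \<mu>. (\<lambda>k. f (torus_rep C + w k)) \<longlonglongrightarrow> f (torus_rep C + v)"
      proof (intro always_eventually allI)
        fix C
        have "isCont f (torus_rep C + v)" using f(1) by (simp add: continuous_on_eq_continuous_at)
        then show "(\<lambda>k. f (torus_rep C + w k)) \<longlonglongrightarrow> f (torus_rep C + v)"
          by (rule isCont_tendsto_compose) (intro tendsto_intros w)
      qed
    qed (use f(3) in \<open>auto intro!: always_eventually\<close>)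
    moreover have "F (w k) = F 0" for k
    proof -
      have "F (w k) = F (real (m k) *\<^sub>R t + l k)" by (simp only: w_def add.commute[of "l k"])
      also have "\<dots> = F (0 + real (m k) *\<^sub>R t)" unfolding F_l[OF ml(1)] by simp
      finally show ?thesis unfolding F_mt .
    qed
    ultimately have "(\<lambda>_. F 0) \<longlonglongrightarrow> F v" by simp
    then show ?thesis using LIMSEQ_unique[OF tendsto_const] by metis
  qed
  interpret P: pair_sigma_finite \<mu> "torus :: (real^'n) set measure" ..
  interpret PP: pair_prob_space \<mu> "torus :: (real^'n) set measure" ..
  have "F 0 = (\<integral>D. F (torus_rep D) \<partial>torus)" 
  proof -
    have "(\<lambda>D :: (real^'n) set. F (torus_rep D)) = (\<lambda>_. F 0)" using F0 by blast
    then show ?thesis using H.prob_space by simp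
  qed
  also have "\<dots> = (\<integral>D. (\<integral>C. f (torus_rep C + torus_rep D) \<partial>\<mu>) \<partial>torus)"
    by (simp add: F_def)
  also have "\<dots> = (\<integral>C. (\<integral>D. f (torus_rep C + torus_rep D) \<partial>torus) \<partial>\<mu>)"
  proof (rule P.Fubini_integral)
    show "integrable (\<mu> \<Otimes>\<^sub>M torus) (\<lambda>(C, D). f (torus_rep C + torus_rep D))"
      by (rule PP.P.integrable_const_bound[where B = 1]) (use f(3) in auto)
  qed
  also have "\<dots> = (\<integral>C. (\<integral>D. f (torus_rep D) \<partial>torus) \<partial>\<mu>)"
  proof (rule Bochner_Integration.integral_cong[OF refl])
    fix C
    show "(\<integral>D. f (torus_rep C + torus_rep D) \<partial>torus) = (\<integral>D. f (torus_rep D) \<partial>torus)"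
      using integral_invariant_translation[OF refl distr_torus_translation fm f(2), of 0 "torus_rep C"]
      by (simp only: add_0 add_0_right add.commute[of _ "torus_rep C"])
  qed
  also have "\<dots> = (\<integral>D. f (torus_rep D) \<partial>torus)" by (simp add: \<mu>.prob_space)
  finally show ?thesis by (simp add: F_def)
qed

text \<open>Unique ergodicity. Continuous periodic functions already have the Haar integral; those
  that decrease with the distance to a closed periodic set approximate its indicator. This settles
  compact subsets of the unit cube, by exhaustion closed sets, and these generate the Borel
  sets.\<close>

lemma torus_unique_invariant:
  fixes t :: "real^'n::finite"
  assumes dense: "\<And>\<xi> e. 0 < e \<Longrightarrow> \<exists>m l. l \<in> int_lattice \<and> norm (\<xi> - l - real m *\<^sub>R t) < e"
    and \<mu>: "sets \<mu> = sets torus" "prob_space \<mu>" "distr \<mu> torus (torus_translation t) = \<mu>"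
  shows "\<mu> = torus"
proof -
  define R where "R = (\<lambda>\<mu> :: (real^'n) set measure. distr \<mu> borel torus_rep)"
  have sp: "space \<mu> = range torus_class" using sets_eq_imp_space_eq[OF \<mu>(1)] by simp
  have rep: "torus_rep \<in> borel_measurable \<mu>'" if "sets \<mu>' = sets torus" for \<mu>' :: "(real^'n) set measure"
    using measurable_torus_rep that by (simp cong: measurable_cong_sets)
  have closed_eq: "measure (R \<mu>) E = measure (R torus) E" if E: "compact E" "E \<subseteq> unit_cube" for E
  proof (cases "E = {}")
    case False
    \<comment> \<open>The periodic extension of \<open>E\<close>: distance to it is a periodic
      function, and it meets the unit cube exactly in \<open>E\<close>.\<close>
    define P where "P = (\<Union>l\<in>int_lattice. \<Union>y\<in>E. {l + y})"
    have clP: "closed P" unfolding P_def by (intro closed_compact_sums closed_subset_int_lattice E) auto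
    have neP: "P \<noteq> {}" using False zero_int_lattice unfolding P_def by blast
    have perP: "x + l \<in> P" if xP: "x \<in> P" "l \<in> int_lattice" for x l
    proof -
      obtain k y where "k \<in> int_lattice" "y \<in> E" "x = k + y" using xP(1) unfolding P_def by blast
      then have "k + l \<in> int_lattice" "x + l = (k + l) + y" using xP(2) by (auto simp: int_lattice_add)
      then show ?thesis using \<open>y \<in> E\<close> unfolding P_def by blast
    qed
    have inf_per: "infdist (x + l) P = infdist x P" if l: "l \<in> int_lattice" for x l
    proof -
      have le: "infdist (x + l) P \<le> infdist x P" if l: "l \<in> int_lattice" for x l
      proof -
        obtain y where y: "y \<in> P" "infdist x P = dist x y" using infdist_attains_inf[OF clP neP] by blast
        have "infdist (x + l) P \<le> dist (x + l) (y + l)" by (rule infdist_le[OF perP[OF y(1) l]])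
        then show ?thesis using y(2) by (simp add: dist_norm)
      qed
      from le[OF l, of x] le[of "- l" "x + l"] l show ?thesis by simp
    qed
    have lim: "(\<lambda>k. max 0 (1 - real k * infdist x P)) \<longlonglongrightarrow> indicator P x" for x
    proof (cases "x \<in> P")
      case True
      then show ?thesis by simp
    next
      case False
      then have pos: "infdist x P > 0" using in_closed_iff_infdist_zero[OF clP neP] infdist_nonneg[of x P] by (simp add: less_le)
      obtain N :: nat where N: "1 / infdist x P < real N" using reals_Archimedean2 by blast
      have "\<forall>\<^sub>F k in sequentially. max 0 (1 - real k * infdist x P) = 0"
        using eventually_ge_at_top[of N]
      proof eventually_elim
        case (elim k)
        then have "1 / infdist x P < real k" using N by linarith
        then have "1 < real k * infdist x P" using pos by (simp add: field_simps)
        then show ?case by simp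
      qed
      then show ?thesis using False by (simp add: tendsto_eventually)
    qed
    have P_Q: "P \<inter> unit_cube = E"
    proof (intro equalityI subsetI)
      fix x assume x: "x \<in> P \<inter> unit_cube"
      then obtain l y where ly: "l \<in> int_lattice" "y \<in> E" "x = l + y" by (auto simp: P_def)
      then have "x = y" using unit_cube_int_lattice[of x y] x E(2) by auto
      then show "x \<in> E" using ly by simp
    next
      fix x assume "x \<in> E"
      then have "0 + x \<in> P" unfolding P_def using zero_int_lattice by blast
      then show "x \<in> P \<inter> unit_cube" using \<open>x \<in> E\<close> E(2) by auto
    qed
    have to_E: "(\<lambda>k. \<integral>C. max 0 (1 - real k * infdist (torus_rep C) P) \<partial>\<mu>') \<longlonglongrightarrow> measure (R \<mu>') E"
      if \<mu>': "sets \<mu>' = sets torus" "prob_space \<mu>'" for \<mu>' :: "(real^'n) set measure"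
    proof -
      interpret prob_space \<mu>' by (rule \<mu>'(2))
      note [measurable] = rep[OF \<mu>'(1)]
      have sp': "space \<mu>' = range torus_class" using sets_eq_imp_space_eq[OF \<mu>'(1)] by simp
      have "(\<lambda>k. \<integral>C. max 0 (1 - real k * infdist (torus_rep C) P) \<partial>\<mu>') \<longlonglongrightarrow> (\<integral>C. indicator P (torus_rep C) \<partial>\<mu>')"
      proof (rule integral_dominated_convergence[where w = "\<lambda>_. 1"])
        show "(\<lambda>C. indicator P (torus_rep C) :: real) \<in> borel_measurable \<mu>'"
          using clP by (intro measurable_compose[OF rep[OF \<mu>'(1)]] borel_measurable_indicator) auto
        show "(\<lambda>C. max 0 (1 - real k * infdist (torus_rep C) P)) \<in> borel_measurable \<mu>'" for k
          by (intro borel_measurable_max borel_measurable_const borel_measurable_diff borel_measurable_times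
              measurable_compose[OF rep[OF \<mu>'(1)]] borel_measurable_continuous_onI continuous_intros)
        show "AE C in \<mu>'. norm (max 0 (1 - real k * infdist (torus_rep C) P)) \<le> 1" for k
          by (intro always_eventually allI) (simp add: mult_nonneg_nonneg infdist_nonneg)
      qed (use lim in auto)
      also have "(\<integral>C. (indicator P (torus_rep C) :: real) \<partial>\<mu>') = (\<integral>C. indicator (torus_rep -` E \<inter> space \<mu>') C \<partial>\<mu>')"
      proof (rule Bochner_Integration.integral_cong[OF refl])
        fix C assume C: "C \<in> space \<mu>'"
        then have "torus_rep C \<in> unit_cube" using sp' by auto
        then show "indicator P (torus_rep C) = (indicator (torus_rep -` E \<inter> space \<mu>') C :: real)"
          using P_Q C by (auto simp: indicator_def)
      qed
      also have "\<dots> = measure (R \<mu>') E"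
      proof -
        have "E \<in> sets borel" using E(1) by (simp add: borel_compact)
        then show ?thesis unfolding R_def by (subst measure_distr[OF rep[OF \<mu>'(1)]]) auto
      qed
      finally show ?thesis .
    qed
    have "(\<integral>C. max 0 (1 - real k * infdist (torus_rep C) P) \<partial>\<mu>) = (\<integral>C. max 0 (1 - real k * infdist (torus_rep C) P) \<partial>torus)" for k
      by (rule integral_unique_invariant[OF dense \<mu>, where f = "\<lambda>x. max 0 (1 - real k * infdist x P)"])
         (auto intro!: continuous_intros simp: inf_per infdist_nonneg)
    then have "(\<lambda>k. \<integral>C. max 0 (1 - real k * infdist (torus_rep C) P) \<partial>torus) \<longlonglongrightarrow> measure (R \<mu>) E"
      using to_E[OF \<mu>(1,2)] by simp
    then show ?thesis using to_E[OF refl prob_space_torus] LIMSEQ_unique by blast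
  qed simp
  have cl: "emeasure (R \<mu>) E = emeasure (R torus) E" if "closed E" for E
  proof -
    \<comment> \<open>The cube is half open, so the part of a closed set inside it is exhausted by
      compact sets that stay away from the missing faces.\<close>
    define K where "K = (\<lambda>m::nat. E \<inter> cbox 0 (vec (1 - inverse (real (Suc m)))))"
    have K: "compact (K m)" "K m \<subseteq> unit_cube" for m
    proof -
      show "compact (K m)" unfolding K_def using that by (intro closed_Int_compact) auto
      show "K m \<subseteq> unit_cube"
      proof
        fix x assume "x \<in> K m"
        then have "0 \<le> x $ i" "x $ i \<le> 1 - inverse (real (Suc m))" for i
          by (auto simp: K_def mem_box_cart)
        moreover have "inverse (real (Suc m)) > 0" by simp
        ultimately show "x \<in> unit_cube" unfolding unit_cube_def by (smt (verit) mem_Collect_eq)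
      qed
    qed
    have inc: "incseq K"
    proof (intro incseq_SucI subsetI)
      fix m x assume x: "x \<in> K m"
      have "inverse (real (Suc (Suc m))) \<le> inverse (real (Suc m))"
        by (rule le_imp_inverse_le) auto
      moreover have "x \<in> E" "0 \<le> x $ i" "x $ i \<le> 1 - inverse (real (Suc m))" for i
        using x by (auto simp: K_def mem_box_cart)
      ultimately show "x \<in> K (Suc m)"
        unfolding K_def mem_box_cart Int_iff by (smt (verit) vec_component zero_index)
    qed
    have UN: "(\<Union>m. K m) = E \<inter> unit_cube"
    proof (intro equalityI subsetI)
      fix x assume x: "x \<in> E \<inter> unit_cube"
      have "\<forall>i. \<exists>m. x $ i \<le> 1 - inverse (real (Suc m))"
      proof
        fix i
        have "0 < 1 - x $ i" using x by (simp add: unit_cube_def)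
        then obtain m where "inverse (real (Suc m)) < 1 - x $ i" using reals_Archimedean by blast
        then show "\<exists>m. x $ i \<le> 1 - inverse (real (Suc m))" by (intro exI[of _ m]) simp
      qed
      then obtain m where m: "\<And>i. x $ i \<le> 1 - inverse (real (Suc (m i)))" by metis
      define M where "M = Max (range m)"
      have "x $ i \<le> 1 - inverse (real (Suc M))" for i
      proof -
        have "m i \<le> M" unfolding M_def by (rule Max_ge) auto
        then have "inverse (real (Suc M)) \<le> inverse (real (Suc (m i)))"
          by (intro le_imp_inverse_le) auto
        then show ?thesis using m[of i] by linarith
      qed
      then have "x \<in> K M" using x by (simp add: K_def mem_box_cart unit_cube_def)
      then show "x \<in> (\<Union>m. K m)" by blast
    qed (use K(2) in \<open>auto simp: K_def\<close>)
    have meas: "measure (R \<mu>') E = lim (\<lambda>m. measure (R \<mu>') (K m))"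
      if \<mu>': "sets \<mu>' = sets torus" "prob_space \<mu>'" for \<mu>' :: "(real^'n) set measure"
    proof -
      interpret \<mu>': prob_space \<mu>' by (rule \<mu>'(2))
      interpret R: prob_space "R \<mu>'" unfolding R_def by (rule \<mu>'.prob_space_distr[OF rep[OF \<mu>'(1)]])
      have sp': "space \<mu>' = range torus_class" using sets_eq_imp_space_eq[OF \<mu>'(1)] by simp
      have "(\<lambda>m. measure (R \<mu>') (K m)) \<longlonglongrightarrow> measure (R \<mu>') (\<Union>m. K m)"
        using K(1) inc by (intro R.finite_Lim_measure_incseq) (auto simp: R_def borel_compact)
      moreover have "measure (R \<mu>') (\<Union>m. K m) = measure (R \<mu>') E"
      proof -
        have "torus_rep -` (E \<inter> unit_cube) \<inter> space \<mu>' = torus_rep -` E \<inter> space \<mu>'" using sp' by auto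
        then show ?thesis
          unfolding UN R_def using \<open>closed E\<close>
          by (subst (1 2) measure_distr[OF rep[OF \<mu>'(1)]]) (auto intro: borel_closed)
      qed
      ultimately show ?thesis by (simp add: limI)
    qed
    interpret R1: prob_space "R \<mu>" unfolding R_def by (rule prob_space.prob_space_distr[OF \<mu>(2) rep[OF \<mu>(1)]])
    interpret R2: prob_space "R torus" unfolding R_def by (rule prob_space.prob_space_distr[OF prob_space_torus rep[OF refl]])
    have "measure (R \<mu>) E = measure (R torus) E"
      unfolding meas[OF \<mu>(1,2)] meas[OF refl prob_space_torus] using closed_eq[OF K] by simp
    then show ?thesis by (simp add: R1.emeasure_eq_measure R2.emeasure_eq_measure)
  qed
  have "R \<mu> = R torus"
  proof (rule measure_eqI_generator_eq[where E = "Collect closed" and \<Omega> = UNIV and A = "\<lambda>_. UNIV"])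
    show "Int_stable (Collect closed :: (real^'n) set set)" by (auto simp: Int_stable_def)
    show "sets (R \<mu>) = sigma_sets UNIV (Collect closed)"
      unfolding R_def sets_distr by (subst borel_eq_closed) simp
    show "sets (R torus) = sigma_sets UNIV (Collect closed)"
      unfolding R_def sets_distr by (subst borel_eq_closed) simp
    interpret R1: prob_space "R \<mu>" unfolding R_def by (rule prob_space.prob_space_distr[OF \<mu>(2) rep[OF \<mu>(1)]])
    show "emeasure (R \<mu>) UNIV \<noteq> \<infinity>" by simp
  qed (use cl in auto)
  moreover have "distr (R \<mu>') torus torus_class = \<mu>'" if \<mu>': "sets \<mu>' = sets torus" for \<mu>' :: "(real^'n) set measure"
  proof -
    have sp': "space \<mu>' = range torus_class" using sets_eq_imp_space_eq[OF \<mu>'] by simp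
    have "distr (R \<mu>') torus torus_class = distr \<mu>' torus (torus_class \<circ> torus_rep)"
      unfolding R_def by (rule distr_distr[OF measurable_torus_class rep[OF \<mu>']])
    also have "\<dots> = distr \<mu>' \<mu>' (\<lambda>C. C)"
      using \<mu>' by (intro distr_cong) (auto simp: sp' torus_class_frac_vec)
    also have "\<dots> = \<mu>'" by (rule distr_id)
    finally show ?thesis .
  qed
  ultimately show ?thesis using \<mu>(1) by metis
qed

section \<open>Codings of the rotation\<close>

lemma stream_eq_iff: "\<omega> = \<omega>' \<longleftrightarrow> (\<forall>n. \<omega> !! n = \<omega>' !! n)"
  by (metis ext stream_smap_nats)

context brun_generic
begin

definition pos :: "3 stream \<Rightarrow> nat \<Rightarrow> real^2" where
  "pos \<omega> n = (\<Sum>k<n. step (\<omega> !! k))"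

lemma pos_stake: "pos \<omega> n = coord 0 (abelianization (stake n \<omega>))"
proof (induction n)
  case 0
  have "abelianization ([] :: 3 list) = 0" by (simp add: abelianization_def vec_eq_iff)
  then show ?case by (simp add: pos_def)
next
  case (Suc n)
  have "abelianization [i] = axis i 1" for i :: 3
    by (simp add: abelianization_def vec_eq_iff axis_def)
  then have "abelianization (stake (Suc n) \<omega>) = abelianization (stake n \<omega>) + axis (\<omega> !! n) 1"
    by (simp only: stake_Suc abelianization_append)
  then show ?case using Suc by (simp add: pos_def step_def coord_add)
qed

lemma pos_rotation: "pos \<omega> n - real n *\<^sub>R rotation \<in> int_lattice"
proof -
  have "abelianization (stake n \<omega>) \<in> int_lattice" by (simp add: int_lattice_def abelianization_def)
  from coord_rotation[OF this] show ?thesis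
    by (simp add: pos_stake length_eq_total[symmetric])
qed

lemma codes_pos: "codes_point (piece 0) step \<omega> x \<longleftrightarrow> (\<forall>n. x + pos \<omega> n \<in> piece 0 (\<omega> !! n))"
  by (simp add: codes_point_def pos_def)

lemma limit_word_push:
  assumes "limit_word (sdrop n \<sigma>) \<omega>'"
  shows "\<exists>\<omega>. limit_word (sdrop 0 \<sigma>) \<omega> \<and>
    (\<forall>p. stream_prefix p \<omega>' \<longrightarrow> stream_prefix (subst_upto \<sigma> n p) \<omega>)"
  using assms
proof (induction n arbitrary: \<omega>')
  case 0
  then show ?case by auto
next
  case (Suc n)
  then have "limit_word (sdrop n \<sigma>) (subst_stream (\<sigma> !! n) \<omega>')" using limit_word_Suc by blast
  from Suc.IH[OF this] obtain \<omega> where w: "limit_word (sdrop 0 \<sigma>) \<omega>"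
    "\<And>p. stream_prefix p (subst_stream (\<sigma> !! n) \<omega>') \<Longrightarrow> stream_prefix (subst_upto \<sigma> n p) \<omega>"
    by blast
  have "stream_prefix (subst_upto \<sigma> (Suc n) p) \<omega>" if "stream_prefix p \<omega>'" for p
    using w(2)[OF stream_prefix_subst[OF nonempty that]] by simp
  then show ?case using w(1) by blast
qed

text \<open>The letter \<open>i\<close> starts a limit word of the shifted sequence. Pushing this
  word down puts the image of \<open>i\<close> at the start of a limit word of the sequence
  itself.\<close>

lemma factor_limit_word:
  assumes "sublist w (subst_upto \<sigma> n [i])"
  obtains p \<omega> where "limit_word (sdrop 0 \<sigma>) \<omega>" "stream_prefix (p @ w) \<omega>"
proof -
  obtain \<omega>' where w': "limit_word (sdrop n \<sigma>) \<omega>'" "shd \<omega>' = i" by (rule limit_word_starting)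
  then have "stream_prefix [i] \<omega>'" by (simp add: stream_prefix_def)
  with limit_word_push[OF w'(1)] obtain \<omega> where \<omega>: "limit_word (sdrop 0 \<sigma>) \<omega>"
    "stream_prefix (subst_upto \<sigma> n [i]) \<omega>" by blast
  obtain p q where "subst_upto \<sigma> n [i] = p @ w @ q" using assms by (auto simp: sublist_def)
  then have "stream_prefix (p @ w) \<omega>" using \<omega>(2) by (auto simp: stream_prefix_iff)
  with \<omega>(1) show ?thesis by (rule that)
qed

text \<open>Converse direction: at a deep enough level the image of a single letter is longer than
  the prefix in question.\<close>

lemma limit_word_factor:
  assumes "limit_word (sdrop 0 \<sigma>) \<omega>"
  shows "\<exists>n a. sublist (stake m (sdrop k \<omega>)) (subst_upto \<sigma> n [a])"
proof -
  obtain k0 where k0: "\<And>i. k + m \<le> length (subst_upto (sdrop 0 \<sigma>) k0 [i])"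
    using length_subst_grows[of "k + m" 0] by blast
  obtain \<omega>' where w': "\<And>p. stream_prefix p \<omega>' \<Longrightarrow> stream_prefix (subst_upto (sdrop 0 \<sigma>) k0 p) \<omega>"
    using limit_word_add[OF assms, of k0] by blast
  define v where "v = subst_upto \<sigma> k0 [shd \<omega>']"
  have "stream_prefix v \<omega>" using w'[of "[shd \<omega>']"] by (simp add: v_def stream_prefix_def)
  moreover have len: "k + m \<le> length v" using k0 by (simp add: v_def)
  ultimately have "stake (k + m) \<omega> = take (k + m) v"
    unfolding stream_prefix_def by (metis min_absorb1 take_stake)
  then have "stake k \<omega> @ stake m (sdrop k \<omega>) = take (k + m) v" by (simp only: stake_add)
  then have "v = stake k \<omega> @ stake m (sdrop k \<omega>) @ drop (k + m) v"
    by (metis append.assoc append_take_drop_id)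
  then have "sublist (stake m (sdrop k \<omega>)) v" unfolding sublist_def by blast
  then show ?thesis unfolding v_def by blast
qed

lemma limit_word_codes:
  assumes "limit_word (sdrop 0 \<sigma>) \<omega>" "stream_prefix p \<omega>"
  shows "codes_point (piece 0) step (sdrop (length p) \<omega>) (coord 0 (abelianization p))"
  unfolding codes_pos
proof
  fix n
  let ?v = "sdrop (length p) \<omega>"
  have \<omega>: "\<omega> = p @- ?v" using assms(2) by (metis stream_prefix_def stake_sdrop)
  have "?v = stake (Suc n) ?v @- sdrop (Suc n) ?v" by (rule stake_sdrop[symmetric])
  then have "\<omega> = ((p @ stake n ?v) @ [?v !! n]) @- sdrop (Suc n) ?v"
    using \<omega> by (metis append.assoc shift_append stake_Suc)
  then have "stream_prefix ((p @ stake n ?v) @ [?v !! n]) \<omega>" unfolding stream_prefix_iff by blast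
  then have "abelianization (p @ stake n ?v) \<in> prefix_points 0 (?v !! n)"
    unfolding prefix_points_def using assms(1) by blast
  from closure_subset[THEN subsetD, OF imageI[OF this, of "coord 0"]]
  have "coord 0 (abelianization (p @ stake n ?v)) \<in> piece 0 (?v !! n)"
    unfolding piece_def .
  then show "coord 0 (abelianization p) + pos ?v n \<in> piece 0 (?v !! n)"
    by (simp add: pos_stake abelianization_append coord_add)
qed

text \<open>The points consistent with the first \<open>m + 1\<close> letters form nested compact
  sets. They are nonempty, because such a prefix occurs in a limit word, after some
  \<open>p\<close>, and there the projection of \<open>p\<close> codes it.\<close>

lemma sadic_shift_coded:
  assumes "\<omega> \<in> sadic_shift \<sigma>"
  shows "\<exists>x. codes_point (piece 0) step \<omega> x"
proof -
  define F where "F = (\<lambda>m. \<Inter>k\<in>{..m}. (+) (- pos \<omega> k) ` piece 0 (\<omega> !! k))"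
  have memF: "x \<in> F m \<longleftrightarrow> (\<forall>k\<le>m. x + pos \<omega> k \<in> piece 0 (\<omega> !! k))" for x m
  proof -
    have "x \<in> (+) (- pos \<omega> k) ` piece 0 (\<omega> !! k) \<longleftrightarrow> x + pos \<omega> k \<in> piece 0 (\<omega> !! k)" for k
      by (force intro: image_eqI[of _ _ "x + pos \<omega> k"])
    then show ?thesis by (auto simp: F_def)
  qed
  have "\<Inter>(range F) \<noteq> {}"
  proof (rule compact_nest)
    show "compact (F m)" for m
      unfolding F_def using compact_translation[OF compact_piece] by (intro compact_Inter) blast+
    show "F m \<noteq> {}" for m
    proof -
      obtain n i where "sublist (stake (Suc m) (sdrop 0 \<omega>)) (subst_upto \<sigma> n [i])"
        using assms unfolding sadic_shift_def by blast
      then obtain p \<omega>' where w': "limit_word (sdrop 0 \<sigma>) \<omega>'" "stream_prefix (p @ stake (Suc m) \<omega>) \<omega>'"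
        using factor_limit_word by (metis sdrop.simps(1))
      have pre: "stream_prefix p \<omega>'" using w'(2) by (auto simp: stream_prefix_iff)
      have v: "stake (Suc m) (sdrop (length p) \<omega>') = stake (Suc m) \<omega>"
      proof -
        obtain \<omega>'' where "\<omega>' = p @- (stake (Suc m) \<omega> @- \<omega>'')" using w'(2) by (auto simp: stream_prefix_iff)
        then show ?thesis by (simp add: sdrop_shift stake_shift del: stake.simps)
      qed
      have nth: "sdrop (length p) \<omega>' !! k = \<omega> !! k" if "k \<le> m" for k
        using that v by (metis le_imp_less_Suc stake_nth)
      have "coord 0 (abelianization p) + pos \<omega> k \<in> piece 0 (\<omega> !! k)" if "k \<le> m" for k
      proof -
        have "pos (sdrop (length p) \<omega>') k = pos \<omega> k"
          unfolding pos_def using nth that by (intro sum.cong) auto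
        then show ?thesis using limit_word_codes[OF w'(1) pre] nth[OF that] unfolding codes_pos by metis
      qed
      then have "coord 0 (abelianization p) \<in> F m" unfolding memF by blast
      then show ?thesis by blast
    qed
    show "F n \<subseteq> F m" if "m \<le> n" for m n 
    proof
      fix x assume "x \<in> F n"
      then show "x \<in> F m" using that unfolding memF by (meson order.trans)
    qed
  qed
  then obtain x where "\<And>m. x \<in> F m" by blast
  then have "codes_point (piece 0) step \<omega> x" unfolding memF codes_pos by blast
  then show ?thesis by blast
qed

text \<open>The orbit of \<open>x\<close> is dense in every piece, so \<open>y - x\<close> translates every piece into itself.\<close>
lemma codes_point_unique:
  assumes "codes_point (piece 0) step \<omega> x" "codes_point (piece 0) step \<omega> y"
  shows "x = y"
proof -
  define i where "i = (1 :: 3)"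
  define v where "v = y - x"
  have open_case: "\<xi> + v \<in> piece 0 i" if \<xi>: "\<xi> \<in> interior (piece 0 i)" for \<xi>
  proof -
    have "\<exists>z\<in>piece 0 i. dist z (\<xi> + v) < e" if e: "0 < e" for e
    proof -
      let ?U = "interior (piece 0 i) \<inter> ball \<xi> (e / 2)"
      have "open ?U" "?U \<noteq> {}" using \<xi> e by auto
      then have "\<not> negligible ?U" using open_not_negligible by blast
      then obtain \<zeta> where \<zeta>: "\<zeta> \<in> ?U" "simple_point \<zeta>"
        using negligible_subset[OF negligible_not_simple] by blast
      define W where "W = \<Union>(tile 0 ` (surface (height 0) - {(lift 0, i)}))"
      have clW: "closed W" unfolding W_def by (rule closed_Union_tile_0) auto
      have tile_W: "\<eta> \<in> W" if "\<eta> - l \<in> piece 0 j" "l \<in> int_lattice" "(l, j) \<noteq> (0, i)" for \<eta> l j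
      proof -
        have "(lift l, j) \<in> surface (height 0) - {(lift 0, i)}"
          using that(2,3) injD[OF inj_lift] unfolding Diff_iff lift_in_surface by auto
        then show ?thesis unfolding W_def using that(1) tile_0_lift by blast
      qed
      have "\<zeta> \<notin> W"
      proof
        assume "\<zeta> \<in> W"
        then obtain q where q: "q \<in> surface (height 0)" "q \<noteq> (lift 0, i)" "\<zeta> \<in> tile 0 q"
          unfolding W_def by blast
        obtain z j where zj: "q = (z, j)" by (cases q)
        have "z \<in> int_lattice \<and> total z = 0" using q(1) unfolding zj height_0 surface_vec_1 .
        then have z: "z = lift (coord 0 z)" by (simp add: coord_total_0)
        then have l: "coord 0 z \<in> int_lattice" "\<zeta> - coord 0 z \<in> piece 0 j"
          using q zj tile_0_lift[of \<zeta> "coord 0 z" j] lift_in_surface[of "coord 0 z" j] by auto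
        have "\<zeta> - 0 \<in> piece 0 i" using \<zeta>(1) interior_subset by auto
        then have "coord 0 z = 0" "j = i" using \<zeta>(2) l unfolding simple_point_def by (metis zero_int_lattice)+
        then show False using q(2) zj z by simp
      qed
      then have "\<zeta> \<in> - W" by simp
      moreover have "open (- W)" using clW by auto
      ultimately obtain d where d: "0 < d" "ball \<zeta> d \<subseteq> - W" by (metis open_contains_ball)
      obtain m l where ml: "l \<in> int_lattice" "norm (\<zeta> - x - l - real m *\<^sub>R rotation) < min d (e / 2)"
      proof -
        have "0 < min d (e / 2)" using d(1) e by simp
        then show ?thesis by (rule rotation_dense) (rule that)
      qed
      define k where "k = l - (pos \<omega> m - real m *\<^sub>R rotation)"
      have k: "k \<in> int_lattice" unfolding k_def by (intro int_lattice_diff ml(1) pos_rotation)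
      have near: "dist \<zeta> (x + pos \<omega> m + k) < min d (e / 2)"
        using ml(2) by (simp add: k_def dist_norm algebra_simps)
      then have "x + pos \<omega> m + k \<notin> W" using d(2) by auto
      moreover have "(x + pos \<omega> m + k) - k \<in> piece 0 (\<omega> !! m)" using assms(1) by (simp add: codes_pos)
      ultimately have "k = 0" "\<omega> !! m = i" using tile_W[OF _ k] by blast+
      then have "y + pos \<omega> m \<in> piece 0 i" "dist \<zeta> (x + pos \<omega> m) < e / 2"
        using assms(2) near unfolding codes_pos by (metis, simp)
      moreover have "dist (y + pos \<omega> m) (\<xi> + v) \<le> dist (x + pos \<omega> m) \<zeta> + dist \<zeta> \<xi>"
      proof -
        have "dist (y + pos \<omega> m) (\<xi> + v) = dist (x + pos \<omega> m) \<xi>"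
          by (simp add: dist_norm v_def algebra_simps)
        then show ?thesis using dist_triangle by metis
      qed
      moreover have "dist \<zeta> \<xi> < e / 2" using \<zeta>(1) by (simp add: dist_commute)
      ultimately show ?thesis by (intro bexI[of _ "y + pos \<omega> m"]) (auto simp: dist_commute)
    qed
    then have "\<xi> + v \<in> closure (piece 0 i)" by (simp add: closure_approachable)
    then show ?thesis by (simp add: compact_imp_closed[OF compact_piece] closure_closed)
  qed
  have shift: "\<xi> + v \<in> piece 0 i" if "\<xi> \<in> piece 0 i" for \<xi>
  proof -
    have "closed ((\<lambda>\<xi>. \<xi> + v) -` piece 0 i)"
      by (rule closed_vimage[OF compact_imp_closed[OF compact_piece]]) (intro continuous_intros)
    then have "closure (interior (piece 0 i)) \<subseteq> (\<lambda>\<xi>. \<xi> + v) -` piece 0 i"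
      using open_case by (intro closure_minimal) auto
    then show ?thesis using that unfolding piece_closure_interior by blast
  qed
  have mem: "real n *\<^sub>R v \<in> piece 0 i" for n
  proof (induction n)
    case (Suc n)
    then show ?case using shift[of "real n *\<^sub>R v"] by (simp add: algebra_simps)
  qed (simp add: zero_piece)
  have bnd: "real n * norm v \<le> 2 * (\<Sum>l. rate 0 l)" for n using norm_piece[OF mem[of n]] by simp
  have "norm v = 0"
  proof (rule ccontr)
    assume "norm v \<noteq> 0"
    then have "0 < norm v" by simp
    then obtain n where "2 * (\<Sum>l. rate 0 l) < real n * norm v" using reals_Archimedean3 by blast
    then show False using bnd[of n] by simp
  qed
  then show ?thesis by (simp add: v_def)
qed

section \<open>Words and points determine each other\<close>

definition coded_point :: "3 stream \<Rightarrow> real^2" where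
  "coded_point \<omega> = (THE x. codes_point (piece 0) step \<omega> x)"

lemma coded_point_eqI: "codes_point (piece 0) step \<omega> x \<Longrightarrow> coded_point \<omega> = x"
  unfolding coded_point_def using codes_point_unique by blast

lemma coded_point_codes: "\<omega> \<in> sadic_shift \<sigma> \<Longrightarrow> codes_point (piece 0) step \<omega> (coded_point \<omega>)"
  using sadic_shift_coded coded_point_eqI by metis

lemma stl_sadic_shift: "\<omega> \<in> sadic_shift \<sigma> \<Longrightarrow> stl \<omega> \<in> sadic_shift \<sigma>"
  unfolding sadic_shift_def mem_Collect_eq sdrop.simps(2)[symmetric] by blast

lemma coded_point_stl:
  assumes "\<omega> \<in> sadic_shift \<sigma>"
  shows "coded_point (stl \<omega>) = coded_point \<omega> + step (shd \<omega>)"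
proof (rule coded_point_eqI)
  have "pos \<omega> (Suc n) = step (shd \<omega>) + pos (stl \<omega>) n" for n
    unfolding pos_def by (simp add: sum.lessThan_Suc_shift del: sum.lessThan_Suc)
  then show "codes_point (piece 0) step (stl \<omega>) (coded_point \<omega> + step (shd \<omega>))"
    using coded_point_codes[OF assms] unfolding codes_pos by (metis add.assoc snth.simps(2))
qed

text \<open>On simple points this is the letter of the only piece containing the point modulo the
  lattice. Elsewhere the first match is taken, with 3 as default, which gives an everywhere defined
  Borel function.\<close>

definition letter :: "real^2 \<Rightarrow> 3" where
  "letter \<xi> = (if \<exists>l\<in>int_lattice. \<xi> - l \<in> piece 0 1 then 1
     else if \<exists>l\<in>int_lattice. \<xi> - l \<in> piece 0 2 then 2 else 3)"

lemma letter_eqI: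
  assumes "simple_point \<xi>" "l \<in> int_lattice" "\<xi> - l \<in> piece 0 i"
  shows "letter \<xi> = i"
proof -
  have "j = i" if "l' \<in> int_lattice" "\<xi> - l' \<in> piece 0 j" for l' j
    using assms that unfolding simple_point_def by blast
  then have "(\<exists>l\<in>int_lattice. \<xi> - l \<in> piece 0 j) \<longleftrightarrow> j = i" for j
    using assms(2,3) by blast
  then show ?thesis using exhaust_3[of i] by (auto simp: letter_def)
qed

lemma letter_translate:
  assumes "k \<in> int_lattice"
  shows "letter (\<xi> + k) = letter \<xi>"
proof -
  have "(\<exists>l\<in>int_lattice. \<xi> + k - l \<in> piece 0 i) \<longleftrightarrow> (\<exists>l\<in>int_lattice. \<xi> - l \<in> piece 0 i)" (is "?L \<longleftrightarrow> ?R") for i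
  proof
    assume ?L
    then obtain l where l: "l \<in> int_lattice" "\<xi> + k - l \<in> piece 0 i" by blast
    then have "l - k \<in> int_lattice" "\<xi> - (l - k) \<in> piece 0 i"
      using int_lattice_diff assms by (auto simp: algebra_simps)
    then show ?R by blast
  next
    assume ?R
    then obtain l where l: "l \<in> int_lattice" "\<xi> - l \<in> piece 0 i" by blast
    then have "l + k \<in> int_lattice" "\<xi> + k - (l + k) \<in> piece 0 i"
      using int_lattice_add assms by auto
    then show ?L by blast
  qed
  then show ?thesis by (simp add: letter_def)
qed

definition coding :: "real^2 \<Rightarrow> 3 stream" where
  "coding \<xi> = smap (\<lambda>n. letter (\<xi> + real n *\<^sub>R rotation)) nats"

lemma coding_nth [simp]: "coding \<xi> !! n = letter (\<xi> + real n *\<^sub>R rotation)"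
  by (simp add: coding_def)

lemma coding_translate: "k \<in> int_lattice \<Longrightarrow> coding (\<xi> + k) = coding \<xi>"
  using letter_translate[of k "\<xi> + real n *\<^sub>R rotation" for n]
  by (intro stream_eq_iff[THEN iffD2] allI) (simp add: algebra_simps)

lemma coding_sdrop: "coding (\<xi> + real k *\<^sub>R rotation) = sdrop k (coding \<xi>)"
  by (intro stream_eq_iff[THEN iffD2] allI) (simp add: sdrop_snth algebra_simps)

text \<open>Words are one-sided, so only the forward orbit has to avoid the overlaps.\<close>

definition good :: "real^2 \<Rightarrow> bool" where
  "good \<xi> \<longleftrightarrow> (\<forall>n. simple_point (\<xi> + real n *\<^sub>R rotation))"

lemma good_translate: 
  assumes "l \<in> int_lattice"
  shows "good (\<xi> + l) \<longleftrightarrow> good \<xi>"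
proof -
  have "\<xi> + l + real n *\<^sub>R rotation = (\<xi> + real n *\<^sub>R rotation) + l" for n by simp
  then show ?thesis unfolding good_def using simple_point_translate[OF assms] by metis
qed

lemma good_rotation: "good \<xi> \<Longrightarrow> good (\<xi> + real k *\<^sub>R rotation)"
  unfolding good_def by (metis add.assoc of_nat_add scaleR_add_left)

lemma AE_good: "AE \<xi> in lborel. good \<xi>"
  unfolding good_def by (rule AE_all_countable[THEN iffD2]) (intro allI AE_simple_point)

lemma coding_nth_eqI:
  assumes "good \<xi>" "\<xi> + pos \<omega> n \<in> piece 0 i"
  shows "coding \<xi> !! n = i"
proof -
  have "\<xi> + real n *\<^sub>R rotation - (- (pos \<omega> n - real n *\<^sub>R rotation)) \<in> piece 0 i"
    using assms(2) by (simp add: algebra_simps)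
  moreover have "- (pos \<omega> n - real n *\<^sub>R rotation) \<in> int_lattice"
    using pos_rotation[of \<omega> n] by (subst int_lattice_uminus)
  ultimately show ?thesis
    using letter_eqI assms(1) unfolding good_def coding_nth by blast
qed

lemma coding_coded_point:
  assumes "\<omega> \<in> sadic_shift \<sigma>" "good (coded_point \<omega>)"
  shows "coding (coded_point \<omega>) = \<omega>"
  using coding_nth_eqI[OF assms(2)] coded_point_codes[OF assms(1)]
  unfolding codes_pos stream_eq_iff by blast

lemma coding_codes:
  assumes "good \<xi>" "\<xi> \<in> piece 0 i"
  shows "codes_point (piece 0) step (coding \<xi>) \<xi>"
  unfolding codes_pos
proof
  fix n
  have "\<exists>i. \<xi> + pos (coding \<xi>) n \<in> piece 0 i"
  proof (induction n)
    case 0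
    then show ?case using assms(2) by (auto simp: pos_def)
  next
    case (Suc n)
    then obtain i where i: "\<xi> + pos (coding \<xi>) n \<in> piece 0 i" by blast
    have "pos (coding \<xi>) (Suc n) = pos (coding \<xi>) n + step i"
      using coding_nth_eqI[OF assms(1) i] by (simp add: pos_def)
    then show ?case using piece_exchange[OF i] by (simp add: add.assoc)
  qed
  then show "\<xi> + pos (coding \<xi>) n \<in> piece 0 (coding \<xi> !! n)"
    using coding_nth_eqI[OF assms(1)] by metis
qed

text \<open>Along the orbit of a good point each of the first \<open>m\<close> pieces is hit alone,
  and the others are closed, so all nearby points have the same first \<open>m\<close> letters.
  Prefix points are dense in the piece, and near \<open>\<xi>\<close> one of them belongs to a limit
  word.\<close>

lemma coding_prefix_factor:
  assumes "good \<xi>" "\<xi> \<in> piece 0 i"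
  shows "\<exists>n a. sublist (stake m (coding \<xi>)) (subst_upto \<sigma> n [a])"
proof -
  let ?c = "coding \<xi>"
  have "\<forall>\<^sub>F x in nhds \<xi>. \<forall>j. x + pos ?c n \<in> piece 0 j \<longrightarrow> j = ?c !! n" for n
  proof -
    let ?V = "(\<lambda>x. x + pos ?c n) -` (\<Union>j\<in>UNIV - {?c !! n}. piece 0 j)"
    have "closed (\<Union>j\<in>UNIV - {?c !! n}. piece 0 j)"
      by (rule closed_UN) (auto intro: compact_imp_closed compact_piece)
    then have "closed ?V" by (rule closed_vimage) (intro continuous_intros)
    then have "open (- ?V)" by auto
    moreover have "\<xi> \<in> - ?V" using coding_nth_eqI[OF assms(1)] by auto
    ultimately have "\<forall>\<^sub>F x in nhds \<xi>. x \<in> - ?V" by (rule eventually_nhds_in_open)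
    then show ?thesis by (rule eventually_mono) auto
  qed
  then have "\<forall>\<^sub>F x in nhds \<xi>. \<forall>n\<in>{..<m}. \<forall>j. x + pos ?c n \<in> piece 0 j \<longrightarrow> j = ?c !! n"
    by (intro eventually_ball_finite) auto
  then obtain U where U: "open U" "\<xi> \<in> U"
    "\<And>x n j. x \<in> U \<Longrightarrow> n < m \<Longrightarrow> x + pos ?c n \<in> piece 0 j \<Longrightarrow> j = ?c !! n"
    unfolding eventually_nhds by (metis lessThan_iff)
  have "U \<inter> coord 0 ` prefix_points 0 i \<noteq> {}"
    using assms(2) U(1,2) unfolding piece_def closure_iff_nhds_not_empty by blast
  then obtain p \<omega> where p: "limit_word (sdrop 0 \<sigma>) \<omega>" "stream_prefix (p @ [i]) \<omega>"
    "coord 0 (abelianization p) \<in> U"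
    unfolding prefix_points_def by blast
  have pre: "stream_prefix p \<omega>" using p(2) by (auto simp: stream_prefix_iff)
  let ?v = "sdrop (length p) \<omega>"
  note codes = limit_word_codes[OF p(1) pre, unfolded codes_pos, rule_format]
  have "stake n ?v = stake n ?c" if "n \<le> m" for n
    using that
  proof (induction n)
    case (Suc n)
    then have IH: "stake n ?v = stake n ?c" by simp
    then have "pos ?v n = pos ?c n" by (simp add: pos_stake)
    then have "?v !! n = ?c !! n" using U(3)[OF p(3), of n] codes[of n] Suc.prems by simp
    then show ?case using IH by (simp only: stake_Suc)
  qed simp
  from this[of m] show ?thesis using limit_word_factor[OF p(1), of m "length p"] by simp
qed

lemma coding_in_sadic_shift:
  assumes "good \<xi>"
  shows "coding \<xi> \<in> sadic_shift \<sigma>"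
proof -
  have "\<exists>n a. sublist (stake m (sdrop k (coding \<xi>))) (subst_upto \<sigma> n [a])" for k m
  proof -
    obtain l i where l: "l \<in> int_lattice" "(\<xi> + real k *\<^sub>R rotation) - l \<in> piece 0 i"
      using pieces_cover by blast
    let ?x = "(\<xi> + real k *\<^sub>R rotation) + - l"
    have l': "- l \<in> int_lattice" using l(1) by simp
    have "good ?x" using good_rotation[OF assms] good_translate[OF l'] by blast
    moreover have "coding ?x = sdrop k (coding \<xi>)" unfolding coding_translate[OF l'] coding_sdrop ..
    ultimately show ?thesis using coding_prefix_factor[of ?x i m] l(2) by simp
  qed
  then show ?thesis unfolding sadic_shift_def by blast
qed

text \<open>The two points agree only modulo the lattice, since \<open>\<xi>\<close> need not lie in
  the pieces while the coded point does.\<close>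

lemma coded_point_coding:
  assumes "good \<xi>"
  shows "coded_point (coding \<xi>) - \<xi> \<in> int_lattice"
proof -
  obtain l i where l: "l \<in> int_lattice" "\<xi> - l \<in> piece 0 i" using pieces_cover by blast
  have l': "- l \<in> int_lattice" using l(1) by simp
  have "good (\<xi> + - l)" using assms good_translate[OF l'] by blast
  moreover have "\<xi> + - l \<in> piece 0 i" using l(2) by simp
  ultimately have "coded_point (coding (\<xi> + - l)) = \<xi> + - l"
    by (intro coded_point_eqI coding_codes)
  then show ?thesis using l' unfolding coding_translate[OF l'] by simp
qed

end

section \<open>The S-adic shift as a rotation\<close>

context brun_generic
begin

abbreviation words :: "3 stream measure" where
  "words \<equiv> restrict_space (stream_space (count_space UNIV)) (sadic_shift \<sigma>)"

lemma space_words: "space words = sadic_shift \<sigma>"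
  by (simp add: space_restrict_space space_stream_space)

lemma measurable_stl_words: "stl \<in> measurable words words"
proof (rule measurable_restrict_space2)
  show "stl \<in> space words \<rightarrow> sadic_shift \<sigma>" using stl_sadic_shift by (auto simp: space_words)
  show "stl \<in> measurable words (stream_space (count_space UNIV))"
    by (rule measurable_restrict_space1) measurable
qed

text \<open>
  By compactness, \<open>coded_point \<omega> \<in> F\<close> is a countable conjunction of conditions on prefixes of \<open>\<omega>\<close>.
\<close>
lemma coded_point_closed_iff:
  assumes "closed F" and \<omega>: "\<omega> \<in> sadic_shift \<sigma>"
  shows "coded_point \<omega> \<in> F \<longleftrightarrow> (\<forall>m. \<exists>x\<in>F. \<forall>k\<le>m. x + pos \<omega> k \<in> piece 0 (\<omega> !! k))"
proof
  assume "coded_point \<omega> \<in> F"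
  then show "\<forall>m. \<exists>x\<in>F. \<forall>k\<le>m. x + pos \<omega> k \<in> piece 0 (\<omega> !! k)"
    using coded_point_codes[OF \<omega>] unfolding codes_pos by blast
next
  assume R: "\<forall>m. \<exists>x\<in>F. \<forall>k\<le>m. x + pos \<omega> k \<in> piece 0 (\<omega> !! k)"
  define G where "G = (\<lambda>m. F \<inter> (\<Inter>k\<in>{..m}. (\<lambda>x. x + pos \<omega> k) -` piece 0 (\<omega> !! k)))"
  have memG: "x \<in> G m \<longleftrightarrow> x \<in> F \<and> (\<forall>k\<le>m. x + pos \<omega> k \<in> piece 0 (\<omega> !! k))" for x m
    by (auto simp: G_def)
  have "\<Inter>(range G) \<noteq> {}"
  proof (rule compact_nest)
    fix m
    have "closed ((\<lambda>x. x + pos \<omega> k) -` piece 0 (\<omega> !! k))" for k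
      by (rule closed_vimage[OF compact_imp_closed[OF compact_piece]]) (intro continuous_intros)
    then have "closed (G m)" unfolding G_def using assms(1) by (intro closed_Int closed_INT) auto
    moreover have "G m \<subseteq> piece 0 (\<omega> !! 0)"
    proof
      fix x assume "x \<in> G m"
      then have "x + pos \<omega> 0 \<in> piece 0 (\<omega> !! 0)" unfolding memG by blast
      then show "x \<in> piece 0 (\<omega> !! 0)" by (simp add: pos_def)
    qed
    ultimately show "compact (G m)"
      using compact_Int_closed[OF compact_piece[of 0 "\<omega> !! 0"], of "G m"] by (simp add: inf.absorb2)
    show "G m \<noteq> {}" using R memG by blast
    show "G n \<subseteq> G m" if "m \<le> n" for n m
    proof
      fix x assume "x \<in> G n"
      then show "x \<in> G m" using that unfolding memG by (meson order.trans)
    qed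
  qed
  then obtain x where x: "\<And>m. x \<in> G m" by blast
  then have "codes_point (piece 0) step \<omega> x" unfolding codes_pos memG by blast
  then show "coded_point \<omega> \<in> F" using x coded_point_eqI unfolding memG by metis
qed

lemma measurable_coded_point: "coded_point \<in> measurable words borel"
proof (rule measurable_sigma_sets[where A = "Collect closed" and \<Omega> = UNIV])
  show "sets borel = sigma_sets UNIV (Collect closed :: (real^2) set set)" by (subst borel_eq_closed) simp
  fix F :: "(real^2) set" assume "F \<in> Collect closed"
  then have F: "closed F" by simp
  define S where "S = (\<lambda>m. {w :: 3 list. \<exists>x\<in>F. \<forall>k\<le>m. x + coord 0 (abelianization (take k w)) \<in> piece 0 (w ! k)})"
  have "coded_point \<omega> \<in> F \<longleftrightarrow> (\<forall>m. stake (Suc m) \<omega> \<in> S m)" if "\<omega> \<in> sadic_shift \<sigma>" for \<omega>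
  proof -
    have "stake (Suc m) \<omega> ! k = \<omega> !! k" "take k (stake (Suc m) \<omega>) = stake k \<omega>" if "k \<le> m" for k m
      using that stake_nth[of k "Suc m" \<omega>] take_stake[of k "Suc m" \<omega>] by (auto simp: min_absorb1 simp del: stake.simps)
    then have "stake (Suc m) \<omega> \<in> S m \<longleftrightarrow> (\<exists>x\<in>F. \<forall>k\<le>m. x + pos \<omega> k \<in> piece 0 (\<omega> !! k))" for m
      by (simp add: S_def pos_stake del: stake.simps)
    then show ?thesis unfolding coded_point_closed_iff[OF F that] by blast
  qed
  then have "coded_point -` F \<inter> space words = {\<omega> \<in> space words. \<forall>m. stake (Suc m) \<omega> \<in> S m}"
    unfolding space_words by blast
  also have "\<dots> \<in> sets words"
  proof -
    have "stake (Suc m) \<in> measurable words (count_space UNIV)" for m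
      by (intro measurable_restrict_space1 measurable_stake)
    from measurable_sets[OF this] have "{\<omega> \<in> space words. stake (Suc m) \<omega> \<in> S m} \<in> sets words" for m
      by (simp add: vimage_def Int_def conj_commute del: stake.simps)
    then show ?thesis by (rule sets.sets_Collect_countable_All)
  qed
  finally show "coded_point -` F \<inter> space words \<in> sets words" .
qed auto

lemma measurable_letter: "letter \<in> measurable borel (count_space UNIV)"
proof -
  have "{\<xi>. \<exists>l\<in>int_lattice. \<xi> - l \<in> piece 0 i} \<in> sets borel" for i
  proof -
    have "{\<xi>. \<exists>l\<in>int_lattice. \<xi> - l \<in> piece 0 i} = (\<Union>l\<in>int_lattice. (\<lambda>\<xi>. \<xi> - l) -` piece 0 i)" by auto
    moreover have "(\<lambda>\<xi>. \<xi> - l) -` piece 0 i \<in> sets borel" for l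
      by (intro borel_closed closed_vimage[OF compact_imp_closed[OF compact_piece]] continuous_intros)
    ultimately show ?thesis using countable_int_lattice by auto
  qed
  then have [measurable]: "Measurable.pred borel (\<lambda>\<xi>. \<exists>l\<in>int_lattice. \<xi> - l \<in> piece 0 i)" for i
    by (simp add: pred_def)
  show ?thesis unfolding letter_def by measurable
qed

lemma measurable_coding: "coding \<in> measurable borel (stream_space (count_space UNIV))"
proof (rule measurable_stream_space2)
  fix n
  have "(\<lambda>\<xi>. letter (\<xi> + real n *\<^sub>R rotation)) \<in> measurable borel (count_space UNIV)"
    by (rule measurable_compose[OF _ measurable_letter]) measurable
  then show "(\<lambda>\<xi>. coding \<xi> !! n) \<in> measurable borel (count_space UNIV)" by simp
qed

lemma borel_good: "{\<xi>. good \<xi>} \<in> sets borel"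
proof -
  have "{\<xi>. good \<xi>} = (\<Inter>n. - ((\<lambda>\<xi>. \<xi> + real n *\<^sub>R rotation) -` {\<xi>. \<not> simple_point \<xi>}))"
    by (auto simp: good_def)
  also have "\<dots> \<in> sets borel"
  proof -
    have "(\<lambda>\<xi>. \<xi> + real n *\<^sub>R rotation) -` {\<xi>. \<not> simple_point \<xi>} \<inter> space borel \<in> sets borel" for n
      by (rule measurable_sets[OF _ borel_not_simple]) measurable
    then have "- ((\<lambda>\<xi>. \<xi> + real n *\<^sub>R rotation) -` {\<xi>. \<not> simple_point \<xi>}) \<in> sets borel" for n
      by (metis borel_comp inf_top.right_neutral space_borel)
    then show ?thesis by (intro sets.countable_INT) auto
  qed
  finally show ?thesis .
qed

abbreviation good_classes :: "(real^2) set set" where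
  "good_classes \<equiv> torus_class ` {\<xi>. good \<xi>}"

lemma torus_class_good: "torus_class \<xi> \<in> good_classes \<longleftrightarrow> good \<xi>"
proof
  assume "torus_class \<xi> \<in> good_classes"
  then obtain \<eta> where "good \<eta>" "\<xi> - \<eta> \<in> int_lattice" by (auto simp: torus_class_eq_iff)
  then show "good \<xi>" using good_translate[of "\<xi> - \<eta>" \<eta>] by simp
qed blast

lemma good_classes_torus: "good_classes \<in> sets torus"
proof -
  have "torus_class -` good_classes = {\<xi>. good \<xi>}" using torus_class_good by blast
  then show ?thesis using borel_good by (auto simp: sets_torus)
qed

lemma AE_good_classes: "AE C in torus. C \<in> good_classes"
proof (rule AE_I)
  have B: "space torus - good_classes \<in> sets torus" using good_classes_torus by blast
  show "{C \<in> space torus. C \<notin> good_classes} \<subseteq> space torus - good_classes" by blast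
  have "emeasure torus (space torus - good_classes) = emeasure lborel (torus_class -` (space torus - good_classes) \<inter> unit_cube)"
    by (rule emeasure_torus[OF B])
  also have "\<dots> \<le> emeasure lborel (space lborel - {\<xi>. good \<xi>})"
    using borel_good torus_class_good by (intro emeasure_mono) auto
  also have "\<dots> = 0"
  proof -
    have "space lborel - {\<xi>. good \<xi>} \<in> sets lborel" using borel_good by auto
    moreover have "{\<xi> \<in> space lborel. \<not> good \<xi>} = space lborel - {\<xi>. good \<xi>}" by auto
    ultimately show ?thesis using AE_iff_measurable AE_good by blast
  qed
  finally show "emeasure torus (space torus - good_classes) = 0" by simp
  show "space torus - good_classes \<in> sets torus" by (rule B)
qed

text \<open>Off the good classes the value is an arbitrary word of the shift, so the map goes into
  \<open>words\<close> everywhere and the image of Haar measure is defined on it.\<close>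

definition word_of :: "(real^2) set \<Rightarrow> 3 stream" where
  "word_of C = (if C \<in> good_classes then coding (torus_rep C) else (SOME \<omega>. \<omega> \<in> sadic_shift \<sigma>))"

definition class_of :: "3 stream \<Rightarrow> (real^2) set" where
  "class_of \<omega> = torus_class (coded_point \<omega>)"

lemma word_of_class: 
  assumes "good \<xi>"
  shows "word_of (torus_class \<xi>) = coding \<xi>"
proof -
  have "coding (\<xi> + (frac_vec \<xi> - \<xi>)) = coding \<xi>"
  proof (rule coding_translate)
    have "- (\<xi> - frac_vec \<xi>) \<in> int_lattice" using diff_frac_vec by (subst int_lattice_uminus)
    then show "frac_vec \<xi> - \<xi> \<in> int_lattice" by simp
  qed
  then show ?thesis using assms torus_class_good by (simp add: word_of_def)
qed

lemma word_of_sadic_shift: "word_of C \<in> sadic_shift \<sigma>"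
proof (cases "C \<in> good_classes")
  case True
  then show ?thesis using word_of_class coding_in_sadic_shift by auto
next
  case False
  have "ae_filter (lborel :: (real^2) measure) \<noteq> bot" by (simp add: ae_filter_eq_bot_iff)
  then obtain \<xi> where "good \<xi>" using eventually_happens[OF AE_good] by blast
  then have "coding \<xi> \<in> sadic_shift \<sigma>" by (rule coding_in_sadic_shift)
  then show ?thesis using False unfolding word_of_def by (metis someI)
qed

lemma measurable_word_of: "word_of \<in> measurable torus words"
proof (rule measurable_restrict_space2)
  have pred: "{C \<in> space torus. C \<in> good_classes} \<in> sets torus"
    using sets.Int[OF good_classes_torus sets.top] by (simp only: Int_def mem_Collect_eq conj_commute)
  have "(\<lambda>C. coding (torus_rep C)) \<in> measurable torus (stream_space (count_space UNIV))"
    by (rule measurable_compose[OF measurable_torus_rep measurable_coding])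
  then show "word_of \<in> measurable torus (stream_space (count_space UNIV))"
    unfolding word_of_def by (intro measurable_If pred) (auto simp: space_stream_space)
qed (use word_of_sadic_shift in auto)

lemma measurable_class_of: "class_of \<in> measurable words torus"
  unfolding class_of_def by (rule measurable_compose[OF measurable_coded_point measurable_torus_class])

lemma class_of_word_of:
  assumes "C \<in> good_classes"
  shows "class_of (word_of C) = C"
proof -
  obtain \<xi> where \<xi>: "good \<xi>" "C = torus_class \<xi>" using assms by blast
  show ?thesis
    unfolding \<xi>(2) word_of_class[OF \<xi>(1)] class_of_def torus_class_eq_iff by (rule coded_point_coding[OF \<xi>(1)])
qed

lemma word_of_class_of:
  assumes "\<omega> \<in> sadic_shift \<sigma>" "class_of \<omega> \<in> good_classes"
  shows "word_of (class_of \<omega>) = \<omega>"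
proof -
  have "good (coded_point \<omega>)" using assms(2) torus_class_good by (simp add: class_of_def)
  then show ?thesis using coding_coded_point[OF assms(1)] by (simp add: class_of_def word_of_class)
qed

lemma class_of_stl:
  assumes "\<omega> \<in> sadic_shift \<sigma>"
  shows "class_of (stl \<omega>) = torus_translation rotation (class_of \<omega>)"
  using step_rotation[of "shd \<omega>"]
  by (simp add: class_of_def coded_point_stl[OF assms] torus_translation_class torus_class_eq_iff)

lemma good_classes_translation:
  assumes "C \<in> good_classes"
  shows "torus_translation rotation C \<in> good_classes"
proof -
  obtain \<xi> where \<xi>: "good \<xi>" "C = torus_class \<xi>" using assms by blast
  have "good (\<xi> + rotation)" using good_rotation[OF \<xi>(1), of 1] by simp
  then show ?thesis using \<xi>(2) torus_class_good torus_translation_class by metis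
qed

lemma word_of_translation:
  assumes "C \<in> good_classes"
  shows "word_of (torus_translation rotation C) = stl (word_of C)"
proof -
  obtain \<xi> where \<xi>: "good \<xi>" "C = torus_class \<xi>" using assms by blast
  have "good (\<xi> + rotation)" using good_rotation[OF \<xi>(1), of 1] by simp
  moreover have "coding (\<xi> + rotation) = stl (coding \<xi>)" using coding_sdrop[of \<xi> 1] by simp
  ultimately show ?thesis using \<xi> by (simp add: torus_translation_class word_of_class)
qed

definition word_measure :: "3 stream measure" where
  "word_measure = distr torus words word_of"

lemma invariant_word_measure: "invariant_prob_on (sadic_shift \<sigma>) word_measure"
proof -
  interpret T: prob_space "torus :: (real^2) set measure" by (rule prob_space_torus)
  have ms: "measurable word_measure word_measure = measurable words words"
    by (rule measurable_cong_sets) (simp_all add: word_measure_def)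
  have "distr word_measure word_measure stl = distr (distr torus words word_of) words stl"
    unfolding word_measure_def by (rule distr_cong) simp_all
  also have "\<dots> = distr torus words (stl \<circ> word_of)"
    by (rule distr_distr[OF measurable_stl_words measurable_word_of])
  also have "\<dots> = distr torus words (word_of \<circ> torus_translation rotation)"
  proof (rule distr_cong_AE[OF refl refl])
    show "AE C in torus. (stl \<circ> word_of) C = (word_of \<circ> torus_translation rotation) C"
      using AE_good_classes by (rule eventually_mono) (simp add: word_of_translation)
  qed (auto intro: measurable_comp measurable_stl_words measurable_word_of measurable_torus_translation)
  also have "\<dots> = distr (distr torus torus (torus_translation rotation)) words word_of"
    by (rule distr_distr[OF measurable_word_of measurable_torus_translation, symmetric])
  also have "\<dots> = word_measure" by (simp add: distr_torus_translation word_measure_def)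
  finally have "distr word_measure word_measure stl = word_measure" .
  moreover have "prob_space word_measure"
    unfolding word_measure_def by (rule T.prob_space_distr[OF measurable_word_of])
  ultimately show ?thesis
    using measurable_stl_words ms by (simp add: invariant_prob_on_def invariant_prob_def word_measure_def)
qed

text \<open>The image of an invariant measure under \<open>class_of\<close> is invariant under the
  rotation, hence Haar. So almost every word has a good class; there \<open>word_of\<close> undoes
  \<open>class_of\<close>, and applying it to Haar measure recovers the given measure.\<close>

lemma unique_word_measure:
  assumes "invariant_prob_on (sadic_shift \<sigma>) \<mu>"
  shows "\<mu> = word_measure"
proof -
  have \<mu>: "sets \<mu> = sets words" "prob_space \<mu>" "stl \<in> measurable \<mu> \<mu>" "distr \<mu> \<mu> stl = \<mu>"
    using assms by (auto simp: invariant_prob_on_def invariant_prob_def)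
  interpret M: prob_space \<mu> by (rule \<mu>(2))
  have sp: "space \<mu> = sadic_shift \<sigma>" using sets_eq_imp_space_eq[OF \<mu>(1)] space_words by simp
  have cl: "class_of \<in> measurable \<mu> torus"
    using measurable_class_of \<mu>(1) by (simp cong: measurable_cong_sets)
  let ?n = "distr \<mu> torus class_of"
  have n: "?n = torus"
  proof (rule torus_unique_invariant[where t = rotation])
    show "\<exists>m l. l \<in> int_lattice \<and> norm (\<xi> - l - real m *\<^sub>R rotation) < e" if "0 < e" for \<xi> e
      using rotation_dense[OF that, of \<xi>] by blast
    show "prob_space ?n" by (rule M.prob_space_distr[OF cl])
    have "distr ?n torus (torus_translation rotation) = distr \<mu> torus (torus_translation rotation \<circ> class_of)"
      by (rule distr_distr[OF measurable_torus_translation cl])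
    also have "\<dots> = distr \<mu> torus (class_of \<circ> stl)"
      by (rule distr_cong) (auto simp: sp class_of_stl)
    also have "\<dots> = distr (distr \<mu> \<mu> stl) torus class_of"
      by (rule distr_distr[OF cl \<mu>(3), symmetric])
    finally show "distr ?n torus (torus_translation rotation) = ?n" by (simp add: \<mu>(4))
  qed simp
  have "AE C in ?n. C \<in> good_classes" unfolding n by (rule AE_good_classes)
  then have good: "AE \<omega> in \<mu>. class_of \<omega> \<in> good_classes"
  proof (subst (asm) AE_distr_iff[OF cl])
    show "{C \<in> space torus. C \<in> good_classes} \<in> sets torus"
      using sets.Int[OF good_classes_torus sets.top] by (simp only: Int_def mem_Collect_eq conj_commute)
  qed
  have "word_measure = distr ?n words word_of" unfolding n word_measure_def ..
  also have "\<dots> = distr \<mu> words (word_of \<circ> class_of)" by (rule distr_distr[OF measurable_word_of cl])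
  also have "\<dots> = distr \<mu> \<mu> (\<lambda>\<omega>. \<omega>)"
  proof (rule distr_cong_AE)
    show "AE \<omega> in \<mu>. (word_of \<circ> class_of) \<omega> = \<omega>"
      using good by (rule AE_mp) (rule AE_I2, simp add: sp word_of_class_of)
  qed (use \<mu>(1) in \<open>auto intro!: measurable_comp[OF cl measurable_word_of]\<close>)
  also have "\<dots> = \<mu>" by (rule distr_id)
  finally show ?thesis by simp
qed

text \<open>Between the words with a good class and the good classes, \<open>class_of\<close> and
  \<open>word_of\<close> are mutually inverse; both sets have full measure and are stable under the
  dynamics.\<close>

lemma conjugate_word_measure:
  "measurably_conjugate word_measure stl torus (torus_translation rotation)"
proof -
  let ?A = "{\<omega> \<in> sadic_shift \<sigma>. class_of \<omega> \<in> good_classes}"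
  have sets_wm: "sets word_measure = sets words" and sp: "space word_measure = sadic_shift \<sigma>"
    by (simp_all add: word_measure_def space_words)
  have A: "?A \<in> sets word_measure"
    using measurable_sets[OF measurable_class_of good_classes_torus]
    unfolding sets_wm space_words by (simp add: vimage_def Int_def conj_commute)
  have wA: "word_of C \<in> ?A" if "C \<in> good_classes" for C
    using that by (simp add: word_of_sadic_shift class_of_word_of)
  have em: "emeasure word_measure E = emeasure torus (word_of -` E \<inter> space torus)" if "E \<in> sets word_measure" for E
    unfolding word_measure_def using that sets_wm by (intro emeasure_distr measurable_word_of) simp
  have cl: "class_of \<in> measurable word_measure torus"
    using measurable_class_of sets_wm by (simp cong: measurable_cong_sets)
  have wo: "word_of \<in> measurable torus word_measure"
    using measurable_word_of sets_wm by (simp cong: measurable_cong_sets)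
  have inj: "inj_on class_of ?A" by (rule inj_on_inverseI[where g = word_of]) (simp add: word_of_class_of)
  have bij: "bij_betw class_of ?A good_classes"
  proof (rule bij_betw_imageI[OF inj])
    show "class_of ` ?A = good_classes"
    proof (intro equalityI subsetI)
      fix C assume "C \<in> good_classes"
      then show "C \<in> class_of ` ?A" using wA class_of_word_of by (metis (no_types, lifting) imageI)
    qed blast
  qed
  have inv: "the_inv_into ?A class_of C = word_of C" if "C \<in> good_classes" for C
    by (rule the_inv_into_f_eq[OF inj class_of_word_of[OF that] wA[OF that]])
  have 1: "emeasure word_measure (space word_measure - ?A) = 0"
  proof -
    have "emeasure word_measure (space word_measure - ?A) = emeasure torus (word_of -` (space word_measure - ?A) \<inter> space torus)"
      using A by (intro em) blast
    also have "\<dots> = 0"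
    proof (rule AE_iff_measurable[THEN iffD1])
      show "word_of -` (space word_measure - ?A) \<inter> space torus \<in> sets torus"
        using A by (intro measurable_sets[OF wo]) blast
      show "{C \<in> space torus. \<not> word_of C \<in> ?A} = word_of -` (space word_measure - ?A) \<inter> space torus"
        using word_of_sadic_shift by (auto simp: sp)
      show "AE C in torus. word_of C \<in> ?A" using AE_good_classes by (rule eventually_mono) (rule wA)
    qed
    finally show ?thesis .
  qed
  have 2: "emeasure torus (space torus - good_classes) = 0"
  proof -
    have N: "space torus - good_classes \<in> sets torus" by (rule sets.Diff[OF sets.top good_classes_torus])
    have eq: "{C \<in> space torus. C \<notin> good_classes} = space torus - good_classes" by (rule set_diff_eq[symmetric])
    show ?thesis by (rule AE_iff_measurable[OF N eq, THEN iffD1, OF AE_good_classes])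
  qed
  have 3: "emeasure word_measure (class_of -` C \<inter> ?A) = emeasure torus C" if C: "C \<in> sets torus" "C \<subseteq> good_classes" for C
  proof -
    have E: "class_of -` C \<inter> ?A \<in> sets word_measure"
    proof -
      have "class_of -` C \<inter> space word_measure \<in> sets word_measure" by (rule measurable_sets[OF cl C(1)])
      moreover have "class_of -` C \<inter> ?A = class_of -` C \<inter> space word_measure" using C(2) sp by blast
      ultimately show ?thesis by simp
    qed
    have "emeasure word_measure (class_of -` C \<inter> ?A) = emeasure torus (word_of -` (class_of -` C \<inter> ?A) \<inter> space torus)"
      by (rule em[OF E])
    also have "\<dots> = emeasure torus C"
    proof (rule emeasure_eq_AE)
      show "AE D in torus. D \<in> word_of -` (class_of -` C \<inter> ?A) \<inter> space torus \<longleftrightarrow> D \<in> C"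
        using AE_good_classes
      proof (rule eventually_mono)
        fix D assume D: "D \<in> good_classes"
        then have "D \<in> space torus" by auto
        then show "D \<in> word_of -` (class_of -` C \<inter> ?A) \<inter> space torus \<longleftrightarrow> D \<in> C"
          using wA[OF D] class_of_word_of[OF D] by simp
      qed
      show "word_of -` (class_of -` C \<inter> ?A) \<inter> space torus \<in> sets torus" by (rule measurable_sets[OF wo E])
    qed (rule C(1))
    finally show ?thesis .
  qed
  have 4: "class_of \<in> measurable (restrict_space word_measure ?A) (restrict_space torus good_classes)"
    by (rule measurable_restrict_space2) (auto intro: measurable_restrict_space1 cl simp: space_restrict_space)
  have 5: "the_inv_into ?A class_of \<in> measurable (restrict_space torus good_classes) (restrict_space word_measure ?A)"
  proof -
    have "word_of \<in> measurable (restrict_space torus good_classes) (restrict_space word_measure ?A)"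
      by (rule measurable_restrict_space2) (use wA in \<open>auto intro: measurable_restrict_space1 wo simp: space_restrict_space\<close>)
    then show ?thesis
      by (rule measurable_cong[THEN iffD1, rotated]) (auto simp: space_restrict_space inv)
  qed
  have 6: "stl ` ?A \<subseteq> ?A" using stl_sadic_shift class_of_stl good_classes_translation by auto
  have 7: "torus_translation rotation ` good_classes \<subseteq> good_classes" using good_classes_translation by blast
  show ?thesis
    unfolding measurably_conjugate_def
    using A good_classes_torus 1 2 3 4 5 6 7 bij class_of_stl
    by (intro bexI[of _ ?A] bexI[of _ good_classes] exI[of _ class_of]) auto
qed

lemma natural_codings_words: "natural_codings int_lattice rotation (sadic_shift \<sigma>)"
  unfolding natural_codings_def using natural_partition_pieces sadic_shift_coded by blast

end

section \<open>Almost every directive sequence is generic\<close>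

lemma visits_le_shift: "visits \<sigma> (m + n) k \<le> visits \<sigma> m (n + k)"
  unfolding visits_def by (rule card_mono[OF finite_visits]) auto

text \<open>The condition \<open>4 \<le> k\<close> says that a block beginning at \<open>m\<close>
  fits into the window.\<close>

lemma visits_Suc_left:
  assumes "4 \<le> k"
  shows "visits \<sigma> m (Suc k) = (if occurs \<sigma> m then 1 else 0) + visits \<sigma> (Suc m) k"
proof -
  have "{l. m \<le> l \<and> l + 5 \<le> m + Suc k \<and> occurs \<sigma> l} =
      {l. l = m \<and> occurs \<sigma> m} \<union> {l. Suc m \<le> l \<and> l + 5 \<le> Suc m + k \<and> occurs \<sigma> l}" (is "?L = ?A \<union> ?B")
  proof (rule set_eqI)
    fix l
    show "l \<in> ?L \<longleftrightarrow> l \<in> ?A \<union> ?B" using assms by (cases "l = m") auto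
  qed
  moreover have "card (?A \<union> ?B) = card ?A + card ?B" 
  proof (rule card_Un_disjoint)
    show "finite ?B" by (rule finite_visits)
  qed auto
  moreover have "card ?A = (if occurs \<sigma> m then 1 else 0)" by simp
  ultimately show ?thesis by (simp only: visits_def)
qed

text \<open>
  Seen from the last level \<open>m + d\<close> backwards, the number of visits increases at each occurrence, so the
  sum over the occurrences is dominated by a geometric series, up to the last few levels.
\<close>
lemma sum_rate_backwards:
  fixes c :: real
  assumes c: "0 < c" "c < 1"
  shows "(\<Sum>k\<le>d. (if occurs \<sigma> (m + d - k) then c ^ visits \<sigma> (m + d - k) k else 0))
    \<le> 5 + c / (1 - c) * (1 - c ^ visits \<sigma> m d)"
proof -
  have nonneg: "0 \<le> c / (1 - c) * (1 - c ^ n)" for n using c by (intro mult_nonneg_nonneg) (auto simp: power_le_one)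
  show ?thesis
  proof (induction d arbitrary: m)
    case 0
    show ?case using c by (simp only: atMost_0 sum.insert[OF finite.emptyI] empty_iff sum.empty visits_0) auto
  next
    case (Suc d)
    show ?case
    proof (cases "d < 4")
      case True
      have "(\<Sum>k\<le>Suc d. (if occurs \<sigma> (m + Suc d - k) then c ^ visits \<sigma> (m + Suc d - k) k else 0)) \<le> (\<Sum>k\<le>Suc d. 1)"
        using c by (intro sum_mono) (auto simp: power_le_one)
      also have "\<dots> \<le> 5" using True by simp
      finally show ?thesis using nonneg[of "visits \<sigma> m (Suc d)"] by linarith
    next
      case False
      let ?n = "visits \<sigma> (Suc m) d"
      have v: "visits \<sigma> m (Suc d) = (if occurs \<sigma> m then 1 else 0) + ?n"
        using False by (intro visits_Suc_left) simp
      have "(\<Sum>k\<le>Suc d. (if occurs \<sigma> (m + Suc d - k) then c ^ visits \<sigma> (m + Suc d - k) k else 0)) =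
          (\<Sum>k\<le>d. (if occurs \<sigma> (Suc m + d - k) then c ^ visits \<sigma> (Suc m + d - k) k else 0)) +
          (if occurs \<sigma> m then c ^ visits \<sigma> m (Suc d) else 0)"
      proof -
        have "m + Suc d - k = Suc m + d - k" for k by simp
        then show ?thesis by (simp only: sum.atMost_Suc) simp
      qed
      also have "\<dots> \<le> 5 + c / (1 - c) * (1 - c ^ ?n) + (if occurs \<sigma> m then c ^ visits \<sigma> m (Suc d) else 0)"
        using Suc.IH[of "Suc m"] by (rule add_right_mono)
      \<comment> \<open>If a block begins at \<open>m\<close>, the added power of \<open>c\<close>
        is the next term of the geometric series.\<close>
      also have "\<dots> = 5 + c / (1 - c) * (1 - c ^ visits \<sigma> m (Suc d))"
        using c by (simp add: v field_simps)
      finally show ?thesis .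
    qed
  qed
qed

lemma sdrop_funpow: "(stl ^^ n) \<sigma> = sdrop n \<sigma>"
  by (induction n arbitrary: \<sigma>) (auto simp: funpow_swap1)

lemma occurs_sdrop: "occurs (sdrop n \<sigma>) m \<longleftrightarrow> occurs \<sigma> (n + m)"
  by (simp add: occurs_def sdrop_snth add.assoc)

section \<open>Recurrence and summable return rates under an ergodic measure\<close>

locale brun_process =
  fixes \<nu> :: "3 substitution stream measure"
  assumes sets_nu: "sets \<nu> = sets (stream_space (count_space brun_substitutions))"
    and invariant: "invariant_prob \<nu> stl"
    and ergodic: "ergodic \<nu> stl"
    and cylinder: "\<And>w. w \<in> lists brun_substitutions \<Longrightarrow>
           emeasure \<nu> {\<sigma> \<in> streams brun_substitutions. stake (length w) \<sigma> = w} > 0"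
begin

sublocale prob_space \<nu>
  using invariant by (simp add: invariant_prob_def)

lemma space_nu: "space \<nu> = streams brun_substitutions"
  using sets_eq_imp_space_eq[OF sets_nu] by (simp add: space_stream_space)

lemma measurable_sdrop_nu: "sdrop n \<in> measurable \<nu> \<nu>"
proof (induction n)
  case (Suc n)
  have "stl \<in> measurable \<nu> \<nu>" using invariant by (simp add: invariant_prob_def)
  from measurable_comp[OF this Suc] show ?case by (simp add: comp_def)
qed (simp add: measurable_ident_sets)

lemma distr_sdrop: "distr \<nu> \<nu> (sdrop n) = \<nu>"
proof (induction n)
  case (Suc n)
  have stl: "stl \<in> measurable \<nu> \<nu>" "distr \<nu> \<nu> stl = \<nu>" using invariant by (auto simp: invariant_prob_def)
  have "distr \<nu> \<nu> (sdrop (Suc n)) = distr \<nu> \<nu> (sdrop n \<circ> stl)" by (rule distr_cong) auto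
  also have "\<dots> = distr (distr \<nu> \<nu> stl) \<nu> (sdrop n)" by (rule distr_distr[OF measurable_sdrop_nu stl(1), symmetric])
  finally show ?case unfolding stl(2) Suc .
qed (simp add: distr_id)

lemma brun_sequence_space: "\<sigma> \<in> space \<nu> \<Longrightarrow> brun_sequence \<sigma>"
  by unfold_locales (simp add: space_nu streams_iff_snth)

lemma sdrop_space: "\<sigma> \<in> space \<nu> \<Longrightarrow> sdrop n \<sigma> \<in> space \<nu>"
  using measurable_space[OF measurable_sdrop_nu] .

lemma measurable_occurs: "{\<sigma> \<in> space \<nu>. occurs \<sigma> m} \<in> sets \<nu>"
proof -
  have "{\<sigma> \<in> space \<nu>. \<sigma> !! n = brun3} \<in> sets \<nu>" for n
  proof -
    have "(\<lambda>\<sigma>. \<sigma> !! n) \<in> measurable \<nu> (count_space brun_substitutions)"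
      using measurable_snth[of n "count_space brun_substitutions"] sets_nu by (simp cong: measurable_cong_sets)
    from measurable_sets[OF this, of "{brun3}"] show ?thesis
      by (simp add: brun_substitutions_def vimage_def Int_def conj_commute)
  qed
  then have "{\<sigma> \<in> space \<nu>. \<forall>j\<in>{..<5}. \<sigma> !! (m + j) = brun3} \<in> sets \<nu>"
    by (intro sets.sets_Collect_finite_All) auto
  then show ?thesis by (simp only: occurs_def Ball_def lessThan_iff)
qed

lemma real_visits:
  "real (visits \<sigma> m k) = (\<Sum>l\<in>{l. m \<le> l \<and> l + 5 \<le> m + k}. if occurs \<sigma> l then 1 else 0)"
proof -
  have fin: "finite {l. m \<le> l \<and> l + 5 \<le> m + k}" by (rule finite_subset[of _ "{..m+k}"]) auto
  have "{l. m \<le> l \<and> l + 5 \<le> m + k \<and> occurs \<sigma> l} = {l \<in> {l. m \<le> l \<and> l + 5 \<le> m + k}. occurs \<sigma> l}" by auto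
  then show ?thesis using fin by (simp add: visits_def sum.If_cases Int_def)
qed

lemma measurable_indicator_occurs: "(\<lambda>\<sigma>. if occurs \<sigma> l then 1 else 0 :: real) \<in> borel_measurable \<nu>"
  by (rule measurable_If[OF _ _ measurable_occurs]) auto

lemma measurable_visits: "(\<lambda>\<sigma>. real (visits \<sigma> m k)) \<in> borel_measurable \<nu>"
  unfolding real_visits by (intro borel_measurable_sum measurable_indicator_occurs)

lemma measurable_rate: "(\<lambda>\<sigma>. contraction_rate ^ visits \<sigma> m k) \<in> borel_measurable \<nu>"
proof -
  have "contraction_rate ^ visits \<sigma> m k = contraction_rate powr real (visits \<sigma> m k)" for \<sigma>
    by (simp add: powr_realpow contraction_rate_bounds)
  then show ?thesis using measurable_visits by simp
qed

lemma prob_occurs: "0 < prob {\<sigma> \<in> space \<nu>. occurs \<sigma> 0}"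
proof -
  have "{\<sigma> \<in> streams brun_substitutions. stake (length (replicate 5 brun3)) \<sigma> = replicate 5 brun3} =
      {\<sigma> \<in> space \<nu>. occurs \<sigma> 0}"
    by (auto simp: space_nu occurs_def list_eq_iff_nth_eq simp del: stake.simps replicate.simps)
  moreover have "replicate 5 brun3 \<in> lists brun_substitutions"
    by (simp add: in_lists_conv_set brun_substitutions_def)
  note cylinder[OF this]
  ultimately have "0 < emeasure \<nu> {\<sigma> \<in> space \<nu>. occurs \<sigma> 0}" by (simp only:)
  then show ?thesis by (simp add: emeasure_eq_measure)
qed

lemma prob_sdrop:
  assumes "E \<in> sets \<nu>"
  shows "prob (sdrop n -` E \<inter> space \<nu>) = prob E"
  using measure_distr[OF measurable_sdrop_nu assms, of n] by (simp add: distr_sdrop)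

text \<open>The set of sequences entering \<open>E\<close> infinitely often is invariant. It is the
  decreasing limit of sets that each contain a preimage of \<open>E\<close>, so its probability is
  at least that of \<open>E\<close>, and ergodicity makes it 1.\<close>

lemma recurrence:
  assumes E: "E \<in> sets \<nu>" and pos: "0 < prob E"
  shows "AE \<sigma> in \<nu>. \<forall>N. \<exists>n\<ge>N. sdrop n \<sigma> \<in> E"
proof -
  define U where "U = (\<lambda>N. \<Union>n\<in>{N..}. sdrop n -` E \<inter> space \<nu>)"
  have U: "U N \<in> sets \<nu>" for N
    unfolding U_def by (intro sets.countable_UN') (auto intro: measurable_sets[OF measurable_sdrop_nu E])
  have L: "(\<Inter>N. U N) = {\<sigma> \<in> space \<nu>. \<forall>N. \<exists>n\<ge>N. sdrop n \<sigma> \<in> E}"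
    unfolding U_def by (intro set_eqI) (auto simp: Bex_def)
  have LS: "(\<Inter>N. U N) \<in> sets \<nu>" using U by blast
  have "(\<lambda>N. prob (U N)) \<longlonglongrightarrow> prob (\<Inter>N. U N)"
  proof (rule finite_Lim_measure_decseq)
    show "decseq U" unfolding decseq_def U_def by (intro allI impI UN_mono) auto
  qed (use U in blast)
  moreover have "prob E \<le> prob (U N)" for N
    using finite_measure_mono[of "sdrop N -` E \<inter> space \<nu>" "U N"] U prob_sdrop[OF E, of N]
    unfolding U_def by auto
  ultimately have "prob E \<le> prob (\<Inter>N. U N)" using LIMSEQ_le_const by blast
  then have "prob (\<Inter>N. U N) \<noteq> 0" using pos by linarith
  moreover have "stl -` (\<Inter>N. U N) \<inter> space \<nu> = (\<Inter>N. U N)"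
  proof -
    have eq: "(\<forall>N. \<exists>n\<ge>N. sdrop n (stl \<sigma>) \<in> E) \<longleftrightarrow> (\<forall>N. \<exists>n\<ge>N. sdrop n \<sigma> \<in> E)" for \<sigma>
    proof
      assume l: "\<forall>N. \<exists>n\<ge>N. sdrop n (stl \<sigma>) \<in> E"
      show "\<forall>N. \<exists>n\<ge>N. sdrop n \<sigma> \<in> E"
      proof
        fix N
        obtain n where "n \<ge> N" "sdrop (Suc n) \<sigma> \<in> E" using l by auto
        then show "\<exists>n\<ge>N. sdrop n \<sigma> \<in> E" by (intro exI[of _ "Suc n"]) auto
      qed
    next
      assume r: "\<forall>N. \<exists>n\<ge>N. sdrop n \<sigma> \<in> E"
      show "\<forall>N. \<exists>n\<ge>N. sdrop n (stl \<sigma>) \<in> E"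
      proof
        fix N
        obtain n where n: "n \<ge> Suc N" "sdrop n \<sigma> \<in> E" using r by blast
        then obtain n' where "n = Suc n'" by (cases n) auto
        then show "\<exists>n\<ge>N. sdrop n (stl \<sigma>) \<in> E" using n by (intro exI[of _ n']) auto
      qed
    qed
    have "stl \<sigma> \<in> space \<nu>" if "\<sigma> \<in> space \<nu>" for \<sigma> using sdrop_space[OF that, of 1] by simp
    then show ?thesis unfolding L using eq by blast
  qed
  ultimately have "prob (\<Inter>N. U N) = 1" using ergodic LS unfolding ergodic_def by blast
  from AE_prob_1[OF this] show ?thesis unfolding L by (rule eventually_mono) simp
qed

definition return_sum :: "3 substitution stream \<Rightarrow> ennreal" where
  "return_sum \<sigma> = (\<Sum>k. ennreal (contraction_rate ^ visits \<sigma> 0 k))"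

lemma measurable_return_sum: "return_sum \<in> borel_measurable \<nu>"
  unfolding return_sum_def by (intro borel_measurable_suminf_order measurable_compose[OF measurable_rate measurable_ennreal])

text \<open>Stationarity replaces the start at level 0 of the \<open>k\<close>-th term by a start at
  level \<open>K - k\<close>. All windows then end at the common level \<open>K\<close>, and
  \<open>sum_rate_backwards\<close> bounds the partial sum pointwise, independently of
  \<open>K\<close>. A sum with fixed start has no such pointwise bound.\<close>

lemma integral_return_sum:
  "(\<integral>\<^sup>+\<sigma>. (if occurs \<sigma> 0 then return_sum \<sigma> else 0) \<partial>\<nu>) < \<infinity>"
proof -
  let ?c = contraction_rate
  let ?g = "\<lambda>k \<sigma>. ennreal (if occurs \<sigma> 0 then ?c ^ visits \<sigma> 0 k else 0)"
  have gm: "?g k \<in> borel_measurable \<nu>" for k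
    by (intro measurable_compose[OF _ measurable_ennreal] measurable_If[OF measurable_rate _ measurable_occurs]) auto
  have partial: "(\<Sum>k\<le>K. \<integral>\<^sup>+\<sigma>. ?g k \<sigma> \<partial>\<nu>) \<le> ennreal (5 + ?c / (1 - ?c))" for K
  proof -
    have "(\<integral>\<^sup>+\<sigma>. ?g k \<sigma> \<partial>\<nu>) = (\<integral>\<^sup>+\<sigma>. ?g k (sdrop (K - k) \<sigma>) \<partial>\<nu>)" for k
    proof -
      have "?g k \<in> borel_measurable (distr \<nu> \<nu> (sdrop (K - k)))" unfolding distr_sdrop by (rule gm)
      from nn_integral_distr[OF measurable_sdrop_nu this] show ?thesis unfolding distr_sdrop .
    qed
    then have "(\<Sum>k\<le>K. \<integral>\<^sup>+\<sigma>. ?g k \<sigma> \<partial>\<nu>) = (\<Sum>k\<le>K. \<integral>\<^sup>+\<sigma>. ?g k (sdrop (K - k) \<sigma>) \<partial>\<nu>)"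
      by (intro sum.cong refl)
    also have "\<dots> = (\<integral>\<^sup>+\<sigma>. (\<Sum>k\<le>K. ?g k (sdrop (K - k) \<sigma>)) \<partial>\<nu>)"
      by (rule nn_integral_sum[symmetric]) (rule measurable_compose[OF measurable_sdrop_nu gm])
    also have "\<dots> \<le> (\<integral>\<^sup>+\<sigma>. ennreal (5 + ?c / (1 - ?c)) \<partial>\<nu>)"
    proof (rule nn_integral_mono)
      fix \<sigma>
      have "(\<Sum>k\<le>K. ?g k (sdrop (K - k) \<sigma>)) =
          ennreal (\<Sum>k\<le>K. (if occurs \<sigma> (0 + K - k) then ?c ^ visits \<sigma> (0 + K - k) k else 0))"
      proof -
        have "visits (sdrop (K - k) \<sigma>) 0 k = visits \<sigma> (0 + K - k) k" for k
          using visits_sdrop[of "K - k" \<sigma> 0 k] by simp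
        then show ?thesis
          by (subst sum_ennreal) (auto simp: occurs_sdrop contraction_rate_bounds less_imp_le cong: if_cong)
      qed
      also have "\<dots> \<le> ennreal (5 + ?c / (1 - ?c) * (1 - ?c ^ visits \<sigma> 0 K))"
        by (intro ennreal_leI sum_rate_backwards contraction_rate_bounds)
      also have "\<dots> \<le> ennreal (5 + ?c / (1 - ?c))"
        using contraction_rate_bounds by (intro ennreal_leI add_left_mono mult_left_le) auto
      finally show "(\<Sum>k\<le>K. ?g k (sdrop (K - k) \<sigma>)) \<le> ennreal (5 + ?c / (1 - ?c))" .
    qed
    also have "\<dots> = ennreal (5 + ?c / (1 - ?c))" by (simp add: emeasure_space_1)
    finally show ?thesis .
  qed
  have "(\<Sum>k. \<integral>\<^sup>+\<sigma>. ?g k \<sigma> \<partial>\<nu>) \<le> ennreal (5 + ?c / (1 - ?c))"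
  proof (rule suminf_le_const[OF summableI])
    fix K
    have "(\<Sum>k<K. \<integral>\<^sup>+\<sigma>. ?g k \<sigma> \<partial>\<nu>) \<le> (\<Sum>k\<le>K. \<integral>\<^sup>+\<sigma>. ?g k \<sigma> \<partial>\<nu>)"
      by (rule sum_mono2) auto
    then show "(\<Sum>k<K. \<integral>\<^sup>+\<sigma>. ?g k \<sigma> \<partial>\<nu>) \<le> ennreal (5 + ?c / (1 - ?c))" using partial order.trans by blast
  qed
  also have "(\<Sum>k. \<integral>\<^sup>+\<sigma>. ?g k \<sigma> \<partial>\<nu>) = (\<integral>\<^sup>+\<sigma>. (\<Sum>k. ?g k \<sigma>) \<partial>\<nu>)"
    by (rule nn_integral_suminf[symmetric]) (rule gm)
  also have "(\<lambda>\<sigma>. \<Sum>k. ?g k \<sigma>) = (\<lambda>\<sigma>. if occurs \<sigma> 0 then return_sum \<sigma> else 0)"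
    by (auto simp: return_sum_def)
  finally show ?thesis unfolding infinity_ennreal_def by (rule le_less_trans) (rule ennreal_less_top)
qed

text \<open>The return sum is almost surely finite where a block begins, and this has positive
  probability; so some bound \<open>C\<close> is met there with positive probability, and
  \<open>recurrence\<close> repeats it at infinitely many levels.\<close>

theorem AE_brun_generic: "AE \<sigma> in \<nu>. brun_generic \<sigma>"
proof -
  define E where "E = (\<lambda>C::nat. {\<sigma> \<in> space \<nu>. occurs \<sigma> 0} \<inter> {\<sigma> \<in> space \<nu>. return_sum \<sigma> \<le> of_nat C})"
  have E: "E C \<in> sets \<nu>" for C
    unfolding E_def by (intro sets.Int measurable_occurs borel_measurable_le measurable_return_sum) auto
  have "\<exists>C. 0 < prob (E C)"
  proof (rule ccontr)
    assume "\<not> (\<exists>C. 0 < prob (E C))"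
    then have "prob (E C) = 0" for C using measure_nonneg[of \<nu> "E C"] by (metis antisym_conv2 less_irrefl)
    then have "AE \<sigma> in \<nu>. \<sigma> \<notin> E C" for C
      using E by (intro AE_I[of _ _ "E C"]) (auto simp: emeasure_eq_measure)
    then have notE: "AE \<sigma> in \<nu>. \<forall>C. \<sigma> \<notin> E C" by (simp add: AE_all_countable)
    have m: "(\<lambda>\<sigma>. if occurs \<sigma> 0 then return_sum \<sigma> else 0) \<in> borel_measurable \<nu>"
      by (intro measurable_If[OF measurable_return_sum _ measurable_occurs]) auto
    have "AE \<sigma> in \<nu>. (if occurs \<sigma> 0 then return_sum \<sigma> else 0) \<noteq> \<infinity>"
      using integral_return_sum by (intro nn_integral_PInf_AE[OF m]) auto
    then have "AE \<sigma> in \<nu>. \<not> occurs \<sigma> 0"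
      using notE AE_space
    proof eventually_elim
      case (elim \<sigma>)
      show ?case
      proof
        assume occ: "occurs \<sigma> 0"
        then have "return_sum \<sigma> \<noteq> \<infinity>" using elim(1) by simp
        then obtain C where "return_sum \<sigma> < of_nat C" using ennreal_Ex_less_of_nat
          by (auto simp: less_top)
        then have "\<sigma> \<in> E C" using occ elim(3) by (simp add: E_def)
        then show False using elim(2) by blast
      qed
    qed
    then have "prob {\<sigma> \<in> space \<nu>. occurs \<sigma> 0} = 0"
      using measurable_occurs by (subst (asm) AE_iff_measurable[OF _ refl]) (auto simp: emeasure_eq_measure)
    then show False using prob_occurs by simp
  qed
  then obtain C where C: "0 < prob (E C)" by blast
  show ?thesis
    using recurrence[OF E C] AE_space
  proof eventually_elim
    case (elim \<sigma>)
    interpret brun_sequence \<sigma> using elim(2) by (rule brun_sequence_space)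
    have gen: "occurs \<sigma> n" "summable (\<lambda>k. contraction_rate ^ visits \<sigma> n k)"
      "(\<Sum>k. contraction_rate ^ visits \<sigma> n k) \<le> real C" if "sdrop n \<sigma> \<in> E C" for n
    proof -
      have s: "occurs \<sigma> n" "(\<Sum>k. ennreal (contraction_rate ^ visits \<sigma> n k)) \<le> of_nat C"
        using that by (simp_all add: E_def return_sum_def occurs_sdrop visits_sdrop)
      show "occurs \<sigma> n" by (rule s)
      have nn: "0 \<le> contraction_rate ^ visits \<sigma> n k" for k by (simp add: contraction_rate_bounds less_imp_le)
      have "(\<Sum>k. ennreal (contraction_rate ^ visits \<sigma> n k)) \<noteq> top"
        using s(2) by (metis ennreal_of_nat_eq_real_of_nat ennreal_neq_top top.extremum_uniqueI)
      then show sum: "summable (\<lambda>k. contraction_rate ^ visits \<sigma> n k)" by (rule summable_suminf_not_top[OF nn])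
      have "ennreal (\<Sum>k. contraction_rate ^ visits \<sigma> n k) \<le> ennreal (real C)"
        using s(2) suminf_ennreal2[OF nn sum] by (simp add: ennreal_of_nat_eq_real_of_nat)
      then show "(\<Sum>k. contraction_rate ^ visits \<sigma> n k) \<le> real C" by (simp add: ennreal_le_iff)
    qed
    obtain n where n: "sdrop n \<sigma> \<in> E C" using elim(1) by blast
    have "summable (\<lambda>k. contraction_rate ^ visits \<sigma> 0 (k + n))"
    proof (rule summable_comparison_test'[OF gen(2)[OF n]])
      fix k
      have "visits \<sigma> n k \<le> visits \<sigma> 0 (k + n)" using visits_le_shift[of \<sigma> 0 n k] by (simp only: add_0 add.commute[of n])
      then have "contraction_rate ^ visits \<sigma> 0 (k + n) \<le> contraction_rate ^ visits \<sigma> n k"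
        using contraction_rate_bounds by (intro power_decreasing) auto
      then show "norm (contraction_rate ^ visits \<sigma> 0 (k + n)) \<le> contraction_rate ^ visits \<sigma> n k"
        by (simp add: contraction_rate_bounds less_imp_le)
    qed
    then have "summable (\<lambda>k. contraction_rate ^ visits \<sigma> 0 k)"
      by (subst (asm) summable_iff_shift)
    moreover have "\<exists>C. \<forall>N. \<exists>n\<ge>N. occurs \<sigma> n \<and> (\<Sum>k. contraction_rate ^ visits \<sigma> n k) \<le> C"
    proof (rule exI[of _ "real C"], rule allI)
      fix N
      obtain n where "n \<ge> N" "sdrop n \<sigma> \<in> E C" using elim(1) by blast
      then show "\<exists>n\<ge>N. occurs \<sigma> n \<and> (\<Sum>k. contraction_rate ^ visits \<sigma> n k) \<le> real C" using gen(1,3) by blast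
    qed
    ultimately show ?case by unfold_locales
  qed
qed

end

section \<open>Lyapunov exponents\<close>

text \<open>Fekete's subadditive lemma; the linear lower bound keeps the infimum finite.\<close>

lemma fekete:
  fixes a :: "nat \<Rightarrow> real"
  assumes sub: "\<And>m n. a (m + n) \<le> a m + a n" and lower: "\<And>n. - C * real n \<le> a n"
  obtains L where "(\<lambda>n. a n / real n) \<longlonglongrightarrow> L"
proof -
  define L where "L = Inf ((\<lambda>n. a n / real n) ` {1..})"
  have bdd: "bdd_below ((\<lambda>n. a n / real n) ` {1..})"
  proof (rule bdd_belowI2[of _ "- C"])
    fix n :: nat assume "n \<in> {1..}"
    then show "- C \<le> a n / real n" using lower[of n] by (simp add: field_simps)
  qed
  have multiple: "a (q * k) \<le> real q * a k" if "0 < q" for q k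
    using that
  proof (induction q)
    case (Suc q)
    show ?case
    proof (cases q)
      case 0
      then show ?thesis by simp
    next
      case (Suc q')
      then have "a (k + q * k) \<le> a k + real q * a k" using sub[of k "q * k"] Suc.IH by simp
      then show ?thesis by (simp add: algebra_simps)
    qed
  qed simp
  have "(\<lambda>n. a n / real n) \<longlonglongrightarrow> L"
  proof (rule LIMSEQ_I)
    fix e :: real assume e: "0 < e"
    have "L < L + e / 2" using e by simp
    then obtain k where k: "k \<ge> 1" "a k / real k < L + e / 2"
    proof -
      have "\<exists>z\<in>(\<lambda>n. a n / real n) ` {1..}. z < L + e / 2"
        by (rule cInf_lessD) (use \<open>L < L + e / 2\<close> in \<open>auto simp: L_def\<close>)
      then show ?thesis using that by auto
    qed
    \<comment> \<open>Bounds the contribution of the remainder \<open>n mod k\<close>, uniformly in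
      \<open>n\<close>.\<close>
    define B where "B = Max (insert 0 ((\<lambda>r. a r) ` {..k})) + (\<bar>L + e / 2\<bar>) * real k"
    have B: "a r - (L + e / 2) * real r \<le> B" if "r \<le> k" for r
    proof -
      have "a r \<le> Max (insert 0 ((\<lambda>r. a r) ` {..k}))" using that by (intro Max_ge) auto
      moreover have "- (L + e / 2) * real r \<le> \<bar>L + e / 2\<bar> * real k"
        using that by (intro mult_mono) auto
      ultimately show ?thesis unfolding B_def by linarith
    qed
    obtain N :: nat where N: "2 * \<bar>B\<bar> / e < real N" using reals_Archimedean2 by blast
    show "\<exists>no. \<forall>n\<ge>no. norm (a n / real n - L) < e"
    proof (intro exI allI impI)
      fix n assume n: "max (max N k) 1 \<le> n"
      have low: "L \<le> a n / real n" unfolding L_def using n bdd by (intro cInf_lower) auto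
      define q r where "q = n div k" and "r = n mod k"
      have qr: "n = q * k + r" "r \<le> k" "0 < q"
        using k(1) n by (auto simp: q_def r_def div_greater_zero_iff less_imp_le)
      have "a n \<le> real q * a k + a r" using sub[of "q * k" r] multiple[OF qr(3), of k] qr(1) by simp
      also have "real q * a k \<le> real q * ((L + e / 2) * real k)"
        using k by (intro mult_left_mono) (auto simp: field_simps)
      also have "real q * ((L + e / 2) * real k) + a r = (L + e / 2) * real n + (a r - (L + e / 2) * real r)"
        unfolding qr(1) by (simp add: algebra_simps)
      also have "\<dots> \<le> (L + e / 2) * real n + B" using B[OF qr(2)] by simp
      finally have "a n / real n \<le> L + e / 2 + B / real n" using n by (simp add: field_simps)
      moreover have "B / real n < e / 2"
      proof -
        have "2 * \<bar>B\<bar> / e < real n" using N n by linarith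
        then have "\<bar>B\<bar> / real n < e / 2" using e n by (simp add: field_simps)
        moreover have "B / real n \<le> \<bar>B\<bar> / real n" by (intro divide_right_mono) auto
        ultimately show ?thesis by linarith
      qed
      ultimately show "norm (a n / real n - L) < e" unfolding real_norm_def using low by linarith
    qed
  qed
  then show ?thesis by (rule that)
qed

section \<open>Frobenius norms and exterior powers of matrices of size 3\<close>

lemma norm_matrix_sq: "(norm (A :: real^'n^'m))\<^sup>2 = (\<Sum>i\<in>UNIV. \<Sum>j\<in>UNIV. (A $ i $ j)\<^sup>2)"
  by (simp add: norm_vec_def L2_set_def sum_nonneg)

lemma norm_transpose [simp]: "norm (transpose A) = norm (A :: real^'n^'m)"
proof -
  have "(norm (transpose A))\<^sup>2 = (norm A)\<^sup>2"
    unfolding norm_matrix_sq by (subst sum.swap) (simp add: transpose_def)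
  then show ?thesis by simp
qed

lemma abs_entry_le_norm: "\<bar>A $ i $ j\<bar> \<le> norm (A :: real^'n^'m)"
  using component_le_norm_cart[of "A $ i" j] Finite_Cartesian_Product.norm_nth_le[of A i] by linarith

lemma norm_matrix_le: "norm (A :: real^3^3) \<le> 9 * r" if "\<And>i j. \<bar>A $ i $ j\<bar> \<le> r"
proof -
  have "norm A \<le> (\<Sum>i\<in>UNIV. norm (A $ i))" unfolding norm_vec_def[of A] by (rule L2_set_le_sum) simp
  also have "\<dots> \<le> (\<Sum>i\<in>(UNIV :: 3 set). \<Sum>j\<in>(UNIV :: 3 set). \<bar>A $ i $ j\<bar>)" by (intro sum_mono norm_le_l1_cart)
  also have "\<dots> \<le> (\<Sum>i\<in>(UNIV :: 3 set). \<Sum>j\<in>(UNIV :: 3 set). r)" by (intro sum_mono that)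
  finally show ?thesis by simp
qed

lemma norm_matrix_mult: "norm (A ** B) \<le> norm A * norm (B :: real^'n^'k)" for A :: "real^'k^'m"
proof -
  have "((A ** B) $ i $ j)\<^sup>2 \<le> (\<Sum>k\<in>UNIV. (A $ i $ k)\<^sup>2) * (\<Sum>k\<in>UNIV. (B $ k $ j)\<^sup>2)" for i j
    unfolding matrix_matrix_mult_def by (simp add: Cauchy_Schwarz_ineq_sum)
  then have "(norm (A ** B))\<^sup>2 \<le> (\<Sum>i\<in>UNIV. \<Sum>j\<in>UNIV. (\<Sum>k\<in>UNIV. (A $ i $ k)\<^sup>2) * (\<Sum>k\<in>UNIV. (B $ k $ j)\<^sup>2))"
    unfolding norm_matrix_sq by (intro sum_mono)
  also have "\<dots> = (norm A)\<^sup>2 * (\<Sum>j\<in>UNIV. \<Sum>k\<in>UNIV. (B $ k $ j)\<^sup>2)"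
    unfolding norm_matrix_sq by (rule sum_product[symmetric])
  also have "(\<Sum>j\<in>UNIV. \<Sum>k\<in>UNIV. (B $ k $ j)\<^sup>2) = (norm B)\<^sup>2"
    unfolding norm_matrix_sq by (rule sum.swap)
  finally show ?thesis by (simp add: power_mult_distrib[symmetric] power2_le_iff_abs_le)
qed

text \<open>In dimension 3 this is the second exterior power in a reordered basis with signs chosen
  so that the map stays multiplicative. Each pair of indices is replaced by the missing one.\<close>

definition cofactors :: "real^3^3 \<Rightarrow> real^3^3" where
  "cofactors A = vector [
     vector [A$2$2 * A$3$3 - A$2$3 * A$3$2, A$2$3 * A$3$1 - A$2$1 * A$3$3, A$2$1 * A$3$2 - A$2$2 * A$3$1],
     vector [A$3$2 * A$1$3 - A$3$3 * A$1$2, A$3$3 * A$1$1 - A$3$1 * A$1$3, A$3$1 * A$1$2 - A$3$2 * A$1$1],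
     vector [A$1$2 * A$2$3 - A$1$3 * A$2$2, A$1$3 * A$2$1 - A$1$1 * A$2$3, A$1$1 * A$2$2 - A$1$2 * A$2$1]]"

lemma cofactors_nth [simp]:
  "cofactors A $ 1 $ 1 = A$2$2 * A$3$3 - A$2$3 * A$3$2"
  "cofactors A $ 1 $ 2 = A$2$3 * A$3$1 - A$2$1 * A$3$3"
  "cofactors A $ 1 $ 3 = A$2$1 * A$3$2 - A$2$2 * A$3$1"
  "cofactors A $ 2 $ 1 = A$3$2 * A$1$3 - A$3$3 * A$1$2"
  "cofactors A $ 2 $ 2 = A$3$3 * A$1$1 - A$3$1 * A$1$3"
  "cofactors A $ 2 $ 3 = A$3$1 * A$1$2 - A$3$2 * A$1$1"
  "cofactors A $ 3 $ 1 = A$1$2 * A$2$3 - A$1$3 * A$2$2"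
  "cofactors A $ 3 $ 2 = A$1$3 * A$2$1 - A$1$1 * A$2$3"
  "cofactors A $ 3 $ 3 = A$1$1 * A$2$2 - A$1$2 * A$2$1"
  by (simp_all add: cofactors_def)

lemma cofactors_mult: "cofactors (A ** B) = cofactors A ** cofactors B"
  by (simp add: vec_eq_iff forall_3 matrix_matrix_mult_def sum_3 algebra_simps)

lemma cofactors_transpose: "cofactors (transpose A) = transpose (cofactors A)"
  by (simp add: vec_eq_iff forall_3 transpose_def algebra_simps)

lemma cofactors_cofactors: "cofactors (cofactors A) = det A *\<^sub>R A"
  by (simp add: vec_eq_iff forall_3 det_3 algebra_simps)

lemma cofactors_det: "A ** transpose (cofactors A) = det A *\<^sub>R mat 1"
  by (simp add: vec_eq_iff forall_3 matrix_matrix_mult_def transpose_def sum_3 det_3 mat_def algebra_simps)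

lemma abs_minor_le:
  fixes a b c d :: real
  assumes "\<bar>a\<bar> \<le> r" "\<bar>b\<bar> \<le> s" "\<bar>c\<bar> \<le> r" "\<bar>d\<bar> \<le> s"
  shows "\<bar>a * b - c * d\<bar> \<le> 2 * r * s"
proof -
  have "\<bar>a * b\<bar> \<le> r * s" "\<bar>c * d\<bar> \<le> r * s" 
    unfolding abs_mult using assms by (auto intro!: mult_mono order_trans[OF abs_ge_zero])
  then show ?thesis using abs_triangle_ineq4[of "a * b" "c * d"] by simp
qed

lemma norm_cofactors_le: "norm (cofactors A) \<le> 18 * (norm A)\<^sup>2"
proof -
  have "\<bar>cofactors A $ i $ j\<bar> \<le> 2 * norm A * norm A" for i j
    using exhaust_3[of i] exhaust_3[of j] by (auto intro!: abs_minor_le abs_entry_le_norm)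
  from norm_matrix_le[OF this] show ?thesis by (simp add: power2_eq_square)
qed

text \<open>The numeral 3 of this type is 0, so the order is 3 < 1 < 2. Hence the unusual increasing
  lists in \<open>wedge_basis_3\<close>.\<close>

lemma less_3: "(3::3) < 1" "(1::3) < 2" "(3::3) < 2" "\<not> (1::3) < 3" "\<not> (2::3) < 1" "\<not> (2::3) < 3"
  by (simp_all add: less_bit1_def bit1.Rep_numeral bit1.Rep_1)

lemma wedge_basis_3:
  "wedge_basis 1 = {[1], [2], [3 :: 3]}"
  "wedge_basis 2 = {[3, 1], [3, 2], [1, 2 :: 3]}"
  "wedge_basis 3 = {[3, 1, 2 :: 3]}"
proof -
  have ex: "a = 1 \<or> a = 2 \<or> a = 3" for a :: 3 by (rule exhaust_3)
  show "wedge_basis 1 = {[1], [2], [3 :: 3]}"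
  proof (rule set_eqI)
    fix I :: "3 list"
    show "I \<in> wedge_basis 1 \<longleftrightarrow> I \<in> {[1], [2], [3]}"
      using ex by (auto simp: wedge_basis_def length_Suc_conv)
  qed
  show "wedge_basis 2 = {[3, 1], [3, 2], [1, 2 :: 3]}"
  proof (rule set_eqI)
    fix I :: "3 list"
    show "I \<in> wedge_basis 2 \<longleftrightarrow> I \<in> {[3, 1], [3, 2], [1, 2]}"
    proof
      assume "I \<in> wedge_basis 2"
      then obtain a b where I: "I = [a, b]" "a < b"
        by (auto simp: wedge_basis_def length_Suc_conv numeral_2_eq_2)
      then show "I \<in> {[3, 1], [3, 2], [1, 2]}" using ex[of a] ex[of b] less_3 by auto
    qed (auto simp: wedge_basis_def less_3)
  qed
  show "wedge_basis 3 = {[3, 1, 2 :: 3]}"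
  proof (rule set_eqI)
    fix I :: "3 list"
    show "I \<in> wedge_basis 3 \<longleftrightarrow> I \<in> {[3, 1, 2]}"
    proof
      assume "I \<in> wedge_basis 3"
      then obtain a b c where I: "I = [a, b, c]" "a < b" "b < c"
        by (auto simp: wedge_basis_def length_Suc_conv numeral_3_eq_3)
      then show "I \<in> {[3, 1, 2]}" using ex[of a] ex[of b] ex[of c] less_3 by auto
    qed (auto simp: wedge_basis_def less_3)
  qed
qed

lemma wedge_coord_1: "wedge_coord [x] [i] = x $ i"
  by (simp add: wedge_coord_def lessThan_Suc)

lemma wedge_coord_2: "wedge_coord [x, y] [i, j] = x $ i * y $ j - x $ j * y $ i"
  by (simp add: wedge_coord_def lessThan_Suc sum_over_permutations_insert sign_swap_id)

lemma wedge_coord_3: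
  "wedge_coord [x, y, z] [i, j, k] =
     x $ i * y $ j * z $ k + x $ j * y $ k * z $ i + x $ k * y $ i * z $ j
     - x $ i * y $ k * z $ j - x $ j * y $ i * z $ k - x $ k * y $ j * z $ i"
  by (simp add: wedge_coord_def lessThan_Suc sum_over_permutations_insert sign_swap_id
      sign_compose permutation_swap_id algebra_simps)

lemma matrix_axis: "((A :: real^'n^'m) *v axis j 1) $ i = A $ i $ j"
  by (simp add: matrix_vector_mul_component inner_axis)

lemma wedge_norm_1: "wedge_norm 1 A = norm (A :: real^3^3)"
proof -
  have "(\<Sum>I\<in>wedge_basis 1. \<Sum>J\<in>wedge_basis 1. (wedge_power A I J)\<^sup>2) = (norm A)\<^sup>2"
    unfolding wedge_basis_3 norm_matrix_sq by (simp add: wedge_power_def wedge_coord_1 matrix_axis sum_3)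
  then show ?thesis by (simp add: wedge_norm_def)
qed

text \<open>Order and signs of the basis vectors disappear in the sum of squares.\<close>

lemma wedge_norm_2: "wedge_norm 2 A = norm (cofactors A)"
proof -
  have "(\<Sum>I\<in>wedge_basis 2. \<Sum>J\<in>wedge_basis 2. (wedge_power A I J)\<^sup>2) = (norm (cofactors A))\<^sup>2"
    unfolding wedge_basis_3 norm_matrix_sq
    by (simp add: wedge_power_def wedge_coord_2 matrix_axis sum_3 power2_eq_square algebra_simps)
  then show ?thesis by (simp add: wedge_norm_def)
qed

lemma wedge_norm_3: "wedge_norm 3 A = \<bar>det (A :: real^3^3)\<bar>"
proof -
  have "(\<Sum>I\<in>wedge_basis 3. \<Sum>J\<in>wedge_basis 3. (wedge_power A I J)\<^sup>2) = (det A)\<^sup>2"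
    unfolding wedge_basis_3
    by (simp add: wedge_power_def wedge_coord_3 matrix_axis det_3 algebra_simps)
  then show ?thesis by (simp add: wedge_norm_def)
qed

lemma cocycle_eq: "cocycle n \<sigma> = transpose (incidence_upto \<sigma> n)"
proof (induction n)
  case (Suc n)
  have "shd ((stl ^^ n) \<sigma>) = \<sigma> !! n" by (simp add: sdrop_funpow)
  then show ?case using Suc by (simp add: matrix_transpose_mul)
qed (simp add: transpose_mat)

lemma wedge_norm_cocycle:
  "wedge_norm 1 (cocycle n \<sigma>) = norm (incidence_upto \<sigma> n)"
  "wedge_norm 2 (cocycle n \<sigma>) = norm (cofactors (incidence_upto \<sigma> n))"
  "wedge_norm 3 (cocycle n \<sigma>) = \<bar>det (incidence_upto \<sigma> n)\<bar>"
  by (simp_all only: wedge_norm_1 wedge_norm_2 wedge_norm_3 cocycle_eq cofactors_transpose norm_transpose det_transpose)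

lemma det_incidence: "s \<in> brun_substitutions \<Longrightarrow> \<bar>det (incidence_matrix s)\<bar> = 1"
  by (elim brun_cases) (simp_all add: det_3 incidence_matrix_def brun1_def brun2_def brun3_def)

lemma norm_incidence:
  assumes "s \<in> brun_substitutions"
  shows "norm (incidence_matrix s) \<le> 9" "norm (cofactors (incidence_matrix s)) \<le> 18 * 9\<^sup>2"
proof -
  have "\<bar>incidence_matrix s $ i $ j\<bar> \<le> 1" for i j
    using assms exhaust_3[of i] exhaust_3[of j]
    by (elim brun_cases disjE) (simp_all add: incidence_matrix_def brun1_def brun2_def brun3_def)
  from norm_matrix_le[OF this] show le: "norm (incidence_matrix s) \<le> 9" by simp
  have "norm (cofactors (incidence_matrix s)) \<le> 18 * (norm (incidence_matrix s))\<^sup>2" by (rule norm_cofactors_le)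
  also have "\<dots> \<le> 18 * 9\<^sup>2" using le by (intro mult_left_mono power_mono) auto
  finally show "norm (cofactors (incidence_matrix s)) \<le> 18 * 9\<^sup>2" .
qed

section \<open>Norms of products and of their exterior squares\<close>

context brun_sequence
begin

lemma det_incidence_upto: "\<bar>det (incidence_upto \<sigma> n)\<bar> = 1"
  by (induction n) (simp_all add: det_mul abs_mult det_incidence brun)

text \<open>1458 = 18 * 9^2 bounds one factor, in the matrix and in the cofactor version; the
  additional power absorbs the norm of the identity at level 0.\<close>

lemma norm_incidence_upto_le:
  "norm (incidence_upto \<sigma> n) \<le> 1458 ^ Suc n" "norm (cofactors (incidence_upto \<sigma> n)) \<le> 1458 ^ Suc n"
proof -
  have I: "\<bar>(mat 1 :: real^3^3) $ i $ j\<bar> \<le> 1" for i j by (simp add: mat_def)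
  have "cofactors (mat 1) = mat 1" by (simp add: vec_eq_iff forall_3 mat_def)
  then have 0: "norm (mat 1 :: real^3^3) \<le> 9" "norm (cofactors (mat 1)) \<le> 9"
    using norm_matrix_le[OF I] by auto
  show "norm (incidence_upto \<sigma> n) \<le> 1458 ^ Suc n"
  proof (induction n)
    case (Suc n)
    have "norm (incidence_upto \<sigma> (Suc n)) \<le> norm (incidence_upto \<sigma> n) * norm (incidence_matrix (\<sigma> !! n))"
      by (simp add: norm_matrix_mult)
    also have "\<dots> \<le> 1458 ^ Suc n * 1458" using Suc norm_incidence(1)[OF brun, of n] by (intro mult_mono) auto
    finally show ?case by (simp add: mult.commute)
  qed (use 0 in simp)
  show "norm (cofactors (incidence_upto \<sigma> n)) \<le> 1458 ^ Suc n"
  proof (induction n)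
    case (Suc n)
    have "norm (cofactors (incidence_upto \<sigma> (Suc n))) \<le>
        norm (cofactors (incidence_upto \<sigma> n)) * norm (cofactors (incidence_matrix (\<sigma> !! n)))"
      by (simp add: cofactors_mult norm_matrix_mult)
    also have "\<dots> \<le> 1458 ^ Suc n * 1458" using Suc norm_incidence(2)[OF brun, of n] by (intro mult_mono) auto
    finally show ?case by (simp add: mult.commute)
  qed (use 0 in simp)
qed

text \<open>The determinant is 1 or -1, so the product with the transposed cofactor matrix is plus
  or minus the identity. Together with the upper bounds this bounds both logarithms from
  below.\<close>

lemma norm_mult_cofactors_ge: "1 \<le> norm (incidence_upto \<sigma> n) * norm (cofactors (incidence_upto \<sigma> n))"
proof -
  let ?P = "incidence_upto \<sigma> n"
  have "1 = \<bar>(?P ** transpose (cofactors ?P)) $ 1 $ 1\<bar>"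
    using det_incidence_upto[of n] by (simp add: cofactors_det mat_def)
  also have "\<dots> \<le> norm (?P ** transpose (cofactors ?P))" by (rule abs_entry_le_norm)
  also have "\<dots> \<le> norm ?P * norm (cofactors ?P)" using norm_matrix_mult[of ?P "transpose (cofactors ?P)"] by simp
  finally show ?thesis .
qed

lemma norm_incidence_upto_pos:
  "0 < norm (incidence_upto \<sigma> n)" "0 < norm (cofactors (incidence_upto \<sigma> n))"
  using norm_mult_cofactors_ge[of n]
  by (cases "incidence_upto \<sigma> n = 0"; cases "cofactors (incidence_upto \<sigma> n) = 0"; simp)+

lemma ln_norm_incidence_upto:
  "\<bar>ln (norm (incidence_upto \<sigma> n))\<bar> \<le> real (Suc n) * ln 1458"
  "\<bar>ln (norm (cofactors (incidence_upto \<sigma> n)))\<bar> \<le> real (Suc n) * ln 1458"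
proof -
  note pos = norm_incidence_upto_pos[of n]
  have up: "ln (norm (incidence_upto \<sigma> n)) \<le> real (Suc n) * ln 1458"
    "ln (norm (cofactors (incidence_upto \<sigma> n))) \<le> real (Suc n) * ln 1458"
    using norm_incidence_upto_le[of n] pos by (simp_all only: ln_realpow[symmetric] ln_le_cancel_iff zero_less_power zero_less_numeral)
  have "ln 1 \<le> ln (norm (incidence_upto \<sigma> n) * norm (cofactors (incidence_upto \<sigma> n)))"
    using norm_mult_cofactors_ge[of n] by (intro ln_mono) auto
  then have "0 \<le> ln (norm (incidence_upto \<sigma> n)) + ln (norm (cofactors (incidence_upto \<sigma> n)))"
    using pos by (simp add: ln_mult)
  with up show "\<bar>ln (norm (incidence_upto \<sigma> n))\<bar> \<le> real (Suc n) * ln 1458"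
    "\<bar>ln (norm (cofactors (incidence_upto \<sigma> n)))\<bar> \<le> real (Suc n) * ln 1458" by linarith+
qed

text \<open>
  Up to a bounded vector, every \<open>x \<and> y\<close> is of the form \<open>x' \<and> y\<close> with \<open>x'\<close> orthogonal to the sorted
  vector \<open>prod_mat 0 n *v vec 1\<close>, and there the product contracts.
\<close>
lemma norm_cofactors_contraction:
  "norm (cofactors (incidence_upto \<sigma> n)) \<le>
     36 * contraction_rate ^ visits \<sigma> 0 n * norm (incidence_upto \<sigma> n)"
proof -
  let ?P = "incidence_upto \<sigma> n" and ?r = "contraction_rate ^ visits \<sigma> 0 n"
  have P: "prod_mat 0 n = ?P" by (simp add: prod_mat_def)
  define u where "u = ?P *v vec 1"
  have "sorted_vec (vec 1 :: real^3)" by (simp add: sorted_vec_def)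
  then have u: "sorted_vec u" using sorted_vec_prod_mat[of "vec 1" 0 n] by (simp add: u_def P)
  have ratio: "0 \<le> u$i / u$3" "u$i / u$3 \<le> 1" for i
    using u exhaust_3[of i] by (auto simp: sorted_vec_def field_simps)
  \<comment> \<open>Subtracting a multiple of the third unit vector makes the vector orthogonal to
    \<open>u\<close>; the coefficient is at most 1 because \<open>u$3\<close> is the largest
    coordinate.\<close>
  define x where "x = (\<lambda>i. axis i 1 - (u$i / u$3) *\<^sub>R axis 3 1 :: real^3)"
  have xb: "bounded_by 1 (x i)" if "i \<noteq> 3" for i
    using that ratio[of i] by (auto simp: bounded_by_def x_def axis_def)
  have "x i \<bullet> u = 0" if "i \<noteq> 3" for i
    using u by (simp add: x_def inner_diff_left inner_axis' sorted_vec_def)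
  then have xP: "bounded_by (?r * 1) (x i v* ?P)" if "i \<noteq> 3" for i
    using prod_mat_contraction[of "vec 1" 1 "x i" 0 n] that xb \<open>sorted_vec (vec 1)\<close> by (simp add: P u_def)
  have xP_nth: "(x i v* ?P) $ j = ?P$i$j - (u$i / u$3) * ?P$3$j" for i j
    using exhaust_3[of i] by (elim disjE) (simp_all add: x_def vector_matrix_mult_def axis_def sum_3)
  let ?s = "norm ?P"
  have row: "\<bar>(x i v* ?P) $ j\<bar> \<le> ?r" if "i \<noteq> 3" for i j using xP[OF that] by (simp add: bounded_by_def)
  have ent: "\<bar>?P $ i $ j\<bar> \<le> ?s" for i j by (rule abs_entry_le_norm)
  let ?X = "\<lambda>i j. (x i v* ?P) $ j"
  have minor: "\<bar>?X i j * ?P $ i' $ j' - ?X i k * ?P $ i' $ k'\<bar> \<le> 2 * ?r * ?s" if "i \<noteq> 3" for i j i' j' k k'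
    by (rule abs_minor_le) (rule row[OF that] ent)+
  have c1: "cofactors ?P $ 1 $ 1 = ?X 2 2 * ?P$3$3 - ?X 2 3 * ?P$3$2"
    "cofactors ?P $ 1 $ 2 = ?X 2 3 * ?P$3$1 - ?X 2 1 * ?P$3$3"
    "cofactors ?P $ 1 $ 3 = ?X 2 1 * ?P$3$2 - ?X 2 2 * ?P$3$1"
    unfolding xP_nth cofactors_nth by (simp_all add: algebra_simps)
  have c2: "cofactors ?P $ 2 $ 1 = - (?X 1 2 * ?P$3$3 - ?X 1 3 * ?P$3$2)"
    "cofactors ?P $ 2 $ 2 = - (?X 1 3 * ?P$3$1 - ?X 1 1 * ?P$3$3)"
    "cofactors ?P $ 2 $ 3 = - (?X 1 1 * ?P$3$2 - ?X 1 2 * ?P$3$1)"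
    unfolding xP_nth cofactors_nth by (simp_all add: algebra_simps)
  \<comment> \<open>These minors do not involve row 3, so replacing row 1 by its contracted version
    leaves a minor of rows 3 and 2, which is a cofactor of row 1 already bounded. This makes 4 out
    of 2, and 36 = 9 * 4 in the end.\<close>
  have c3: "cofactors ?P $ 3 $ 1 = (?X 1 2 * ?P$2$3 - ?X 1 3 * ?P$2$2) - (u$1 / u$3) * cofactors ?P $ 1 $ 1"
    "cofactors ?P $ 3 $ 2 = (?X 1 3 * ?P$2$1 - ?X 1 1 * ?P$2$3) - (u$1 / u$3) * cofactors ?P $ 1 $ 2"
    "cofactors ?P $ 3 $ 3 = (?X 1 1 * ?P$2$2 - ?X 1 2 * ?P$2$1) - (u$1 / u$3) * cofactors ?P $ 1 $ 3"
    unfolding xP_nth cofactors_nth by (simp_all add: algebra_simps)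
  have b1: "\<bar>cofactors ?P $ 1 $ j\<bar> \<le> 2 * ?r * ?s" for j
    using exhaust_3[of j] by (elim disjE) (simp_all only: c1, (rule minor, simp)+)
  have b2: "\<bar>cofactors ?P $ 2 $ j\<bar> \<le> 2 * ?r * ?s" for j
    using exhaust_3[of j] by (elim disjE) (simp_all only: c2 abs_minus_cancel, (rule minor, simp)+)
  have b3: "\<bar>cofactors ?P $ 3 $ j\<bar> \<le> 4 * ?r * ?s" for j
  proof -
    have "\<bar>(u$1 / u$3) * cofactors ?P $ 1 $ j\<bar> \<le> 2 * ?r * ?s"
      using mult_mono[OF ratio(2)[of 1] b1[of j]] ratio(1)[of 1]
      unfolding abs_mult abs_of_nonneg[OF ratio(1)] by simp
    then have tri: "\<bar>m - (u$1 / u$3) * cofactors ?P $ 1 $ j\<bar> \<le> 4 * ?r * ?s" if "\<bar>m\<bar> \<le> 2 * ?r * ?s" for m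
      using that by linarith
    have "\<exists>m. cofactors ?P $ 3 $ j = m - (u$1 / u$3) * cofactors ?P $ 1 $ j \<and> \<bar>m\<bar> \<le> 2 * ?r * ?s"
      using exhaust_3[of j] c3 minor[of 1] by (elim disjE) (metis letter_neq(5))+
    then show ?thesis using tri by metis
  qed
  have rs: "0 \<le> ?r * ?s" using contraction_rate_bounds by (intro mult_nonneg_nonneg) (auto simp: less_imp_le)
  have "\<bar>cofactors ?P $ i $ j\<bar> \<le> 4 * ?r * ?s" for i j
    using exhaust_3[of i] b1[of j] b2[of j] b3[of j] rs by (elim disjE) auto
  from norm_matrix_le[OF this] show ?thesis by simp
qed

end

section \<open>Expected logarithms and the Lyapunov exponents\<close>

context brun_process
begin

abbreviation log_norm :: "nat \<Rightarrow> 3 substitution stream \<Rightarrow> real" where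
  "log_norm n \<sigma> \<equiv> ln (norm (incidence_upto \<sigma> n))"

abbreviation log_conorm :: "nat \<Rightarrow> 3 substitution stream \<Rightarrow> real" where
  "log_conorm n \<sigma> \<equiv> ln (norm (cofactors (incidence_upto \<sigma> n)))"

lemma measurable_entry: "(\<lambda>\<sigma>. incidence_upto \<sigma> n $ i $ j) \<in> borel_measurable \<nu>"
proof (induction n arbitrary: i j)
  case (Suc n)
  have "(\<lambda>\<sigma>. \<sigma> !! n) \<in> measurable \<nu> (count_space brun_substitutions)"
    using measurable_snth[of n "count_space brun_substitutions"] sets_nu by (simp cong: measurable_cong_sets)
  then have "(\<lambda>\<sigma>. incidence_matrix (\<sigma> !! n) $ k $ j) \<in> borel_measurable \<nu>" for k
    by (rule measurable_compose) simp
  then show ?case using Suc.IH by (simp add: matrix_matrix_mult_def)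
qed simp

lemma borel_measurable_norm_entries:
  fixes A :: "'a \<Rightarrow> real^'n^'m"
  assumes "\<And>i j. (\<lambda>x. A x $ i $ j) \<in> borel_measurable M"
  shows "(\<lambda>x. norm (A x)) \<in> borel_measurable M"
proof -
  have "norm (A x) = sqrt (\<Sum>i\<in>UNIV. \<Sum>j\<in>UNIV. (A x $ i $ j)\<^sup>2)" for x
    by (simp add: norm_matrix_sq[symmetric])
  then show ?thesis using assms by simp
qed

lemma measurable_log_norm: "log_norm n \<in> borel_measurable \<nu>"
  by (intro borel_measurable_ln borel_measurable_norm_entries measurable_entry)

lemma measurable_log_conorm: "log_conorm n \<in> borel_measurable \<nu>"
proof (intro borel_measurable_ln borel_measurable_norm_entries)
  fix i j
  show "(\<lambda>\<sigma>. cofactors (incidence_upto \<sigma> n) $ i $ j) \<in> borel_measurable \<nu>"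
    using exhaust_3[of i] exhaust_3[of j] measurable_entry[of n] by (elim disjE) simp_all
qed

lemma integrable_log:
  "integrable \<nu> (log_norm n)" "integrable \<nu> (log_conorm n)"
proof -
  have b: "AE \<sigma> in \<nu>. norm (log_norm n \<sigma>) \<le> real (Suc n) * ln 1458"
    "AE \<sigma> in \<nu>. norm (log_conorm n \<sigma>) \<le> real (Suc n) * ln 1458"
    using brun_sequence.ln_norm_incidence_upto[OF brun_sequence_space] by (auto intro!: AE_I2)
  show "integrable \<nu> (log_norm n)" by (rule integrable_const_bound[OF b(1) measurable_log_norm])
  show "integrable \<nu> (log_conorm n)" by (rule integrable_const_bound[OF b(2) measurable_log_conorm])
qed

lemma integral_log_bound:
  "\<bar>\<integral>\<sigma>. log_norm n \<sigma> \<partial>\<nu>\<bar> \<le> real (Suc n) * ln 1458" "\<bar>\<integral>\<sigma>. log_conorm n \<sigma> \<partial>\<nu>\<bar> \<le> real (Suc n) * ln 1458"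
proof -
  have b: "\<bar>\<integral>\<sigma>. f \<sigma> \<partial>\<nu>\<bar> \<le> real (Suc n) * ln 1458"
    if "integrable \<nu> f" "\<And>\<sigma>. \<sigma> \<in> space \<nu> \<Longrightarrow> \<bar>f \<sigma>\<bar> \<le> real (Suc n) * ln 1458" for f
  proof -
    have "\<bar>\<integral>\<sigma>. f \<sigma> \<partial>\<nu>\<bar> \<le> (\<integral>\<sigma>. \<bar>f \<sigma>\<bar> \<partial>\<nu>)" by (rule integral_abs_bound)
    also have "\<dots> \<le> (\<integral>\<sigma>. real (Suc n) * ln 1458 \<partial>\<nu>)"
      using that by (intro integral_mono) auto
    finally show ?thesis by (simp add: prob_space)
  qed
  note ln = brun_sequence.ln_norm_incidence_upto[OF brun_sequence_space]
  show "\<bar>\<integral>\<sigma>. log_norm n \<sigma> \<partial>\<nu>\<bar> \<le> real (Suc n) * ln 1458" by (rule b[OF integrable_log(1) ln(1)])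
  show "\<bar>\<integral>\<sigma>. log_conorm n \<sigma> \<partial>\<nu>\<bar> \<le> real (Suc n) * ln 1458" by (rule b[OF integrable_log(2) ln(2)])
qed

lemma integral_sdrop:
  assumes "f \<in> borel_measurable \<nu>"
  shows "(\<integral>\<sigma>. f (sdrop n \<sigma>) \<partial>\<nu>) = (\<integral>\<sigma>. (f \<sigma> :: real) \<partial>\<nu>)"
proof -
  have "f \<in> borel_measurable (distr \<nu> \<nu> (sdrop n))" unfolding distr_sdrop by (rule assms)
  from integral_distr[OF measurable_sdrop_nu assms, of n] show ?thesis unfolding distr_sdrop by simp
qed

lemma integral_log_subadditive:
  "(\<integral>\<sigma>. log_norm (m + n) \<sigma> \<partial>\<nu>) \<le> (\<integral>\<sigma>. log_norm m \<sigma> \<partial>\<nu>) + (\<integral>\<sigma>. log_norm n \<sigma> \<partial>\<nu>)"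
  "(\<integral>\<sigma>. log_conorm (m + n) \<sigma> \<partial>\<nu>) \<le> (\<integral>\<sigma>. log_conorm m \<sigma> \<partial>\<nu>) + (\<integral>\<sigma>. log_conorm n \<sigma> \<partial>\<nu>)"
proof -
  have int: "integrable \<nu> (\<lambda>\<sigma>. f (sdrop m \<sigma>))" if "integrable \<nu> f" for f :: "_ \<Rightarrow> real"
    using integrable_distr[OF measurable_sdrop_nu, of m f] that by (simp add: distr_sdrop)
  have sub: "(\<integral>\<sigma>. f (m + n) \<sigma> \<partial>\<nu>) \<le> (\<integral>\<sigma>. f m \<sigma> \<partial>\<nu>) + (\<integral>\<sigma>. f n \<sigma> \<partial>\<nu>)"
    if f: "\<And>n. integrable \<nu> (f n)"
      "\<And>\<sigma>. \<sigma> \<in> space \<nu> \<Longrightarrow> f (m + n) \<sigma> \<le> f m \<sigma> + f n (sdrop m \<sigma>)" for f :: "nat \<Rightarrow> _ \<Rightarrow> real"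
  proof -
    have "(\<integral>\<sigma>. f (m + n) \<sigma> \<partial>\<nu>) \<le> (\<integral>\<sigma>. f m \<sigma> + f n (sdrop m \<sigma>) \<partial>\<nu>)"
      using f int[OF f(1)] by (intro integral_mono) auto
    also have "\<dots> = (\<integral>\<sigma>. f m \<sigma> \<partial>\<nu>) + (\<integral>\<sigma>. f n (sdrop m \<sigma>) \<partial>\<nu>)"
      using f(1) int[OF f(1)] by (intro Bochner_Integration.integral_add) auto
    also have "(\<integral>\<sigma>. f n (sdrop m \<sigma>) \<partial>\<nu>) = (\<integral>\<sigma>. f n \<sigma> \<partial>\<nu>)"
      by (rule integral_sdrop) (rule borel_measurable_integrable[OF f(1)])
    finally show ?thesis .
  qed
  have pos: "0 < norm (incidence_upto \<sigma> k)" "0 < norm (cofactors (incidence_upto \<sigma> k))"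
    "0 < norm (incidence_upto (sdrop m \<sigma>) k)" "0 < norm (cofactors (incidence_upto (sdrop m \<sigma>) k))"
    if "\<sigma> \<in> space \<nu>" for \<sigma> k
    using brun_sequence.norm_incidence_upto_pos brun_sequence_space that sdrop_space by blast+
  show "(\<integral>\<sigma>. log_norm (m + n) \<sigma> \<partial>\<nu>) \<le> (\<integral>\<sigma>. log_norm m \<sigma> \<partial>\<nu>) + (\<integral>\<sigma>. log_norm n \<sigma> \<partial>\<nu>)"
  proof (rule sub[OF integrable_log(1)])
    fix \<sigma> assume "\<sigma> \<in> space \<nu>"
    note pos = pos[OF this]
    have "norm (incidence_upto \<sigma> (m + n)) \<le> norm (incidence_upto \<sigma> m) * norm (incidence_upto (sdrop m \<sigma>) n)"
      unfolding incidence_upto_add by (rule norm_matrix_mult)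
    from ln_mono[OF this] show "log_norm (m + n) \<sigma> \<le> log_norm m \<sigma> + log_norm n (sdrop m \<sigma>)"
      using pos(1)[of "m + n"] pos(1)[of m] pos(3)[of n] by (simp add: ln_mult)
  qed
  show "(\<integral>\<sigma>. log_conorm (m + n) \<sigma> \<partial>\<nu>) \<le> (\<integral>\<sigma>. log_conorm m \<sigma> \<partial>\<nu>) + (\<integral>\<sigma>. log_conorm n \<sigma> \<partial>\<nu>)"
  proof (rule sub[OF integrable_log(2)])
    fix \<sigma> assume "\<sigma> \<in> space \<nu>"
    note pos = pos[OF this]
    have "norm (cofactors (incidence_upto \<sigma> (m + n))) \<le>
        norm (cofactors (incidence_upto \<sigma> m)) * norm (cofactors (incidence_upto (sdrop m \<sigma>) n))"
      unfolding incidence_upto_add cofactors_mult by (rule norm_matrix_mult)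
    from ln_mono[OF this] show "log_conorm (m + n) \<sigma> \<le> log_conorm m \<sigma> + log_conorm n (sdrop m \<sigma>)"
      using pos(2)[of "m + n"] pos(2)[of m] pos(4)[of n] by (simp add: ln_mult)
  qed
qed

lemma log_limits:
  obtains L1 L2 where "(\<lambda>n. (\<integral>\<sigma>. log_norm n \<sigma> \<partial>\<nu>) / real n) \<longlonglongrightarrow> L1"
    "(\<lambda>n. (\<integral>\<sigma>. log_conorm n \<sigma> \<partial>\<nu>) / real n) \<longlonglongrightarrow> L2"
proof -
  have lim: "\<exists>L. (\<lambda>n. a n / real n) \<longlonglongrightarrow> L"
    if sub: "\<And>m n. a (m + n) \<le> a m + a n" and bnd: "\<And>n. \<bar>a n\<bar> \<le> real (Suc n) * ln 1458" for a :: "nat \<Rightarrow> real"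
  proof -
    \<comment> \<open>Factor 2 because \<open>Suc n\<close> is at most 2 n for positive n; at 0
      subadditivity itself gives nonnegativity.\<close>
    have "- (2 * ln 1458) * real n \<le> a n" for n
    proof (cases "n = 0")
      case True
      then show ?thesis using sub[of 0 0] by simp
    next
      case False
      have "real (Suc n) * ln 1458 \<le> (2 * real n) * ln 1458" using False by (intro mult_right_mono) auto
      then have "- ((2 * real n) * ln 1458) \<le> a n" using bnd[of n] unfolding abs_le_iff by (meson le_minus_iff minus_le_iff order.trans)
      then show ?thesis by (simp add: mult_ac)
    qed
    then show ?thesis using fekete[OF sub] by metis
  qed
  show ?thesis
    using lim[OF integral_log_subadditive(1) integral_log_bound(1)]
      lim[OF integral_log_subadditive(2) integral_log_bound(2)] that by blast
qed

text \<open>There are n - 4 possible starting levels, equally likely by stationarity. Counting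
  overlapping blocks makes this an identity.\<close>

lemma integral_visits:
  assumes "4 \<le> n"
  shows "(\<integral>\<sigma>. real (visits \<sigma> 0 n) \<partial>\<nu>) = (real n - 4) * prob {\<sigma> \<in> space \<nu>. occurs \<sigma> 0}"
proof -
  have occ: "(\<integral>\<sigma>. (if occurs \<sigma> l then 1 else 0 :: real) \<partial>\<nu>) = prob {\<sigma> \<in> space \<nu>. occurs \<sigma> 0}" for l
  proof -
    have "(\<integral>\<sigma>. (if occurs \<sigma> l then 1 else 0 :: real) \<partial>\<nu>) = (\<integral>\<sigma>. indicator {\<sigma> \<in> space \<nu>. occurs \<sigma> l} \<sigma> \<partial>\<nu>)"
      by (intro Bochner_Integration.integral_cong) (auto simp: indicator_def)
    also have "\<dots> = prob {\<sigma> \<in> space \<nu>. occurs \<sigma> l}" using measurable_occurs by simp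
    also have "{\<sigma> \<in> space \<nu>. occurs \<sigma> l} = sdrop l -` {\<sigma> \<in> space \<nu>. occurs \<sigma> 0} \<inter> space \<nu>"
      using sdrop_space by (auto simp: occurs_sdrop)
    also have "prob \<dots> = prob {\<sigma> \<in> space \<nu>. occurs \<sigma> 0}" by (rule prob_sdrop[OF measurable_occurs])
    finally show ?thesis .
  qed
  have int: "integrable \<nu> (\<lambda>\<sigma>. if occurs \<sigma> l then 1 else 0 :: real)" for l
    by (rule integrable_const_bound[where B = 1]) (auto intro: measurable_indicator_occurs)
  have "{l. 0 \<le> l \<and> l + 5 \<le> 0 + n} = {..<n - 4}" using assms by auto
  then show ?thesis
    unfolding real_visits using assms
    by (simp only: Bochner_Integration.integral_sum[OF int] occ) (simp add: of_nat_diff)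
qed

lemma log_conorm_le:
  assumes "4 \<le> n"
  shows "(\<integral>\<sigma>. log_conorm n \<sigma> \<partial>\<nu>) \<le> ln 36 + ln contraction_rate * ((real n - 4) * prob {\<sigma> \<in> space \<nu>. occurs \<sigma> 0})
    + (\<integral>\<sigma>. log_norm n \<sigma> \<partial>\<nu>)"
proof -
  have int: "integrable \<nu> (\<lambda>\<sigma>. real (visits \<sigma> 0 n))"
  proof (rule integrable_const_bound[where B = "real n"])
    show "AE \<sigma> in \<nu>. norm (real (visits \<sigma> 0 n)) \<le> real n"
    proof (rule AE_I2)
      fix \<sigma>
      have "visits \<sigma> 0 n \<le> n" using visits_add_le[of \<sigma> 0 0 n] by simp
      then show "norm (real (visits \<sigma> 0 n)) \<le> real n" by simp
    qed
  qed (rule measurable_visits)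
  have "(\<integral>\<sigma>. log_conorm n \<sigma> \<partial>\<nu>) \<le> (\<integral>\<sigma>. ln 36 + ln contraction_rate * real (visits \<sigma> 0 n) + log_norm n \<sigma> \<partial>\<nu>)"
  proof (rule integral_mono)
    show "integrable \<nu> (\<lambda>\<sigma>. ln 36 + ln contraction_rate * real (visits \<sigma> 0 n) + log_norm n \<sigma>)"
      using int integrable_log(1) by (intro Bochner_Integration.integrable_add integrable_mult_right) auto
    fix \<sigma> assume "\<sigma> \<in> space \<nu>"
    then interpret brun_sequence \<sigma> by (rule brun_sequence_space)
    have "log_conorm n \<sigma> \<le> ln (36 * contraction_rate ^ visits \<sigma> 0 n * norm (incidence_upto \<sigma> n))"
      by (rule ln_mono[OF norm_cofactors_contraction]) (rule norm_incidence_upto_pos)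
    also have "\<dots> = ln 36 + ln contraction_rate * real (visits \<sigma> 0 n) + log_norm n \<sigma>"
      using contraction_rate_bounds norm_incidence_upto_pos(1)[of n] by (simp add: ln_mult ln_realpow)
    finally show "log_conorm n \<sigma> \<le> ln 36 + ln contraction_rate * real (visits \<sigma> 0 n) + log_norm n \<sigma>" .
  qed (rule integrable_log)
  also have "\<dots> = ln 36 + ln contraction_rate * (\<integral>\<sigma>. real (visits \<sigma> 0 n) \<partial>\<nu>) + (\<integral>\<sigma>. log_norm n \<sigma> \<partial>\<nu>)"
    using int integrable_log(1) by (simp add: prob_space)
  finally show ?thesis unfolding integral_visits[OF assms] .
qed

text \<open>Taking cofactors twice returns the matrix up to sign, so its norm is controlled by the
  squared norm of the exterior square.\<close>

lemma log_norm_le: "(\<integral>\<sigma>. log_norm n \<sigma> \<partial>\<nu>) \<le> ln 18 + 2 * (\<integral>\<sigma>. log_conorm n \<sigma> \<partial>\<nu>)"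
proof -
  have "(\<integral>\<sigma>. log_norm n \<sigma> \<partial>\<nu>) \<le> (\<integral>\<sigma>. ln 18 + 2 * log_conorm n \<sigma> \<partial>\<nu>)"
  proof (rule integral_mono)
    show "integrable \<nu> (\<lambda>\<sigma>. ln 18 + 2 * log_conorm n \<sigma>)"
      using integrable_log(2) by (intro Bochner_Integration.integrable_add integrable_mult_right) auto
    fix \<sigma> assume "\<sigma> \<in> space \<nu>"
    then interpret brun_sequence \<sigma> by (rule brun_sequence_space)
    have "norm (incidence_upto \<sigma> n) = norm (cofactors (cofactors (incidence_upto \<sigma> n)))"
      by (simp add: cofactors_cofactors det_incidence_upto)
    also have "\<dots> \<le> 18 * (norm (cofactors (incidence_upto \<sigma> n)))\<^sup>2" by (rule norm_cofactors_le)
    finally have "log_norm n \<sigma> \<le> ln (18 * (norm (cofactors (incidence_upto \<sigma> n)))\<^sup>2)"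
      by (rule ln_mono) (rule norm_incidence_upto_pos)
    also have "\<dots> = ln 18 + 2 * log_conorm n \<sigma>"
      using norm_incidence_upto_pos(2)[of n] by (simp add: ln_mult ln_realpow)
    finally show "log_norm n \<sigma> \<le> ln 18 + 2 * log_conorm n \<sigma>" .
  qed (rule integrable_log)
  also have "\<dots> = ln 18 + 2 * (\<integral>\<sigma>. log_conorm n \<sigma> \<partial>\<nu>)"
    using integrable_log(2) by (simp add: prob_space)
  finally show ?thesis .
qed

text \<open>With \<open>L1\<close> and \<open>L2\<close> the growth rates of the product and of its
  exterior square, contraction gives \<open>L2 < L1\<close>, that is a negative second exponent. The
  double cofactor gives L1 \<le> 2 L2, which orders the last two exponents since all three sum to 0.
  The two inequalities together force \<open>L1 > 0\<close>.\<close>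

theorem pisot: "pisot_condition \<nu>"
proof -
  obtain L1 L2 where L: "(\<lambda>n. (\<integral>\<sigma>. log_norm n \<sigma> \<partial>\<nu>) / real n) \<longlonglongrightarrow> L1"
    "(\<lambda>n. (\<integral>\<sigma>. log_conorm n \<sigma> \<partial>\<nu>) / real n) \<longlonglongrightarrow> L2"
    by (rule log_limits)
  define p where "p = prob {\<sigma> \<in> space \<nu>. occurs \<sigma> 0}"
  define c where "c = ln contraction_rate"
  have c: "c < 0" using contraction_rate_bounds by (simp add: c_def)
  have "L2 \<le> 0 + c * p + L1"
  proof (rule LIMSEQ_le[OF L(2)])
    show "(\<lambda>n. (ln 36 - 4 * c * p) / real n + c * p + (\<integral>\<sigma>. log_norm n \<sigma> \<partial>\<nu>) / real n) \<longlonglongrightarrow> 0 + c * p + L1"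
      by (intro tendsto_add tendsto_const lim_const_over_n L(1))
    show "\<exists>N. \<forall>n\<ge>N. (\<integral>\<sigma>. log_conorm n \<sigma> \<partial>\<nu>) / real n \<le>
        (ln 36 - 4 * c * p) / real n + c * p + (\<integral>\<sigma>. log_norm n \<sigma> \<partial>\<nu>) / real n"
    proof (intro exI[of _ 4] allI impI)
      fix n :: nat assume n: "4 \<le> n"
      have "(\<integral>\<sigma>. log_conorm n \<sigma> \<partial>\<nu>) \<le> (ln 36 - 4 * c * p) + c * p * real n + (\<integral>\<sigma>. log_norm n \<sigma> \<partial>\<nu>)"
        using log_conorm_le[OF n] by (simp add: c_def p_def algebra_simps)
      then have "(\<integral>\<sigma>. log_conorm n \<sigma> \<partial>\<nu>) / real n \<le>
          ((ln 36 - 4 * c * p) + c * p * real n + (\<integral>\<sigma>. log_norm n \<sigma> \<partial>\<nu>)) / real n"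
        by (intro divide_right_mono) auto
      also have "\<dots> = (ln 36 - 4 * c * p) / real n + c * p + (\<integral>\<sigma>. log_norm n \<sigma> \<partial>\<nu>) / real n"
        using n by (simp add: add_divide_distrib)
      finally show "(\<integral>\<sigma>. log_conorm n \<sigma> \<partial>\<nu>) / real n \<le>
          (ln 36 - 4 * c * p) / real n + c * p + (\<integral>\<sigma>. log_norm n \<sigma> \<partial>\<nu>) / real n" .
    qed
  qed
  moreover have "c * p < 0" using c prob_occurs by (simp add: p_def mult_neg_pos)
  ultimately have L21: "L2 < L1" by linarith
  have L12: "L1 \<le> 0 + 2 * L2"
  proof (rule LIMSEQ_le[OF L(1)])
    show "(\<lambda>n. ln 18 / real n + 2 * ((\<integral>\<sigma>. log_conorm n \<sigma> \<partial>\<nu>) / real n)) \<longlonglongrightarrow> 0 + 2 * L2"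
      by (intro tendsto_add tendsto_mult tendsto_const lim_const_over_n L(2))
    show "\<exists>N. \<forall>n\<ge>N. (\<integral>\<sigma>. log_norm n \<sigma> \<partial>\<nu>) / real n \<le> ln 18 / real n + 2 * ((\<integral>\<sigma>. log_conorm n \<sigma> \<partial>\<nu>) / real n)"
    proof (intro exI allI impI)
      fix n :: nat
      show "(\<integral>\<sigma>. log_norm n \<sigma> \<partial>\<nu>) / real n \<le> ln 18 / real n + 2 * ((\<integral>\<sigma>. log_conorm n \<sigma> \<partial>\<nu>) / real n)"
        using divide_right_mono[OF log_norm_le[of n], of "real n"] by (simp add: add_divide_distrib)
    qed
  qed
  define \<theta> where "\<theta> = (\<lambda>k::nat. if k = 1 then L1 else if k = 2 then L2 - L1 else - L2)"
  have "(\<forall>n. integrable \<nu> (\<lambda>x. ln (wedge_norm k (cocycle n x)))) \<and>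
      (\<lambda>n. (1 / real n) * (\<integral>x. ln (wedge_norm k (cocycle n x)) \<partial>\<nu>)) \<longlonglongrightarrow> (\<Sum>j=1..k. \<theta> j)"
    if k: "k \<in> {1..3}" for k
  proof -
    have "k = 1 \<or> k = 2 \<or> k = 3" using k by auto
    then consider "k = 1" | "k = 2" | "k = 3" by blast
    then show ?thesis
    proof cases
      case 1
      then show ?thesis using integrable_log(1) L(1) by (simp add: wedge_norm_cocycle(1)[unfolded One_nat_def] \<theta>_def)
    next
      case 2
      have "(\<Sum>j=1..2. \<theta> j) = L2" by (simp add: \<theta>_def numeral_2_eq_2)
      then show ?thesis unfolding 2 wedge_norm_cocycle using integrable_log(2) L(2) by simp
    next
      case 3
      have "(\<Sum>j=1..3. \<theta> j) = 0" by (simp add: \<theta>_def numeral_2_eq_2 numeral_3_eq_3)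
      moreover have "(\<integral>x. ln \<bar>det (incidence_upto x n)\<bar> \<partial>\<nu>) = 0" "integrable \<nu> (\<lambda>x. ln \<bar>det (incidence_upto x n)\<bar>)" for n
      proof -
        have z: "ln \<bar>det (incidence_upto x n)\<bar> = 0" if "x \<in> space \<nu>" for x
          using brun_sequence.det_incidence_upto[OF brun_sequence_space[OF that]] by simp
        then show "(\<integral>x. ln \<bar>det (incidence_upto x n)\<bar> \<partial>\<nu>) = 0"
          by (simp cong: Bochner_Integration.integral_cong)
        show "integrable \<nu> (\<lambda>x. ln \<bar>det (incidence_upto x n)\<bar>)"
          using z by (simp cong: Bochner_Integration.integrable_cong)
      qed
      ultimately show ?thesis unfolding 3 wedge_norm_cocycle by simp
    qed
  qed
  then have "lyapunov_exponents \<nu> \<theta>" unfolding lyapunov_exponents_def by blast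
  moreover have "\<theta> 1 > 0" "0 > \<theta> 2" "\<theta> 2 \<ge> \<theta> 3" using L21 L12 by (simp_all add: \<theta>_def)
  ultimately show ?thesis unfolding pisot_condition_def by blast
qed

end

theorem theorem3p10:
  fixes \<nu> :: "3 substitution stream measure"
  assumes "sets \<nu> = sets (stream_space (count_space brun_substitutions))"
    and "invariant_prob \<nu> stl"
    and "ergodic \<nu> stl"
    and "\<And>w. w \<in> lists brun_substitutions \<Longrightarrow>
           emeasure \<nu> {\<sigma> \<in> streams brun_substitutions. stake (length w) \<sigma> = w} > 0"
  shows "pisot_condition \<nu> \<and>
    (AE \<sigma> in \<nu>.
      (\<exists>u. right_eigenvector \<sigma> u \<and> tiling_of_perp (vec 1) (rauzy_collection \<sigma> u)) \<and>
      (\<exists>\<mu>. invariant_prob_on (sadic_shift \<sigma>) \<mu> \<and>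
           (\<forall>\<mu>'. invariant_prob_on (sadic_shift \<sigma>) \<mu>' \<longrightarrow> \<mu>' = \<mu>) \<and>
           (\<exists>t :: real^2.
              measurably_conjugate \<mu> stl torus (torus_translation t) \<and>
              natural_codings int_lattice t (sadic_shift \<sigma>))))"
proof -
  interpret brun_process \<nu> using assms by unfold_locales
  show ?thesis
  proof (intro conjI pisot)
    show "AE \<sigma> in \<nu>.
      (\<exists>u. right_eigenvector \<sigma> u \<and> tiling_of_perp (vec 1) (rauzy_collection \<sigma> u)) \<and>
      (\<exists>\<mu>. invariant_prob_on (sadic_shift \<sigma>) \<mu> \<and>
           (\<forall>\<mu>'. invariant_prob_on (sadic_shift \<sigma>) \<mu>' \<longrightarrow> \<mu>' = \<mu>) \<and>
           (\<exists>t :: real^2.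
              measurably_conjugate \<mu> stl torus (torus_translation t) \<and>
              natural_codings int_lattice t (sadic_shift \<sigma>)))"
      using AE_brun_generic
    proof (rule eventually_mono)
      fix \<sigma> assume "brun_generic \<sigma>"
      then interpret brun_generic \<sigma> .
      show "(\<exists>u. right_eigenvector \<sigma> u \<and> tiling_of_perp (vec 1) (rauzy_collection \<sigma> u)) \<and>
        (\<exists>\<mu>. invariant_prob_on (sadic_shift \<sigma>) \<mu> \<and>
           (\<forall>\<mu>'. invariant_prob_on (sadic_shift \<sigma>) \<mu>' \<longrightarrow> \<mu>' = \<mu>) \<and>
           (\<exists>t :: real^2.
              measurably_conjugate \<mu> stl torus (torus_translation t) \<and>
              natural_codings int_lattice t (sadic_shift \<sigma>)))"
        using right_eigenvector_eig tiling invariant_word_measure unique_word_measure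
          conjugate_word_measure natural_codings_words by blast
    qed
  qed
qed

end
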